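(* Let $\mathcal{U}$ be an open subset of some $\mathbb{R}^p$ and let $\{K^{\lambda}\}_{\lambda\in\mathcal{U}}$ be a family of symmetric non-negative measurable kernels on $\mathbb{R}_+^*\times\mathbb{R}_+^*$ depending in a $\mathcal{C}^2$ way on $\lambda\in\mathcal{U}$; write $K^{\partial\lambda}(x,y)=\partial_\lambda K^\lambda(x,y)$. Let $\varphi:\mathbb{R}_+^*\to[1,\infty)$ be a measurable sub-additive function such that for all $\lambda\in\mathcal{U}$ and all $x,y\in\mathbb{R}_+^*$ $$K^{\lambda}(x,y)\le \varphi(x)\varphi(y),\qquad |K^{\partial\lambda}(x,y)|\le\varphi(x)\varphi(y).$$ Let $\mu_0$ be a non-negative Radon measure on $\mathbb{R}_+^*$ such that $\int\varphi^{4+\varepsilon}(x)\,\mu_0(dx)<\infty$ for some $\varepsilon>0$. Let $T<T(\mu_0)$ and, for $\lambda\in\mathcal{U}$, let $\{\mu_t^\lambda\}_{0\le t\le T}$ be the solution of Smoluchowski's equation with kernel $K^\lambda$ and initial condition $\mu_0$. Then the map $(t,\lambda)\in[0,T]\times\mathcal{U}\mapsto\mu_t^\lambda\in(\mathcal{M}_1,\|\cdot\|_1)$ is a $\mathcal{C}^1$ function, and its derivative $\sigma_t^\lambda=\partial_\lambda\mu_t^\lambda$ satisfies, for every bounded measurable function $f$ on $\mathbb{R}_+^*$ and every $t\in[0,T]$, $$(f,\sigma_t^\lambda)=(f,\sigma_0^\lambda)+\int_0^t\int\{f\}(x,y)\,K^\lambda(x,y)\,\mu_s^\lambda(dx)\,\sigma_s^\lambda(dy)\,ds+\frac12\int_0^t\int\{f\}(x,y)\,K^{\partial\lambda}(x,y)\,\mu_s^\lambda(dx)\,\mu_s^\lambda(dy)\,ds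 .$$ Moreover, the function $t\mapsto\sigma_t^\lambda$ is the only $(\mathcal{M}_1,\|\cdot\|_1)$-valued solution of this equation (with the given initial value $\sigma_0^\lambda$).
   Context: $\mathbb{R}_+^*=(0,\infty)$. All functions and measures are on $\mathbb{R}_+^*$. For a function $f$ and a (signed) measure $\mu$, $(f,\mu)=\int f\,d\mu$. We write $\{f\}(x,y)=f(x+y)-f(x)-f(y)$. Sub-additive means $\varphi(x+y)\le\varphi(x)+\varphi(y)$ for all $x,y\in\mathbb{R}_+^*$. $\mathcal{M}_1$ is the space of signed Radon measures $\mu$ with $\|\mu\|_1:=(\varphi,|\mu|)<\infty$. Smoluchowski's equation with kernel $K$ and initial condition $\mu_0$ is, for bounded measurable $f$, $$\frac{d}{dt}(f,\mu_t)=\frac12\int\{f\}(x,y)K(x,y)\,\mu_t(dx)\,\mu_t(dy),$$ for non-negative measures $\mu_t$. The time $T(\mu_0)>0$: by a theorem of J. Norris, since $(\varphi^{4+\varepsilon},\mu_0)<\infty$, there is a time $T(\mu_0)>0$ (depending only on $\varphi$, $\varepsilon$, $\mu_0$) such that for every symmetric non-negative measurable kernel $K\le\varphi(x)\varphi(y)$ Smoluchowski's equation has a unique solution $\mu_t$ on $[0,T(\mu_0))$ for which $(\varphi^{4+\varepsilon},\mu_t)$ remains finite, and for each $T<T(\mu_0)$ there is a constant $C(T)$, independent of $K$, with $(\varphi^{4+\varepsilon},\mu_t)\le C(T)$ for all $t\le T$. The initial measure $\mu_0$ does not depend on $\lambda$. When $p>1$, $K^{\partial\lambda}$ and $\sigma_t^\lambda$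 are $\mathbb{R}^p$-valued and the statements are understood componentwise. *)

theory Defs
  imports "HOL-Analysis.Analysis"
begin

abbreviation pos_borel :: "real measure" where
  "pos_borel \<equiv> restrict_space borel {0<..}"

definition radon :: "real measure \<Rightarrow> bool" where
  "radon M \<longleftrightarrow> sets M = sets pos_borel \<and>
     (\<forall>C. compact C \<and> C \<subseteq> {0<..} \<longrightarrow> emeasure M C < \<infinity>)"

definition bdd_measurable :: "(real \<Rightarrow> real) \<Rightarrow> bool" where
  "bdd_measurable f \<longleftrightarrow> f \<in> borel_measurable pos_borel \<and> (\<exists>B. \<forall>x>0. \<bar>f x\<bar> \<le> B)"

definition brace :: "(real \<Rightarrow> real) \<Rightarrow> real \<Rightarrow> real \<Rightarrow> real" where
  "brace f x y = f (x + y) - f x - f y"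

definition sub_additive :: "(real \<Rightarrow> real) \<Rightarrow> bool" where
  "sub_additive \<phi> \<longleftrightarrow> (\<forall>x>0. \<forall>y>0. \<phi> (x + y) \<le> \<phi> x + \<phi> y)"


subsection \<open>Signed measures of finite weighted norm\<close>

text \<open>
  A signed measure is a set function on the Borel sets of the open half-line. All weights used
  below are at least 1, so a signed Radon measure of finite weighted norm has finite total
  variation; conversely, a finite signed Borel measure on the open half-line is Radon. Hence
  real-valued countably additive set functions suffice. They are set to 0 on the sets that are
  not measurable, so that equality of signed measures is equality of functions and a finite
  measure \<open>M\<close>, viewed as a signed measure, is the function \<open>measure M\<close>.
\<close>

definition signed_measure :: "(real set \<Rightarrow> real) \<Rightarrow> bool" where
  "signed_measure \<nu> \<longleftrightarrow>
     (\<forall>A. A \<notin> sets pos_borel \<longrightarrow> \<nu> A = 0) \<and> \<nu> {} = 0 \<and>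
     (\<forall>A :: nat \<Rightarrow> real set. range A \<subseteq> sets pos_borel \<and> disjoint_family A \<longrightarrow>
        (\<lambda>n. \<nu> (A n)) sums \<nu> (\<Union>n. A n))"

text \<open>
  Jordan decomposition. As \<^const>\<open>ennreal\<close> truncates negative reals at 0 and the
  empty set is admitted, the supremum is that of \<open>\<nu> B\<close> over measurable \<open>B \<subseteq> A\<close>.
\<close>

definition pos_part :: "(real set \<Rightarrow> real) \<Rightarrow> real measure" where
  "pos_part \<nu> = measure_of {0<..} (sets pos_borel)
     (\<lambda>A. SUP B\<in>{B \<in> sets pos_borel. B \<subseteq> A}. ennreal (\<nu> B))"

definition neg_part :: "(real set \<Rightarrow> real) \<Rightarrow> real measure" where
  "neg_part \<nu> = pos_part (\<lambda>A. - \<nu> A)"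

definition total_var :: "(real set \<Rightarrow> real) \<Rightarrow> real measure" where
  "total_var \<nu> = measure_of {0<..} (sets pos_borel)
     (\<lambda>A. emeasure (pos_part \<nu>) A + emeasure (neg_part \<nu>) A)"

definition signed_integral :: "(real set \<Rightarrow> real) \<Rightarrow> (real \<Rightarrow> real) \<Rightarrow> real" where
  "signed_integral \<nu> f = (\<integral>x. f x \<partial>pos_part \<nu>) - (\<integral>x. f x \<partial>neg_part \<nu>)"

definition M1 :: "(real \<Rightarrow> real) \<Rightarrow> (real set \<Rightarrow> real) set" where
  "M1 \<phi> = {\<nu>. signed_measure \<nu> \<and> (\<integral>\<^sup>+x. ennreal (\<phi> x) \<partial>total_var \<nu>) < \<infinity>}"

definition norm1 :: "(real \<Rightarrow> real) \<Rightarrow> (real set \<Rightarrow> real) \<Rightarrow> real" where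
  "norm1 \<phi> \<nu> = enn2real (\<integral>\<^sup>+x. ennreal (\<phi> x) \<partial>total_var \<nu>)"


subsection \<open>Continuous differentiability\<close>

definition C2_on :: "(real^'p) set \<Rightarrow> (real^'p \<Rightarrow> real) \<Rightarrow> bool" where
  "C2_on U g \<longleftrightarrow> (\<exists>(G :: real^'p \<Rightarrow> real^'p) (H :: real^'p \<Rightarrow> real^'p^'p).
     (\<forall>l\<in>U. (GDERIV g l :> G l) \<and> (G has_derivative (\<lambda>h. H l *v h)) (at l)) \<and>
     continuous_on U H)"

text \<open>
  The Frechet derivative of a map into the normed space \<open>(M1 \<phi>, norm1 \<phi>)\<close>. The norm depends on
  \<open>\<phi>\<close>, so this space is not an instance of the type class of normed vector spaces and
  \<^const>\<open>has_derivative\<close> does not apply; the next two definitions spell out the same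
  notion for it.
\<close>

definition M1_bounded_linear ::
  "(real \<Rightarrow> real) \<Rightarrow> ('a::real_normed_vector \<Rightarrow> real set \<Rightarrow> real) \<Rightarrow> bool" where
  "M1_bounded_linear \<phi> L \<longleftrightarrow>
     (\<forall>h. L h \<in> M1 \<phi>) \<and>
     (\<forall>h k A. L (h + k) A = L h A + L k A) \<and>
     (\<forall>c h A. L (c *\<^sub>R h) A = c * L h A) \<and>
     (\<exists>C. \<forall>h. norm1 \<phi> (L h) \<le> C * norm h)"

definition M1_has_derivative ::
  "(real \<Rightarrow> real) \<Rightarrow> ('a::real_normed_vector \<Rightarrow> real set \<Rightarrow> real) \<Rightarrow>
   ('a \<Rightarrow> real set \<Rightarrow> real) \<Rightarrow> 'a \<Rightarrow> 'a set \<Rightarrow> bool" where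
  "M1_has_derivative \<phi> F L z S \<longleftrightarrow>
     M1_bounded_linear \<phi> L \<and>
     ((\<lambda>w. norm1 \<phi> (\<lambda>A. F w A - F z A - L (w - z) A) / norm (w - z)) \<longlongrightarrow> 0)
       (at z within S)"

text \<open>
  \<open>F\<close> is a continuously differentiable map from \<open>S\<close> to \<open>M1 \<phi>\<close> with derivative \<open>D\<close>, where \<open>D\<close>
  is continuous for the operator norm.
\<close>

definition M1_C1 ::
  "(real \<Rightarrow> real) \<Rightarrow> 'a::real_normed_vector set \<Rightarrow> ('a \<Rightarrow> real set \<Rightarrow> real) \<Rightarrow>
   ('a \<Rightarrow> 'a \<Rightarrow> real set \<Rightarrow> real) \<Rightarrow> bool" where
  "M1_C1 \<phi> S F D \<longleftrightarrow>
     (\<forall>z\<in>S. F z \<in> M1 \<phi> \<and> M1_has_derivative \<phi> F (D z) z S) \<and>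
     (\<forall>z\<in>S. \<forall>e>0. \<exists>d>0. \<forall>w\<in>S. dist w z < d \<longrightarrow>
        (\<forall>h. norm1 \<phi> (\<lambda>A. D w h A - D z h A) \<le> e * norm h))"


subsection \<open>Smoluchowski's equation\<close>

definition coag_kernel :: "(real \<Rightarrow> real) \<Rightarrow> (real \<Rightarrow> real \<Rightarrow> real) \<Rightarrow> bool" where
  "coag_kernel \<phi> K \<longleftrightarrow>
     (\<lambda>(x, y). K x y) \<in> borel_measurable (pos_borel \<Otimes>\<^sub>M pos_borel) \<and>
     (\<forall>x>0. \<forall>y>0. K x y = K y x \<and> 0 \<le> K x y \<and> K x y \<le> \<phi> x * \<phi> y)"

text \<open>
  Solutions on the half-open interval \<open>[0, Ts)\<close> for which the moment of order \<open>q\<close> of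
  \<open>\<phi>\<close> stays finite.
\<close>

definition smoluchowski_solution ::
  "(real \<Rightarrow> real) \<Rightarrow> real \<Rightarrow> (real \<Rightarrow> real \<Rightarrow> real) \<Rightarrow> real measure \<Rightarrow> real \<Rightarrow>
   (real \<Rightarrow> real measure) \<Rightarrow> bool" where
  "smoluchowski_solution \<phi> q K \<mu>0 Ts \<mu> \<longleftrightarrow>
     \<mu> 0 = \<mu>0 \<and>
     (\<forall>t\<in>{0..<Ts}. radon (\<mu> t) \<and> (\<integral>\<^sup>+x. ennreal (\<phi> x powr q) \<partial>\<mu> t) < \<infinity>) \<and>
     (\<forall>f. bdd_measurable f \<longrightarrow> (\<forall>t\<in>{0..<Ts}.
        ((\<lambda>s. \<integral>x. f x \<partial>\<mu> s) has_real_derivative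
           1 / 2 * (\<integral>x. (\<integral>y. brace f x y * K x y \<partial>\<mu> t) \<partial>\<mu> t)) (at t within {0..<Ts})))"

text \<open>
  The defining property of the time up to which Norris' theorem provides, simultaneously for all
  kernels dominated by \<open>\<phi> x * \<phi> y\<close>, a unique solution and a moment bound that
  does not depend on the kernel.
\<close>

definition norris_time :: "(real \<Rightarrow> real) \<Rightarrow> real \<Rightarrow> real measure \<Rightarrow> real \<Rightarrow> bool" where
  "norris_time \<phi> q \<mu>0 Ts \<longleftrightarrow>
     0 < Ts \<and>
     (\<forall>K. coag_kernel \<phi> K \<longrightarrow>
        (\<exists>\<mu>. smoluchowski_solution \<phi> q K \<mu>0 Ts \<mu> \<and>
             (\<forall>\<nu>. smoluchowski_solution \<phi> q K \<mu>0 Ts \<nu> \<longrightarrow> (\<forall>t\<in>{0..<Ts}. \<nu> t = \<mu> t)))) \<and>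
     (\<forall>T<Ts. \<exists>C::real. \<forall>K \<mu>. coag_kernel \<phi> K \<and> smoluchowski_solution \<phi> q K \<mu>0 Ts \<mu> \<longrightarrow>
        (\<forall>t\<in>{0..T}. (\<integral>\<^sup>+x. ennreal (\<phi> x powr q) \<partial>\<mu> t) \<le> ennreal C))"

text \<open>
  The linearised equation on \<open>[0, T]\<close> for a parameter derivative \<open>\<sigma>\<close>, with \<open>k\<close> the
  corresponding derivative of the kernel \<open>K\<close>. Integrability of the norm of \<open>\<sigma>\<close> makes the
  time integrals converge absolutely; it is automatic for solutions that are bounded or
  continuous in this norm. The integrability of the two time integrands is required because the
  integral of a non-integrable function is 0 by convention.
\<close>

definition linearised_solution ::
  "(real \<Rightarrow> real) \<Rightarrow> (real \<Rightarrow> real \<Rightarrow> real) \<Rightarrow> (real \<Rightarrow> real \<Rightarrow> real) \<Rightarrow> real \<Rightarrow>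
   (real \<Rightarrow> real measure) \<Rightarrow> (real \<Rightarrow> real set \<Rightarrow> real) \<Rightarrow> bool" where
  "linearised_solution \<phi> K k T \<mu> \<sigma> \<longleftrightarrow>
     (\<forall>t\<in>{0..T}. \<sigma> t \<in> M1 \<phi>) \<and>
     set_integrable lborel {0..T} (\<lambda>t. norm1 \<phi> (\<sigma> t)) \<and>
     (\<forall>f. bdd_measurable f \<longrightarrow>
        (let g = (\<lambda>s. signed_integral (\<sigma> s) (\<lambda>y. \<integral>x. brace f x y * K x y \<partial>\<mu> s));
             h = (\<lambda>s. \<integral>y. (\<integral>x. brace f x y * k x y \<partial>\<mu> s) \<partial>\<mu> s)
         in set_integrable lborel {0..T} g \<and> set_integrable lborel {0..T} h \<and>
            (\<forall>t\<in>{0..T}. signed_integral (\<sigma> t) f =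
               signed_integral (\<sigma> 0) f + (LINT s:{0..t}|lborel. g s)
               + 1 / 2 * (LINT s:{0..t}|lborel. h s))))"

end

theory Submission
  imports Defs
begin

text \<open>
  The whole proof rests on one estimate, \<open>norm1_estimate\<close>. Consider a curve of signed measures \<open>\<rho>\<close> with
  \<open>\<rho> 0 = 0\<close> that solves, up to an error of size \<open>\<eta>\<close>, the linear equation
  \<open>d/dt (f, \<rho> t) = (\<integral>\<integral> {f}(x, y) K(x, y) \<kappa> t(dx) \<rho> t(dy))\<close>, where the driver \<open>\<kappa> t\<close> is a non-negative
  measure. Then \<open>norm1 w (\<rho> t) \<le> C * \<eta>\<close>. The operator on the right-hand side is unbounded
  on the space with weight \<open>w\<close>, because \<open>K\<close> is only bounded by \<open>\<phi> x * \<phi> y\<close>. What saves the estimate is the sign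
  of the loss term: formally, testing with \<open>f = w * sgn (\<rho> t)\<close>,

    \<open>d/dt (w, |\<rho> t|) \<le> \<integral>\<integral> (w (x + y) + w x - w y) K(x, y) \<kappa> t(dx) |\<rho> t|(dy)\<close>,

  and for \<open>w = \<phi>\<close> or \<open>w = \<phi>\<^sup>2\<close> sub-additivity of \<open>\<phi>\<close> makes the difference \<open>w (x + y) - w y\<close> one
  power of \<open>\<phi> y\<close> smaller than \<open>w y\<close>. The factor \<open>\<phi> y\<close> of the kernel is thereby absorbed, the cost is a
  higher moment in \<open>x\<close>, which falls on the driver, and Gronwall's inequality applies.

  The estimate is used twice. With the weight \<open>\<phi>\<^sup>2\<close> it is applied to the difference of the solutions
  for two parameters, driven by their average, and shows that the solution is Lipschitz in the
  parameter (\<open>lambda_lipschitz\<close>). Knowing this, the difference of the solutions for two parameters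
  \<open>l1\<close>, \<open>l2\<close> close to \<open>l0\<close> solves the equation linearised at \<open>l0\<close> in the direction \<open>l1 - l2\<close> up to
  an error \<open>o(|l1 - l2|)\<close>, measured against test functions bounded by \<open>\<phi>\<close>
  (\<open>difference_linearised\<close>). With the weight \<open>\<phi>\<close> the estimate now shows that difference
  quotients are Cauchy in the norm. Their limit is an exact solution of the linearised equation
  (\<open>linearised_limit\<close>); by the same estimate it is the only one, hence linear in the direction, and it is
  the derivative (\<open>strict_derivative\<close>). As \<open>l1\<close> and \<open>l2\<close> both vary, the derivative is strict, and
  strict differentiability near \<open>l0\<close> already contains continuity of the derivative at \<open>l0\<close>.

  The derivative in time is easier: the rate of change is Lipschitz in time on test
  functions bounded by \<open>\<phi>\<close>, so difference quotients in time are Cauchy at an explicit speed. The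
  moments of \<open>\<phi>\<close> up to the third, in terms of which all constants are expressed, are bounded uniformly
  in the parameter because the moment bound that comes with the time \<open>T(\<mu>\<^sub>0)\<close> does not depend on the kernel.

  A norm \<open>norm1 w\<close> is never differentiated along a curve. Norms are controlled through the pairing
  with bounded test functions \<open>f\<close> such that \<open>|f| \<le> w\<close> (\<open>norm1_leI\<close>), so that every step can be reduced to
  the equation, which is stated for bounded test functions.
\<close>

section \<open>Signed measures and their total variation\<close>

lemma space_pos_borel [simp]: "space pos_borel = {0<..}"
  by (simp add: space_restrict_space)

lemma sigma_algebra_pos_borel: "sigma_algebra {0<..} (sets pos_borel)"
  using sets.sigma_algebra_axioms[of pos_borel] by simp

lemma sets_pos_borel_subset: "A \<in> sets pos_borel \<Longrightarrow> A \<subseteq> {0<..}"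
  using sets.sets_into_space[of A pos_borel] by simp

lemma signed_measure_Un:
  assumes "signed_measure \<nu>" "A \<in> sets pos_borel" "B \<in> sets pos_borel" "A \<inter> B = {}"
  shows "\<nu> (A \<union> B) = \<nu> A + \<nu> B"
proof -
  have e: "\<nu> {} = 0" using assms(1) by (simp add: signed_measure_def)
  have d: "disjoint_family (binaryset A B)"
    using assms(4) by (auto simp: disjoint_family_on_def binaryset_def)
  have "range (binaryset A B) \<subseteq> sets pos_borel"
    using assms(2,3) by (auto simp: range_binaryset_eq)
  with d have "(\<lambda>n. \<nu> (binaryset A B n)) sums \<nu> (\<Union>n. binaryset A B n)"
    using assms(1) unfolding signed_measure_def by blast
  moreover have "(\<lambda>n. \<nu> (binaryset A B n)) sums (\<nu> A + \<nu> B)"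
    by (rule binaryset_sums) (rule e)
  ultimately show ?thesis
    using sums_unique2 by (fastforce simp: UN_binaryset_eq)
qed

lemma signed_measure_uminus: "signed_measure \<nu> \<Longrightarrow> signed_measure (\<lambda>A. - \<nu> A)"
  unfolding signed_measure_def by (auto intro: sums_minus)

text \<open>
  The set function that \<open>pos_part\<close> is generated from. It is needed as a function in its
  own right: only after it is shown to be countably additive on the Borel sets do
  \<open>pos_part\<close> and \<open>total_var\<close> have computable values.
\<close>

definition pos_var :: "(real set \<Rightarrow> real) \<Rightarrow> real set \<Rightarrow> ennreal" where
  "pos_var \<nu> A = (SUP B\<in>{B \<in> sets pos_borel. B \<subseteq> A}. ennreal (\<nu> B))"

lemma pos_var_upper: "B \<in> sets pos_borel \<Longrightarrow> B \<subseteq> A \<Longrightarrow> ennreal (\<nu> B) \<le> pos_var \<nu> A"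
  unfolding pos_var_def by (rule SUP_upper) auto

lemma pos_var_mono: "A \<subseteq> B \<Longrightarrow> pos_var \<nu> A \<le> pos_var \<nu> B"
  unfolding pos_var_def by (rule SUP_subset_mono) auto

text \<open>
  Union of two competitors is a competitor. A competitor of negative measure counts as 0 and is
  dropped.
\<close>

lemma pos_var_superadditive:
  assumes "signed_measure \<nu>" "A \<inter> A' = {}"
  shows "pos_var \<nu> A + pos_var \<nu> A' \<le> pos_var \<nu> (A \<union> A')"
proof -
  have *: "ennreal (\<nu> B) + ennreal (\<nu> C) \<le> pos_var \<nu> (A \<union> A')"
    if B: "B \<in> sets pos_borel" "B \<subseteq> A" and C: "C \<in> sets pos_borel" "C \<subseteq> A'" for B C
  proof (cases "\<nu> B \<ge> 0 \<and> \<nu> C \<ge> 0")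
    case True
    have "\<nu> (B \<union> C) = \<nu> B + \<nu> C" using B C assms by (intro signed_measure_Un) auto
    then have "ennreal (\<nu> B) + ennreal (\<nu> C) = ennreal (\<nu> (B \<union> C))"
      using True by (simp add: ennreal_plus)
    also have "\<dots> \<le> pos_var \<nu> (A \<union> A')" using B C by (intro pos_var_upper) auto
    finally show ?thesis .
  next
    case False
    then have "ennreal (\<nu> B) + ennreal (\<nu> C) = ennreal (\<nu> C) \<or>
      ennreal (\<nu> B) + ennreal (\<nu> C) = ennreal (\<nu> B)"
      by (auto simp: ennreal_neg)
    moreover have "ennreal (\<nu> B) \<le> pos_var \<nu> (A \<union> A')" "ennreal (\<nu> C) \<le> pos_var \<nu> (A \<union> A')"
      using B C by (auto intro!: pos_var_upper)
    ultimately show ?thesis by metis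
  qed
  have ne: "{B \<in> sets pos_borel. B \<subseteq> A''} \<noteq> {}" for A'' :: "real set" by auto
  have **: "ennreal (\<nu> B) + pos_var \<nu> A' \<le> pos_var \<nu> (A \<union> A')"
    if B: "B \<in> sets pos_borel" "B \<subseteq> A" for B
  proof -
    have "ennreal (\<nu> B) + pos_var \<nu> A' = (SUP C\<in>{C \<in> sets pos_borel. C \<subseteq> A'}. ennreal (\<nu> B) + ennreal (\<nu> C))"
      unfolding pos_var_def[of \<nu> A'] by (rule ennreal_SUP_add_right) (rule ne)
    then show ?thesis using *[OF B] by (auto intro!: SUP_least)
  qed
  show ?thesis
  proof -
    have "pos_var \<nu> A + pos_var \<nu> A' = (SUP C\<in>{C \<in> sets pos_borel. C \<subseteq> A}. ennreal (\<nu> C) + pos_var \<nu> A')"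
      unfolding pos_var_def[of \<nu> A] by (rule ennreal_SUP_add_left[symmetric]) (rule ne)
    then show ?thesis using ** by (auto intro!: SUP_least)
  qed
qed

text \<open>
  Superadditivity, passed to the limit, gives one inequality. For the other, a competitor
  \<open>B\<close> for the union is cut into the pieces \<open>B \<inter> A n\<close>, each a
  competitor for \<open>A n\<close>.
\<close>

lemma countably_additive_pos_var:
  assumes "signed_measure \<nu>"
  shows "countably_additive (sets pos_borel) (pos_var \<nu>)"
  unfolding countably_additive_def
proof (intro allI impI)
  fix A :: "nat \<Rightarrow> real set"
  assume A: "range A \<subseteq> sets pos_borel" "disjoint_family A" "(\<Union>i. A i) \<in> sets pos_borel"
  have fin: "(\<Sum>i<n. pos_var \<nu> (A i)) \<le> pos_var \<nu> (\<Union>i<n. A i)" for n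
  proof (induction n)
    case (Suc n)
    have "A i \<inter> A n = {}" if "i < n" for i
      using A(2) that unfolding disjoint_family_on_def by (metis UNIV_I less_irrefl)
    then have "(\<Union>i<n. A i) \<inter> A n = {}" by blast
    then have "pos_var \<nu> (\<Union>i<n. A i) + pos_var \<nu> (A n) \<le> pos_var \<nu> ((\<Union>i<n. A i) \<union> A n)"
      using assms by (intro pos_var_superadditive)
    also have "(\<Union>i<n. A i) \<union> A n = (\<Union>i<Suc n. A i)" by (auto simp: lessThan_Suc)
    finally show ?case using Suc by (auto intro: order_trans[OF add_right_mono])
  qed simp
  have "(\<Sum>i. pos_var \<nu> (A i)) \<le> pos_var \<nu> (\<Union>i. A i)"
  proof (rule suminf_le_const)
    fix n
    have "pos_var \<nu> (\<Union>i<n. A i) \<le> pos_var \<nu> (\<Union>i. A i)" by (rule pos_var_mono) auto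
    with fin[of n] show "(\<Sum>i<n. pos_var \<nu> (A i)) \<le> pos_var \<nu> (\<Union>i. A i)" by (rule order_trans)
  qed simp
  moreover have "pos_var \<nu> (\<Union>i. A i) \<le> (\<Sum>i. pos_var \<nu> (A i))"
    unfolding pos_var_def[of \<nu> "\<Union>i. A i"]
  proof (rule SUP_least, clarify)
    fix B assume B: "B \<in> sets pos_borel" "B \<subseteq> (\<Union>i. A i)"
    have "range (\<lambda>n. B \<inter> A n) \<subseteq> sets pos_borel"
      using A(1) B(1) by (auto intro!: sets.Int)
    moreover have "disjoint_family (\<lambda>n. B \<inter> A n)"
      using A(2) by (rule disjoint_family_on_bisimulation) auto
    ultimately have "(\<lambda>n. \<nu> (B \<inter> A n)) sums \<nu> (\<Union>n. B \<inter> A n)"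
      using assms unfolding signed_measure_def by blast
    moreover from B have "(\<Union>n. B \<inter> A n) = B" by auto
    ultimately have s: "(\<lambda>n. \<Sum>i<n. \<nu> (B \<inter> A i)) \<longlonglongrightarrow> \<nu> B" by (simp add: sums_def)
    have le: "ennreal (\<Sum>i<n. \<nu> (B \<inter> A i)) \<le> (\<Sum>i. pos_var \<nu> (A i))" for n
    proof -
      have "ennreal (\<Sum>i<n. \<nu> (B \<inter> A i)) \<le> ennreal (\<Sum>i<n. max 0 (\<nu> (B \<inter> A i)))"
        by (intro ennreal_leI sum_mono) auto
      also have "\<dots> = (\<Sum>i<n. ennreal (\<nu> (B \<inter> A i)))"
      proof -
        have "(\<Sum>i<n. ennreal (max 0 (\<nu> (B \<inter> A i)))) = ennreal (\<Sum>i<n. max 0 (\<nu> (B \<inter> A i)))"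
          by (rule sum_ennreal) auto
        moreover have "ennreal (max 0 x) = ennreal x" for x by (auto simp: max_def ennreal_neg)
        ultimately show ?thesis by simp
      qed
      also have "\<dots> \<le> (\<Sum>i<n. pos_var \<nu> (A i))"
        using A B by (intro sum_mono pos_var_upper) auto
      also have "\<dots> \<le> (\<Sum>i. pos_var \<nu> (A i))" by (rule sum_le_suminf) auto
      finally show ?thesis .
    qed
    show "ennreal (\<nu> B) \<le> (\<Sum>i. pos_var \<nu> (A i))"
      by (rule LIMSEQ_le_const2[OF tendsto_ennrealI[OF s]]) (use le in auto)
  qed
  ultimately show "(\<Sum>i. pos_var \<nu> (A i)) = pos_var \<nu> (\<Union>i. A i)" by (rule antisym)
qed

lemma pos_part_sets [simp]: "sets (pos_part \<nu>) = sets pos_borel"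
  unfolding pos_part_def using sigma_algebra.sets_measure_of_eq[OF sigma_algebra_pos_borel] by simp

lemma neg_part_sets [simp]: "sets (neg_part \<nu>) = sets pos_borel"
  by (simp add: neg_part_def)

lemma total_var_sets [simp]: "sets (total_var \<nu>) = sets pos_borel"
  unfolding total_var_def using sigma_algebra.sets_measure_of_eq[OF sigma_algebra_pos_borel] by simp

lemma parts_space [simp]:
  "space (pos_part \<nu>) = {0<..}" "space (neg_part \<nu>) = {0<..}" "space (total_var \<nu>) = {0<..}"
  using sets_eq_imp_space_eq[OF pos_part_sets] sets_eq_imp_space_eq[OF neg_part_sets]
    sets_eq_imp_space_eq[OF total_var_sets] by auto

lemma emeasure_pos_part:
  assumes "signed_measure \<nu>" "A \<in> sets pos_borel"
  shows "emeasure (pos_part \<nu>) A = pos_var \<nu> A"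
  unfolding pos_part_def pos_var_def[symmetric]
proof (rule emeasure_measure_of_sigma)
  have "\<nu> {} = 0" using assms(1) by (simp add: signed_measure_def)
  moreover have "{B \<in> sets pos_borel. B \<subseteq> {}} = {{}}"
    using sets.empty_sets[of pos_borel] by (blast dest: subset_empty[THEN iffD1])
  ultimately show "positive (sets pos_borel) (pos_var \<nu>)" by (simp add: positive_def pos_var_def)
next
  show "sigma_algebra {0<..} (sets pos_borel)" by (rule sigma_algebra_pos_borel)
next
  show "countably_additive (sets pos_borel) (pos_var \<nu>)"
    by (rule countably_additive_pos_var) (rule assms(1))
next
  show "A \<in> sets pos_borel" by (rule assms(2))
qed

lemma emeasure_neg_part:
  assumes "signed_measure \<nu>" "A \<in> sets pos_borel"
  shows "emeasure (neg_part \<nu>) A = pos_var (\<lambda>A. - \<nu> A) A"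
  unfolding neg_part_def by (rule emeasure_pos_part[OF signed_measure_uminus[OF assms(1)] assms(2)])

lemma emeasure_total_var:
  assumes "signed_measure \<nu>" "A \<in> sets pos_borel"
  shows "emeasure (total_var \<nu>) A = emeasure (pos_part \<nu>) A + emeasure (neg_part \<nu>) A"
  unfolding total_var_def
proof (rule emeasure_measure_of_sigma)
  show "positive (sets pos_borel) (\<lambda>A. emeasure (pos_part \<nu>) A + emeasure (neg_part \<nu>) A)"
    by (simp add: positive_def)
  show "countably_additive (sets pos_borel) (\<lambda>A. emeasure (pos_part \<nu>) A + emeasure (neg_part \<nu>) A)"
    unfolding countably_additive_def
  proof (intro allI impI)
    fix A :: "nat \<Rightarrow> real set"
    assume A: "range A \<subseteq> sets pos_borel" "disjoint_family A" "(\<Union>i. A i) \<in> sets pos_borel"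
    have "(\<Sum>i. emeasure (pos_part \<nu>) (A i) + emeasure (neg_part \<nu>) (A i)) =
        (\<Sum>i. emeasure (pos_part \<nu>) (A i)) + (\<Sum>i. emeasure (neg_part \<nu>) (A i))"
      by (rule suminf_add[symmetric]) auto
    then show "(\<Sum>i. emeasure (pos_part \<nu>) (A i) + emeasure (neg_part \<nu>) (A i)) =
        emeasure (pos_part \<nu>) (\<Union>i. A i) + emeasure (neg_part \<nu>) (\<Union>i. A i)"
      using A by (simp add: suminf_emeasure)
  qed
qed (fact sigma_algebra_pos_borel assms(2))+

text \<open>
  Boundedness of the set function is what makes the positive and negative parts finite measures. It
  holds for every element of a space \<open>M1 w\<close> with \<open>w \<ge> 1\<close>, and is kept
  as a notion of its own because limits are first obtained without a weight.
\<close>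

definition finite_signed_measure :: "(real set \<Rightarrow> real) \<Rightarrow> bool" where
  "finite_signed_measure \<nu> \<longleftrightarrow> signed_measure \<nu> \<and> (\<exists>B. \<forall>A. \<bar>\<nu> A\<bar> \<le> B)"

lemma finite_signed_measure_signed: "finite_signed_measure \<nu> \<Longrightarrow> signed_measure \<nu>"
  by (simp add: finite_signed_measure_def)

lemma finite_signed_measure_uminus:
  "finite_signed_measure \<nu> \<Longrightarrow> finite_signed_measure (\<lambda>A. - \<nu> A)"
  by (auto simp: finite_signed_measure_def signed_measure_uminus)

lemma finite_measure_pos_part:
  assumes "finite_signed_measure \<nu>"
  shows "finite_measure (pos_part \<nu>)"
proof
  obtain B where B: "\<And>A. \<bar>\<nu> A\<bar> \<le> B" using assms by (auto simp: finite_signed_measure_def)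
  have "pos_var \<nu> {0<..} \<le> ennreal B"
    unfolding pos_var_def using B by (auto intro!: SUP_least ennreal_leI simp: abs_le_iff)
  moreover have "{0<..} \<in> sets pos_borel" using sets.top[of pos_borel] by simp
  ultimately show "emeasure (pos_part \<nu>) (space (pos_part \<nu>)) \<noteq> \<infinity>"
    using emeasure_pos_part[OF finite_signed_measure_signed[OF assms], of "{0<..}"]
    by (metis ennreal_less_top infinity_ennreal_def leD parts_space(1))
qed

lemma finite_measure_neg_part:
  "finite_signed_measure \<nu> \<Longrightarrow> finite_measure (neg_part \<nu>)"
  unfolding neg_part_def by (intro finite_measure_pos_part finite_signed_measure_uminus)

lemma finite_measure_total_var:
  assumes "finite_signed_measure \<nu>"
  shows "finite_measure (total_var \<nu>)"
proof
  interpret P: finite_measure "pos_part \<nu>" by (rule finite_measure_pos_part) fact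
  interpret N: finite_measure "neg_part \<nu>" by (rule finite_measure_neg_part) fact
  have "{0<..} \<in> sets pos_borel" using sets.top[of pos_borel] by simp
  then show "emeasure (total_var \<nu>) (space (total_var \<nu>)) \<noteq> \<infinity>"
    using emeasure_total_var[OF finite_signed_measure_signed[OF assms], of "{0<..}"]
      P.emeasure_finite N.emeasure_finite
    by (metis ennreal_add_eq_top infinity_ennreal_def parts_space(3))
qed

text \<open>
  For \<open>B \<subseteq> A\<close>, additivity turns \<open>\<nu> B\<close> into
  \<open>\<nu> A - \<nu> (A - B)\<close>. Taking the supremum over \<open>B\<close> bounds the
  positive part of \<open>A\<close> by \<open>\<nu> A\<close> plus its negative part; the same with
  \<open>-\<nu>\<close> gives the reverse inequality.
\<close>

lemma jordan_decomposition:
  assumes "finite_signed_measure \<nu>" "A \<in> sets pos_borel"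
  shows "\<nu> A = measure (pos_part \<nu>) A - measure (neg_part \<nu>) A"
proof -
  interpret P: finite_measure "pos_part \<nu>" by (rule finite_measure_pos_part) fact
  interpret N: finite_measure "neg_part \<nu>" by (rule finite_measure_neg_part) fact
  have s: "signed_measure \<nu>" using assms by (simp add: finite_signed_measure_signed)
  have d: "\<nu> A = \<nu> B + \<nu> (A - B)" if "B \<in> sets pos_borel" "B \<subseteq> A" for B
    using signed_measure_Un[OF s, of B "A - B"] that assms(2) by (auto simp: Un_absorb1)
  have "\<nu> B \<le> \<nu> A + measure (neg_part \<nu>) A" if "B \<in> sets pos_borel" "B \<subseteq> A" for B
  proof -
    have "ennreal (- \<nu> (A - B)) \<le> emeasure (neg_part \<nu>) A"
      unfolding emeasure_neg_part[OF s assms(2)]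
      using pos_var_upper[of "A - B" A "\<lambda>A. - \<nu> A"] that assms(2) by auto
    then have "- \<nu> (A - B) \<le> measure (neg_part \<nu>) A"
      by (auto simp: N.emeasure_eq_measure ennreal_le_iff2 intro: order_trans[OF _ measure_nonneg])
    then show ?thesis using d[OF that] by linarith
  qed
  then have "emeasure (pos_part \<nu>) A \<le> ennreal (\<nu> A + measure (neg_part \<nu>) A)"
    unfolding emeasure_pos_part[OF s assms(2)] pos_var_def
    by (auto intro!: SUP_least ennreal_leI)
  moreover have nn: "0 \<le> \<nu> A + measure (neg_part \<nu>) A"
    using \<open>\<And>B. B \<in> sets pos_borel \<Longrightarrow> B \<subseteq> A \<Longrightarrow> \<nu> B \<le> _\<close>[of "{}"] s by (simp add: signed_measure_def)
  ultimately have 1: "measure (pos_part \<nu>) A \<le> \<nu> A + measure (neg_part \<nu>) A"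
    by (simp add: P.emeasure_eq_measure)
  have "- \<nu> B \<le> measure (pos_part \<nu>) A - \<nu> A" if "B \<in> sets pos_borel" "B \<subseteq> A" for B
  proof -
    have "ennreal (\<nu> (A - B)) \<le> emeasure (pos_part \<nu>) A"
      unfolding emeasure_pos_part[OF s assms(2)]
      using pos_var_upper[of "A - B" A "\<nu>"] that assms(2) by auto
    then have "\<nu> (A - B) \<le> measure (pos_part \<nu>) A"
      by (auto simp: P.emeasure_eq_measure ennreal_le_iff2 intro: order_trans[OF _ measure_nonneg])
    then show ?thesis using d[OF that] by linarith
  qed
  then have "emeasure (neg_part \<nu>) A \<le> ennreal (measure (pos_part \<nu>) A - \<nu> A)"
    unfolding emeasure_neg_part[OF s assms(2)] pos_var_def
    by (auto intro!: SUP_least ennreal_leI)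
  moreover have "0 \<le> measure (pos_part \<nu>) A - \<nu> A"
    using \<open>\<And>B. B \<in> sets pos_borel \<Longrightarrow> B \<subseteq> A \<Longrightarrow> - \<nu> B \<le> _\<close>[of "{}"] s by (simp add: signed_measure_def)
  ultimately have 2: "measure (neg_part \<nu>) A \<le> measure (pos_part \<nu>) A - \<nu> A"
    by (simp add: N.emeasure_eq_measure)
  from 1 2 show ?thesis by linarith
qed

text \<open>
  A Hahn set for the pair of unsigned measures \<open>pos_part \<nu>\<close>,
  \<open>neg_part \<nu>\<close> is a set on which \<open>\<nu>\<close> is non-negative and off which
  it is non-positive. Since both parts are suprema of values of \<open>\<nu>\<close> and
  \<open>-\<nu>\<close>, each of them vanishes on the wrong side.
\<close>

lemma hahn_decomposition:
  assumes "finite_signed_measure \<nu>"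
  obtains Y where "Y \<in> sets pos_borel"
    "\<And>A. A \<in> sets pos_borel \<Longrightarrow> emeasure (pos_part \<nu>) A = emeasure (total_var \<nu>) (A \<inter> Y)"
    "\<And>A. A \<in> sets pos_borel \<Longrightarrow> emeasure (neg_part \<nu>) A = emeasure (total_var \<nu>) (A - Y)"
proof -
  interpret P: finite_measure "pos_part \<nu>" by (rule finite_measure_pos_part) fact
  interpret N: finite_measure "neg_part \<nu>" by (rule finite_measure_neg_part) fact
  have s: "signed_measure \<nu>" using assms by (simp add: finite_signed_measure_signed)
  obtain Y where Y: "Y \<in> sets pos_borel"
    and le: "\<And>X. X \<in> sets pos_borel \<Longrightarrow> X \<subseteq> Y \<Longrightarrow> emeasure (neg_part \<nu>) X \<le> emeasure (pos_part \<nu>) X"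
    and ge: "\<And>X. X \<in> sets pos_borel \<Longrightarrow> X \<inter> Y = {} \<Longrightarrow> emeasure (pos_part \<nu>) X \<le> emeasure (neg_part \<nu>) X"
    using finite_unsigned_Hahn_decomposition[OF P.finite_measure_axioms N.finite_measure_axioms] by auto
  have pos: "0 \<le> \<nu> X" if "X \<in> sets pos_borel" "X \<subseteq> Y" for X
    using le[OF that] jordan_decomposition[OF assms that(1)]
    by (simp add: P.emeasure_eq_measure N.emeasure_eq_measure)
  have neg: "\<nu> X \<le> 0" if "X \<in> sets pos_borel" "X \<inter> Y = {}" for X
    using ge[OF that] jordan_decomposition[OF assms that(1)]
    by (simp add: P.emeasure_eq_measure N.emeasure_eq_measure)
  have P0: "emeasure (pos_part \<nu>) X = 0" if "X \<in> sets pos_borel" "X \<inter> Y = {}" for X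
  proof -
    have "pos_var \<nu> X \<le> 0"
      unfolding pos_var_def
    proof (rule SUP_least, clarify)
      fix B assume "B \<in> sets pos_borel" "B \<subseteq> X"
      then have "\<nu> B \<le> 0" using that by (intro neg) auto
      then show "ennreal (\<nu> B) \<le> 0" by (simp add: ennreal_neg)
    qed
    then show ?thesis using emeasure_pos_part[OF s that(1)] by simp
  qed
  have N0: "emeasure (neg_part \<nu>) X = 0" if "X \<in> sets pos_borel" "X \<subseteq> Y" for X
  proof -
    have "pos_var (\<lambda>A. - \<nu> A) X \<le> 0"
      unfolding pos_var_def
    proof (rule SUP_least, clarify)
      fix B assume "B \<in> sets pos_borel" "B \<subseteq> X"
      then have "0 \<le> \<nu> B" using that by (intro pos) auto
      then show "ennreal (- \<nu> B) \<le> 0" by (simp add: ennreal_neg)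
    qed
    then show ?thesis using emeasure_neg_part[OF s that(1)] by simp
  qed
  show thesis
  proof (rule that[of Y])
    fix A assume A: "A \<in> sets pos_borel"
    have sp: "emeasure \<kappa> A = emeasure \<kappa> (A \<inter> Y) + emeasure \<kappa> (A - Y)"
      if "sets \<kappa> = sets pos_borel" for \<kappa> :: "real measure"
      using that A Y by (subst plus_emeasure) (auto intro!: arg_cong[where f="emeasure \<kappa>"])
    have I: "A \<inter> Y \<in> sets pos_borel" "A - Y \<in> sets pos_borel" using A Y by auto
    show "emeasure (pos_part \<nu>) A = emeasure (total_var \<nu>) (A \<inter> Y)"
      using I P0[of "A - Y"] N0[of "A \<inter> Y"] by (subst sp) (auto simp: emeasure_total_var[OF s])
    show "emeasure (neg_part \<nu>) A = emeasure (total_var \<nu>) (A - Y)"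
      using I P0[of "A - Y"] N0[of "A \<inter> Y"] by (subst sp) (auto simp: emeasure_total_var[OF s])
  qed (rule Y)
qed

text \<open>
  Polar decomposition \<open>d\<nu> = S d|\<nu>|\<close>. It reduces integration against a signed
  measure to integration against the positive measure \<open>total_var \<nu>\<close>, for which
  dominated convergence and Fubini's theorem are available.
\<close>

definition polar :: "(real set \<Rightarrow> real) \<Rightarrow> (real \<Rightarrow> real) \<Rightarrow> bool" where
  "polar \<nu> S \<longleftrightarrow> S \<in> borel_measurable pos_borel \<and> (\<forall>x. S x = 1 \<or> S x = - 1) \<and>
     (\<forall>f. integrable (total_var \<nu>) f \<longrightarrow> signed_integral \<nu> f = (\<integral>x. f x * S x \<partial>total_var \<nu>))"

lemma measurable_eq_pos_borel:
  "sets M = sets pos_borel \<Longrightarrow> borel_measurable M = borel_measurable pos_borel"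
  by (rule measurable_cong_sets) auto

lemma polar_exists:
  assumes "finite_signed_measure \<nu>"
  shows "\<exists>S. polar \<nu> S"
proof -
  interpret T: finite_measure "total_var \<nu>" by (rule finite_measure_total_var) fact
  obtain Y where Y: "Y \<in> sets pos_borel"
    and P: "\<And>A. A \<in> sets pos_borel \<Longrightarrow> emeasure (pos_part \<nu>) A = emeasure (total_var \<nu>) (A \<inter> Y)"
    and N: "\<And>A. A \<in> sets pos_borel \<Longrightarrow> emeasure (neg_part \<nu>) A = emeasure (total_var \<nu>) (A - Y)"
    using hahn_decomposition[OF assms] by blast
  define Z where "Z = {0<..} - Y"
  have Z: "Z \<in> sets pos_borel" unfolding Z_def using Y sets.compl_sets[of Y pos_borel] by simp
  have emd: "emeasure (density (total_var \<nu>) (\<lambda>x. ennreal (indicator W x))) A = emeasure (total_var \<nu>) (W \<inter> A)"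
    if "W \<in> sets pos_borel" "A \<in> sets pos_borel" for W A
    unfolding ennreal_indicator using that by (intro emeasure_restricted) auto
  have P: "pos_part \<nu> = density (total_var \<nu>) (\<lambda>x. ennreal (indicator Y x))"
    by (rule measure_eqI) (simp_all add: P emd Y Int_commute)
  have "A - Y = Z \<inter> A" if "A \<in> sets pos_borel" for A
    using sets_pos_borel_subset[OF that] by (auto simp: Z_def)
  then have N: "neg_part \<nu> = density (total_var \<nu>) (\<lambda>x. ennreal (indicator Z x))"
    by (intro measure_eqI) (simp_all add: N emd Z)
  have si: "signed_integral \<nu> f = (\<integral>x. f x * (if x \<in> Y then 1 else - 1) \<partial>total_var \<nu>)"
    if f: "integrable (total_var \<nu>) f" for f
  proof -
    have m: "f \<in> borel_measurable (total_var \<nu>)" using f by auto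
    have Ys: "Y \<in> sets (total_var \<nu>)" "Z \<in> sets (total_var \<nu>)" using Y Z by auto
    have int: "integrable (total_var \<nu>) (\<lambda>x. indicator Y x *\<^sub>R f x)"
       "integrable (total_var \<nu>) (\<lambda>x. indicator Z x *\<^sub>R f x)"
      using f Ys by (intro integrable_mult_indicator; simp)+
    have "signed_integral \<nu> f = (\<integral>x. indicator Y x *\<^sub>R f x \<partial>total_var \<nu>) - (\<integral>x. indicator Z x *\<^sub>R f x \<partial>total_var \<nu>)"
    proof -
      have "integral\<^sup>L (density (total_var \<nu>) (\<lambda>x. ennreal (indicator W x))) f = (\<integral>x. indicator W x *\<^sub>R f x \<partial>total_var \<nu>)"
        if "W \<in> sets (total_var \<nu>)" for W
        using m that by (intro integral_density borel_measurable_indicator AE_I2) auto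
      then show ?thesis unfolding signed_integral_def P N using Ys by metis
    qed
    also have "\<dots> = (\<integral>x. indicator Y x *\<^sub>R f x - indicator Z x *\<^sub>R f x \<partial>total_var \<nu>)"
      using int by (rule Bochner_Integration.integral_diff[symmetric])
    also have "\<dots> = (\<integral>x. f x * (if x \<in> Y then 1 else - 1) \<partial>total_var \<nu>)"
      by (rule Bochner_Integration.integral_cong) (auto simp: Z_def)
    finally show ?thesis .
  qed
  have "(\<lambda>x. if x \<in> Y then 1 else - 1 :: real) \<in> borel_measurable pos_borel"
    using Y by (intro measurable_If_set) (auto simp: Int_absorb2 sets_pos_borel_subset)
  then show ?thesis using si unfolding polar_def by (intro exI[of _ "\<lambda>x. if x \<in> Y then 1 else - 1"]) auto
qed

definition sgn_density :: "(real set \<Rightarrow> real) \<Rightarrow> real \<Rightarrow> real" where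
  "sgn_density \<nu> = (SOME S. polar \<nu> S)"

lemma polar_sgn_density: "finite_signed_measure \<nu> \<Longrightarrow> polar \<nu> (sgn_density \<nu>)"
  unfolding sgn_density_def using polar_exists by (rule someI_ex)

lemma sgn_density:
  assumes "finite_signed_measure \<nu>"
  shows sgn_density_measurable: "sgn_density \<nu> \<in> borel_measurable pos_borel"
    and sgn_density_abs: "\<bar>sgn_density \<nu> x\<bar> = 1"
    and signed_integral_polar: "integrable (total_var \<nu>) f \<Longrightarrow>
      signed_integral \<nu> f = (\<integral>x. f x * sgn_density \<nu> x \<partial>total_var \<nu>)"
  using polar_sgn_density[OF assms] unfolding polar_def by (auto, metis abs_1 abs_minus_cancel)

section \<open>The spaces of signed measures with a weight\<close>

definition weight :: "(real \<Rightarrow> real) \<Rightarrow> bool" where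
  "weight w \<longleftrightarrow> w \<in> borel_measurable pos_borel \<and> (\<forall>x>0. 1 \<le> w x)"

lemma bdd_measurable_integrable:
  assumes "finite_measure M" "sets M = sets pos_borel" "bdd_measurable f"
  shows "integrable M f"
proof -
  interpret finite_measure M by fact
  have sp: "space M = {0<..}" using sets_eq_imp_space_eq[OF assms(2)] by simp
  obtain B where "\<And>x. x > 0 \<Longrightarrow> \<bar>f x\<bar> \<le> B" using assms(3) by (auto simp: bdd_measurable_def)
  then show ?thesis using assms(2,3) sp
    by (intro integrable_const_bound[of _ B])
      (auto simp: bdd_measurable_def measurable_eq_pos_borel[OF assms(2)])
qed

lemma bdd_measurable_mult_sgn:
  assumes "finite_signed_measure \<nu>" "bdd_measurable f"
  shows "bdd_measurable (\<lambda>x. f x * sgn_density \<nu> x)"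
  using assms sgn_density_measurable[OF assms(1)]
  by (auto simp: bdd_measurable_def abs_mult sgn_density_abs)

lemma sgn_density_mult_self [simp]:
  assumes "finite_signed_measure \<nu>"
  shows "sgn_density \<nu> x * sgn_density \<nu> x = 1"
  using sgn_density_abs[OF assms, of x] by (metis abs_mult_self_eq mult_1)

lemma total_var_integral:
  assumes "finite_signed_measure \<nu>" "integrable (total_var \<nu>) f"
  shows "(\<integral>x. f x \<partial>total_var \<nu>) = signed_integral \<nu> (\<lambda>x. f x * sgn_density \<nu> x)"
proof -
  have "integrable (total_var \<nu>) (\<lambda>x. f x * sgn_density \<nu> x)"
    using assms(2) sgn_density_measurable[OF assms(1)]
    by (intro Bochner_Integration.integrable_bound[OF assms(2)])
      (auto simp: abs_mult sgn_density_abs[OF assms(1)] measurable_eq_pos_borel[OF total_var_sets])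
  then show ?thesis
    using assms(1) by (simp add: signed_integral_polar mult.assoc)
qed

lemma abs_signed_integral_le:
  assumes "finite_signed_measure \<nu>" "integrable (total_var \<nu>) f"
  shows "\<bar>signed_integral \<nu> f\<bar> \<le> (\<integral>x. \<bar>f x\<bar> \<partial>total_var \<nu>)"
proof -
  have "\<bar>\<integral>x. f x * sgn_density \<nu> x \<partial>total_var \<nu>\<bar> \<le> (\<integral>x. \<bar>f x * sgn_density \<nu> x\<bar> \<partial>total_var \<nu>)"
    by (rule integral_abs_bound)
  then show ?thesis using assms by (simp add: signed_integral_polar abs_mult sgn_density_abs)
qed

lemma integral_simple_function:
  fixes F :: "real \<Rightarrow> real"
  assumes "finite_measure M" "sets M = sets pos_borel" "simple_function pos_borel F"
  shows "(\<integral>x. F x \<partial>M) = (\<Sum>y\<in>F ` {0<..}. y * measure M {x \<in> {0<..}. F x = y})"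
proof -
  interpret finite_measure M by fact
  have sp: "space M = {0<..}" using sets_eq_imp_space_eq[OF assms(2)] by simp
  have "simple_function M F" using assms(2,3) sp by (simp add: simple_function_def)
  moreover have "emeasure M {y \<in> space M. F y \<noteq> 0} \<noteq> \<infinity>" by simp
  ultimately have "Bochner_Integration.simple_bochner_integrable M F" by (rule simple_bochner_integrable.intros)
  then have "integral\<^sup>L M F = Bochner_Integration.simple_bochner_integral M F"
    by (rule simple_bochner_integrable_eq_integral[symmetric])
  then show ?thesis by (simp add: simple_bochner_integral_def sp mult.commute)
qed

text \<open>
  This formula is visibly linear in \<open>\<nu>\<close>, which the definition by positive and
  negative parts is not.
\<close>

lemma signed_integral_simple_function:
  assumes "finite_signed_measure \<nu>" "simple_function pos_borel F"
  shows "signed_integral \<nu> F = (\<Sum>y\<in>F ` {0<..}. y * \<nu> {x \<in> {0<..}. F x = y})"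
proof -
  have s: "{x \<in> {0<..}. F x = y} \<in> sets pos_borel" for y
  proof -
    have "F -` {y} \<inter> space pos_borel \<in> sets pos_borel"
      using assms(2) by (rule simple_functionD(2))
    moreover have "F -` {y} \<inter> space pos_borel = {x \<in> {0<..}. F x = y}" by auto
    ultimately show ?thesis by simp
  qed
  show ?thesis
    unfolding signed_integral_def jordan_decomposition[OF assms(1) s]
      integral_simple_function[OF finite_measure_pos_part[OF assms(1)] pos_part_sets assms(2)]
      integral_simple_function[OF finite_measure_neg_part[OF assms(1)] neg_part_sets assms(2)]
    by (simp add: sum_subtractf right_diff_distrib)
qed

lemma signed_integral_tendsto:
  assumes \<nu>: "finite_signed_measure \<nu>" and g: "integrable (total_var \<nu>) g"
    and F: "\<And>i. F i \<in> borel_measurable pos_borel" and f: "f \<in> borel_measurable pos_borel"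
    and le: "\<And>i x. x > 0 \<Longrightarrow> \<bar>F i x\<bar> \<le> g x"
    and lim: "\<And>x. x > 0 \<Longrightarrow> (\<lambda>i. F i x) \<longlonglongrightarrow> f x"
  shows "(\<lambda>i. signed_integral \<nu> (F i)) \<longlonglongrightarrow> signed_integral \<nu> f"
proof -
  note m = measurable_eq_pos_borel[OF total_var_sets] sgn_density_measurable[OF \<nu>]
  have fle: "\<bar>f x\<bar> \<le> g x" if "x > 0" for x
    by (rule LIMSEQ_le_const2[OF tendsto_rabs[OF lim[OF that]]]) (use le[OF that] in auto)
  have iF: "integrable (total_var \<nu>) (F i)" for i
    using g F le by (intro Bochner_Integration.integrable_bound[OF g]) (auto simp: m intro!: AE_I2 order_trans[OF le])
  have if': "integrable (total_var \<nu>) f"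
    using g f fle by (intro Bochner_Integration.integrable_bound[OF g]) (auto simp: m intro!: AE_I2 order_trans[OF fle])
  have mS: "(\<lambda>x. h x * sgn_density \<nu> x) \<in> borel_measurable (total_var \<nu>)"
    if "h \<in> borel_measurable pos_borel" for h :: "real \<Rightarrow> real"
    unfolding measurable_eq_pos_borel[OF total_var_sets] using that m(2) by (rule borel_measurable_times)
  note mS = mS[OF F] mS[OF f]
  have "(\<lambda>i. \<integral>x. F i x * sgn_density \<nu> x \<partial>total_var \<nu>) \<longlonglongrightarrow> (\<integral>x. f x * sgn_density \<nu> x \<partial>total_var \<nu>)"
    using g
    by (intro integral_dominated_convergence[where w=g])
      (auto intro!: AE_I2 tendsto_mult lim mS simp: abs_mult sgn_density_abs[OF \<nu>] le)
  then show ?thesis using signed_integral_polar[OF \<nu>] iF if' by simp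
qed

lemma finite_signed_measure_lincomb:
  assumes "finite_signed_measure \<nu>1" "finite_signed_measure \<nu>2"
  shows "finite_signed_measure (\<lambda>A. a * \<nu>1 A + b * \<nu>2 A)"
proof -
  obtain B1 B2 where B: "\<And>A. \<bar>\<nu>1 A\<bar> \<le> B1" "\<And>A. \<bar>\<nu>2 A\<bar> \<le> B2"
    using assms by (auto simp: finite_signed_measure_def)
  have "\<bar>a * \<nu>1 A + b * \<nu>2 A\<bar> \<le> \<bar>a\<bar> * B1 + \<bar>b\<bar> * B2" for A
  proof -
    have "\<bar>a * \<nu>1 A + b * \<nu>2 A\<bar> \<le> \<bar>a\<bar> * \<bar>\<nu>1 A\<bar> + \<bar>b\<bar> * \<bar>\<nu>2 A\<bar>"
      by (metis abs_mult abs_triangle_ineq)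
    also have "\<dots> \<le> \<bar>a\<bar> * B1 + \<bar>b\<bar> * B2"
      using B by (intro add_mono mult_left_mono) auto
    finally show ?thesis .
  qed
  moreover have "signed_measure (\<lambda>A. a * \<nu>1 A + b * \<nu>2 A)"
    using assms[THEN finite_signed_measure_signed] unfolding signed_measure_def
    by (auto intro!: sums_add sums_mult)
  ultimately show ?thesis unfolding finite_signed_measure_def by blast
qed

text \<open>
  The parts of a linear combination are not linear combinations of the parts. So linearity in the
  measure is read off from simple functions and carried over by dominated convergence.
\<close>

lemma signed_integral_lincomb:
  assumes \<nu>: "finite_signed_measure \<nu>1" "finite_signed_measure \<nu>2"
    and f: "f \<in> borel_measurable pos_borel"
    and i: "integrable (total_var \<nu>1) f" "integrable (total_var \<nu>2) f"
      "integrable (total_var (\<lambda>A. a * \<nu>1 A + b * \<nu>2 A)) f"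
  shows "signed_integral (\<lambda>A. a * \<nu>1 A + b * \<nu>2 A) f = a * signed_integral \<nu>1 f + b * signed_integral \<nu>2 f"
proof -
  have \<nu>': "finite_signed_measure (\<lambda>A. a * \<nu>1 A + b * \<nu>2 A)"
    using \<nu> by (rule finite_signed_measure_lincomb)
  obtain F where F': "\<forall>i. simple_function pos_borel (F i)"
    "\<forall>x\<in>space pos_borel. (\<lambda>i. F i x) \<longlonglongrightarrow> f x"
    "\<forall>i. \<forall>x\<in>space pos_borel. dist (F i x) 0 \<le> 2 * dist (f x) 0"
    using borel_measurable_implies_sequence_metric[OF f, of 0] by blast
  then have F: "\<And>i. simple_function pos_borel (F i)"
    and lim: "\<And>x. x > 0 \<Longrightarrow> (\<lambda>i. F i x) \<longlonglongrightarrow> f x"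
    and le: "\<And>i x. x > 0 \<Longrightarrow> \<bar>F i x\<bar> \<le> 2 * \<bar>f x\<bar>"
    by (auto simp: dist_real_def)
  have Fm: "F i \<in> borel_measurable pos_borel" for i
    using F by (rule borel_measurable_simple_function)
  have c: "(\<lambda>i. signed_integral \<kappa> (F i)) \<longlonglongrightarrow> signed_integral \<kappa> f"
    if "finite_signed_measure \<kappa>" "integrable (total_var \<kappa>) f" for \<kappa>
    using that Fm f le lim by (intro signed_integral_tendsto[where g="\<lambda>x. 2 * \<bar>f x\<bar>"]) auto
  have "(\<lambda>i. a * signed_integral \<nu>1 (F i) + b * signed_integral \<nu>2 (F i)) \<longlonglongrightarrow>
      a * signed_integral \<nu>1 f + b * signed_integral \<nu>2 f"
    using \<nu> i by (intro tendsto_intros c) auto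
  moreover have "signed_integral (\<lambda>A. a * \<nu>1 A + b * \<nu>2 A) (F i) =
      a * signed_integral \<nu>1 (F i) + b * signed_integral \<nu>2 (F i)" for i
    unfolding signed_integral_simple_function[OF \<nu>' F] signed_integral_simple_function[OF \<nu>(1) F]
      signed_integral_simple_function[OF \<nu>(2) F]
    by (simp add: sum_distrib_left sum.distrib algebra_simps)
  ultimately show ?thesis using c[OF \<nu>' i(3)] LIMSEQ_unique by fastforce
qed

lemma signed_integral_lincomb_bdd:
  assumes \<nu>: "finite_signed_measure \<nu>1" "finite_signed_measure \<nu>2" and f: "bdd_measurable f"
  shows "signed_integral (\<lambda>A. a * \<nu>1 A + b * \<nu>2 A) f = a * signed_integral \<nu>1 f + b * signed_integral \<nu>2 f"
proof (rule signed_integral_lincomb[OF \<nu>])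
  show "f \<in> borel_measurable pos_borel" using f by (simp add: bdd_measurable_def)
qed (intro bdd_measurable_integrable finite_measure_total_var \<nu> finite_signed_measure_lincomb f total_var_sets)+

text \<open>
  The test functions \<open>min w n * S\<close>, with \<open>S\<close> the sign density of
  \<open>\<nu>\<close>, are bounded and exhaust the norm by monotone convergence.
\<close>

lemma nn_integral_total_var_le:
  assumes \<nu>: "finite_signed_measure \<nu>" and w: "w \<in> borel_measurable pos_borel" "\<And>x. x > 0 \<Longrightarrow> 0 \<le> w x"
    and le: "\<And>f. bdd_measurable f \<Longrightarrow> (\<forall>x>0. \<bar>f x\<bar> \<le> w x) \<Longrightarrow> signed_integral \<nu> f \<le> c"
  shows "(\<integral>\<^sup>+x. ennreal (w x) \<partial>total_var \<nu>) \<le> ennreal c"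
proof -
  note fin = finite_measure_total_var[OF \<nu>]
  note m = measurable_eq_pos_borel[OF total_var_sets]
  define v where "v n x = min (w x) (real n)" for n x
  have vm: "v n \<in> borel_measurable pos_borel" for n using w(1) unfolding v_def[abs_def] by simp
  have vb: "bdd_measurable (v n)" for n
    using vm w(2) by (auto simp: bdd_measurable_def v_def intro!: exI[of _ "real n"])
  have *: "(\<integral>\<^sup>+x. ennreal (v n x) \<partial>total_var \<nu>) \<le> ennreal c" for n
  proof -
    have i: "integrable (total_var \<nu>) (v n)"
      by (rule bdd_measurable_integrable[OF fin total_var_sets vb])
    have "(\<integral>\<^sup>+x. ennreal (v n x) \<partial>total_var \<nu>) = ennreal (\<integral>x. v n x \<partial>total_var \<nu>)"
      by (intro nn_integral_eq_integral i) (use w(2) in \<open>auto simp: v_def intro!: AE_I2\<close>)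
    also have "(\<integral>x. v n x \<partial>total_var \<nu>) = signed_integral \<nu> (\<lambda>x. v n x * sgn_density \<nu> x)"
      using \<nu> i by (rule total_var_integral)
    also have "ennreal \<dots> \<le> ennreal c"
      using w(2) by (intro ennreal_leI le bdd_measurable_mult_sgn \<nu> vb)
        (auto simp: abs_mult sgn_density_abs[OF \<nu>] v_def)
    finally show ?thesis .
  qed
  have s: "(SUP n. ennreal (v n x)) = ennreal (w x)" for x
  proof (rule antisym)
    show "(SUP n. ennreal (v n x)) \<le> ennreal (w x)"
      by (auto intro!: SUP_least ennreal_leI simp: v_def)
    have "v (nat \<lceil>w x\<rceil>) x = w x" unfolding v_def by linarith
    then show "ennreal (w x) \<le> (SUP n. ennreal (v n x))"
      by (metis SUP_upper UNIV_I)
  qed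
  have "(\<integral>\<^sup>+x. ennreal (w x) \<partial>total_var \<nu>) = (\<integral>\<^sup>+x. (SUP n. ennreal (v n x)) \<partial>total_var \<nu>)"
    by (simp add: s)
  also have "\<dots> = (SUP n. \<integral>\<^sup>+x. ennreal (v n x) \<partial>total_var \<nu>)"
  proof (rule nn_integral_monotone_convergence_SUP)
    show "incseq (\<lambda>n x. ennreal (v n x))"
      by (auto simp: incseq_def le_fun_def v_def intro!: ennreal_leI)
  qed (use vm in \<open>simp add: m\<close>)
  also have "\<dots> \<le> ennreal c" by (rule SUP_least) (rule *)
  finally show ?thesis .
qed

lemma signed_integral_zero [simp]: "signed_integral \<nu> (\<lambda>x. 0) = 0"
  by (simp add: signed_integral_def)

lemma bdd_measurable_zero [simp]: "bdd_measurable (\<lambda>x. 0)"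
  by (auto simp: bdd_measurable_def)

text \<open>
  The norm is the supremum of the pairings with bounded test functions below the weight. Evolving
  norms are estimated from above in this way, since the evolution equations are known for bounded test
  functions.
\<close>

lemma norm1_leI:
  assumes "finite_signed_measure \<nu>" "weight w"
    and le: "\<And>f. bdd_measurable f \<Longrightarrow> (\<forall>x>0. \<bar>f x\<bar> \<le> w x) \<Longrightarrow> signed_integral \<nu> f \<le> c"
  shows "\<nu> \<in> M1 w" "norm1 w \<nu> \<le> c"
proof -
  have w: "0 \<le> w x" if "x > 0" for x using assms(2) that unfolding weight_def by (metis order_trans zero_le_one)
  have "(\<integral>\<^sup>+x. ennreal (w x) \<partial>total_var \<nu>) \<le> ennreal c"
    using assms w by (intro nn_integral_total_var_le) (auto simp: weight_def)
  moreover have "0 \<le> c" using le[of "\<lambda>x. 0"] w by simp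
  ultimately show "\<nu> \<in> M1 w" "norm1 w \<nu> \<le> c"
    using assms(1) by (auto simp: M1_def norm1_def finite_signed_measure_def enn2real_leI
       intro: le_less_trans)
qed

lemma M1_finite_signed_measure:
  assumes "\<nu> \<in> M1 w" "weight w"
  shows "finite_signed_measure \<nu>"
proof -
  have s: "signed_measure \<nu>" and fin: "(\<integral>\<^sup>+x. ennreal (w x) \<partial>total_var \<nu>) < \<infinity>"
    using assms(1) by (auto simp: M1_def)
  have top: "{0<..} \<in> sets pos_borel" using sets.top[of pos_borel] by simp
  have "emeasure (total_var \<nu>) {0<..} = (\<integral>\<^sup>+x. 1 \<partial>total_var \<nu>)" by simp
  also have "\<dots> \<le> (\<integral>\<^sup>+x. ennreal (w x) \<partial>total_var \<nu>)"
    using assms(2) by (intro nn_integral_mono) (auto simp: weight_def)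
  finally have "emeasure (total_var \<nu>) {0<..} < \<infinity>" using fin by (rule le_less_trans)
  then obtain c where c: "c \<ge> 0" "emeasure (total_var \<nu>) {0<..} = ennreal c"
    by (metis ennreal_cases infinity_ennreal_def order_less_irrefl)
  have "\<bar>\<nu> A\<bar> \<le> c" for A
  proof (cases "A \<in> sets pos_borel")
    case True
    then have A: "A \<subseteq> {0<..}" by (rule sets_pos_borel_subset)
    have "ennreal (\<nu> A) \<le> ennreal c"
      unfolding c(2)[symmetric] emeasure_total_var[OF s top] emeasure_pos_part[OF s top]
      using pos_var_upper[OF True A, of \<nu>] by (simp add: add_increasing2)
    moreover have "ennreal (- \<nu> A) \<le> ennreal c"
      unfolding c(2)[symmetric] emeasure_total_var[OF s top] emeasure_neg_part[OF s top]
      using pos_var_upper[OF True A, of "\<lambda>A. - \<nu> A"] by (simp add: add_increasing)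
    ultimately show ?thesis using c(1) by (auto simp: ennreal_le_iff abs_le_iff)
  qed (use s c in \<open>auto simp: signed_measure_def\<close>)
  then show ?thesis using s by (auto simp: finite_signed_measure_def)
qed

lemma M1_integrable:
  assumes "\<nu> \<in> M1 w" "weight w"
  shows "integrable (total_var \<nu>) w" and "norm1 w \<nu> = (\<integral>x. w x \<partial>total_var \<nu>)"
proof -
  have w: "0 \<le> w x" if "x > 0" for x using assms(2) that unfolding weight_def by (metis order_trans zero_le_one)
  show i: "integrable (total_var \<nu>) w"
    using assms w by (intro integrableI_nonneg)
      (auto simp: M1_def weight_def measurable_eq_pos_borel[OF total_var_sets] intro!: AE_I2)
  show "norm1 w \<nu> = (\<integral>x. w x \<partial>total_var \<nu>)"
    unfolding norm1_def using i w by (subst nn_integral_eq_integral) (auto intro!: AE_I2 integral_nonneg_AE enn2real_ennreal)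
qed

lemma norm1_nonneg [simp]: "0 \<le> norm1 w \<nu>"
  by (simp add: norm1_def)

lemma integrable_total_var_bound:
  assumes "\<nu> \<in> M1 w" "weight w" "f \<in> borel_measurable pos_borel" "\<And>x. x > 0 \<Longrightarrow> \<bar>f x\<bar> \<le> c * w x"
  shows "integrable (total_var \<nu>) f"
proof (rule Bochner_Integration.integrable_bound)
  show "integrable (total_var \<nu>) (\<lambda>x. c * w x)" using M1_integrable(1)[OF assms(1,2)] by simp
  show "f \<in> borel_measurable (total_var \<nu>)" using assms(3) by (simp add: measurable_eq_pos_borel[OF total_var_sets])
  show "AE x in total_var \<nu>. norm (f x) \<le> norm (c * w x)"
    using assms(4) by (intro AE_I2) (auto intro: order_trans[OF _ abs_ge_self])
qed

lemma integral_total_var_bound: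
  assumes "\<nu> \<in> M1 w" "weight w" "f \<in> borel_measurable pos_borel" "\<And>x. x > 0 \<Longrightarrow> \<bar>f x\<bar> \<le> c * w x"
  shows "(\<integral>x. \<bar>f x\<bar> \<partial>total_var \<nu>) \<le> c * norm1 w \<nu>"
proof -
  have "(\<integral>x. \<bar>f x\<bar> \<partial>total_var \<nu>) \<le> (\<integral>x. c * w x \<partial>total_var \<nu>)"
    using integrable_total_var_bound[OF assms] M1_integrable(1)[OF assms(1,2)] assms(4)
    by (intro integral_mono) auto
  then show ?thesis by (simp add: M1_integrable(2)[OF assms(1,2)])
qed

lemma signed_integral_bound:
  assumes "\<nu> \<in> M1 w" "weight w" "f \<in> borel_measurable pos_borel" "\<And>x. x > 0 \<Longrightarrow> \<bar>f x\<bar> \<le> c * w x"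
  shows "\<bar>signed_integral \<nu> f\<bar> \<le> c * norm1 w \<nu>"
  using abs_signed_integral_le[OF M1_finite_signed_measure[OF assms(1,2)] integrable_total_var_bound[OF assms]]
    integral_total_var_bound[OF assms] by simp

text \<open>
  By duality: the pairing with a bounded test function is linear in the measure, while the total
  variation is only sub-linear.
\<close>

lemma M1_lincomb:
  assumes "\<nu>1 \<in> M1 w" "\<nu>2 \<in> M1 w" "weight w"
  shows "(\<lambda>A. a * \<nu>1 A + b * \<nu>2 A) \<in> M1 w"
    and "norm1 w (\<lambda>A. a * \<nu>1 A + b * \<nu>2 A) \<le> \<bar>a\<bar> * norm1 w \<nu>1 + \<bar>b\<bar> * norm1 w \<nu>2"
proof -
  note fs = M1_finite_signed_measure[OF assms(1,3)] M1_finite_signed_measure[OF assms(2,3)]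
  have "signed_integral (\<lambda>A. a * \<nu>1 A + b * \<nu>2 A) f \<le> \<bar>a\<bar> * norm1 w \<nu>1 + \<bar>b\<bar> * norm1 w \<nu>2"
    if f: "bdd_measurable f" "\<forall>x>0. \<bar>f x\<bar> \<le> w x" for f
  proof -
    have b: "\<bar>signed_integral \<nu> f\<bar> \<le> norm1 w \<nu>" if "\<nu> \<in> M1 w" for \<nu>
      using signed_integral_bound[OF that assms(3), of f 1] f by (auto simp: bdd_measurable_def)
    have "a * signed_integral \<nu>1 f + b * signed_integral \<nu>2 f \<le> \<bar>a\<bar> * \<bar>signed_integral \<nu>1 f\<bar> + \<bar>b\<bar> * \<bar>signed_integral \<nu>2 f\<bar>"
      by (metis abs_ge_self abs_mult add_mono)
    also have "\<dots> \<le> \<bar>a\<bar> * norm1 w \<nu>1 + \<bar>b\<bar> * norm1 w \<nu>2"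
      using b assms by (intro add_mono mult_left_mono) auto
    finally show ?thesis using signed_integral_lincomb_bdd[OF fs f(1)] by simp
  qed
  from norm1_leI[OF finite_signed_measure_lincomb[OF fs] assms(3) this]
  show "(\<lambda>A. a * \<nu>1 A + b * \<nu>2 A) \<in> M1 w"
    "norm1 w (\<lambda>A. a * \<nu>1 A + b * \<nu>2 A) \<le> \<bar>a\<bar> * norm1 w \<nu>1 + \<bar>b\<bar> * norm1 w \<nu>2"
    by blast+
qed

lemma signed_integral_lincomb_M1:
  assumes "\<nu>1 \<in> M1 w" "\<nu>2 \<in> M1 w" "weight w" "f \<in> borel_measurable pos_borel" "\<And>x. x > 0 \<Longrightarrow> \<bar>f x\<bar> \<le> c * w x"
  shows "signed_integral (\<lambda>A. a * \<nu>1 A + b * \<nu>2 A) f = a * signed_integral \<nu>1 f + b * signed_integral \<nu>2 f"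
  using assms(4) integrable_total_var_bound[OF _ assms(3-5)] M1_lincomb(1)[OF assms(1-3)] assms(1,2)
    M1_finite_signed_measure[OF assms(1,3)] M1_finite_signed_measure[OF assms(2,3)]
  by (intro signed_integral_lincomb) auto

lemma M1_diff:
  assumes "\<nu>1 \<in> M1 w" "\<nu>2 \<in> M1 w" "weight w"
  shows "(\<lambda>A. \<nu>1 A - \<nu>2 A) \<in> M1 w"
    and "norm1 w (\<lambda>A. \<nu>1 A - \<nu>2 A) \<le> norm1 w \<nu>1 + norm1 w \<nu>2"
  using M1_lincomb[OF assms, of 1 "-1"] by auto

lemma signed_integral_diff_bdd:
  assumes "\<alpha> \<in> M1 w" "\<beta> \<in> M1 w" "weight w" "bdd_measurable f"
  shows "signed_integral (\<lambda>A. \<alpha> A - \<beta> A) f = signed_integral \<alpha> f - signed_integral \<beta> f"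
  using signed_integral_lincomb_bdd[OF M1_finite_signed_measure[OF assms(1,3)] M1_finite_signed_measure[OF assms(2,3)] assms(4), of 1 "-1"]
  by simp

lemma M1_scale:
  assumes "\<nu> \<in> M1 w" "weight w"
  shows "(\<lambda>A. a * \<nu> A) \<in> M1 w" "norm1 w (\<lambda>A. a * \<nu> A) \<le> \<bar>a\<bar> * norm1 w \<nu>"
  using M1_lincomb[OF assms(1,1,2), of a 0] by auto

lemma norm1_triangle:
  assumes "\<alpha> \<in> M1 w" "\<beta> \<in> M1 w" "\<gamma> \<in> M1 w" "weight w"
  shows "norm1 w (\<lambda>A. \<alpha> A - \<gamma> A) \<le> norm1 w (\<lambda>A. \<alpha> A - \<beta> A) + norm1 w (\<lambda>A. \<beta> A - \<gamma> A)"
  using M1_lincomb(2)[OF M1_diff(1)[OF assms(1,2,4)] M1_diff(1)[OF assms(2,3,4)] assms(4), of 1 1]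
  by simp

lemma norm1_minus_commute:
  assumes "\<alpha> \<in> M1 w" "\<beta> \<in> M1 w" "weight w"
  shows "norm1 w (\<lambda>A. \<alpha> A - \<beta> A) = norm1 w (\<lambda>A. \<beta> A - \<alpha> A)"
  using M1_scale(2)[OF M1_diff(1)[OF assms] assms(3), of "-1"]
    M1_scale(2)[OF M1_diff(1)[OF assms(2,1,3)] assms(3), of "-1"] by simp

lemma abs_le_norm1:
  assumes "\<nu> \<in> M1 w" "weight w"
  shows "\<bar>\<nu> A\<bar> \<le> norm1 w \<nu>"
proof (cases "A \<in> sets pos_borel")
  case True
  note fs = M1_finite_signed_measure[OF assms]
  have A: "indicator A \<in> borel_measurable pos_borel" using True by simp
  have "signed_integral \<nu> (indicator A) = \<nu> A"
    unfolding signed_integral_def using True sets_pos_borel_subset[OF True]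
    by (simp add: jordan_decomposition[OF fs True] Int_absorb2)
  moreover have "\<bar>signed_integral \<nu> (indicator A)\<bar> \<le> 1 * norm1 w \<nu>"
    using assms A by (intro signed_integral_bound) (auto simp: weight_def split: split_indicator intro: order_trans)
  ultimately show ?thesis by simp
next
  case False
  then show ?thesis using assms by (auto simp: M1_def signed_measure_def)
qed

lemma M1_mono:
  assumes "\<nu> \<in> M1 w" "weight w" "weight v" "\<And>x. x > 0 \<Longrightarrow> v x \<le> w x"
  shows "\<nu> \<in> M1 v" "norm1 v \<nu> \<le> norm1 w \<nu>"
proof -
  have "(\<integral>\<^sup>+x. ennreal (v x) \<partial>total_var \<nu>) \<le> (\<integral>\<^sup>+x. ennreal (w x) \<partial>total_var \<nu>)"
    using assms(4) by (intro nn_integral_mono ennreal_leI) auto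
  then show "\<nu> \<in> M1 v" "norm1 v \<nu> \<le> norm1 w \<nu>"
    using assms(1) by (auto simp: M1_def norm1_def intro: le_less_trans enn2real_mono)
qed

section \<open>Finite and non-negative measures as signed measures\<close>

lemma finite_signed_measure_measure:
  assumes "finite_measure \<alpha>" "sets \<alpha> = sets pos_borel"
  shows "finite_signed_measure (measure \<alpha>)"
proof -
  interpret finite_measure \<alpha> by fact
  have "signed_measure (measure \<alpha>)"
    unfolding signed_measure_def using assms(2) by (auto intro!: finite_measure_UNION simp: measure_notin_sets)
  moreover have "\<bar>measure \<alpha> A\<bar> \<le> measure \<alpha> (space \<alpha>)" for A by (simp add: bounded_measure)
  ultimately show ?thesis by (auto simp: finite_signed_measure_def)
qed

text \<open>
  For a non-negative set function the supremum over subsets of \<open>A\<close> is attained at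
  \<open>A\<close>, and the negative part is trivial.
\<close>

lemma parts_of_measure:
  assumes "finite_measure \<alpha>" "sets \<alpha> = sets pos_borel"
  shows "pos_part (measure \<alpha>) = \<alpha>" "emeasure (neg_part (measure \<alpha>)) A = 0" "total_var (measure \<alpha>) = \<alpha>"
proof -
  interpret finite_measure \<alpha> by fact
  have s: "signed_measure (measure \<alpha>)"
    by (rule finite_signed_measure_signed[OF finite_signed_measure_measure[OF assms]])
  show P: "pos_part (measure \<alpha>) = \<alpha>"
  proof (rule measure_eqI)
    fix A assume "A \<in> sets (pos_part (measure \<alpha>))"
    then have A: "A \<in> sets pos_borel" by simp
    have "pos_var (measure \<alpha>) A = emeasure \<alpha> A"
    proof (rule antisym)
      show "pos_var (measure \<alpha>) A \<le> emeasure \<alpha> A"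
        unfolding pos_var_def using A assms(2)
        by (auto intro!: SUP_least emeasure_mono simp: emeasure_eq_measure[symmetric])
      show "emeasure \<alpha> A \<le> pos_var (measure \<alpha>) A"
        using pos_var_upper[OF A order_refl, of "measure \<alpha>"] by (simp add: emeasure_eq_measure)
    qed
    then show "emeasure (pos_part (measure \<alpha>)) A = emeasure \<alpha> A"
      using emeasure_pos_part[OF s A] by simp
  qed (simp add: assms(2))
  show N: "emeasure (neg_part (measure \<alpha>)) A = 0" for A
  proof (cases "A \<in> sets pos_borel")
    case True
    have "pos_var (\<lambda>A. - measure \<alpha> A) A \<le> 0"
      unfolding pos_var_def by (rule SUP_least) (simp add: ennreal_neg)
    then show ?thesis using emeasure_neg_part[OF s True] by simp
  qed (simp add: emeasure_notin_sets)
  show "total_var (measure \<alpha>) = \<alpha>"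
    by (rule measure_eqI) (use assms(2) in \<open>auto simp: emeasure_total_var[OF s] P N\<close>)
qed

lemma signed_integral_measure:
  assumes "finite_measure \<alpha>" "sets \<alpha> = sets pos_borel"
  shows "signed_integral (measure \<alpha>) f = (\<integral>x. f x \<partial>\<alpha>)"
proof -
  have "neg_part (measure \<alpha>) = null_measure pos_borel"
    by (rule measure_eqI) (simp_all add: parts_of_measure[OF assms])
  then show ?thesis by (simp add: signed_integral_def parts_of_measure[OF assms])
qed

lemma signed_integral_cong:
  "(\<And>x. x > 0 \<Longrightarrow> f x = g x) \<Longrightarrow> signed_integral \<nu> f = signed_integral \<nu> g"
  unfolding signed_integral_def
  by (intro arg_cong2[where f="(-)"] Bochner_Integration.integral_cong) auto

lemma signed_integral_scale: "signed_integral \<nu> (\<lambda>x. a * f x) = a * signed_integral \<nu> f"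
  by (simp add: signed_integral_def right_diff_distrib)

lemma signed_integral_fun_lincomb:
  assumes "finite_signed_measure \<nu>" "integrable (total_var \<nu>) f" "integrable (total_var \<nu>) g"
  shows "signed_integral \<nu> (\<lambda>x. a * f x + b * g x) = a * signed_integral \<nu> f + b * signed_integral \<nu> g"
proof -
  note m = measurable_eq_pos_borel[OF total_var_sets] sgn_density_measurable[OF assms(1)]
  have i: "integrable (total_var \<nu>) (\<lambda>x. h x * sgn_density \<nu> x)" if "integrable (total_var \<nu>) h" for h
  proof (rule Bochner_Integration.integrable_bound[OF that])
    have "h \<in> borel_measurable pos_borel" using borel_measurable_integrable[OF that] by (simp add: m)
    then show "(\<lambda>x. h x * sgn_density \<nu> x) \<in> borel_measurable (total_var \<nu>)"
      unfolding m using m(2) by (rule borel_measurable_times)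
  qed (simp add: abs_mult sgn_density_abs[OF assms(1)])
  have "signed_integral \<nu> (\<lambda>x. a * f x + b * g x) =
      (\<integral>x. a * (f x * sgn_density \<nu> x) + b * (g x * sgn_density \<nu> x) \<partial>total_var \<nu>)"
    using assms by (subst signed_integral_polar) (auto simp: algebra_simps)
  also have "\<dots> = a * (\<integral>x. f x * sgn_density \<nu> x \<partial>total_var \<nu>) + b * (\<integral>x. g x * sgn_density \<nu> x \<partial>total_var \<nu>)"
    using i[OF assms(2)] i[OF assms(3)] by simp
  finally show ?thesis using assms by (simp add: signed_integral_polar)
qed

lemma signed_integral_fun_lincomb_M1:
  assumes "\<nu> \<in> M1 w" "weight w" "f \<in> borel_measurable pos_borel" "\<And>x. x > 0 \<Longrightarrow> \<bar>f x\<bar> \<le> c * w x"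
    "g \<in> borel_measurable pos_borel" "\<And>x. x > 0 \<Longrightarrow> \<bar>g x\<bar> \<le> d * w x"
  shows "signed_integral \<nu> (\<lambda>x. a * f x + b * g x) = a * signed_integral \<nu> f + b * signed_integral \<nu> g"
  by (intro signed_integral_fun_lincomb M1_finite_signed_measure[OF assms(1,2)]
      integrable_total_var_bound[OF assms(1-4)] integrable_total_var_bound[OF assms(1,2,5,6)])

lemma signed_integral_nonneg_measure:
  assumes "finite_signed_measure \<kappa>" "\<And>A. 0 \<le> \<kappa> A"
  shows "signed_integral \<kappa> f = (\<integral>x. f x \<partial>total_var \<kappa>)"
proof -
  note s = finite_signed_measure_signed[OF assms(1)]
  have N: "emeasure (neg_part \<kappa>) A = 0" if "A \<in> sets pos_borel" for A
  proof -
    have "pos_var (\<lambda>A. - \<kappa> A) A \<le> 0"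
      unfolding pos_var_def by (rule SUP_least) (simp add: ennreal_neg assms(2))
    then show ?thesis using emeasure_neg_part[OF s that] by simp
  qed
  have "neg_part \<kappa> = null_measure pos_borel"
    by (rule measure_eqI) (simp_all add: N)
  moreover have "total_var \<kappa> = pos_part \<kappa>"
    by (rule measure_eqI) (simp_all add: N emeasure_total_var[OF s])
  ultimately show ?thesis by (simp add: signed_integral_def)
qed

lemma signed_integral_mono:
  assumes \<kappa>: "\<kappa> \<in> M1 w" "weight w" "\<And>A. 0 \<le> \<kappa> A"
    and f: "f \<in> borel_measurable pos_borel" "\<And>x. x > 0 \<Longrightarrow> \<bar>f x\<bar> \<le> c * w x"
    and g: "g \<in> borel_measurable pos_borel" "\<And>x. x > 0 \<Longrightarrow> \<bar>g x\<bar> \<le> d * w x"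
    and le: "\<And>x. x > 0 \<Longrightarrow> f x \<le> g x"
  shows "signed_integral \<kappa> f \<le> signed_integral \<kappa> g"
  unfolding signed_integral_nonneg_measure[OF M1_finite_signed_measure[OF \<kappa>(1,2)] \<kappa>(3)]
  using integrable_total_var_bound[OF \<kappa>(1,2) f] integrable_total_var_bound[OF \<kappa>(1,2) g] le
  by (intro integral_mono) auto

lemma norm1_nonneg_measure:
  assumes "\<kappa> \<in> M1 w" "weight w" "\<And>A. 0 \<le> \<kappa> A"
  shows "norm1 w \<kappa> = signed_integral \<kappa> w"
  using assms by (simp add: M1_integrable(2) signed_integral_nonneg_measure M1_finite_signed_measure)

section \<open>Completeness\<close>

lemma signed_measure_sum:
  assumes "signed_measure \<nu>" "range A \<subseteq> sets pos_borel" "disjoint_family (A :: nat \<Rightarrow> real set)"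
  shows "(\<Sum>i<k. \<nu> (A i)) = \<nu> (\<Union>i<k. A i)"
proof (induction k)
  case 0
  then show ?case using assms(1) by (simp add: signed_measure_def)
next
  case (Suc k)
  have "A i \<inter> A k = {}" if "i < k" for i
    using assms(3) that unfolding disjoint_family_on_def by (metis UNIV_I less_irrefl)
  then have "(\<Union>i<k. A i) \<inter> A k = {}" by blast
  moreover have "(\<Union>i<k. A i) \<in> sets pos_borel" "A k \<in> sets pos_borel"
    using assms(2) by (auto intro!: sets.finite_UN)
  ultimately have "\<nu> ((\<Union>i<k. A i) \<union> A k) = \<nu> (\<Union>i<k. A i) + \<nu> (A k)"
    using assms(1) by (intro signed_measure_Un)
  moreover have "(\<Union>i<Suc k. A i) = (\<Union>i<k. A i) \<union> A k" by (auto simp: lessThan_Suc)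
  ultimately show ?case using Suc by simp
qed

text \<open>
  Countable additivity survives because the approximation is uniform over all sets: tails of the limit
  are compared with tails of a single approximant.
\<close>

lemma finite_signed_measure_uniform_limit:
  assumes \<nu>: "\<And>n. finite_signed_measure (\<nu> n)" and le: "\<And>n A. \<bar>\<nu> n A - L A\<bar> \<le> r n"
    and r: "r \<longlonglongrightarrow> (0::real)"
  shows "finite_signed_measure L"
proof -
  have lim: "(\<lambda>n. \<nu> n A) \<longlonglongrightarrow> L A" for A
  proof -
    have "(\<lambda>n. \<nu> n A - L A) \<longlonglongrightarrow> 0"
      by (rule Lim_null_comparison[OF _ r]) (use le in auto)
    then show ?thesis by (simp add: LIM_zero_iff)
  qed
  note s = finite_signed_measure_signed[OF \<nu>]
  have 1: "L A = 0" if "A \<notin> sets pos_borel" for A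
  proof (rule LIMSEQ_unique[OF lim])
    have "\<nu> n A = 0" for n using s[of n] that by (simp add: signed_measure_def)
    then show "(\<lambda>n. \<nu> n A) \<longlonglongrightarrow> 0" by simp
  qed
  have 2: "L {} = 0"
  proof (rule LIMSEQ_unique[OF lim])
    have "\<nu> n {} = 0" for n using s[of n] by (simp add: signed_measure_def)
    then show "(\<lambda>n. \<nu> n {}) \<longlonglongrightarrow> 0" by simp
  qed
  have 3: "(\<lambda>n. L (A n)) sums L (\<Union>n. A n)"
    if A: "range A \<subseteq> sets pos_borel" "disjoint_family A" for A :: "nat \<Rightarrow> real set"
  proof -
    have fin: "(\<Sum>i<k. L (A i)) = L (\<Union>i<k. A i)" for k
    proof (rule LIMSEQ_unique)
      show "(\<lambda>n. \<Sum>i<k. \<nu> n (A i)) \<longlonglongrightarrow> (\<Sum>i<k. L (A i))" by (intro tendsto_sum lim)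
      show "(\<lambda>n. \<Sum>i<k. \<nu> n (A i)) \<longlonglongrightarrow> L (\<Union>i<k. A i)"
        unfolding signed_measure_sum[OF s A] by (rule lim)
    qed
    show ?thesis unfolding sums_def
    proof (rule LIMSEQ_I)
      fix e :: real assume e: "0 < e"
      obtain n where n: "\<bar>r n\<bar> < e / 3"
        using LIMSEQ_D[OF r, of "e / 3"] e by auto
      have "(\<lambda>i. \<nu> n (A i)) sums \<nu> n (\<Union>i. A i)"
        using s[of n] A unfolding signed_measure_def by blast
      then obtain N where N: "\<And>k. k \<ge> N \<Longrightarrow> norm ((\<Sum>i<k. \<nu> n (A i)) - \<nu> n (\<Union>i. A i)) < e / 3"
        unfolding sums_def using LIMSEQ_D e by (metis divide_pos_pos zero_less_numeral)
      have "norm ((\<Sum>i<k. L (A i)) - L (\<Union>i. A i)) < e" if "k \<ge> N" for k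
        using N[OF that] n le[of n "\<Union>i<k. A i"] le[of n "\<Union>i. A i"]
        unfolding fin signed_measure_sum[OF s A] by (auto simp: abs_if split: if_splits)
      then show "\<exists>no. \<forall>k\<ge>no. norm ((\<Sum>i<k. L (A i)) - L (\<Union>i. A i)) < e" by blast
    qed
  qed
  obtain B where B: "\<And>A. \<bar>\<nu> 0 A\<bar> \<le> B" using \<nu>[of 0] by (auto simp: finite_signed_measure_def)
  have "\<bar>L A\<bar> \<le> B + r 0" for A using B[of A] le[of 0 A] by linarith
  then show ?thesis using 1 2 3 unfolding finite_signed_measure_def signed_measure_def by blast
qed

lemma abs_signed_integral_le_sup:
  assumes \<nu>: "finite_signed_measure \<nu>" and r: "\<And>A. \<bar>\<nu> A\<bar> \<le> r"
    and f: "bdd_measurable f" "\<And>x. x > 0 \<Longrightarrow> \<bar>f x\<bar> \<le> B" "0 \<le> B"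
  shows "\<bar>signed_integral \<nu> f\<bar> \<le> B * (2 * r)"
proof -
  interpret T: finite_measure "total_var \<nu>" by (rule finite_measure_total_var[OF \<nu>])
  note s = finite_signed_measure_signed[OF \<nu>]
  have top: "{0<..} \<in> sets pos_borel" using sets.top[of pos_borel] by simp
  have r0: "0 \<le> r" using r[of "{}"] by linarith
  have "emeasure (total_var \<nu>) {0<..} \<le> ennreal r + ennreal r"
    unfolding emeasure_total_var[OF s top] emeasure_pos_part[OF s top] emeasure_neg_part[OF s top] pos_var_def
    using r by (intro add_mono SUP_least ennreal_leI) (auto simp: abs_le_iff)
  also have "\<dots> = ennreal (2 * r)" using r0 by (simp add: ennreal_plus[symmetric] del: ennreal_plus)
  finally have m: "measure (total_var \<nu>) {0<..} \<le> 2 * r"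
    using r0 by (simp add: T.emeasure_eq_measure)
  have i: "integrable (total_var \<nu>) f" by (rule bdd_measurable_integrable[OF T.finite_measure_axioms total_var_sets f(1)])
  have "\<bar>signed_integral \<nu> f\<bar> \<le> (\<integral>x. \<bar>f x\<bar> \<partial>total_var \<nu>)"
    by (rule abs_signed_integral_le[OF \<nu> i])
  also have "\<dots> \<le> (\<integral>x. B \<partial>total_var \<nu>)"
    using i f(2) by (intro integral_mono) auto
  also have "\<dots> \<le> B * (2 * r)" using m f(3) by (simp add: mult.commute mult_left_mono)
  finally show ?thesis .
qed

text \<open>
  The speed \<open>r\<close> is part of the statement because the lemma is applied to curves at each
  time separately, and the conclusion has to be uniform in time. The limit is taken set by set; the
  norm bound is then recovered by duality with bounded test functions.
\<close>

lemma M1_complete: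
  assumes w: "weight w" and \<nu>: "\<And>n. \<nu> n \<in> M1 w" and r: "r \<longlonglongrightarrow> (0::real)"
    and cauchy: "\<And>m n. norm1 w (\<lambda>A. \<nu> m A - \<nu> n A) \<le> r m + r n"
  shows "\<exists>L\<in>M1 w. \<forall>n. norm1 w (\<lambda>A. \<nu> n A - L A) \<le> r n"
proof -
  note fs = M1_finite_signed_measure[OF \<nu> w]
  note md = M1_diff(1)[OF \<nu> \<nu> w]
  have c: "\<bar>\<nu> m A - \<nu> n A\<bar> \<le> r m + r n" for m n A
    using abs_le_norm1[OF md[of m n] w, of A] cauchy[of m n] by linarith
  have "Cauchy (\<lambda>n. \<nu> n A)" for A
  proof (rule metric_CauchyI)
    fix e :: real assume "0 < e"
    then obtain N where N: "\<And>n. n \<ge> N \<Longrightarrow> \<bar>r n\<bar> < e / 2"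
      using LIMSEQ_D[OF r, of "e / 2"] by auto
    have "dist (\<nu> m A) (\<nu> n A) < e" if "m \<ge> N" "n \<ge> N" for m n
      using c[of m A n] N[OF that(1)] N[OF that(2)] by (auto simp: dist_real_def)
    then show "\<exists>M. \<forall>m\<ge>M. \<forall>n\<ge>M. dist (\<nu> m A) (\<nu> n A) < e" by blast
  qed
  then have "\<exists>l. (\<lambda>n. \<nu> n A) \<longlonglongrightarrow> l" for A by (simp add: Cauchy_convergent_iff convergent_def)
  then obtain L where L: "\<And>A. (\<lambda>n. \<nu> n A) \<longlonglongrightarrow> L A" by metis
  have le: "\<bar>\<nu> n A - L A\<bar> \<le> r n" for n A
  proof (rule LIMSEQ_le)
    show "(\<lambda>m. \<bar>\<nu> n A - \<nu> m A\<bar>) \<longlonglongrightarrow> \<bar>\<nu> n A - L A\<bar>" by (intro tendsto_intros L)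
    have "(\<lambda>m. r n + r m) \<longlonglongrightarrow> r n + 0" by (intro tendsto_intros r)
    then show "(\<lambda>m. r n + r m) \<longlonglongrightarrow> r n" by simp
  qed (use c in auto)
  have fsL: "finite_signed_measure L" by (rule finite_signed_measure_uniform_limit[OF fs le r])
  have fsd: "finite_signed_measure (\<lambda>A. \<nu> n A - L A)" for n
    using finite_signed_measure_lincomb[OF fs[of n] fsL, where a=1 and b="-1"] by simp
  have *: "(\<lambda>A. \<nu> n A - L A) \<in> M1 w" "norm1 w (\<lambda>A. \<nu> n A - L A) \<le> r n" for n
  proof -
    have "signed_integral (\<lambda>A. \<nu> n A - L A) f \<le> r n"
      if f: "bdd_measurable f" "\<forall>x>0. \<bar>f x\<bar> \<le> w x" for f
    proof -
      obtain B where B: "\<forall>x>0. \<bar>f x\<bar> \<le> B" using f(1) by (auto simp: bdd_measurable_def)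
      then have B0: "0 \<le> B" by (metis abs_ge_zero order_trans zero_less_one)
      have d: "signed_integral (\<lambda>A. \<nu> m A - L A) f = signed_integral (\<nu> m) f - signed_integral L f" for m
        using signed_integral_lincomb_bdd[OF fs[of m] fsL f(1), where a=1 and b="-1"] by simp
      have "(\<lambda>m. signed_integral (\<nu> m) f - signed_integral L f) \<longlonglongrightarrow> 0"
      proof (rule Lim_null_comparison)
        show "(\<lambda>m. B * (2 * r m)) \<longlonglongrightarrow> 0" using tendsto_mult[OF tendsto_const tendsto_mult[OF tendsto_const r]] by simp
        show "\<forall>\<^sub>F m in sequentially. norm (signed_integral (\<nu> m) f - signed_integral L f) \<le> B * (2 * r m)"
          unfolding d[symmetric] using abs_signed_integral_le_sup[OF fsd le f(1) _ B0] B by auto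
      qed
      then have lim: "(\<lambda>m. signed_integral (\<nu> n) f - signed_integral (\<nu> m) f) \<longlonglongrightarrow> signed_integral (\<nu> n) f - signed_integral L f"
        by (intro tendsto_intros) (simp add: LIM_zero_iff)
      have "signed_integral (\<nu> n) f - signed_integral (\<nu> m) f \<le> r n + r m" for m
      proof -
        have "signed_integral (\<lambda>A. \<nu> n A - \<nu> m A) f = signed_integral (\<nu> n) f - signed_integral (\<nu> m) f"
          using signed_integral_lincomb_bdd[OF fs[of n] fs[of m] f(1), where a=1 and b="-1"] by simp
        moreover have "\<bar>signed_integral (\<lambda>A. \<nu> n A - \<nu> m A) f\<bar> \<le> 1 * norm1 w (\<lambda>A. \<nu> n A - \<nu> m A)"
          using md w f by (intro signed_integral_bound) (auto simp: bdd_measurable_def)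
        ultimately show ?thesis using cauchy[of n m] by linarith
      qed
      moreover have "(\<lambda>m. r n + r m) \<longlonglongrightarrow> r n" using tendsto_add[OF tendsto_const r] by simp
      ultimately have "signed_integral (\<nu> n) f - signed_integral L f \<le> r n"
        using lim by (intro LIMSEQ_le[OF lim]) auto
      then show ?thesis by (simp add: d)
    qed
    from norm1_leI[OF fsd w this] show "(\<lambda>A. \<nu> n A - L A) \<in> M1 w" "norm1 w (\<lambda>A. \<nu> n A - L A) \<le> r n" by blast+
  qed
  have "(\<lambda>A. \<nu> 0 A - (\<nu> 0 A - L A)) \<in> M1 w" by (rule M1_diff(1)[OF \<nu> *(1) w])
  then have "L \<in> M1 w" by simp
  then show ?thesis using *(2) by blast
qed

section \<open>Bilinear forms\<close>

definition bilin :: "(real \<Rightarrow> real \<Rightarrow> real) \<Rightarrow> (real set \<Rightarrow> real) \<Rightarrow> (real set \<Rightarrow> real) \<Rightarrow> real" where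
  "bilin g \<delta> \<rho> = signed_integral \<rho> (\<lambda>y. signed_integral \<delta> (\<lambda>x. g x y))"

abbreviation coag_form :: "(real \<Rightarrow> real) \<Rightarrow> (real \<Rightarrow> real \<Rightarrow> real) \<Rightarrow> (real set \<Rightarrow> real) \<Rightarrow> (real set \<Rightarrow> real) \<Rightarrow> real" where
  "coag_form f k \<equiv> bilin (\<lambda>x y. brace f x y * k x y)"

text \<open>
  Boundedness of \<open>g\<close> by a product of weights makes the form continuous for the norms with
  these weights. The constant is kept explicit, as smallness of errors later comes from it.
\<close>

definition kernel_bound :: "(real \<Rightarrow> real \<Rightarrow> real) \<Rightarrow> real \<Rightarrow> (real \<Rightarrow> real) \<Rightarrow> (real \<Rightarrow> real) \<Rightarrow> bool" where
  "kernel_bound g c a b \<longleftrightarrow> (\<lambda>(x, y). g x y) \<in> borel_measurable (pos_borel \<Otimes>\<^sub>M pos_borel) \<and>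
     (\<forall>x>0. \<forall>y>0. \<bar>g x y\<bar> \<le> c * (a x * b y))"

lemma kernel_bound_section:
  assumes "kernel_bound g c a b" "y > 0"
  shows "(\<lambda>x. g x y) \<in> borel_measurable pos_borel" and "x > 0 \<Longrightarrow> \<bar>g x y\<bar> \<le> (c * b y) * a x"
proof -
  have 1: "(\<lambda>x. (x, y)) \<in> pos_borel \<rightarrow>\<^sub>M pos_borel \<Otimes>\<^sub>M pos_borel"
    using assms(2) by (intro measurable_Pair2') simp
  have 2: "(\<lambda>(x, y). g x y) \<in> borel_measurable (pos_borel \<Otimes>\<^sub>M pos_borel)"
    using assms(1) by (simp add: kernel_bound_def)
  from measurable_compose[OF 1 2]
  show "(\<lambda>x. g x y) \<in> borel_measurable pos_borel" by simp
  show "x > 0 \<Longrightarrow> \<bar>g x y\<bar> \<le> (c * b y) * a x"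
    using assms unfolding kernel_bound_def by (auto simp: ac_simps)
qed

lemma kernel_bound_swap:
  assumes "kernel_bound g c a b"
  shows "kernel_bound (\<lambda>x y. g y x) c b a"
proof -
  have "(\<lambda>(x, y). g x y) \<in> borel_measurable (pos_borel \<Otimes>\<^sub>M pos_borel)"
    using assms by (simp add: kernel_bound_def)
  then have "(\<lambda>(x, y). g y x) \<in> borel_measurable (pos_borel \<Otimes>\<^sub>M pos_borel)"
    using measurable_pair_swap_iff[of "\<lambda>(x, y). g x y" pos_borel pos_borel borel]
    by (simp add: case_prod_beta)
  then show ?thesis using assms by (auto simp: kernel_bound_def mult.commute)
qed

lemma bilin_inner:
  assumes \<delta>: "\<delta> \<in> M1 a" "weight a" and g: "kernel_bound g c a b"
  shows bilin_inner_measurable: "(\<lambda>y. signed_integral \<delta> (\<lambda>x. g x y)) \<in> borel_measurable pos_borel"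
    and bilin_inner_bound: "y > 0 \<Longrightarrow> \<bar>signed_integral \<delta> (\<lambda>x. g x y)\<bar> \<le> (c * norm1 a \<delta>) * b y"
proof -
  note fs = M1_finite_signed_measure[OF \<delta>]
  interpret T: finite_measure "total_var \<delta>" by (rule finite_measure_total_var[OF fs])
  have gm: "(\<lambda>(x, y). g y x) \<in> borel_measurable (pos_borel \<Otimes>\<^sub>M total_var \<delta>)"
    using kernel_bound_swap[OF g] unfolding kernel_bound_def
    by (subst measurable_cong_sets[OF sets_pair_measure_cong[OF refl total_var_sets] refl]) auto
  have "sgn_density \<delta> \<in> borel_measurable (total_var \<delta>)"
    using sgn_density_measurable[OF fs] by (simp add: measurable_eq_pos_borel[OF total_var_sets])
  then have Sm: "(\<lambda>z. sgn_density \<delta> (snd z)) \<in> borel_measurable (pos_borel \<Otimes>\<^sub>M total_var \<delta>)"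
    by (rule measurable_compose[OF measurable_snd])
  have "(\<lambda>(y, x). g x y * sgn_density \<delta> x) \<in> borel_measurable (pos_borel \<Otimes>\<^sub>M total_var \<delta>)"
    using borel_measurable_times[OF gm Sm] by (simp add: split_def)
  then have "(\<lambda>y. \<integral>x. g x y * sgn_density \<delta> x \<partial>total_var \<delta>) \<in> borel_measurable pos_borel"
    by (rule T.borel_measurable_lebesgue_integral)
  moreover have "signed_integral \<delta> (\<lambda>x. g x y) = (\<integral>x. g x y * sgn_density \<delta> x \<partial>total_var \<delta>)" if "y > 0" for y
    using integrable_total_var_bound[OF \<delta> kernel_bound_section[OF g that]] fs by (intro signed_integral_polar) auto
  ultimately show "(\<lambda>y. signed_integral \<delta> (\<lambda>x. g x y)) \<in> borel_measurable pos_borel"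
    by (subst measurable_cong) auto
  show "\<bar>signed_integral \<delta> (\<lambda>x. g x y)\<bar> \<le> (c * norm1 a \<delta>) * b y" if "y > 0"
    using signed_integral_bound[OF \<delta> kernel_bound_section[OF g that]] by (simp add: ac_simps)
qed

lemma bilin_bound:
  assumes "\<delta> \<in> M1 a" "weight a" "\<rho> \<in> M1 b" "weight b" "kernel_bound g c a b"
  shows "\<bar>bilin g \<delta> \<rho>\<bar> \<le> c * norm1 a \<delta> * norm1 b \<rho>"
  unfolding bilin_def
  by (rule signed_integral_bound[OF assms(3,4) bilin_inner_measurable[OF assms(1,2,5)] bilin_inner_bound[OF assms(1,2,5)]])

lemma bilin_lincomb_right:
  assumes "\<delta> \<in> M1 a" "weight a" "\<rho>1 \<in> M1 b" "\<rho>2 \<in> M1 b" "weight b" "kernel_bound g c a b"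
  shows "bilin g \<delta> (\<lambda>A. p * \<rho>1 A + q * \<rho>2 A) = p * bilin g \<delta> \<rho>1 + q * bilin g \<delta> \<rho>2"
  unfolding bilin_def
  by (rule signed_integral_lincomb_M1[OF assms(3-5) bilin_inner_measurable[OF assms(1,2,6)] bilin_inner_bound[OF assms(1,2,6)]])

lemma bilin_lincomb_left:
  assumes "\<delta>1 \<in> M1 a" "\<delta>2 \<in> M1 a" "weight a" "\<rho> \<in> M1 b" "weight b" "kernel_bound g c a b"
  shows "bilin g (\<lambda>A. p * \<delta>1 A + q * \<delta>2 A) \<rho> = p * bilin g \<delta>1 \<rho> + q * bilin g \<delta>2 \<rho>"
proof -
  have "bilin g (\<lambda>A. p * \<delta>1 A + q * \<delta>2 A) \<rho> =
    signed_integral \<rho> (\<lambda>y. p * signed_integral \<delta>1 (\<lambda>x. g x y) + q * signed_integral \<delta>2 (\<lambda>x. g x y))"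
    unfolding bilin_def
    by (intro signed_integral_cong signed_integral_lincomb_M1[OF assms(1-3) kernel_bound_section[OF assms(6)]])
  then show ?thesis
    unfolding bilin_def
    using signed_integral_fun_lincomb_M1[OF assms(4,5) bilin_inner_measurable[OF assms(1,3,6)] bilin_inner_bound[OF assms(1,3,6)]
        bilin_inner_measurable[OF assms(2,3,6)] bilin_inner_bound[OF assms(2,3,6)]] by simp
qed

lemma bilin_kernel_lincomb:
  assumes "\<delta> \<in> M1 a" "weight a" "\<rho> \<in> M1 b" "weight b" "kernel_bound g c a b" "kernel_bound h d a b"
  shows "bilin (\<lambda>x y. p * g x y + q * h x y) \<delta> \<rho> = p * bilin g \<delta> \<rho> + q * bilin h \<delta> \<rho>"
proof -
  have "bilin (\<lambda>x y. p * g x y + q * h x y) \<delta> \<rho> =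
    signed_integral \<rho> (\<lambda>y. p * signed_integral \<delta> (\<lambda>x. g x y) + q * signed_integral \<delta> (\<lambda>x. h x y))"
    unfolding bilin_def
    by (intro signed_integral_cong signed_integral_fun_lincomb_M1[OF assms(1,2) kernel_bound_section[OF assms(5)] kernel_bound_section[OF assms(6)]])
  then show ?thesis
    unfolding bilin_def
    using signed_integral_fun_lincomb_M1[OF assms(3,4) bilin_inner_measurable[OF assms(1,2,5)] bilin_inner_bound[OF assms(1,2,5)]
        bilin_inner_measurable[OF assms(1,2,6)] bilin_inner_bound[OF assms(1,2,6)]] by simp
qed

lemma bilin_cong:
  "(\<And>x y. x > 0 \<Longrightarrow> y > 0 \<Longrightarrow> g x y = h x y) \<Longrightarrow> bilin g \<delta> \<rho> = bilin h \<delta> \<rho>"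
  unfolding bilin_def by (intro signed_integral_cong)

lemma bilin_scale: "bilin (\<lambda>x y. a * g x y) \<delta> \<rho> = a * bilin g \<delta> \<rho>"
  by (simp add: bilin_def signed_integral_scale)

lemma bilin_zero [simp]: "bilin (\<lambda>x y. 0) \<delta> \<rho> = 0"
  by (simp add: bilin_def)

text \<open>
  Fubini's theorem after polar decomposition of both measures.
\<close>

lemma bilin_swap:
  assumes \<delta>: "\<delta> \<in> M1 a" "weight a" and \<rho>: "\<rho> \<in> M1 b" "weight b" and g: "kernel_bound g c a b"
  shows "bilin g \<delta> \<rho> = bilin (\<lambda>x y. g y x) \<rho> \<delta>"
proof -
  note fs = M1_finite_signed_measure[OF \<delta>] M1_finite_signed_measure[OF \<rho>]
  interpret D: finite_measure "total_var \<delta>" by (rule finite_measure_total_var[OF fs(1)])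
  interpret R: finite_measure "total_var \<rho>" by (rule finite_measure_total_var[OF fs(2)])
  interpret P: pair_sigma_finite "total_var \<delta>" "total_var \<rho>" ..
  have a0: "0 \<le> a x" if "x > 0" for x using \<delta>(2) that unfolding weight_def by (metis order_trans zero_le_one)
  have b0: "0 \<le> b x" if "x > 0" for x using \<rho>(2) that unfolding weight_def by (metis order_trans zero_le_one)
  define F where "F x y = g x y * sgn_density \<delta> x * sgn_density \<rho> y" for x y
  have PS: "borel_measurable (total_var \<delta> \<Otimes>\<^sub>M total_var \<rho>) = borel_measurable (pos_borel \<Otimes>\<^sub>M pos_borel)"
    by (rule measurable_cong_sets[OF sets_pair_measure_cong[OF total_var_sets total_var_sets] refl])
  have S1: "(\<lambda>z. sgn_density \<delta> (fst z)) \<in> borel_measurable (pos_borel \<Otimes>\<^sub>M pos_borel)"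
    by (rule measurable_compose[OF measurable_fst sgn_density_measurable[OF fs(1)]])
  have S2: "(\<lambda>z. sgn_density \<rho> (snd z)) \<in> borel_measurable (pos_borel \<Otimes>\<^sub>M pos_borel)"
    by (rule measurable_compose[OF measurable_snd sgn_density_measurable[OF fs(2)]])
  have G: "(\<lambda>(x, y). g x y) \<in> borel_measurable (pos_borel \<Otimes>\<^sub>M pos_borel)"
    using g by (simp add: kernel_bound_def)
  have Fm: "case_prod F \<in> borel_measurable (total_var \<delta> \<Otimes>\<^sub>M total_var \<rho>)"
    unfolding PS using borel_measurable_times[OF borel_measurable_times[OF G S1] S2]
    by (simp add: F_def split_def)
  have Fb: "\<bar>F x y\<bar> \<le> c * (a x * b y)" if "x > 0" "y > 0" for x y
    using g that by (auto simp: F_def abs_mult sgn_density_abs fs kernel_bound_def)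
  have Fi: "integrable (total_var \<delta> \<Otimes>\<^sub>M total_var \<rho>) (case_prod F)"
  proof (rule P.Fubini_integrable[OF Fm])
    have "integrable (total_var \<delta>) (\<lambda>x. norm1 b \<rho> * (c * a x))"
      using M1_integrable(1)[OF \<delta>] by simp
    then show "integrable (total_var \<delta>) (\<lambda>x. \<integral>y. norm (case_prod F (x, y)) \<partial>total_var \<rho>)"
    proof (rule Bochner_Integration.integrable_bound)
      show "(\<lambda>x. \<integral>y. norm (case_prod F (x, y)) \<partial>total_var \<rho>) \<in> borel_measurable (total_var \<delta>)"
        using Fm by (intro R.borel_measurable_lebesgue_integral) (auto simp: split_def)
      show "AE x in total_var \<delta>. norm (\<integral>y. norm (case_prod F (x, y)) \<partial>total_var \<rho>) \<le> norm (norm1 b \<rho> * (c * a x))"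
      proof (rule AE_I2)
        fix x assume "x \<in> space (total_var \<delta>)"
        then have x: "x > 0" by simp
        have Fx: "(\<lambda>y. F x y) \<in> borel_measurable (total_var \<rho>)"
          using measurable_compose[OF measurable_Pair1'[of x "total_var \<delta>"] Fm] x by simp
        have i: "integrable (total_var \<rho>) (F x)"
          using Fb[OF x] Fx by (intro integrable_total_var_bound[OF \<rho>, of _ "c * a x"])
            (auto simp: measurable_eq_pos_borel[OF total_var_sets] ac_simps)
        have "(\<integral>y. \<bar>F x y\<bar> \<partial>total_var \<rho>) \<le> (c * a x) * norm1 b \<rho>"
          using Fb[OF x] Fx by (intro integral_total_var_bound[OF \<rho>])
            (auto simp: measurable_eq_pos_borel[OF total_var_sets] ac_simps)
        then show "norm (\<integral>y. norm (case_prod F (x, y)) \<partial>total_var \<rho>) \<le> norm (norm1 b \<rho> * (c * a x))"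
          by (simp add: ac_simps abs_of_nonneg integral_nonneg_AE)
      qed
    qed
    show "AE x in total_var \<delta>. integrable (total_var \<rho>) (\<lambda>y. case_prod F (x, y))"
    proof (rule AE_I2)
      fix x assume "x \<in> space (total_var \<delta>)"
      then have x: "x > 0" by simp
      have "(\<lambda>y. F x y) \<in> borel_measurable (total_var \<rho>)"
        using measurable_compose[OF measurable_Pair1'[of x "total_var \<delta>"] Fm] x by simp
      then show "integrable (total_var \<rho>) (\<lambda>y. case_prod F (x, y))"
        using Fb[OF x] by (intro integrable_total_var_bound[OF \<rho>, of _ "c * a x"])
            (auto simp: measurable_eq_pos_borel[OF total_var_sets] ac_simps)
    qed
  qed
  have e: "bilin h \<delta>' \<rho>' = (\<integral>y. (\<integral>x. h x y * sgn_density \<delta>' x * sgn_density \<rho>' y \<partial>total_var \<delta>') \<partial>total_var \<rho>')"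
    if \<delta>': "\<delta>' \<in> M1 a'" "weight a'" and \<rho>': "\<rho>' \<in> M1 b'" "weight b'" and h: "kernel_bound h c a' b'" for h \<delta>' \<rho>' a' b'
  proof -
    note fs' = M1_finite_signed_measure[OF \<delta>'] M1_finite_signed_measure[OF \<rho>']
    have "bilin h \<delta>' \<rho>' = (\<integral>y. signed_integral \<delta>' (\<lambda>x. h x y) * sgn_density \<rho>' y \<partial>total_var \<rho>')"
      unfolding bilin_def
      by (rule signed_integral_polar[OF fs'(2) integrable_total_var_bound[OF \<rho>' bilin_inner_measurable[OF \<delta>' h] bilin_inner_bound[OF \<delta>' h]]])
    also have "\<dots> = (\<integral>y. (\<integral>x. h x y * sgn_density \<delta>' x * sgn_density \<rho>' y \<partial>total_var \<delta>') \<partial>total_var \<rho>')"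
    proof (rule Bochner_Integration.integral_cong[OF refl])
      fix y assume "y \<in> space (total_var \<rho>')"
      then have y: "y > 0" by simp
      show "signed_integral \<delta>' (\<lambda>x. h x y) * sgn_density \<rho>' y = (\<integral>x. h x y * sgn_density \<delta>' x * sgn_density \<rho>' y \<partial>total_var \<delta>')"
        using signed_integral_polar[OF fs'(1) integrable_total_var_bound[OF \<delta>' kernel_bound_section[OF h y]]]
        by simp
    qed
    finally show ?thesis .
  qed
  have "bilin g \<delta> \<rho> = (\<integral>y. (\<integral>x. F x y \<partial>total_var \<delta>) \<partial>total_var \<rho>)"
    using e[OF \<delta> \<rho> g] by (simp add: F_def)
  also have "\<dots> = (\<integral>x. (\<integral>y. F x y \<partial>total_var \<rho>) \<partial>total_var \<delta>)" by (rule P.Fubini_integral[OF Fi])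
  also have "\<dots> = bilin (\<lambda>x y. g y x) \<rho> \<delta>"
    using e[OF \<rho> \<delta> kernel_bound_swap[OF g]] by (simp add: F_def mult.assoc mult.commute[of "sgn_density \<rho> _"])
  finally show ?thesis .
qed

lemma bilin_abs_le_nonneg:
  assumes a: "\<alpha> \<in> M1 a" "weight a" "\<And>A. 0 \<le> \<alpha> A" and b: "\<beta> \<in> M1 b" "weight b" "\<And>A. 0 \<le> \<beta> A"
    and g: "kernel_bound g c a b" and h: "kernel_bound h d a b"
    and le: "\<And>x y. x > 0 \<Longrightarrow> y > 0 \<Longrightarrow> \<bar>g x y\<bar> \<le> h x y"
  shows "\<bar>bilin g \<alpha> \<beta>\<bar> \<le> bilin h \<alpha> \<beta>"
proof -
  have mono: "bilin g' \<alpha> \<beta> \<le> bilin h \<alpha> \<beta>"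
    if g': "kernel_bound g' c a b" and le': "\<And>x y. x > 0 \<Longrightarrow> y > 0 \<Longrightarrow> g' x y \<le> h x y" for g'
    unfolding bilin_def
  proof (rule signed_integral_mono[OF b bilin_inner_measurable[OF a(1,2) g'] bilin_inner_bound[OF a(1,2) g']
        bilin_inner_measurable[OF a(1,2) h] bilin_inner_bound[OF a(1,2) h]])
    fix y :: real assume y: "y > 0"
    show "signed_integral \<alpha> (\<lambda>x. g' x y) \<le> signed_integral \<alpha> (\<lambda>x. h x y)"
      using le' y by (intro signed_integral_mono[OF a kernel_bound_section[OF g' y] kernel_bound_section[OF h y]]) auto
  qed
  have "kernel_bound (\<lambda>x y. -1 * g x y) c a b"
    using g borel_measurable_uminus[of "\<lambda>(x, y). g x y" "pos_borel \<Otimes>\<^sub>M pos_borel"]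
    by (simp add: kernel_bound_def split_def)
  then have "bilin (\<lambda>x y. -1 * g x y) \<alpha> \<beta> \<le> bilin h \<alpha> \<beta>"
    using le by (intro mono) (auto simp: abs_le_iff)
  moreover have "bilin g \<alpha> \<beta> \<le> bilin h \<alpha> \<beta>" using le g by (intro mono) (auto simp: abs_le_iff)
  ultimately show ?thesis unfolding bilin_scale by simp
qed

lemma bilin_diff_bound:
  assumes a: "\<alpha> \<in> M1 a" "\<alpha>' \<in> M1 a" "weight a" and b: "\<beta> \<in> M1 b" "\<beta>' \<in> M1 b" "weight b"
    and g: "kernel_bound g c a b" and c: "0 \<le> c"
  shows "\<bar>bilin g \<alpha> \<beta> - bilin g \<alpha>' \<beta>'\<bar> \<le>
    c * (norm1 a (\<lambda>A. \<alpha> A - \<alpha>' A) * norm1 b \<beta> + norm1 a \<alpha>' * norm1 b (\<lambda>A. \<beta> A - \<beta>' A))"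
proof -
  note da = M1_diff(1)[OF a] and db = M1_diff(1)[OF b]
  have 1: "bilin g (\<lambda>A. \<alpha> A - \<alpha>' A) \<beta> = bilin g \<alpha> \<beta> - bilin g \<alpha>' \<beta>"
    using bilin_lincomb_left[OF a b(1,3) g, of 1 "-1"] by simp
  have 2: "bilin g \<alpha>' (\<lambda>A. \<beta> A - \<beta>' A) = bilin g \<alpha>' \<beta> - bilin g \<alpha>' \<beta>'"
    using bilin_lincomb_right[OF a(2,3) b g, of 1 "-1"] by simp
  have "\<bar>bilin g (\<lambda>A. \<alpha> A - \<alpha>' A) \<beta>\<bar> \<le> c * norm1 a (\<lambda>A. \<alpha> A - \<alpha>' A) * norm1 b \<beta>"
    by (rule bilin_bound[OF da a(3) b(1,3) g])
  moreover have "\<bar>bilin g \<alpha>' (\<lambda>A. \<beta> A - \<beta>' A)\<bar> \<le> c * norm1 a \<alpha>' * norm1 b (\<lambda>A. \<beta> A - \<beta>' A)"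
    by (rule bilin_bound[OF a(2,3) db b(3) g])
  moreover have "\<bar>bilin g \<alpha> \<beta> - bilin g \<alpha>' \<beta>'\<bar> \<le> \<bar>bilin g (\<lambda>A. \<alpha> A - \<alpha>' A) \<beta>\<bar> + \<bar>bilin g \<alpha>' (\<lambda>A. \<beta> A - \<beta>' A)\<bar>"
    unfolding 1 2 by linarith
  ultimately show ?thesis by (simp add: algebra_simps)
qed

text \<open>
  Turns the difference of two quadratic terms into a term linear in the difference, driven by the
  average of the two measures. The average of two solutions is non-negative, as the driver in the
  estimate has to be.
\<close>

lemma bilin_polarization:
  assumes a: "\<alpha> \<in> M1 w" "\<beta> \<in> M1 w" "weight w" and g: "kernel_bound g c w w"
    and sym: "\<And>x y. x > 0 \<Longrightarrow> y > 0 \<Longrightarrow> g x y = g y x"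
  shows "bilin g (\<lambda>A. 1 / 2 * \<alpha> A + 1 / 2 * \<beta> A) (\<lambda>A. \<alpha> A - \<beta> A) = 1 / 2 * bilin g \<alpha> \<alpha> - 1 / 2 * bilin g \<beta> \<beta>"
proof -
  note av = M1_lincomb(1)[OF a(1,2,3), of "1/2" "1/2"]
  have "bilin g \<alpha> \<beta> = bilin (\<lambda>x y. g y x) \<beta> \<alpha>" by (rule bilin_swap[OF a(1,3) a(2,3) g])
  also have "\<dots> = bilin g \<beta> \<alpha>" using sym by (intro bilin_cong) auto
  finally have s: "bilin g \<alpha> \<beta> = bilin g \<beta> \<alpha>" .
  have "bilin g (\<lambda>A. 1 / 2 * \<alpha> A + 1 / 2 * \<beta> A) (\<lambda>A. \<alpha> A - \<beta> A) =
      bilin g (\<lambda>A. 1 / 2 * \<alpha> A + 1 / 2 * \<beta> A) \<alpha> - bilin g (\<lambda>A. 1 / 2 * \<alpha> A + 1 / 2 * \<beta> A) \<beta>"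
    using bilin_lincomb_right[OF av a(3) a(1,2,3) g, of 1 "-1"] by simp
  also have "bilin g (\<lambda>A. 1 / 2 * \<alpha> A + 1 / 2 * \<beta> A) \<alpha> = 1 / 2 * bilin g \<alpha> \<alpha> + 1 / 2 * bilin g \<beta> \<alpha>"
    by (rule bilin_lincomb_left[OF a a(1,3) g])
  also have "bilin g (\<lambda>A. 1 / 2 * \<alpha> A + 1 / 2 * \<beta> A) \<beta> = 1 / 2 * bilin g \<alpha> \<beta> + 1 / 2 * bilin g \<beta> \<beta>"
    by (rule bilin_lincomb_left[OF a a(2,3) g])
  finally show ?thesis using s by simp
qed

lemma continuous_on_bilin:
  assumes \<alpha>: "\<And>t. t \<in> I \<Longrightarrow> \<alpha> t \<in> M1 a" "weight a" and \<beta>: "\<And>t. t \<in> I \<Longrightarrow> \<beta> t \<in> M1 b" "weight b"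
    and g: "kernel_bound g c a b" and c: "0 \<le> c"
    and ca: "\<And>t. t \<in> I \<Longrightarrow> ((\<lambda>s. norm1 a (\<lambda>A. \<alpha> s A - \<alpha> t A)) \<longlongrightarrow> 0) (at t within I)"
    and cb: "\<And>t. t \<in> I \<Longrightarrow> ((\<lambda>s. norm1 b (\<lambda>A. \<beta> s A - \<beta> t A)) \<longlongrightarrow> 0) (at t within I)"
  shows "continuous_on I (\<lambda>t. bilin g (\<alpha> t) (\<beta> t))"
  unfolding continuous_on
proof
  fix t assume t: "t \<in> I"
  have lim: "((\<lambda>s. c * (norm1 a (\<lambda>A. \<alpha> s A - \<alpha> t A) * (norm1 b (\<beta> t) + norm1 b (\<lambda>A. \<beta> s A - \<beta> t A))
      + norm1 a (\<alpha> t) * norm1 b (\<lambda>A. \<beta> s A - \<beta> t A))) \<longlongrightarrow> c * (0 * (norm1 b (\<beta> t) + 0) + norm1 a (\<alpha> t) * 0)) (at t within I)"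
    by (intro tendsto_intros ca[OF t] cb[OF t])
  have "((\<lambda>s. bilin g (\<alpha> s) (\<beta> s) - bilin g (\<alpha> t) (\<beta> t)) \<longlongrightarrow> 0) (at t within I)"
  proof (rule Lim_null_comparison)
    show "\<forall>\<^sub>F s in at t within I. norm (bilin g (\<alpha> s) (\<beta> s) - bilin g (\<alpha> t) (\<beta> t)) \<le>
       c * (norm1 a (\<lambda>A. \<alpha> s A - \<alpha> t A) * (norm1 b (\<beta> t) + norm1 b (\<lambda>A. \<beta> s A - \<beta> t A))
      + norm1 a (\<alpha> t) * norm1 b (\<lambda>A. \<beta> s A - \<beta> t A))"
      unfolding eventually_at_filter
    proof (intro always_eventually allI impI)
      fix s assume s: "s \<in> I"
      have "norm1 b (\<beta> s) \<le> norm1 b (\<beta> t) + norm1 b (\<lambda>A. \<beta> s A - \<beta> t A)"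
        using M1_lincomb(2)[OF \<beta>(1)[OF t] M1_diff(1)[OF \<beta>(1)[OF s] \<beta>(1)[OF t] \<beta>(2)] \<beta>(2), of 1 1] by simp
      then have "norm1 a (\<lambda>A. \<alpha> s A - \<alpha> t A) * norm1 b (\<beta> s) \<le>
          norm1 a (\<lambda>A. \<alpha> s A - \<alpha> t A) * (norm1 b (\<beta> t) + norm1 b (\<lambda>A. \<beta> s A - \<beta> t A))"
        by (intro mult_left_mono) auto
      then have "c * (norm1 a (\<lambda>A. \<alpha> s A - \<alpha> t A) * norm1 b (\<beta> s) + norm1 a (\<alpha> t) * norm1 b (\<lambda>A. \<beta> s A - \<beta> t A)) \<le>
         c * (norm1 a (\<lambda>A. \<alpha> s A - \<alpha> t A) * (norm1 b (\<beta> t) + norm1 b (\<lambda>A. \<beta> s A - \<beta> t A))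
           + norm1 a (\<alpha> t) * norm1 b (\<lambda>A. \<beta> s A - \<beta> t A))"
        by (rule mult_left_mono[OF add_right_mono c])
      then show "norm (bilin g (\<alpha> s) (\<beta> s) - bilin g (\<alpha> t) (\<beta> t)) \<le>
         c * (norm1 a (\<lambda>A. \<alpha> s A - \<alpha> t A) * (norm1 b (\<beta> t) + norm1 b (\<lambda>A. \<beta> s A - \<beta> t A))
        + norm1 a (\<alpha> t) * norm1 b (\<lambda>A. \<beta> s A - \<beta> t A))"
        using bilin_diff_bound[OF \<alpha>(1)[OF s] \<alpha>(1)[OF t] \<alpha>(2) \<beta>(1)[OF s] \<beta>(1)[OF t] \<beta>(2) g c] by simp
    qed
  qed (use lim in simp)
  then show "((\<lambda>t. bilin g (\<alpha> t) (\<beta> t)) \<longlongrightarrow> bilin g (\<alpha> t) (\<beta> t)) (at t within I)"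
    by (simp add: LIM_zero_iff)
qed

section \<open>Integrals over time intervals\<close>

lemma set_integrable_Icc_subset:
  fixes g :: "real \<Rightarrow> real"
  assumes "set_integrable lborel {0..T} g" "0 \<le> s" "t \<le> T"
  shows "set_integrable lborel {s..t} g"
  using assms by (intro set_integrable_subset[OF assms(1)]) auto

lemma set_integral_Icc_diff:
  fixes g :: "real \<Rightarrow> real"
  assumes g: "set_integrable lborel {0..T} g" and st: "0 \<le> s" "s \<le> t" "t \<le> T"
  shows "(LINT u:{s..t}|lborel. g u) = (LINT u:{0..t}|lborel. g u) - (LINT u:{0..s}|lborel. g u)"
proof -
  have i: "set_integrable lborel {a..b} g" if "0 \<le> a" "b \<le> T" for a b
    using set_integrable_Icc_subset[OF g that] .
  have "integral {0..s} g + integral {s..t} g = integral {0..t} g"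
    using st set_borel_integral_eq_integral(1)[OF i[of 0 t]] by (intro Henstock_Kurzweil_Integration.integral_combine) auto
  then show ?thesis
    using st set_borel_integral_eq_integral(2)[OF i[of 0 t]] set_borel_integral_eq_integral(2)[OF i[of 0 s]]
      set_borel_integral_eq_integral(2)[OF i[of s t]] by simp
qed

lemma set_integral_Icc_nonneg:
  fixes g :: "real \<Rightarrow> real"
  assumes "\<And>u. u \<in> {s..t} \<Longrightarrow> 0 \<le> g u"
  shows "0 \<le> (LINT u:{s..t}|lborel. g u)"
  unfolding set_lebesgue_integral_def using assms
  by (intro Bochner_Integration.integral_nonneg) (auto split: split_indicator)

lemma set_integral_Icc_abs_le:
  fixes g b :: "real \<Rightarrow> real"
  assumes "set_integrable lborel {s..t} g" "set_integrable lborel {s..t} b"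
    "\<And>u. u \<in> {s..t} \<Longrightarrow> \<bar>g u\<bar> \<le> b u"
  shows "\<bar>LINT u:{s..t}|lborel. g u\<bar> \<le> (LINT u:{s..t}|lborel. b u)"
proof -
  have m: "set_integrable lborel {s..t} (\<lambda>u. - b u)"
    using assms(2) unfolding set_integrable_def by simp
  have n: "(LINT u:{s..t}|lborel. - b u) = - (LINT u:{s..t}|lborel. b u)"
    unfolding set_lebesgue_integral_def by simp
  have "(LINT u:{s..t}|lborel. g u) \<le> (LINT u:{s..t}|lborel. b u)"
    using assms by (intro set_integral_mono) (auto simp: abs_le_iff)
  moreover have "(LINT u:{s..t}|lborel. - b u) \<le> (LINT u:{s..t}|lborel. g u)"
    using assms m by (intro set_integral_mono) (auto simp: abs_le_iff minus_le_iff)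
  ultimately show ?thesis by (simp add: n abs_le_iff)
qed

lemma set_integral_Icc_const:
  fixes c :: real
  assumes "s \<le> t"
  shows "(LINT u:{s..t}|lborel. c) = c * (t - s)" "set_integrable lborel {s..t} (\<lambda>u. c)"
  using assms by (auto simp: set_lebesgue_integral_def set_integrable_def)

lemma continuous_on_set_integral:
  fixes g :: "real \<Rightarrow> real"
  assumes g: "set_integrable lborel {0..T} g"
  shows "continuous_on {0..T} (\<lambda>t. LINT u:{0..t}|lborel. g u)"
proof -
  have "continuous_on {0..T} (\<lambda>t. integral {0..t} g)"
    by (rule indefinite_integral_continuous_1[OF set_borel_integral_eq_integral(1)[OF g]])
  then show ?thesis
    by (rule continuous_on_eq)
      (use set_borel_integral_eq_integral(2)[OF set_integrable_Icc_subset[OF g]] in auto)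
qed

lemma set_integrable_borel_bound:
  fixes g b :: "real \<Rightarrow> real"
  assumes b: "set_integrable lborel {0..T} b"
    and g: "(\<lambda>u. indicator {0..T} u * g u) \<in> borel_measurable borel"
    and le: "\<And>u. u \<in> {0..T} \<Longrightarrow> \<bar>g u\<bar> \<le> b u"
  shows "set_integrable lborel {0..T} g"
  unfolding set_integrable_def
  by (rule Bochner_Integration.integrable_bound[OF b[unfolded set_integrable_def]])
    (use g le in \<open>auto intro!: AE_I2 intro: order_trans[OF le abs_ge_self] split: split_indicator\<close>)

text \<open>
  On a partition of \<open>[0, t]\<close> into \<open>n\<close> equal pieces the errors add up to
  \<open>C * (t / n) * (B t - B 0)\<close>. The extra factor \<open>B t - B s\<close>
  telescopes, whatever the function \<open>B\<close> is.
\<close>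

lemma superadditive_error_vanishes:
  fixes F B :: "real \<Rightarrow> real"
  assumes inc: "\<And>s t. 0 \<le> s \<Longrightarrow> s \<le> t \<Longrightarrow> t \<le> T \<Longrightarrow> F t - F s \<le> C * (t - s) * (B t - B s)"
    and t: "0 \<le> t" "t \<le> T"
  shows "F t \<le> F 0"
proof -
  have part: "F t - F 0 \<le> C * t * (B t - B 0) / real N" if N: "N > 0" for N :: nat
  proof -
    define p where "p i = t * real i / real N" for i
    have p: "0 \<le> p i" "p i \<le> p (Suc i)" for i
      using N t by (auto simp: p_def field_simps)
    have pT: "p i \<le> T" if "i \<le> N" for i
    proof -
      have "p i \<le> t * real N / real N" unfolding p_def
        using that N t by (intro divide_right_mono mult_left_mono) auto
      then show ?thesis using N t by simp
    qed
    have d: "p (Suc i) - p i = t / real N" for i using N by (simp add: p_def field_simps)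
    have "F (p k) - F 0 \<le> C * (t / real N) * (B (p k) - B 0)" if "k \<le> N" for k
      using that
    proof (induction k)
      case (Suc k)
      have "F (p (Suc k)) - F (p k) \<le> C * (t / real N) * (B (p (Suc k)) - B (p k))"
        using inc[of "p k" "p (Suc k)"] p pT[OF Suc.prems] d[of k] by simp
      moreover have "F (p k) - F 0 \<le> C * (t / real N) * (B (p k) - B 0)" using Suc by simp
      ultimately show ?case by (simp add: right_diff_distrib)
    qed (simp add: p_def)
    from this[of N] show ?thesis using N by (simp add: p_def)
  qed
  have "(\<lambda>N. C * t * (B t - B 0) / real N) \<longlonglongrightarrow> 0"
    by (rule lim_const_over_n)
  then have "F t - F 0 \<le> 0"
    by (rule LIMSEQ_le_const) (use part in \<open>auto intro!: exI[of _ 1]\<close>)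
  then show ?thesis by simp
qed

text \<open>
  The function \<open>x\<close> is only integrable, being a norm along a curve that is not known to be
  continuous in this norm. Therefore the supremum \<open>Y\<close> of
  \<open>exp (-2 * c * t) * x t\<close> is used, which is finite by the inequality itself; the
  exponent \<open>2 * c\<close> makes the inequality read \<open>Y \<le> a + Y / 2\<close>.
\<close>

lemma gronwall_integrable:
  fixes x :: "real \<Rightarrow> real"
  assumes x: "set_integrable lborel {0..T} x" "\<And>t. t \<in> {0..T} \<Longrightarrow> 0 \<le> x t"
    and c: "0 < c" and a: "0 \<le> a"
    and le: "\<And>t. t \<in> {0..T} \<Longrightarrow> x t \<le> a + c * (LINT u:{0..t}|lborel. x u)"
    and t: "t \<in> {0..T}"
  shows "x t \<le> 2 * a * exp (2 * c * T)"
proof -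
  define y where "y t = exp (- (2 * c * t)) * x t" for t
  have xy: "x t = exp (2 * c * t) * y t" for t
    unfolding y_def by (simp add: mult.assoc[symmetric] exp_add[symmetric])
  have "y s \<le> a + c * (LINT u:{0..T}|lborel. x u)" if s: "s \<in> {0..T}" for s
  proof -
    have "(LINT u:{0..s}|lborel. x u) \<le> (LINT u:{0..T}|lborel. x u)"
      using set_integral_Icc_diff[OF x(1), of s T] set_integral_Icc_nonneg[of s T x] x(2) s by auto
    then have "x s \<le> a + c * (LINT u:{0..T}|lborel. x u)"
      using le[OF s] c by (meson add_left_mono mult_left_mono less_imp_le order_trans)
    moreover have "y s \<le> 1 * x s"
      unfolding y_def using c s x(2)[OF s] by (intro mult_right_mono) auto
    ultimately show ?thesis by simp
  qed
  then have bdd: "bdd_above (y ` {0..T})" by (intro bdd_aboveI2[where M="a + c * (LINT u:{0..T}|lborel. x u)"]) auto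
  define Y where "Y = Sup (y ` {0..T})"
  have yY: "y s \<le> Y" if "s \<in> {0..T}" for s
    unfolding Y_def using that bdd by (intro cSup_upper) auto
  have Y0: "0 \<le> Y" using yY[OF t] x(2)[OF t] by (auto simp: y_def intro: order_trans[rotated])
  have "y s \<le> a + Y / 2" if s: "s \<in> {0..T}" for s
  proof -
    have ce: "continuous_on {0..s} (\<lambda>u. Y * exp (2 * c * u))" by (intro continuous_intros)
    have ie: "set_integrable lborel {0..s} (\<lambda>u. Y * exp (2 * c * u))"
      by (rule borel_integrable_atLeastAtMost'[OF ce])
    have "((\<lambda>u. Y * exp (2 * c * u)) has_integral
        Y / (2 * c) * exp (2 * c * s) - Y / (2 * c) * exp (2 * c * 0)) {0..s}"
      using s c by (intro fundamental_theorem_of_calculus)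
        (auto intro!: derivative_eq_intros simp: has_real_derivative_iff_has_vector_derivative[symmetric])
    from integral_unique[OF this] set_borel_integral_eq_integral(2)[OF ie]
    have "(LINT u:{0..s}|lborel. Y * exp (2 * c * u)) = Y / (2 * c) * exp (2 * c * s) - Y / (2 * c) * exp (2 * c * 0)"
      by (rule trans[rotated])
    then have I: "(LINT u:{0..s}|lborel. Y * exp (2 * c * u)) = Y / (2 * c) * (exp (2 * c * s) - 1)"
      by (simp only: right_diff_distrib) simp
    have "(LINT u:{0..s}|lborel. x u) \<le> (LINT u:{0..s}|lborel. Y * exp (2 * c * u))"
    proof (rule set_integral_mono[OF _ ie])
      show "set_integrable lborel {0..s} x" using s by (intro set_integrable_Icc_subset[OF x(1)]) auto
      fix u assume "u \<in> {0..s}"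
      then have "exp (2 * c * u) * y u \<le> exp (2 * c * u) * Y" using s yY[of u] by (intro mult_left_mono) auto
      then show "x u \<le> Y * exp (2 * c * u)" unfolding xy[of u] by (simp only: mult.commute)
    qed
    then have "c * (LINT u:{0..s}|lborel. x u) \<le> c * (Y / (2 * c) * (exp (2 * c * s) - 1))"
      unfolding I using c by (intro mult_left_mono) auto
    also have "\<dots> = Y / 2 * exp (2 * c * s) - Y / 2" using c by (simp add: field_simps)
    finally have "x s \<le> a + Y / 2 * exp (2 * c * s)" using le[OF s] Y0 by linarith
    then have "y s \<le> exp (- (2 * c * s)) * (a + Y / 2 * exp (2 * c * s))"
      unfolding y_def by (intro mult_left_mono) auto
    also have "\<dots> = exp (- (2 * c * s)) * a + Y / 2 * (exp (- (2 * c * s)) * exp (2 * c * s))"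
      by (simp only: distrib_left mult.left_commute)
    also have "exp (- (2 * c * s)) * exp (2 * c * s) = 1" by (simp add: exp_add[symmetric])
    also have "exp (- (2 * c * s)) * a \<le> 1 * a" using a c s by (intro mult_right_mono) auto
    finally show ?thesis by simp
  qed
  then have "Y \<le> a + Y / 2" unfolding Y_def[of] using t by (intro cSup_least) auto
  then have "y t \<le> 2 * a" using yY[OF t] by linarith
  then have "exp (2 * c * t) * y t \<le> exp (2 * c * t) * (2 * a)" by (intro mult_left_mono) auto
  moreover have "exp (2 * c * t) * y t = x t" by (rule xy[symmetric])
  moreover have "exp (2 * c * t) * (2 * a) \<le> exp (2 * c * T) * (2 * a)"
    using a c t by (intro mult_right_mono) auto
  ultimately show ?thesis by (metis (no_types, opaque_lifting) mult.commute order_trans)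
qed

section \<open>Weights and kernels\<close>

lemma weight_nonneg: "weight w \<Longrightarrow> x > 0 \<Longrightarrow> 0 \<le> w x"
  unfolding weight_def by (metis order_trans zero_le_one)

text \<open>
  The kernel derivative is bounded componentwise; this costs the factor \<open>CARD('p)\<close> in
  directional derivatives.
\<close>

lemma abs_inner_le:
  fixes v w :: "real^'p"
  assumes "\<And>i. \<bar>w $ i\<bar> \<le> b"
  shows "\<bar>inner v w\<bar> \<le> real CARD('p) * b * norm v"
proof -
  have b0: "0 \<le> b" using assms[of undefined] by linarith
  have "\<bar>inner v w\<bar> \<le> (\<Sum>i\<in>UNIV. \<bar>v $ i * w $ i\<bar>)" unfolding inner_vec_def by (simp add: sum_abs)
  also have "\<dots> \<le> (\<Sum>i\<in>(UNIV :: 'p set). norm v * b)"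
    unfolding abs_mult using assms b0 by (intro sum_mono mult_mono component_le_norm_cart) auto
  finally show ?thesis by (simp add: ac_simps)
qed

lemma measurable_add_pos_borel: "(\<lambda>(x, y). x + y) \<in> pos_borel \<Otimes>\<^sub>M pos_borel \<rightarrow>\<^sub>M pos_borel"
proof (rule measurable_restrict_space2)
  show "(\<lambda>(x, y). x + y) \<in> space (pos_borel \<Otimes>\<^sub>M pos_borel) \<rightarrow> {0<..}"
    by (auto simp: space_pair_measure)
  have "fst \<in> borel_measurable (pos_borel \<Otimes>\<^sub>M pos_borel)" "snd \<in> borel_measurable (pos_borel \<Otimes>\<^sub>M pos_borel)"
    by (auto intro!: measurable_restrict_space1 measurable_compose[OF measurable_fst] measurable_compose[OF measurable_snd] simp: measurable_ident_sets)
  then show "(\<lambda>(x, y). x + y) \<in> borel_measurable (pos_borel \<Otimes>\<^sub>M pos_borel)"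
    using borel_measurable_add[of fst "pos_borel \<Otimes>\<^sub>M pos_borel" snd] by (simp add: split_def)
qed

lemma measurable_pair_pos_borel:
  assumes "f \<in> borel_measurable pos_borel"
  shows "(\<lambda>(x, y). f x) \<in> borel_measurable (pos_borel \<Otimes>\<^sub>M pos_borel)"
    and "(\<lambda>(x, y). f y) \<in> borel_measurable (pos_borel \<Otimes>\<^sub>M pos_borel)"
    and "(\<lambda>(x, y). f (x + y)) \<in> borel_measurable (pos_borel \<Otimes>\<^sub>M pos_borel)"
  using measurable_compose[OF measurable_fst assms, of pos_borel] measurable_compose[OF measurable_snd assms, of pos_borel]
    measurable_compose[OF measurable_add_pos_borel assms] by (simp_all add: split_def)

lemma measurable_brace:
  assumes "f \<in> borel_measurable pos_borel"
  shows "(\<lambda>(x, y). brace f x y) \<in> borel_measurable (pos_borel \<Otimes>\<^sub>M pos_borel)"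
  using borel_measurable_diff[OF borel_measurable_diff[OF measurable_pair_pos_borel(3)[OF assms] measurable_pair_pos_borel(1)[OF assms]] measurable_pair_pos_borel(2)[OF assms]]
  by (simp add: split_def brace_def)

lemma kernel_bound_mult:
  assumes "(\<lambda>(x, y). g x y) \<in> borel_measurable (pos_borel \<Otimes>\<^sub>M pos_borel)"
    "(\<lambda>(x, y). k x y) \<in> borel_measurable (pos_borel \<Otimes>\<^sub>M pos_borel)"
    "\<And>x y. x > 0 \<Longrightarrow> y > 0 \<Longrightarrow> \<bar>g x y * k x y\<bar> \<le> c * (a x * b y)"
  shows "kernel_bound (\<lambda>x y. g x y * k x y) c a b"
  using borel_measurable_times[OF assms(1,2)] assms(3) by (simp add: kernel_bound_def split_def)

locale size_weight =
  fixes \<phi> :: "real \<Rightarrow> real"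
  assumes phi_weight: "weight \<phi>" and phi_sub: "sub_additive \<phi>"
begin

lemma phi_ge1: "x > 0 \<Longrightarrow> 1 \<le> \<phi> x"
  using phi_weight by (simp add: weight_def)

lemma phi_add: "x > 0 \<Longrightarrow> y > 0 \<Longrightarrow> \<phi> (x + y) \<le> \<phi> x + \<phi> y"
  using phi_sub by (simp add: sub_additive_def)

lemma phi_measurable: "\<phi> \<in> borel_measurable pos_borel"
  using phi_weight by (simp add: weight_def)

definition pw :: "nat \<Rightarrow> real \<Rightarrow> real" where
  "pw k x = \<phi> x ^ k"

lemma weight_pw: "weight (pw k)"
  using phi_measurable phi_ge1 by (auto simp: weight_def pw_def[abs_def] one_le_power)

lemma pw_1 [simp]: "pw (Suc 0) = \<phi>" by (simp add: pw_def fun_eq_iff)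

lemma pw_mono: "j \<le> k \<Longrightarrow> x > 0 \<Longrightarrow> pw j x \<le> pw k x"
  unfolding pw_def by (intro power_increasing phi_ge1)

lemma M1_pw_mono:
  assumes "\<nu> \<in> M1 (pw k)" "j \<le> k"
  shows "\<nu> \<in> M1 (pw j)" "norm1 (pw j) \<nu> \<le> norm1 (pw k) \<nu>"
  using M1_mono[OF assms(1) weight_pw weight_pw pw_mono[OF assms(2)]] by auto

lemma M1_pw_phi:
  assumes "\<nu> \<in> M1 (pw k)" "1 \<le> k"
  shows "\<nu> \<in> M1 \<phi>" "norm1 \<phi> \<nu> \<le> norm1 (pw k) \<nu>"
  using M1_pw_mono[OF assms] by auto

text \<open>
  The weights for which the loss term compensates the growth of the kernel. The first inequality is
  the pointwise bound \<open>w (x + y) + w x - w y = O(w y / \<phi> y)\<close> with a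
  constant depending on \<open>x\<close>, multiplied by \<open>\<phi> y\<close>. The second one makes
  the first survive truncation: with \<open>min w n\<close> in place of \<open>w\<close> and
  \<open>w y > n\<close>, the left-hand side is at most \<open>\<phi> y * w x\<close>. The
  common bound \<open>4 * \<phi> x\<^sup>2\<close> covers both weights of interest.
\<close>

definition admissible :: "(real \<Rightarrow> real) \<Rightarrow> bool" where
  "admissible w \<longleftrightarrow> weight w \<and> (\<forall>x>0. \<phi> x \<le> w x) \<and>
     (\<forall>x>0. \<forall>y>0. \<phi> y * (w (x + y) + w x - w y) \<le> 4 * \<phi> x ^ 2 * w y \<and> \<phi> y * w x \<le> 4 * \<phi> x ^ 2 * w y)"

lemma admissible_phi: "admissible \<phi>"
proof -
  have "\<phi> y * (\<phi> (x + y) + \<phi> x - \<phi> y) \<le> 4 * \<phi> x ^ 2 * \<phi> y \<and> \<phi> y * \<phi> x \<le> 4 * \<phi> x ^ 2 * \<phi> y"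
    if x: "x > 0" and y: "y > 0" for x y
  proof -
    have p: "1 \<le> \<phi> x" "1 \<le> \<phi> y" using phi_ge1 x y by auto
    have "\<phi> x * 1 \<le> \<phi> x * \<phi> x" using p by (intro mult_left_mono) auto
    then have q: "\<phi> x \<le> \<phi> x ^ 2" by (simp add: power2_eq_square)
    have "\<phi> y * (\<phi> (x + y) + \<phi> x - \<phi> y) \<le> \<phi> y * (4 * \<phi> x ^ 2)"
      using phi_add[OF x y] p q by (intro mult_left_mono) auto
    moreover have "\<phi> y * \<phi> x \<le> \<phi> y * (4 * \<phi> x ^ 2)"
      using p q by (intro mult_left_mono) auto
    ultimately show ?thesis by (simp add: ac_simps)
  qed
  then show ?thesis by (auto simp: admissible_def phi_weight)
qed

lemma admissible_phi_squared: "admissible (pw 2)"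
proof -
  have "\<phi> y * (\<phi> (x + y) ^ 2 + \<phi> x ^ 2 - \<phi> y ^ 2) \<le> 4 * \<phi> x ^ 2 * \<phi> y ^ 2 \<and> \<phi> y * \<phi> x ^ 2 \<le> 4 * \<phi> x ^ 2 * \<phi> y ^ 2"
    if x: "x > 0" and y: "y > 0" for x y
  proof -
    have p: "1 \<le> \<phi> x" "1 \<le> \<phi> y" "0 \<le> \<phi> (x + y)" using phi_ge1[of x] phi_ge1[of y] phi_ge1[of "x + y"] x y by auto
    have s: "\<phi> (x + y) ^ 2 \<le> (\<phi> x + \<phi> y) ^ 2" using phi_add[OF x y] p by (intro power_mono) auto
    have 1: "\<phi> x ^ 2 * 1 \<le> \<phi> x ^ 2 * \<phi> y" using p by (intro mult_left_mono) auto
    have "(\<phi> x * \<phi> y) * 1 \<le> (\<phi> x * \<phi> y) * \<phi> x" using p by (intro mult_left_mono) auto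
    then have 2: "\<phi> x * \<phi> y \<le> \<phi> x ^ 2 * \<phi> y" by (simp add: power2_eq_square ac_simps)
    have "\<phi> (x + y) ^ 2 + \<phi> x ^ 2 - \<phi> y ^ 2 \<le> 4 * (\<phi> x ^ 2 * \<phi> y)"
      using s 1 2 by (simp add: power2_sum)
    then have "\<phi> y * (\<phi> (x + y) ^ 2 + \<phi> x ^ 2 - \<phi> y ^ 2) \<le> \<phi> y * (4 * (\<phi> x ^ 2 * \<phi> y))"
      using p by (intro mult_left_mono) auto
    moreover have "\<phi> y * \<phi> x ^ 2 \<le> \<phi> y * (4 * (\<phi> x ^ 2 * \<phi> y))"
    proof (intro mult_left_mono)
      show "\<phi> x ^ 2 \<le> 4 * (\<phi> x ^ 2 * \<phi> y)" using 1 p by (smt (verit) mult_nonneg_nonneg zero_le_power2)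
    qed (use p in auto)
    ultimately show ?thesis by (simp add: power2_eq_square ac_simps)
  qed
  moreover have "\<phi> x \<le> pw 2 x" if "x > 0" for x using pw_mono[of 1 2 x] that by simp
  ultimately show ?thesis using weight_pw by (auto simp: admissible_def pw_def)
qed

lemma kernel_bound_bdd:
  assumes "(\<lambda>(x, y). k x y) \<in> borel_measurable (pos_borel \<Otimes>\<^sub>M pos_borel)"
    and k: "\<And>x y. x > 0 \<Longrightarrow> y > 0 \<Longrightarrow> \<bar>k x y\<bar> \<le> L * (\<phi> x * \<phi> y)" and L: "0 \<le> L"
    and f: "f \<in> borel_measurable pos_borel" "\<And>x. x > 0 \<Longrightarrow> \<bar>f x\<bar> \<le> B"
  shows "kernel_bound (\<lambda>x y. brace f x y * k x y) (3 * B * L) \<phi> \<phi>"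
proof (rule kernel_bound_mult[OF measurable_brace[OF f(1)] assms(1)])
  fix x y :: real assume x: "x > 0" and y: "y > 0"
  have "\<bar>brace f x y\<bar> \<le> 3 * B"
    using f(2)[of "x + y"] f(2)[OF x] f(2)[OF y] x y by (simp add: brace_def abs_if split: if_splits)
  then have "\<bar>brace f x y\<bar> * \<bar>k x y\<bar> \<le> (3 * B) * (L * (\<phi> x * \<phi> y))"
    using k[OF x y] by (intro mult_mono) (auto intro: order_trans[OF abs_ge_zero])
  then show "\<bar>brace f x y * k x y\<bar> \<le> 3 * B * L * (\<phi> x * \<phi> y)" by (simp add: abs_mult ac_simps)
qed

lemma brace_phi_bound:
  assumes c: "0 \<le> c" and f: "\<And>x. x > 0 \<Longrightarrow> \<bar>f x\<bar> \<le> c * \<phi> x" and x: "x > 0" and y: "y > 0"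
  shows "\<bar>brace f x y\<bar> \<le> 4 * c * (\<phi> x * \<phi> y)"
proof -
  have p: "1 \<le> \<phi> x" "1 \<le> \<phi> y" using phi_ge1 x y by auto
  have "\<bar>brace f x y\<bar> \<le> c * \<phi> (x + y) + c * \<phi> x + c * \<phi> y"
    using f[of "x + y"] f[OF x] f[OF y] x y by (simp add: brace_def abs_if split: if_splits)
  also have "\<dots> \<le> c * (\<phi> x + \<phi> y) + c * \<phi> x + c * \<phi> y"
    using phi_add[OF x y] c by (intro add_mono mult_left_mono) auto
  also have "\<dots> = 2 * c * (\<phi> x + \<phi> y)" by (simp add: algebra_simps)
  also have "\<dots> \<le> 2 * c * (2 * (\<phi> x * \<phi> y))"
  proof (intro mult_left_mono)
    have "\<phi> x * 1 \<le> \<phi> x * \<phi> y" "1 * \<phi> y \<le> \<phi> x * \<phi> y" using p by (auto intro!: mult_mono)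
    then show "\<phi> x + \<phi> y \<le> 2 * (\<phi> x * \<phi> y)" by simp
  qed (use c in auto)
  finally show ?thesis by simp
qed

text \<open>
  A test function of growth \<open>\<phi>\<close> costs one power of \<open>\<phi>\<close> in each
  variable on top of the power in the bound for the kernel.
\<close>

lemma kernel_bound_phi:
  assumes "(\<lambda>(x, y). k x y) \<in> borel_measurable (pos_borel \<Otimes>\<^sub>M pos_borel)"
    and k: "\<And>x y. x > 0 \<Longrightarrow> y > 0 \<Longrightarrow> \<bar>k x y\<bar> \<le> L * (\<phi> x * \<phi> y)" and L: "0 \<le> L" and c: "0 \<le> c"
    and f: "f \<in> borel_measurable pos_borel" "\<And>x. x > 0 \<Longrightarrow> \<bar>f x\<bar> \<le> c * \<phi> x"
  shows "kernel_bound (\<lambda>x y. brace f x y * k x y) (4 * c * L) (pw 2) (pw 2)"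
proof (rule kernel_bound_mult[OF measurable_brace[OF f(1)] assms(1)])
  fix x y :: real assume x: "x > 0" and y: "y > 0"
  have "\<bar>brace f x y\<bar> * \<bar>k x y\<bar> \<le> (4 * c * (\<phi> x * \<phi> y)) * (L * (\<phi> x * \<phi> y))"
    using brace_phi_bound[OF c f(2) x y] k[OF x y] by (intro mult_mono) (auto intro: order_trans[OF abs_ge_zero])
  then show "\<bar>brace f x y * k x y\<bar> \<le> 4 * c * L * (pw 2 x * pw 2 y)"
    by (simp add: abs_mult ac_simps pw_def power2_eq_square)
qed

text \<open>
  Similarly a test function of growth \<open>\<phi>\<^sup>2\<close> costs two powers. This is where
  third moments come from.
\<close>

lemma kernel_bound_phi_squared:
  assumes "(\<lambda>(x, y). k x y) \<in> borel_measurable (pos_borel \<Otimes>\<^sub>M pos_borel)"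
    and k: "\<And>x y. x > 0 \<Longrightarrow> y > 0 \<Longrightarrow> \<bar>k x y\<bar> \<le> L * (\<phi> x * \<phi> y)" and L: "0 \<le> L" and c: "0 \<le> c"
    and f: "f \<in> borel_measurable pos_borel" "\<And>x. x > 0 \<Longrightarrow> \<bar>f x\<bar> \<le> c * pw 2 x"
  shows "kernel_bound (\<lambda>x y. brace f x y * k x y) (6 * c * L) (pw 3) (pw 3)"
proof (rule kernel_bound_mult[OF measurable_brace[OF f(1)] assms(1)])
  fix x y :: real assume x: "x > 0" and y: "y > 0"
  have p: "1 \<le> \<phi> x" "1 \<le> \<phi> y" "0 \<le> \<phi> (x + y)" using phi_ge1[of x] phi_ge1[of y] phi_ge1[of "x + y"] x y by auto
  have "\<phi> (x + y) ^ 2 \<le> (\<phi> x + \<phi> y) ^ 2" using phi_add[OF x y] p by (intro power_mono) auto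
  moreover have "0 \<le> (\<phi> x - \<phi> y) ^ 2" by simp
  ultimately have s: "\<phi> (x + y) ^ 2 \<le> 2 * \<phi> x ^ 2 + 2 * \<phi> y ^ 2"
    by (simp add: power2_sum power2_diff)
  have "\<bar>brace f x y\<bar> \<le> c * \<phi> (x + y) ^ 2 + c * \<phi> x ^ 2 + c * \<phi> y ^ 2"
    using f(2)[of "x + y"] f(2)[OF x] f(2)[OF y] x y by (simp add: brace_def pw_def abs_if split: if_splits)
  also have "\<dots> = c * (\<phi> (x + y) ^ 2 + \<phi> x ^ 2 + \<phi> y ^ 2)" by (simp add: algebra_simps)
  also have "\<dots> \<le> c * (6 * (\<phi> x ^ 2 * \<phi> y ^ 2))"
  proof (intro mult_left_mono)
    have o: "1 \<le> \<phi> x ^ 2" "1 \<le> \<phi> y ^ 2" using p by (auto intro: one_le_power)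
    have "\<phi> x ^ 2 * 1 \<le> \<phi> x ^ 2 * \<phi> y ^ 2" by (rule mult_left_mono[OF o(2)]) simp
    moreover have "1 * \<phi> y ^ 2 \<le> \<phi> x ^ 2 * \<phi> y ^ 2" by (rule mult_right_mono[OF o(1)]) simp
    ultimately show "\<phi> (x + y) ^ 2 + \<phi> x ^ 2 + \<phi> y ^ 2 \<le> 6 * (\<phi> x ^ 2 * \<phi> y ^ 2)" using s by simp
  qed (rule c)
  finally have "\<bar>brace f x y\<bar> * \<bar>k x y\<bar> \<le> (c * (6 * (\<phi> x ^ 2 * \<phi> y ^ 2))) * (L * (\<phi> x * \<phi> y))"
    using k[OF x y] by (intro mult_mono) (auto intro: order_trans[OF abs_ge_zero])
  then show "\<bar>brace f x y * k x y\<bar> \<le> 6 * c * L * (pw 3 x * pw 3 y)"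
    by (simp add: abs_mult ac_simps pw_def power2_eq_square power3_eq_cube)
qed

section \<open>The basic estimate\<close>

text \<open>
  The differential inequality for the norm, with two defects that are unavoidable in discrete time.
  The sign \<open>S\<close> need not be that of \<open>\<rho>\<close>, as in the application it is the
  sign at a later time; the mismatch is measured by the last term,
  \<open>|\<rho>|(1) - (S, \<rho>)\<close>. Where \<open>S\<close> has the wrong sign the loss term
  does not help, and the loss rate \<open>\<phi> y\<close> is unbounded; so the mismatch is only used
  where \<open>w \<le> m\<close>, and the remaining part is estimated by the tail in the middle
  term.
\<close>

lemma coagulation_form_upper:
  assumes w: "admissible w"
    and K: "(\<lambda>(x, y). K x y) \<in> borel_measurable (pos_borel \<Otimes>\<^sub>M pos_borel)"
      "\<And>x y. x > 0 \<Longrightarrow> y > 0 \<Longrightarrow> 0 \<le> K x y \<and> K x y \<le> \<phi> x * \<phi> y"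
    and \<kappa>: "\<kappa> \<in> M1 (pw 3)" "\<And>A. 0 \<le> \<kappa> A" "norm1 (pw 3) \<kappa> \<le> M"
    and \<rho>: "\<rho> \<in> M1 w"
    and S: "S \<in> borel_measurable pos_borel" "\<And>x. \<bar>S x\<bar> = 1"
    and nm: "0 \<le> n" "0 \<le> m"
    and f_def: "f = (\<lambda>x. min (w x) n * S x)"
  shows "coag_form f K \<kappa> \<rho> \<le> 4 * M * norm1 w \<rho>
    + 2 * n * M * (\<integral>x. (if m < w x then w x else 0) \<partial>total_var \<rho>)
    + n * m * M * ((\<integral>x. 1 \<partial>total_var \<rho>) - signed_integral \<rho> S)"
proof -
  have ww: "weight w" using w by (simp add: admissible_def)
  have wm: "w \<in> borel_measurable pos_borel" using ww by (simp add: weight_def)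
  have w0: "0 \<le> w x" if "x > 0" for x using weight_nonneg[OF ww that] .
  have wphi: "\<phi> x \<le> w x" if "x > 0" for x using w that by (simp add: admissible_def)
  have fs: "finite_signed_measure \<rho>" by (rule M1_finite_signed_measure[OF \<rho> ww])
  have M0: "0 \<le> M" using \<kappa>(3) norm1_nonneg[of "pw 3" \<kappa>] by linarith
  have \<kappa>p: "\<kappa> \<in> M1 \<phi>" "norm1 \<phi> \<kappa> \<le> M" using M1_pw_phi[OF \<kappa>(1)] \<kappa>(3) by auto
  have fm: "f \<in> borel_measurable pos_borel" unfolding f_def using wm S(1) by measurable
  have fb: "\<bar>f x\<bar> \<le> n" if "x > 0" for x using w0[OF that] nm by (simp add: f_def abs_mult S)
  have kb: "kernel_bound (\<lambda>x y. brace f x y * K x y) (3 * n * 1) \<phi> \<phi>"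
    using K fm fb by (intro kernel_bound_bdd) auto
  define h where "h y = signed_integral \<kappa> (\<lambda>x. brace f x y * K x y)" for y
  have hm: "h \<in> borel_measurable pos_borel" unfolding h_def[abs_def]
    by (rule bilin_inner_measurable[OF \<kappa>p(1) phi_weight kb])
  have hb: "\<bar>h y\<bar> \<le> (3 * n * 1 * norm1 \<phi> \<kappa>) * w y" if "y > 0" for y
  proof -
    have "(3 * n * 1 * norm1 \<phi> \<kappa>) * \<phi> y \<le> (3 * n * 1 * norm1 \<phi> \<kappa>) * w y"
      using wphi[OF that] nm by (intro mult_left_mono) auto
    with bilin_inner_bound[OF \<kappa>p(1) phi_weight kb that] show ?thesis unfolding h_def by (rule order_trans)
  qed
  have hi: "integrable (total_var \<rho>) h" by (rule integrable_total_var_bound[OF \<rho> ww hm hb])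
  \<comment> \<open>The pointwise bound behind the three terms;
      \<open>1 - S y * sgn_density \<rho> y\<close> is 0 where the signs agree and 2 where
      they differ.\<close>
  define R where "R y = 4 * M * w y + 2 * n * M * (if m < w y then w y else 0) + n * m * M * (1 - S y * sgn_density \<rho> y)" for y
  have pt: "h y * sgn_density \<rho> y \<le> R y" if y: "y > 0" for y
  proof -
    define s where "s = sgn_density \<rho> y"
    have s: "\<bar>s\<bar> = 1" unfolding s_def by (rule sgn_density_abs[OF fs])
    define q where "q = 1 - S y * s"
    have "\<bar>S y * s\<bar> = 1" by (simp add: abs_mult s S)
    then have q: "0 \<le> q" "q \<le> 2" unfolding q_def by linarith+
    define v where "v = min (w y) n"
    have v: "0 \<le> v" "v \<le> n" unfolding v_def using w0[OF y] nm by auto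
    note sec = kernel_bound_section[OF kb y]
    have p0: "0 \<le> \<phi> y" using phi_ge1[OF y] by simp
    have point: "s * (brace f x y * K x y) \<le> (4 * w y) * pw 3 x + (v * q * \<phi> y) * \<phi> x" if x: "x > 0" for x
    proof -
      have Kx: "0 \<le> K x y" "K x y \<le> \<phi> x * \<phi> y" using K(2)[OF x y] by auto
      have px: "1 \<le> \<phi> x" by (rule phi_ge1[OF x])
      define z where "z = min (w (x + y)) n + min (w x) n - v"
      have u1: "s * f z' \<le> min (w z') n" if "z' > 0" for z'
        using w0[OF that] nm s S(2)[of z'] unfolding f_def by (auto simp: abs_if split: if_splits)
      have u2: "- (s * f z') \<le> min (w z') n" if "z' > 0" for z'
        using w0[OF that] nm s S(2)[of z'] unfolding f_def by (auto simp: abs_if split: if_splits)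
      have "s * brace f x y \<le> z + v * q"
      proof -
        have "s * brace f x y = s * f (x + y) - s * f x - s * f y" by (simp add: brace_def algebra_simps)
        moreover have "s * f y = v - v * q" by (simp add: f_def v_def q_def algebra_simps)
        moreover have "s * f (x + y) \<le> min (w (x + y)) n" using x y by (intro u1) simp
        moreover have "- (s * f x) \<le> min (w x) n" using x by (rule u2)
        ultimately show ?thesis unfolding z_def by linarith
      qed
      then have "(s * brace f x y) * K x y \<le> (z + v * q) * K x y" using Kx by (intro mult_right_mono) auto
      moreover have "z * K x y \<le> (4 * w y) * pw 3 x"
      proof (cases "z \<le> 0")
        case True
        then have "z * K x y \<le> 0" using Kx by (simp add: mult_nonpos_nonneg)
        also have "0 \<le> (4 * w y) * pw 3 x" using w0[OF y] px by (simp add: pw_def)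
        finally show ?thesis .
      next
        case False
        have "\<phi> y * z \<le> 4 * \<phi> x ^ 2 * w y"
        \<comment> \<open>Below the truncation level the weight inequality applies; above it the gain
            \<open>min (w (x + y)) n\<close> is at most the loss \<open>v = n\<close>.\<close>
        proof (cases "w y \<le> n")
          case True
          then have "z \<le> w (x + y) + w x - w y" unfolding z_def v_def by simp
          then have "\<phi> y * z \<le> \<phi> y * (w (x + y) + w x - w y)" using p0 by (rule mult_left_mono)
          also have "\<dots> \<le> 4 * \<phi> x ^ 2 * w y" using w x y unfolding admissible_def by blast
          finally show ?thesis .
        next
          case False
          then have "z \<le> w x" unfolding z_def v_def by simp
          then have "\<phi> y * z \<le> \<phi> y * w x" using p0 by (rule mult_left_mono)
          also have "\<dots> \<le> 4 * \<phi> x ^ 2 * w y" using w x y unfolding admissible_def by blast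
          finally show ?thesis .
        qed
        then have "\<phi> x * (\<phi> y * z) \<le> \<phi> x * (4 * \<phi> x ^ 2 * w y)" using px by (intro mult_left_mono) auto
        moreover have "z * K x y \<le> z * (\<phi> x * \<phi> y)" using False Kx by (intro mult_left_mono) auto
        ultimately show ?thesis by (simp add: pw_def power2_eq_square power3_eq_cube ac_simps)
      qed
      moreover have "v * q * K x y \<le> v * q * (\<phi> x * \<phi> y)" using v q Kx by (intro mult_left_mono) auto
      ultimately show ?thesis by (simp add: algebra_simps)
    qed
    have pw3p: "\<phi> x \<le> pw 3 x" if "x > 0" for x using pw_mono[of 1 3 x] that by simp
    have m3: "pw 3 \<in> borel_measurable pos_borel" using weight_pw by (simp add: weight_def)
    have p3: "0 \<le> pw 3 x" if "x > 0" for x by (rule weight_nonneg[OF weight_pw that])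
    have pp: "0 \<le> \<phi> x" if "x > 0" for x by (rule weight_nonneg[OF phi_weight that])
    have "h y * s = signed_integral \<kappa> (\<lambda>x. s * (brace f x y * K x y) + 0 * (brace f x y * K x y))"
      unfolding h_def by (subst signed_integral_fun_lincomb_M1[OF \<kappa>p(1) phi_weight sec sec]) simp_all
    also have "\<dots> = signed_integral \<kappa> (\<lambda>x. s * (brace f x y * K x y))" by simp
    also have "\<dots> \<le> signed_integral \<kappa> (\<lambda>x. (4 * w y) * pw 3 x + (v * q * \<phi> y) * \<phi> x)"
    proof (rule signed_integral_mono[OF \<kappa>(1) weight_pw \<kappa>(2) _ _ _ _ point])
      show "(\<lambda>x. s * (brace f x y * K x y)) \<in> borel_measurable pos_borel" using sec(1) by simp
      show "(\<lambda>x. (4 * w y) * pw 3 x + (v * q * \<phi> y) * \<phi> x) \<in> borel_measurable pos_borel"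
        using m3 phi_measurable by simp
      show "\<bar>s * (brace f x y * K x y)\<bar> \<le> (3 * n * 1 * \<phi> y) * pw 3 x" if x: "x > 0" for x
      proof -
        have "\<bar>s * (brace f x y * K x y)\<bar> \<le> (3 * n * 1 * \<phi> y) * \<phi> x" using sec(2)[OF x] s by (simp add: abs_mult)
        also have "\<dots> \<le> (3 * n * 1 * \<phi> y) * pw 3 x" using pw3p[OF x] nm p0 by (intro mult_left_mono) auto
        finally show ?thesis .
      qed
      show "\<bar>(4 * w y) * pw 3 x + (v * q * \<phi> y) * \<phi> x\<bar> \<le> (4 * w y + v * q * \<phi> y) * pw 3 x" if x: "x > 0" for x
      proof -
        have "(v * q * \<phi> y) * \<phi> x \<le> (v * q * \<phi> y) * pw 3 x"
          using pw3p[OF x] v q p0 by (intro mult_left_mono) auto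
        moreover have "0 \<le> (4 * w y) * pw 3 x + (v * q * \<phi> y) * \<phi> x"
          using v q p0 p3[OF x] pp[OF x] w0[OF y] by simp
        ultimately show ?thesis by (simp add: algebra_simps)
      qed
    qed auto
    also have "\<dots> = (4 * w y) * signed_integral \<kappa> (pw 3) + (v * q * \<phi> y) * signed_integral \<kappa> \<phi>"
      by (rule signed_integral_fun_lincomb_M1[OF \<kappa>(1) weight_pw m3 _ phi_measurable, where c=1 and d=1])
        (use p3 pp pw3p in auto)
    also have "\<dots> \<le> (4 * w y) * M + (v * q * \<phi> y) * M"
      using \<kappa>(3) \<kappa>p(2) w0[OF y] v q p0
      unfolding norm1_nonneg_measure[OF \<kappa>(1) weight_pw \<kappa>(2)] norm1_nonneg_measure[OF \<kappa>p(1) phi_weight \<kappa>(2)]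
      by (intro add_mono mult_left_mono) auto
    also have "(v * q * \<phi> y) * M \<le> 2 * n * M * (if m < w y then w y else 0) + n * m * M * q"
    proof (cases "m < w y")
      case True
      have "(v * q) * \<phi> y \<le> (n * 2) * w y" using v q p0 wphi[OF y] nm by (intro mult_mono) auto
      then have "(v * q * \<phi> y) * M \<le> (n * 2 * w y) * M" using M0 by (rule mult_right_mono)
      moreover have "0 \<le> n * m * M * q" using nm M0 q by simp
      ultimately show ?thesis using True by (simp add: algebra_simps)
    next
      case False
      have "(v * q) * \<phi> y \<le> (n * q) * m" using v q p0 wphi[OF y] nm False by (intro mult_mono) auto
      then have "(v * q * \<phi> y) * M \<le> (n * q * m) * M" using M0 by (rule mult_right_mono)
      then show ?thesis using False by (simp add: algebra_simps)
    qed
    finally show ?thesis unfolding R_def s_def q_def by (simp add: algebra_simps)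
  qed
  have wi: "integrable (total_var \<rho>) w" by (rule M1_integrable(1)[OF \<rho> ww])
  have cm: "(\<lambda>x. if m < w x then w x else 0) \<in> borel_measurable pos_borel" using wm by measurable
  have ci: "integrable (total_var \<rho>) (\<lambda>x. if m < w x then w x else 0)"
    using w0 by (intro integrable_total_var_bound[OF \<rho> ww cm, of 1]) auto
  interpret T: finite_measure "total_var \<rho>" by (rule finite_measure_total_var[OF fs])
  have Sb: "bdd_measurable S" using S by (auto simp: bdd_measurable_def)
  have Si: "integrable (total_var \<rho>) S" "integrable (total_var \<rho>) (\<lambda>x. S x * sgn_density \<rho> x)"
    by (rule bdd_measurable_integrable[OF T.finite_measure_axioms total_var_sets], rule Sb)
      (rule bdd_measurable_integrable[OF T.finite_measure_axioms total_var_sets bdd_measurable_mult_sgn[OF fs Sb]])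
  have Ri: "integrable (total_var \<rho>) R" unfolding R_def[abs_def] using wi ci Si by simp
  have hSi: "integrable (total_var \<rho>) (\<lambda>y. h y * sgn_density \<rho> y)"
  proof (rule integrable_total_var_bound[OF \<rho> ww])
    show "(\<lambda>y. h y * sgn_density \<rho> y) \<in> borel_measurable pos_borel"
      using hm sgn_density_measurable[OF fs] by (rule borel_measurable_times)
  qed (use hb in \<open>auto simp: abs_mult sgn_density_abs[OF fs]\<close>)
  have "coag_form f K \<kappa> \<rho> = (\<integral>y. h y * sgn_density \<rho> y \<partial>total_var \<rho>)"
    unfolding bilin_def h_def[symmetric] by (rule signed_integral_polar[OF fs hi])
  also have "\<dots> \<le> (\<integral>y. R y \<partial>total_var \<rho>)"
    using hSi Ri pt by (intro integral_mono) auto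
  also have "\<dots> = 4 * M * norm1 w \<rho> + 2 * n * M * (\<integral>x. (if m < w x then w x else 0) \<partial>total_var \<rho>)
    + n * m * M * ((\<integral>x. 1 \<partial>total_var \<rho>) - signed_integral \<rho> S)"
    unfolding R_def M1_integrable(2)[OF \<rho> ww] signed_integral_polar[OF fs Si(1)]
    using wi ci Si by simp
  finally show ?thesis .
qed

text \<open>
  A weak form of the linear equation with driver \<open>\<kappa>\<close>, up to an error. The error is
  proportional to the size of \<open>f\<close> relative to \<open>w\<close>, i.e. it is small in the
  dual norm. For the test functions \<open>min w n * S\<close> it is then bounded independently of
  \<open>n\<close>.
\<close>

definition evolves :: "(real \<Rightarrow> real) \<Rightarrow> (real \<Rightarrow> real \<Rightarrow> real) \<Rightarrow> real \<Rightarrow> real \<Rightarrow>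
    (real \<Rightarrow> real set \<Rightarrow> real) \<Rightarrow> (real \<Rightarrow> real set \<Rightarrow> real) \<Rightarrow> bool" where
  "evolves w K T \<eta> \<kappa> \<rho> \<longleftrightarrow> (\<forall>f. bdd_measurable f \<longrightarrow> (\<exists>g. set_integrable lborel {0..T} g \<and>
     (\<forall>s t. 0 \<le> s \<and> s \<le> t \<and> t \<le> T \<longrightarrow>
        signed_integral (\<rho> t) f - signed_integral (\<rho> s) f = (LINT u:{s..t}|lborel. g u)) \<and>
     (\<forall>u\<in>{0..T}. \<forall>c\<ge>0. (\<forall>x>0. \<bar>f x\<bar> \<le> c * w x) \<longrightarrow>
        \<bar>g u - coag_form f K (\<kappa> u) (\<rho> u)\<bar> \<le> c * \<eta>)))"

lemma evolvesE:
  assumes "evolves w K T \<eta> \<kappa> \<rho>" "bdd_measurable f"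
  obtains g where "set_integrable lborel {0..T} g"
    "\<forall>s t. 0 \<le> s \<and> s \<le> t \<and> t \<le> T \<longrightarrow>
        signed_integral (\<rho> t) f - signed_integral (\<rho> s) f = (LINT u:{s..t}|lborel. g u)"
    "\<forall>u\<in>{0..T}. \<forall>c\<ge>0. (\<forall>x>0. \<bar>f x\<bar> \<le> c * w x) \<longrightarrow>
        \<bar>g u - coag_form f K (\<kappa> u) (\<rho> u)\<bar> \<le> c * \<eta>"
  using assms(1)[unfolded evolves_def, THEN spec, THEN mp, OF assms(2)]
  by (elim exE conjE) (rule that)

text \<open>
  The test function \<open>w * sgn (\<rho> t)\<close> of the formal argument is unbounded and
  depends on time. Both are remedied by discretisation: on a short interval \<open>[s, r]\<close> the
  equation is tested with \<open>f = min w n * sgn (\<rho> r)\<close>, the sign being frozen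
  at the right end. Since \<open>(min w n, |\<rho> s|) \<ge> (f, \<rho> s)\<close>, this
  bounds the increment of \<open>(min w n, |\<rho>|)\<close> from above. Replacing the sign at time
  \<open>u\<close> by the sign at time \<open>r\<close> costs an amount that tends to 0 with the
  length of the interval, on sets where \<open>w \<le> m\<close>. Refining the partition, then
  letting \<open>m \<rightarrow> \<infinity>\<close>, then
  \<open>n \<rightarrow> \<infinity>\<close>, and applying Gronwall's inequality gives the claim.
  The constant depends neither on \<open>\<rho>\<close> nor on the dominating function
  \<open>X'\<close>.
\<close>

lemma norm1_estimate:
  assumes w: "admissible w" and \<eta>: "0 \<le> \<eta>" and M: "0 < M"
    and K: "(\<lambda>(x, y). K x y) \<in> borel_measurable (pos_borel \<Otimes>\<^sub>M pos_borel)"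
      "\<And>x y. x > 0 \<Longrightarrow> y > 0 \<Longrightarrow> 0 \<le> K x y \<and> K x y \<le> \<phi> x * \<phi> y"
    and \<kappa>: "\<And>u. u \<in> {0..T} \<Longrightarrow> \<kappa> u \<in> M1 (pw 3)" "\<And>u A. u \<in> {0..T} \<Longrightarrow> 0 \<le> \<kappa> u A"
      "\<And>u. u \<in> {0..T} \<Longrightarrow> norm1 (pw 3) (\<kappa> u) \<le> M"
    and \<rho>: "\<And>u. u \<in> {0..T} \<Longrightarrow> \<rho> u \<in> M1 w" and \<rho>0: "\<And>A. \<rho> 0 A = 0"
    and X': "set_integrable lborel {0..T} X'" "\<And>u. u \<in> {0..T} \<Longrightarrow> norm1 w (\<rho> u) \<le> X' u"
    and ev: "evolves w K T \<eta> \<kappa> \<rho>" and t: "t \<in> {0..T}"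
  shows "norm1 w (\<rho> t) \<le> 2 * (\<eta> * T) * exp (2 * (4 * M) * T)"
proof -
  have T0: "0 \<le> T" using t by simp
  have ww: "weight w" using w by (simp add: admissible_def)
  have wm: "w \<in> borel_measurable pos_borel" using ww by (simp add: weight_def)
  have w0: "0 \<le> w x" if "x > 0" for x using weight_nonneg[OF ww that] .
  have w1: "1 \<le> w x" if "x > 0" for x using ww that by (simp add: weight_def)
  have wphi: "\<phi> x \<le> w x" if "x > 0" for x using w that by (simp add: admissible_def)
  note fs = M1_finite_signed_measure[OF \<rho> ww]
  note fin = finite_measure_total_var[OF fs]
  \<comment> \<open>A crude bound for the speed of \<open>\<rho>\<close> against test functions bounded by 1. It
      depends on \<open>X'\<close> and serves only for measurability and for the mismatch of signs.\<close>
  define b where "b u = \<eta> + 3 * M * X' u" for u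
  have bi: "set_integrable lborel {0..T} b"
    unfolding b_def[abs_def] using X'(1) set_integral_Icc_const(2)[OF T0, of \<eta>]
    by (intro set_integral_add) auto
  define B where "B t = (LINT u:{0..t}|lborel. b u)" for t
  have Bd: "(LINT u:{s..r}|lborel. b u) = B r - B s" if "0 \<le> s" "s \<le> r" "r \<le> T" for s r
    unfolding B_def by (rule set_integral_Icc_diff[OF bi that])
  have b0: "0 \<le> b u" if "u \<in> {0..T}" for u
    using order_trans[OF norm1_nonneg X'(2)[OF that]] \<eta> M by (simp add: b_def)
  have Bmono: "B s \<le> B r" if "0 \<le> s" "s \<le> r" "r \<le> T" for s r
    using set_integral_Icc_nonneg[of s r b] b0 Bd[OF that] that by auto
  have lip: "\<bar>signed_integral (\<rho> r) f - signed_integral (\<rho> s) f\<bar> \<le> m * (B r - B s)"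
    if f: "bdd_measurable f" "\<And>x. x > 0 \<Longrightarrow> \<bar>f x\<bar> \<le> m" and m: "0 \<le> m" and sr: "0 \<le> s" "s \<le> r" "r \<le> T" for f m s r
  proof -
    obtain g where g: "set_integrable lborel {0..T} g"
      and gd: "\<forall>s t. 0 \<le> s \<and> s \<le> t \<and> t \<le> T \<longrightarrow>
        signed_integral (\<rho> t) f - signed_integral (\<rho> s) f = (LINT u:{s..t}|lborel. g u)"
      and ge: "\<forall>u\<in>{0..T}. \<forall>c\<ge>0. (\<forall>x>0. \<bar>f x\<bar> \<le> c * w x) \<longrightarrow>
        \<bar>g u - coag_form f K (\<kappa> u) (\<rho> u)\<bar> \<le> c * \<eta>"
      by (rule evolvesE[OF ev f(1)])
    have gb: "\<bar>g u\<bar> \<le> m * b u" if u: "u \<in> {0..T}" for u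
    proof -
      have "\<forall>x>0. \<bar>f x\<bar> \<le> m * w x"
        using f(2) w1 m by (metis mult.right_neutral mult_left_mono order_trans)
      then have 1: "\<bar>g u - coag_form f K (\<kappa> u) (\<rho> u)\<bar> \<le> m * \<eta>" using ge u m by blast
      have kb: "kernel_bound (\<lambda>x y. brace f x y * K x y) (3 * m * 1) \<phi> \<phi>"
        using K f by (intro kernel_bound_bdd) (auto simp: bdd_measurable_def)
      have \<rho>p: "\<rho> u \<in> M1 \<phi>" "norm1 \<phi> (\<rho> u) \<le> norm1 w (\<rho> u)"
        using M1_mono[OF \<rho>[OF u] ww phi_weight wphi] by auto
      have \<kappa>p: "\<kappa> u \<in> M1 \<phi>" "norm1 \<phi> (\<kappa> u) \<le> M" using M1_pw_phi[OF \<kappa>(1)[OF u]] \<kappa>(3)[OF u] by auto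
      have "\<bar>coag_form f K (\<kappa> u) (\<rho> u)\<bar> \<le> (3 * m * 1 * norm1 \<phi> (\<kappa> u)) * norm1 \<phi> (\<rho> u)"
        by (rule bilin_bound[OF \<kappa>p(1) phi_weight \<rho>p(1) phi_weight kb])
      also have "\<dots> \<le> (3 * m * 1 * M) * X' u"
        using \<kappa>p(2) \<rho>p(2) X'(2)[OF u] m M by (intro mult_mono) auto
      finally show ?thesis using 1 by (simp add: b_def algebra_simps)
    qed
    have mb: "set_integrable lborel {0..T} (\<lambda>u. m * b u)" using bi by simp
    have "\<bar>LINT u:{s..r}|lborel. g u\<bar> \<le> (LINT u:{s..r}|lborel. m * b u)"
    proof (rule set_integral_Icc_abs_le)
      show "set_integrable lborel {s..r} g" using sr(1,3) by (rule set_integrable_Icc_subset[OF g])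
      show "set_integrable lborel {s..r} (\<lambda>u. m * b u)" using sr(1,3) by (rule set_integrable_Icc_subset[OF mb])
    qed (use gb sr in auto)
    also have "\<dots> = m * (B r - B s)" using Bd[OF sr] by simp
    also have "(LINT u:{s..r}|lborel. g u) = signed_integral (\<rho> r) f - signed_integral (\<rho> s) f"
      using gd sr by metis
    finally show ?thesis .
  qed
  \<comment> \<open>\<open>V v u\<close> is the integral of \<open>v\<close> against \<open>|\<rho> u|\<close>.
      For bounded \<open>v\<close> it is continuous in \<open>u\<close>, by duality with the sign at
      either time; this gives measurability of the norm \<open>X\<close>, a limit of such functions.\<close>
  define V where "V v u = (\<integral>x. v x \<partial>total_var (\<rho> u))" for v :: "real \<Rightarrow> real" and u
  have Vsi: "V v u = signed_integral (\<rho> u) (\<lambda>x. v x * sgn_density (\<rho> u) x)" if "bdd_measurable v" "u \<in> {0..T}" for v u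
    unfolding V_def using that by (intro total_var_integral fs bdd_measurable_integrable fin) auto
  have siV: "signed_integral (\<rho> u) (\<lambda>x. v x * S x) \<le> V v u"
    if v: "bdd_measurable v" "\<And>x. x > 0 \<Longrightarrow> 0 \<le> v x" and u: "u \<in> {0..T}"
      and S: "S \<in> borel_measurable pos_borel" "\<And>x. \<bar>S x\<bar> = 1" for v u S
  proof -
    have "bdd_measurable (\<lambda>x. v x * S x)" using v(1) S by (auto simp: bdd_measurable_def abs_mult)
    then have "\<bar>signed_integral (\<rho> u) (\<lambda>x. v x * S x)\<bar> \<le> (\<integral>x. \<bar>v x * S x\<bar> \<partial>total_var (\<rho> u))"
      using u by (intro abs_signed_integral_le fs bdd_measurable_integrable fin) auto
    also have "\<dots> = V v u" unfolding V_def using v(2) S(2)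
      by (intro Bochner_Integration.integral_cong) (auto simp: abs_mult)
    finally show ?thesis by simp
  qed
  have Vlip1: "V v r - V v s \<le> m * \<bar>B r - B s\<bar>"
    if v: "bdd_measurable v" "\<And>x. x > 0 \<Longrightarrow> 0 \<le> v x" "\<And>x. x > 0 \<Longrightarrow> v x \<le> m" "0 \<le> m" and sr: "s \<in> {0..T}" "r \<in> {0..T}" for v m s r
  proof -
    let ?f = "\<lambda>x. v x * sgn_density (\<rho> r) x"
    have f: "bdd_measurable ?f" "\<And>x. x > 0 \<Longrightarrow> \<bar>?f x\<bar> \<le> m"
      using bdd_measurable_mult_sgn[OF fs[OF sr(2)] v(1)] v by (auto simp: abs_mult sgn_density_abs[OF fs[OF sr(2)]])
    have "V v r - V v s \<le> signed_integral (\<rho> r) ?f - signed_integral (\<rho> s) ?f"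
      using Vsi[OF v(1) sr(2)] siV[OF v(1,2) sr(1) sgn_density_measurable[OF fs[OF sr(2)]] sgn_density_abs[OF fs[OF sr(2)]]]
      by simp
    also have "\<dots> \<le> m * \<bar>B r - B s\<bar>"
    proof (cases "s \<le> r")
      case True
      then show ?thesis using lip[OF f v(4), of s r] Bmono[of s r] sr by auto
    next
      case False
      then show ?thesis using lip[OF f v(4), of r s] Bmono[of r s] sr by auto
    qed
    finally show ?thesis .
  qed
  have Bc: "continuous_on {0..T} B" unfolding B_def[abs_def] by (rule continuous_on_set_integral[OF bi])
  have Vc: "continuous_on {0..T} (V v)"
    if v: "bdd_measurable v" "\<And>x. x > 0 \<Longrightarrow> 0 \<le> v x" "\<And>x. x > 0 \<Longrightarrow> v x \<le> m" "0 \<le> m" for v m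
    unfolding continuous_on
  proof
    fix r assume r: "r \<in> {0..T}"
    have Bt: "((\<lambda>s. m * \<bar>B s - B r\<bar>) \<longlongrightarrow> m * \<bar>B r - B r\<bar>) (at r within {0..T})"
      using Bc r unfolding continuous_on by (intro tendsto_intros) auto
    have "((\<lambda>s. V v s - V v r) \<longlongrightarrow> 0) (at r within {0..T})"
    proof (rule Lim_null_comparison)
      show "\<forall>\<^sub>F s in at r within {0..T}. norm (V v s - V v r) \<le> m * \<bar>B s - B r\<bar>"
        unfolding eventually_at_filter
        using Vlip1[OF v] r by (intro always_eventually) (fastforce simp: abs_le_iff abs_minus_commute)
      show "((\<lambda>s. m * \<bar>B s - B r\<bar>) \<longlongrightarrow> 0) (at r within {0..T})" using Bt by simp
    qed
    then show "(V v \<longlongrightarrow> V v r) (at r within {0..T})" by (simp add: LIM_zero_iff)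
  qed
  have Vmeas: "(\<lambda>u. indicator {0..T} u * V v u) \<in> borel_measurable borel"
    if v: "bdd_measurable v" "\<And>x. x > 0 \<Longrightarrow> 0 \<le> v x" "\<And>x. x > 0 \<Longrightarrow> v x \<le> m" "0 \<le> m" for v m
    using borel_measurable_continuous_on_indicator[OF _ Vc[OF v]] by simp
  define X where "X u = norm1 w (\<rho> u)" for u
  define v where "v n x = min (w x) (real n)" for n x
  have vb: "bdd_measurable (v n)" "\<And>x. x > 0 \<Longrightarrow> 0 \<le> v n x" "\<And>x. x > 0 \<Longrightarrow> v n x \<le> real n" for n
  proof -
    have "v n \<in> borel_measurable pos_borel" using wm unfolding v_def[abs_def] by simp
    then show "bdd_measurable (v n)"
      using w0 by (auto simp: bdd_measurable_def v_def intro!: exI[of _ "real n"])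
  qed (use w0 in \<open>auto simp: v_def\<close>)
  have vX: "(\<lambda>n. V (v n) u) \<longlonglongrightarrow> X u" if u: "u \<in> {0..T}" for u
    unfolding V_def X_def M1_integrable(2)[OF \<rho>[OF u] ww]
  proof (rule integral_dominated_convergence[where w=w])
    show "integrable (total_var (\<rho> u)) w" by (rule M1_integrable(1)[OF \<rho>[OF u] ww])
    show "AE x in total_var (\<rho> u). (\<lambda>n. v n x) \<longlonglongrightarrow> w x"
    proof (rule AE_I2)
      fix x
      have "\<forall>\<^sub>F n in sequentially. v n x = w x"
        using eventually_ge_at_top[of "nat \<lceil>w x\<rceil>"] unfolding v_def by eventually_elim linarith
      then show "(\<lambda>n. v n x) \<longlonglongrightarrow> w x" by (rule tendsto_eventually)
    qed
    show "AE x in total_var (\<rho> u). norm (v n x) \<le> w x" for n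
      using w0 by (intro AE_I2) (auto simp: v_def)
    show "w \<in> borel_measurable (total_var (\<rho> u))" "v n \<in> borel_measurable (total_var (\<rho> u))" for n
      using wm vb(1)[of n] by (auto simp: measurable_eq_pos_borel[OF total_var_sets] bdd_measurable_def)
  qed
  have X0: "0 \<le> X u" for u by (simp add: X_def)
  have Xmeas: "(\<lambda>u. indicator {0..T} u * X u) \<in> borel_measurable borel"
  proof (rule borel_measurable_LIMSEQ_real)
    show "(\<lambda>u. indicator {0..T} u * V (v n) u) \<in> borel_measurable borel" for n
      using Vmeas[OF vb] by simp
    show "(\<lambda>n. indicator {0..T} u * V (v n) u) \<longlonglongrightarrow> indicator {0..T} u * X u" for u :: real
      using vX[of u] by (auto split: split_indicator)
  qed
  have Xi: "set_integrable lborel {0..T} X"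
    by (rule set_integrable_borel_bound[OF X'(1) Xmeas]) (use X'(2) in \<open>simp add: X_def\<close>)
  define E where "E m u = (\<integral>x. (if real m < w x then w x else 0) \<partial>total_var (\<rho> u))" for m u
  define c where "c m x = (if w x \<le> real m then w x else 0)" for m x
  have cb: "bdd_measurable (c m)" "\<And>x. x > 0 \<Longrightarrow> 0 \<le> c m x" "\<And>x. x > 0 \<Longrightarrow> c m x \<le> real m" for m
  proof -
    have "c m \<in> borel_measurable pos_borel" using wm unfolding c_def[abs_def] by measurable
    then show "bdd_measurable (c m)"
      using w0 by (auto simp: bdd_measurable_def c_def intro!: exI[of _ "real m"])
  qed (use w0 in \<open>auto simp: c_def\<close>)
  have em: "(\<lambda>x. if real m < w x then w x else 0) \<in> borel_measurable pos_borel" for m using wm by measurable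
  have E: "E m u = X u - V (c m) u" if u: "u \<in> {0..T}" for m u
  proof -
    have "integrable (total_var (\<rho> u)) (c m)"
      by (rule bdd_measurable_integrable[OF fin[OF u] total_var_sets cb(1)])
    then have "X u - V (c m) u = (\<integral>x. w x - c m x \<partial>total_var (\<rho> u))"
      unfolding X_def V_def M1_integrable(2)[OF \<rho>[OF u] ww] using M1_integrable(1)[OF \<rho>[OF u] ww] by simp
    also have "\<dots> = E m u" unfolding E_def c_def by (intro Bochner_Integration.integral_cong) auto
    finally show ?thesis by simp
  qed
  have Eb: "0 \<le> E m u" "E m u \<le> X u" if u: "u \<in> {0..T}" for m u
  proof -
    show "0 \<le> E m u" unfolding E_def using w0 by (intro Bochner_Integration.integral_nonneg) auto
    have "0 \<le> V (c m) u" unfolding V_def using cb by (intro Bochner_Integration.integral_nonneg) auto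
    then show "E m u \<le> X u" using E[OF u] by simp
  qed
  have Emeas: "(\<lambda>u. indicator {0..T} u * E m u) \<in> borel_measurable borel" for m
  proof -
    have "(\<lambda>u. indicator {0..T} u * E m u) = (\<lambda>u. indicator {0..T} u * X u - indicator {0..T} u * V (c m) u)"
      using E by (auto simp: fun_eq_iff split: split_indicator)
    then show ?thesis using borel_measurable_diff[OF Xmeas Vmeas[OF cb, of m]] by simp
  qed
  have Ei: "set_integrable lborel {0..T} (E m)" for m
    by (rule set_integrable_borel_bound[OF Xi Emeas]) (use Eb in auto)
  have Elim: "(\<lambda>m. E m u) \<longlonglongrightarrow> 0" if u: "u \<in> {0..T}" for u
  proof -
    have "(\<lambda>m. E m u) \<longlonglongrightarrow> (\<integral>x. 0 \<partial>total_var (\<rho> u))"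
      unfolding E_def
    proof (rule integral_dominated_convergence[where w=w])
      show "integrable (total_var (\<rho> u)) w" by (rule M1_integrable(1)[OF \<rho>[OF u] ww])
      show "AE x in total_var (\<rho> u). (\<lambda>m. if real m < w x then w x else 0) \<longlonglongrightarrow> 0"
      proof (rule AE_I2)
        fix x
        have "\<forall>\<^sub>F m in sequentially. (if real m < w x then w x else 0) = 0"
          using eventually_ge_at_top[of "nat \<lceil>w x\<rceil>"] by eventually_elim (simp add: not_less, linarith?)
        then show "(\<lambda>m. if real m < w x then w x else 0) \<longlonglongrightarrow> 0" by (rule tendsto_eventually)
      qed
      show "AE x in total_var (\<rho> u). norm (if real m < w x then w x else 0) \<le> w x" for m
        using w0 by (intro AE_I2) auto
      show "(\<lambda>x. if real m < w x then w x else 0) \<in> borel_measurable (total_var (\<rho> u))" for m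
        using em by (simp only: measurable_eq_pos_borel[OF total_var_sets])
    qed simp
    then show ?thesis by simp
  qed
  define a where "a n m u = \<eta> + 4 * M * X u + 2 * real n * M * E m u" for n m u
  have ai: "set_integrable lborel {0..T} (a n m)" for n m
    unfolding a_def[abs_def] using Xi Ei set_integral_Icc_const(2)[OF T0, of \<eta>]
    by (intro set_integral_add) auto
  \<comment> \<open>The increment over one interval. The error term is quadratic in the length, up to replacing
      one factor by the increment of the continuous function \<open>B\<close>.\<close>
  have inc: "V (v n) r - V (v n) s \<le> (LINT u:{s..r}|lborel. a n m u) + (2 * real n * real m * M) * (r - s) * (B r - B s)"
    if sr: "0 \<le> s" "s \<le> r" "r \<le> T" for n m s r
  proof -
    have rT: "r \<in> {0..T}" and sT: "s \<in> {0..T}" using sr by auto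
    define S where "S = sgn_density (\<rho> r)"
    have S: "S \<in> borel_measurable pos_borel" "\<And>x. \<bar>S x\<bar> = 1"
      unfolding S_def using sgn_density_measurable[OF fs[OF rT]] sgn_density_abs[OF fs[OF rT]] by auto
    have Sb: "bdd_measurable S" using S by (auto simp: bdd_measurable_def)
    define f where "f x = v n x * S x" for x
    have fb: "bdd_measurable f" unfolding f_def S_def by (rule bdd_measurable_mult_sgn[OF fs[OF rT] vb(1)])
    have fw: "\<forall>x>0. \<bar>f x\<bar> \<le> 1 * w x" using w0 by (auto simp: f_def abs_mult S v_def)
    obtain g where g: "set_integrable lborel {0..T} g"
      and gd: "\<forall>s t. 0 \<le> s \<and> s \<le> t \<and> t \<le> T \<longrightarrow>
        signed_integral (\<rho> t) f - signed_integral (\<rho> s) f = (LINT u:{s..t}|lborel. g u)"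
      and ge: "\<forall>u\<in>{0..T}. \<forall>c\<ge>0. (\<forall>x>0. \<bar>f x\<bar> \<le> c * w x) \<longrightarrow>
        \<bar>g u - coag_form f K (\<kappa> u) (\<rho> u)\<bar> \<le> c * \<eta>"
      by (rule evolvesE[OF ev fb])
    have gle: "g u \<le> a n m u + (2 * real n * real m * M) * (B r - B s)" if u: "u \<in> {s..r}" for u
    proof -
      have uT: "u \<in> {0..T}" using u sr by auto
      have "\<bar>g u - coag_form f K (\<kappa> u) (\<rho> u)\<bar> \<le> 1 * \<eta>"
        using ge uT fw by (metis zero_le_one)
      then have 1: "g u \<le> coag_form f K (\<kappa> u) (\<rho> u) + \<eta>" by linarith
      have 2: "coag_form f K (\<kappa> u) (\<rho> u) \<le> 4 * M * norm1 w (\<rho> u)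
          + 2 * real n * M * (\<integral>x. (if real m < w x then w x else 0) \<partial>total_var (\<rho> u))
          + real n * real m * M * ((\<integral>x. 1 \<partial>total_var (\<rho> u)) - signed_integral (\<rho> u) S)"
        by (rule coagulation_form_upper[OF w K \<kappa>(1)[OF uT] \<kappa>(2)[OF uT] \<kappa>(3)[OF uT] \<rho>[OF uT] S])
          (auto simp: f_def v_def)
      have one: "bdd_measurable (\<lambda>x. 1)" by (auto simp: bdd_measurable_def)
      \<comment> \<open>At time \<open>r\<close> the mismatch \<open>|\<rho>|(1) - (S, \<rho>)\<close>
          vanishes, and both of its terms move at speed at most \<open>b\<close>.\<close>
      have V1: "(\<integral>x. 1 \<partial>total_var (\<rho> u)) = V (\<lambda>x. 1) u" "V (\<lambda>x. 1) r = signed_integral (\<rho> r) S"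
        using Vsi[OF one rT] by (simp_all add: V_def S_def)
      have Vr: "V (\<lambda>x. 1) u - V (\<lambda>x. 1) r \<le> 1 * \<bar>B u - B r\<bar>"
        using Vlip1[OF one _ _ _ rT uT, of 1] by simp
      have Sr: "\<bar>signed_integral (\<rho> r) S - signed_integral (\<rho> u) S\<bar> \<le> 1 * (B r - B u)"
        using lip[OF Sb _ _, of 1 u r] S u sr by auto
      have "(\<integral>x. 1 \<partial>total_var (\<rho> u)) - signed_integral (\<rho> u) S \<le> 2 * (B r - B s)"
        using V1 Vr Sr Bmono[of u r] Bmono[of s u] u sr by auto
      then have "real n * real m * M * ((\<integral>x. 1 \<partial>total_var (\<rho> u)) - signed_integral (\<rho> u) S) \<le> real n * real m * M * (2 * (B r - B s))"
        using M by (intro mult_left_mono) auto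
      then show ?thesis using 1 2 unfolding a_def X_def E_def by (simp add: algebra_simps)
    qed
    have "V (v n) r - V (v n) s \<le> signed_integral (\<rho> r) f - signed_integral (\<rho> s) f"
      using Vsi[OF vb(1) rT] siV[OF vb(1,2) sT S] unfolding f_def S_def by simp
    also have "\<dots> = (LINT u:{s..r}|lborel. g u)" using gd sr by blast
    also have "\<dots> \<le> (LINT u:{s..r}|lborel. a n m u + (2 * real n * real m * M) * (B r - B s))"
      using sr gle by (intro set_integral_mono set_integral_add(1) set_integrable_Icc_subset[OF g]
          set_integrable_Icc_subset[OF ai] set_integral_Icc_const(2)) auto
    also have "\<dots> = (LINT u:{s..r}|lborel. a n m u) + (2 * real n * real m * M) * (B r - B s) * (r - s)"
      using sr set_integral_Icc_const(1)[OF sr(2)]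
      by (subst set_integral_add(2)) (auto intro!: set_integrable_Icc_subset[OF ai] set_integral_Icc_const(2))
    finally show ?thesis by (simp only: mult.assoc mult.commute[of "B r - B s" "r - s"])
  qed
  have X00: "X 0 = 0"
  proof -
    have z: "0 \<in> {0..T}" using T0 by simp
    have "(\<lambda>A. 0 * \<rho> 0 A) = \<rho> 0" using \<rho>0 by auto
    then have "X 0 \<le> \<bar>0\<bar> * norm1 w (\<rho> 0)" unfolding X_def using M1_scale(2)[OF \<rho>[OF z] ww, of 0] by simp
    then show ?thesis using X0[of 0] by simp
  qed
  have V00: "V (v n) 0 \<le> 0" for n
  proof -
    have z: "0 \<in> {0..T}" using T0 by simp
    have "V (v n) 0 \<le> X 0" unfolding V_def X_def M1_integrable(2)[OF \<rho>[OF z] ww]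
      using w0 by (intro integral_mono M1_integrable(1)[OF \<rho>[OF z] ww] bdd_measurable_integrable[OF fin[OF z] total_var_sets vb(1)])
        (auto simp: v_def)
    then show ?thesis using X00 by simp
  qed
  have Vle: "V (v n) r \<le> (LINT u:{0..r}|lborel. a n m u)" if r: "r \<in> {0..T}" for n m r
  proof -
    define F where "F r = V (v n) r - (LINT u:{0..r}|lborel. a n m u)" for r
    have "F r \<le> F 0"
    proof (rule superadditive_error_vanishes[where T=T and B=B and C="2 * real n * real m * M"])
      show "F r - F s \<le> (2 * real n * real m * M) * (r - s) * (B r - B s)" if "0 \<le> s" "s \<le> r" "r \<le> T" for s r
        using inc[OF that, of n m] set_integral_Icc_diff[OF ai that, of n m] unfolding F_def by simp
    qed (use r in auto)
    moreover have "(LINT u:{0..0}|lborel. a n m u) = 0"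
      using set_integral_Icc_diff[OF ai order_refl order_refl T0, of n m] by simp
    ultimately show ?thesis using V00[of n] unfolding F_def by linarith
  qed
  \<comment> \<open>Dominated convergence in \<open>m\<close>, with the norm \<open>X\<close> as dominating
      function.\<close>
  have Vle2: "V (v n) r \<le> (LINT u:{0..r}|lborel. \<eta> + 4 * M * X u)" if r: "r \<in> {0..T}" for n r
  proof -
    have i1: "set_integrable lborel {0..r} (\<lambda>u. \<eta> + 4 * M * X u)"
    proof (rule set_integral_add(1))
      show "set_integrable lborel {0..r} (\<lambda>u. \<eta>)" using r by (intro set_integral_Icc_const(2)) simp
      have "set_integrable lborel {0..r} X" using r by (intro set_integrable_Icc_subset[OF Xi]) auto
      then show "set_integrable lborel {0..r} (\<lambda>u. 4 * M * X u)" by simp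
    qed
    have iE: "set_integrable lborel {0..r} (E m)" for m
      using r by (intro set_integrable_Icc_subset[OF Ei]) auto
    have "(\<lambda>m. LINT u:{0..r}|lborel. E m u) \<longlonglongrightarrow> (LINT u:{0..r}|lborel. 0)"
      unfolding set_lebesgue_integral_def
    proof (rule integral_dominated_convergence[where w="\<lambda>u. indicator {0..r} u *\<^sub>R X u"])
      show "integrable lborel (\<lambda>u. indicator {0..r} u *\<^sub>R X u)"
        using set_integrable_Icc_subset[OF Xi, of 0 r] r by (simp add: set_integrable_def)
      show "(\<lambda>u. indicator {0..r} u *\<^sub>R E m u) \<in> borel_measurable lborel" for m
        using iE[of m] by (auto simp: set_integrable_def)
      show "AE u in lborel. (\<lambda>m. indicator {0..r} u *\<^sub>R E m u) \<longlonglongrightarrow> indicator {0..r} u *\<^sub>R 0"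
        using Elim r by (intro AE_I2) (auto split: split_indicator)
      show "AE u in lborel. norm (indicator {0..r} u *\<^sub>R E m u) \<le> indicator {0..r} u *\<^sub>R X u" for m
        using Eb r by (intro AE_I2) (auto split: split_indicator)
    qed simp
    then have "(\<lambda>m. (LINT u:{0..r}|lborel. \<eta> + 4 * M * X u) + 2 * real n * M * (LINT u:{0..r}|lborel. E m u))
        \<longlonglongrightarrow> (LINT u:{0..r}|lborel. \<eta> + 4 * M * X u) + 2 * real n * M * 0"
      by (intro tendsto_intros) (simp add: set_lebesgue_integral_def)
    moreover have "(LINT u:{0..r}|lborel. a n m u) =
        (LINT u:{0..r}|lborel. \<eta> + 4 * M * X u) + 2 * real n * M * (LINT u:{0..r}|lborel. E m u)" for m
      unfolding a_def using i1 iE by (subst set_integral_add(2)) auto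
    ultimately show ?thesis
      using Vle[OF r, of n] by (intro LIMSEQ_le_const[where X="\<lambda>m. LINT u:{0..r}|lborel. a n m u"]) auto
  qed
  have Xle: "X r \<le> \<eta> * T + (4 * M) * (LINT u:{0..r}|lborel. X u)" if r: "r \<in> {0..T}" for r
  proof -
    have "X r \<le> (LINT u:{0..r}|lborel. \<eta> + 4 * M * X u)"
      by (rule LIMSEQ_le_const2[OF vX[OF r]]) (use Vle2[OF r] in auto)
    also have "\<dots> = \<eta> * (r - 0) + (4 * M) * (LINT u:{0..r}|lborel. X u)"
      using r Xi set_integral_Icc_const[of 0 r \<eta>] set_integrable_Icc_subset[OF Xi, of 0 r] by (subst set_integral_add(2)) auto
    also have "\<eta> * (r - 0) \<le> \<eta> * T" using \<eta> r by (intro mult_left_mono) auto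
    finally show ?thesis by simp
  qed
  have "X t \<le> 2 * (\<eta> * T) * exp (2 * (4 * M) * T)"
    by (rule gronwall_integrable[OF Xi X0 _ _ Xle t]) (use M \<eta> T0 in auto)
  then show ?thesis by (simp add: X_def)
qed

end

lemma pos_borel_fst_snd_space: "z \<in> space (pos_borel \<Otimes>\<^sub>M pos_borel) \<Longrightarrow> fst z > 0 \<and> snd z > 0"
  by (auto simp: space_pair_measure)

section \<open>A family of solutions\<close>

text \<open>
  Solutions are treated as signed measures from here on. The set \<open>{0..T}\<close> is closed and
  \<open>M\<close> bounds the third moment uniformly in time and parameter. Continuity of the gradient
  in the parameter makes the kernel strictly differentiable. The initial value does not depend on the
  parameter, so differences of solutions start from 0.
\<close>

locale smoluchowski_family = size_weight \<phi> for \<phi> :: "real \<Rightarrow> real" +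
  fixes U :: "(real^'p) set" and K :: "real^'p \<Rightarrow> real \<Rightarrow> real \<Rightarrow> real"
    and dK :: "real^'p \<Rightarrow> real \<Rightarrow> real \<Rightarrow> real^'p"
    and m :: "real^'p \<Rightarrow> real \<Rightarrow> real set \<Rightarrow> real" and T M :: real
  assumes open_U: "open U" and T0: "0 \<le> T" and M0: "0 < M"
    and coag: "l \<in> U \<Longrightarrow> coag_kernel \<phi> (K l)"
    and K_deriv: "l \<in> U \<Longrightarrow> x > 0 \<Longrightarrow> y > 0 \<Longrightarrow> GDERIV (\<lambda>l'. K l' x y) l :> dK l x y"
    and dK_cont: "x > 0 \<Longrightarrow> y > 0 \<Longrightarrow> continuous_on U (\<lambda>l. dK l x y)"
    and dK_bound: "l \<in> U \<Longrightarrow> x > 0 \<Longrightarrow> y > 0 \<Longrightarrow> \<bar>dK l x y $ i\<bar> \<le> \<phi> x * \<phi> y"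
    and m_M1: "l \<in> U \<Longrightarrow> t \<in> {0..T} \<Longrightarrow> m l t \<in> M1 (pw 3)"
    and m_nonneg: "l \<in> U \<Longrightarrow> t \<in> {0..T} \<Longrightarrow> 0 \<le> m l t A"
    and m_bound: "l \<in> U \<Longrightarrow> t \<in> {0..T} \<Longrightarrow> norm1 (pw 3) (m l t) \<le> M"
    and m_init: "l \<in> U \<Longrightarrow> l' \<in> U \<Longrightarrow> m l 0 = m l' 0"
    and m_deriv: "l \<in> U \<Longrightarrow> t \<in> {0..T} \<Longrightarrow> bdd_measurable f \<Longrightarrow>
      ((\<lambda>s. signed_integral (m l s) f) has_real_derivative
        1 / 2 * coag_form f (K l) (m l t) (m l t)) (at t within {0..T})"
begin

lemma K_measurable: "l \<in> U \<Longrightarrow> (\<lambda>(x, y). K l x y) \<in> borel_measurable (pos_borel \<Otimes>\<^sub>M pos_borel)"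
  using coag by (simp add: coag_kernel_def)

lemma K_bounds: "l \<in> U \<Longrightarrow> x > 0 \<Longrightarrow> y > 0 \<Longrightarrow> 0 \<le> K l x y \<and> K l x y \<le> \<phi> x * \<phi> y"
  using coag by (simp add: coag_kernel_def)

lemma K_abs: "l \<in> U \<Longrightarrow> x > 0 \<Longrightarrow> y > 0 \<Longrightarrow> \<bar>K l x y\<bar> \<le> 1 * (\<phi> x * \<phi> y)"
  using K_bounds by auto

lemma K_sym: "l \<in> U \<Longrightarrow> x > 0 \<Longrightarrow> y > 0 \<Longrightarrow> K l x y = K l y x"
  using coag by (simp add: coag_kernel_def)

definition dKv :: "real^'p \<Rightarrow> real^'p \<Rightarrow> real \<Rightarrow> real \<Rightarrow> real" where
  "dKv l v x y = inner v (dK l x y)"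

lemma pp_nonneg: "x > 0 \<Longrightarrow> y > 0 \<Longrightarrow> 0 \<le> \<phi> x * \<phi> y"
  using phi_ge1[of x] phi_ge1[of y] by simp

lemma dKv_abs: "l \<in> U \<Longrightarrow> x > 0 \<Longrightarrow> y > 0 \<Longrightarrow> \<bar>dKv l v x y\<bar> \<le> (real CARD('p) * norm v) * (\<phi> x * \<phi> y)"
  using abs_inner_le[of "dK l x y" "\<phi> x * \<phi> y" v] dK_bound by (simp add: dKv_def ac_simps)

text \<open>
  A pointwise limit of difference quotients of measurable kernels.
\<close>

lemma dKv_measurable:
  assumes l: "l \<in> U"
  shows "(\<lambda>(x, y). dKv l v x y) \<in> borel_measurable (pos_borel \<Otimes>\<^sub>M pos_borel)"
proof -
  obtain e where e: "e > 0" "ball l e \<subseteq> U" using open_U l by (auto simp: open_contains_ball)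
  define h where "h n = e / (2 * (norm v + 1)) / real (Suc n)" for n
  have nv: "0 < norm v + 1" by (smt (verit) norm_ge_zero)
  have h: "0 < h n" for n using e nv by (simp add: h_def)
  have hl: "h \<longlonglongrightarrow> 0" unfolding h_def[abs_def]
    by (rule LIMSEQ_Suc[OF lim_const_over_n])
  have hU: "l + h n *\<^sub>R v \<in> U" for n
  proof -
    have "e / (2 * (norm v + 1)) / real (Suc n) \<le> e / (2 * (norm v + 1)) / 1"
      using e nv by (intro divide_left_mono) auto
    then have "h n * norm v \<le> e / (2 * (norm v + 1)) * norm v" unfolding h_def by (intro mult_right_mono) auto
    also have "\<dots> \<le> e / (2 * (norm v + 1)) * (norm v + 1)" using e nv by (intro mult_left_mono) auto
    also have "\<dots> = e / 2"
    proof -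
      have "norm v + 1 \<noteq> 0" using nv by simp
      then show ?thesis by (simp only: divide_divide_eq_left[symmetric] times_divide_eq_left nonzero_mult_div_cancel_right) (simp add: field_simps)
    qed
    also have "\<dots> < e" using e by simp
    finally have "norm (h n *\<^sub>R v) < e" using h[of n] by simp
    then show ?thesis using e(2) by (auto simp: dist_norm subset_iff)
  qed
  have meas: "(\<lambda>z. (K (l + h n *\<^sub>R v) (fst z) (snd z) - K l (fst z) (snd z)) / h n) \<in> borel_measurable (pos_borel \<Otimes>\<^sub>M pos_borel)" for n
    using K_measurable[OF hU[of n]] K_measurable[OF l] by (auto simp: split_def)
  have "(\<lambda>z. dKv l v (fst z) (snd z)) \<in> borel_measurable (pos_borel \<Otimes>\<^sub>M pos_borel)"
  proof (rule borel_measurable_LIMSEQ_real[OF _ meas])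
    fix z :: "real \<times> real" assume "z \<in> space (pos_borel \<Otimes>\<^sub>M pos_borel)"
    then have z: "fst z > 0" "snd z > 0" using pos_borel_fst_snd_space by auto
    have D: "((\<lambda>l'. K l' (fst z) (snd z)) has_derivative (\<lambda>w. inner w (dK l (fst z) (snd z)))) (at l)"
      using K_deriv[OF l z] by (simp add: gderiv_def)
    have "((\<lambda>s. l + s *\<^sub>R v) has_derivative (\<lambda>s. s *\<^sub>R v)) (at 0)"
      by (auto intro!: derivative_eq_intros)
    then have "((\<lambda>s. K (l + s *\<^sub>R v) (fst z) (snd z)) has_derivative (\<lambda>s. inner (s *\<^sub>R v) (dK l (fst z) (snd z)))) (at 0)"
      by (rule has_derivative_compose) (use D in simp)
    moreover have "(\<lambda>s. inner (s *\<^sub>R v) (dK l (fst z) (snd z))) = (*) (dKv l v (fst z) (snd z))"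
      by (auto simp: fun_eq_iff dKv_def)
    ultimately have "((\<lambda>s. K (l + s *\<^sub>R v) (fst z) (snd z)) has_real_derivative dKv l v (fst z) (snd z)) (at 0)"
      by (simp only: has_field_derivative_def)
    then have "((\<lambda>s. (K (l + s *\<^sub>R v) (fst z) (snd z) - K l (fst z) (snd z)) / s) \<longlongrightarrow> dKv l v (fst z) (snd z)) (at 0)"
      by (simp add: DERIV_def)
    moreover have "filterlim h (at 0) sequentially"
      using hl h by (auto simp: filterlim_at intro!: always_eventually less_imp_neq[THEN not_sym])
    ultimately show "(\<lambda>n. (K (l + h n *\<^sub>R v) (fst z) (snd z) - K l (fst z) (snd z)) / h n) \<longlonglongrightarrow> dKv l v (fst z) (snd z)"
      by (rule filterlim_compose)
  qed
  then show ?thesis by (simp add: split_def)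
qed

text \<open>
  The reference gradient \<open>D\<close> is free: with \<open>D = 0\<close> the lemma gives the
  Lipschitz bound below, and with the gradient at the centre it gives strict differentiability of the
  kernel.
\<close>

lemma K_mean_value:
  assumes d: "ball l0 d \<subseteq> U" and l: "l1 \<in> ball l0 d" "l2 \<in> ball l0 d" and xy: "x > 0" "y > 0"
    and B: "\<And>l v. l \<in> ball l0 d \<Longrightarrow> \<bar>inner v (dK l x y - D)\<bar> \<le> B * norm v"
  shows "\<bar>K l1 x y - K l2 x y - inner (l1 - l2) D\<bar> \<le> B * norm (l1 - l2)"
proof -
  have "norm ((K l1 x y - inner l1 D) - (K l2 x y - inner l2 D)) \<le> B * norm (l1 - l2)"
  proof (rule differentiable_bound[OF convex_ball _ _ l])
    fix l assume l: "l \<in> ball l0 d"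
    have "((\<lambda>l. K l x y) has_derivative (\<lambda>v. inner v (dK l x y))) (at l)"
      using K_deriv[OF _ xy] l d by (auto simp: gderiv_def)
    then have "((\<lambda>l. K l x y) has_derivative (\<lambda>v. inner v (dK l x y))) (at l within ball l0 d)"
      by (rule has_derivative_at_withinI)
    then show "((\<lambda>l. K l x y - inner l D) has_derivative (\<lambda>v. inner v (dK l x y) - inner v D)) (at l within ball l0 d)"
      by (auto intro!: derivative_eq_intros)
    show "onorm (\<lambda>v. inner v (dK l x y) - inner v D) \<le> B"
      using B[OF l] by (intro onorm_le) (simp add: inner_diff_right)
  qed
  then show ?thesis by (simp add: inner_diff_left algebra_simps)
qed

lemma K_lipschitz:
  assumes d: "ball l0 d \<subseteq> U" and l: "l1 \<in> ball l0 d" "l2 \<in> ball l0 d" and xy: "x > 0" "y > 0"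
  shows "\<bar>K l1 x y - K l2 x y\<bar> \<le> (real CARD('p) * norm (l1 - l2)) * (\<phi> x * \<phi> y)"
proof -
  have "\<bar>K l1 x y - K l2 x y - inner (l1 - l2) 0\<bar> \<le> (real CARD('p) * (\<phi> x * \<phi> y)) * norm (l1 - l2)"
  proof (rule K_mean_value[OF d l xy])
    fix l v assume "l \<in> ball l0 d"
    then have "l \<in> U" using d by auto
    then show "\<bar>inner v (dK l x y - 0)\<bar> \<le> real CARD('p) * (\<phi> x * \<phi> y) * norm v"
      using abs_inner_le[of "dK l x y" "\<phi> x * \<phi> y" v] dK_bound xy by simp
  qed
  then show ?thesis by (simp add: ac_simps)
qed

lemma m_M1_le: "l \<in> U \<Longrightarrow> t \<in> {0..T} \<Longrightarrow> k \<le> 3 \<Longrightarrow> m l t \<in> M1 (pw k)"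
  using M1_pw_mono(1)[OF m_M1] by blast

lemma m_bound_le: "l \<in> U \<Longrightarrow> t \<in> {0..T} \<Longrightarrow> k \<le> 3 \<Longrightarrow> norm1 (pw k) (m l t) \<le> M"
  using M1_pw_mono(2)[OF m_M1] m_bound order_trans by blast

lemma m_phi: "l \<in> U \<Longrightarrow> t \<in> {0..T} \<Longrightarrow> m l t \<in> M1 \<phi>" "l \<in> U \<Longrightarrow> t \<in> {0..T} \<Longrightarrow> norm1 \<phi> (m l t) \<le> M"
  using m_M1_le[of l t 1] m_bound_le[of l t 1] by auto

lemma brace_sym: "brace f x y = brace f y x"
  by (simp add: brace_def add.commute)

text \<open>
  The mean value theorem for each test function \<open>f\<close> with
  \<open>|f| \<le> \<phi>\<^sup>2\<close>; the right-hand side of the equation is bounded by third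
  moments.
\<close>

lemma time_lipschitz:
  assumes l: "l \<in> U" and s: "s \<in> {0..T}" and t: "t \<in> {0..T}"
  shows "norm1 (pw 2) (\<lambda>A. m l t A - m l s A) \<le> 3 * M ^ 2 * \<bar>t - s\<bar>"
proof -
  have mt: "m l t \<in> M1 (pw 2)" and ms: "m l s \<in> M1 (pw 2)" using m_M1_le l s t by auto
  have fs: "finite_signed_measure (\<lambda>A. m l t A - m l s A)"
    by (rule M1_finite_signed_measure[OF M1_diff(1)[OF mt ms weight_pw] weight_pw])
  show ?thesis
  proof (rule norm1_leI(2)[OF fs weight_pw])
    fix f assume f: "bdd_measurable f" "\<forall>x>0. \<bar>f x\<bar> \<le> pw 2 x"
    have fm: "f \<in> borel_measurable pos_borel" using f(1) by (simp add: bdd_measurable_def)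
    have kb: "kernel_bound (\<lambda>x y. brace f x y * K l x y) (6 * 1 * 1) (pw 3) (pw 3)"
      using f by (intro kernel_bound_phi_squared[OF K_measurable[OF l] K_abs[OF l] _ _ fm]) auto
    have "norm (signed_integral (m l t) f - signed_integral (m l s) f) \<le> 3 * M ^ 2 * norm (t - s)"
    proof (rule field_differentiable_bound[OF _ _ _ t s])
      show "convex {0..T}" by simp
      fix r assume r: "r \<in> {0..T}"
      show "((\<lambda>s. signed_integral (m l s) f) has_field_derivative
        1 / 2 * coag_form f (K l) (m l r) (m l r)) (at r within {0..T})"
        by (rule m_deriv[OF l r f(1)])
      have "\<bar>coag_form f (K l) (m l r) (m l r)\<bar> \<le> 6 * 1 * 1 * norm1 (pw 3) (m l r) * norm1 (pw 3) (m l r)"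
        by (rule bilin_bound[OF m_M1[OF l r] weight_pw m_M1[OF l r] weight_pw kb])
      also have "\<dots> \<le> 6 * 1 * 1 * M * M" using m_bound[OF l r] M0 by (intro mult_mono) auto
      finally show "norm (1 / 2 * coag_form f (K l) (m l r) (m l r)) \<le> 3 * M ^ 2"
        by (simp add: power2_eq_square)
    qed
    then show "signed_integral (\<lambda>A. m l t A - m l s A) f \<le> 3 * M ^ 2 * \<bar>t - s\<bar>"
      using signed_integral_diff_bdd[OF mt ms weight_pw f(1)] by simp
  qed
qed

lemma norm1_phi_le_pw2:
  assumes "\<nu> \<in> M1 (pw 2)" shows "norm1 \<phi> \<nu> \<le> norm1 (pw 2) \<nu>"
  using M1_pw_phi(2)[OF assms] by simp

lemma time_continuous:
  assumes l: "l \<in> U" and t: "t \<in> {0..T}"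
  shows "((\<lambda>s. norm1 (pw 2) (\<lambda>A. m l s A - m l t A)) \<longlongrightarrow> 0) (at t within {0..T})"
    and "((\<lambda>s. norm1 \<phi> (\<lambda>A. m l s A - m l t A)) \<longlongrightarrow> 0) (at t within {0..T})"
proof -
  have lim: "((\<lambda>s. 3 * M ^ 2 * \<bar>s - t\<bar>) \<longlongrightarrow> 3 * M ^ 2 * \<bar>t - t\<bar>) (at t within {0..T})"
    by (intro tendsto_intros)
  show 1: "((\<lambda>s. norm1 (pw 2) (\<lambda>A. m l s A - m l t A)) \<longlongrightarrow> 0) (at t within {0..T})"
  proof (rule Lim_null_comparison)
    show "\<forall>\<^sub>F s in at t within {0..T}. norm (norm1 (pw 2) (\<lambda>A. m l s A - m l t A)) \<le> 3 * M ^ 2 * \<bar>s - t\<bar>"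
      unfolding eventually_at_filter using time_lipschitz[OF l t] by (auto intro!: always_eventually)
  qed (use lim in simp)
  show "((\<lambda>s. norm1 \<phi> (\<lambda>A. m l s A - m l t A)) \<longlongrightarrow> 0) (at t within {0..T})"
  proof (rule Lim_null_comparison[OF _ 1])
    show "\<forall>\<^sub>F s in at t within {0..T}. norm (norm1 \<phi> (\<lambda>A. m l s A - m l t A)) \<le> norm1 (pw 2) (\<lambda>A. m l s A - m l t A)"
      unfolding eventually_at_filter
    proof (intro always_eventually allI impI)
      fix s assume s: "s \<in> {0..T}"
      have "(\<lambda>A. m l s A - m l t A) \<in> M1 (pw 2)" using m_M1_le l s t by (intro M1_diff weight_pw) auto
      then show "norm (norm1 \<phi> (\<lambda>A. m l s A - m l t A)) \<le> norm1 (pw 2) (\<lambda>A. m l s A - m l t A)"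
        using norm1_phi_le_pw2 by simp
    qed
  qed
qed

lemma kernel_bound_K:
  assumes "l \<in> U" "bdd_measurable f"
  obtains c where "0 \<le> c" "kernel_bound (\<lambda>x y. brace f x y * K l x y) c \<phi> \<phi>"
proof -
  obtain B where B: "\<And>x. x > 0 \<Longrightarrow> \<bar>f x\<bar> \<le> B" using assms(2) by (auto simp: bdd_measurable_def)
  have "0 \<le> 3 * B * 1" using B[of 1] by simp
  moreover have "kernel_bound (\<lambda>x y. brace f x y * K l x y) (3 * B * 1) \<phi> \<phi>"
    by (rule kernel_bound_bdd[OF K_measurable[OF assms(1)] K_abs[OF assms(1)] _ _ B])
      (use assms(2) in \<open>auto simp: bdd_measurable_def\<close>)
  ultimately show ?thesis by (rule that)
qed

lemma kernel_bound_dKv: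
  assumes "l \<in> U" "bdd_measurable f"
  obtains c where "0 \<le> c" "kernel_bound (\<lambda>x y. brace f x y * dKv l v x y) c \<phi> \<phi>"
proof -
  obtain B where B: "\<And>x. x > 0 \<Longrightarrow> \<bar>f x\<bar> \<le> B" using assms(2) by (auto simp: bdd_measurable_def)
  have "0 \<le> 3 * B * (real CARD('p) * norm v)" using B[of 1] by simp
  moreover have "kernel_bound (\<lambda>x y. brace f x y * dKv l v x y) (3 * B * (real CARD('p) * norm v)) \<phi> \<phi>"
    by (rule kernel_bound_bdd[OF dKv_measurable[OF assms(1)] dKv_abs[OF assms(1)] _ _ B])
      (use assms(2) in \<open>auto simp: bdd_measurable_def\<close>)
  ultimately show ?thesis by (rule that)
qed

text \<open>
  The right-hand side of Smoluchowski's equation.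
\<close>

definition rate :: "real^'p \<Rightarrow> (real \<Rightarrow> real) \<Rightarrow> real \<Rightarrow> real" where
  "rate l f u = 1 / 2 * coag_form f (K l) (m l u) (m l u)"

lemma rate_continuous:
  assumes "l \<in> U" "bdd_measurable f"
  shows "continuous_on {0..T} (rate l f)"
proof -
  obtain c where c: "0 \<le> c" "kernel_bound (\<lambda>x y. brace f x y * K l x y) c \<phi> \<phi>"
    using kernel_bound_K[OF assms] by blast
  show ?thesis unfolding rate_def[abs_def]
    by (intro continuous_intros continuous_on_bilin[OF m_phi(1)[OF assms(1)] phi_weight m_phi(1)[OF assms(1)] phi_weight c(2,1)]
        time_continuous(2) assms(1))
qed

lemma rate_integral:
  assumes "l \<in> U" "bdd_measurable f"
  shows "set_integrable lborel {0..T} (rate l f)"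
    and "0 \<le> s \<Longrightarrow> s \<le> t \<Longrightarrow> t \<le> T \<Longrightarrow>
      signed_integral (m l t) f - signed_integral (m l s) f = (LINT u:{s..t}|lborel. rate l f u)"
proof -
  show i: "set_integrable lborel {0..T} (rate l f)"
    by (rule borel_integrable_atLeastAtMost'[OF rate_continuous[OF assms]])
  assume st: "0 \<le> s" "s \<le> t" "t \<le> T"
  have "(rate l f has_integral (signed_integral (m l t) f - signed_integral (m l s) f)) {s..t}"
  proof (rule fundamental_theorem_of_calculus[OF st(2)])
    fix u assume u: "u \<in> {s..t}"
    have "((\<lambda>s. signed_integral (m l s) f) has_real_derivative rate l f u) (at u within {0..T})"
      unfolding rate_def using u st by (intro m_deriv assms) auto
    then have "((\<lambda>s. signed_integral (m l s) f) has_real_derivative rate l f u) (at u within {s..t})"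
      by (rule DERIV_subset) (use st in auto)
    then show "((\<lambda>s. signed_integral (m l s) f) has_vector_derivative rate l f u) (at u within {s..t})"
      by (simp add: has_real_derivative_iff_has_vector_derivative)
  qed
  then show "signed_integral (m l t) f - signed_integral (m l s) f = (LINT u:{s..t}|lborel. rate l f u)"
    using set_borel_integral_eq_integral(2)[OF set_integrable_Icc_subset[OF i st(1,3)]] by (simp add: integral_unique)
qed

section \<open>Lipschitz dependence on the parameter\<close>

lemma K_diff_measurable:
  assumes "l1 \<in> U" "l2 \<in> U"
  shows "(\<lambda>(x, y). K l1 x y - K l2 x y) \<in> borel_measurable (pos_borel \<Otimes>\<^sub>M pos_borel)"
  using borel_measurable_diff[OF K_measurable[OF assms(1)] K_measurable[OF assms(2)]] by (simp add: split_def)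

lemma m_diff:
  assumes "l1 \<in> U" "l2 \<in> U" "s \<in> {0..T}" "t \<in> {0..T}"
  shows "(\<lambda>A. m l1 s A - m l2 t A) \<in> M1 (pw 2)" "(\<lambda>A. m l1 s A - m l2 t A) \<in> M1 \<phi>"
    "norm1 (pw 2) (\<lambda>A. m l1 s A - m l2 t A) \<le> 2 * M"
    "norm1 \<phi> (\<lambda>A. m l1 s A - m l2 t A) \<le> norm1 (pw 2) (\<lambda>A. m l1 s A - m l2 t A)"
proof -
  have a: "m l1 s \<in> M1 (pw 2)" "m l2 t \<in> M1 (pw 2)" using m_M1_le assms by auto
  show 1: "(\<lambda>A. m l1 s A - m l2 t A) \<in> M1 (pw 2)" by (rule M1_diff(1)[OF a weight_pw])
  show "(\<lambda>A. m l1 s A - m l2 t A) \<in> M1 \<phi>"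
    by (rule M1_diff(1)[OF m_phi(1)[OF assms(1,3)] m_phi(1)[OF assms(2,4)] phi_weight])
  show "norm1 (pw 2) (\<lambda>A. m l1 s A - m l2 t A) \<le> 2 * M"
    using M1_diff(2)[OF a weight_pw] m_bound_le[OF assms(1,3), of 2] m_bound_le[OF assms(2,4), of 2] by simp
  show "norm1 \<phi> (\<lambda>A. m l1 s A - m l2 t A) \<le> norm1 (pw 2) (\<lambda>A. m l1 s A - m l2 t A)"
    by (rule norm1_phi_le_pw2[OF 1])
qed

lemma bilin_split_kernel:
  assumes "\<delta> \<in> M1 \<phi>" "\<rho> \<in> M1 \<phi>" "kernel_bound (\<lambda>x y. brace f x y * k1 x y) c1 \<phi> \<phi>"
    "kernel_bound (\<lambda>x y. brace f x y * k2 x y) c2 \<phi> \<phi>"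
  shows "bilin (\<lambda>x y. brace f x y * (k1 x y - k2 x y)) \<delta> \<rho> =
    coag_form f k1 \<delta> \<rho> - coag_form f k2 \<delta> \<rho>"
  using bilin_kernel_lincomb[OF assms(1) phi_weight assms(2) phi_weight assms(3,4), of 1 "-1"]
  by (simp add: right_diff_distrib)

definition lambda_const :: real where
  "lambda_const = 2 * ((3 * real CARD('p) * M ^ 2) * T) * exp (2 * (4 * M) * T)"

text \<open>
  By polarization the difference of two solutions solves a linear equation with kernel
  \<open>K l1\<close> whose driver is their average; the error comes from
  \<open>K l1 - K l2\<close>. For test functions below \<open>\<phi>\<^sup>2\<close> it is
  controlled by third moments, whence the weight \<open>\<phi>\<^sup>2\<close> in the conclusion.
\<close>

lemma lambda_lipschitz:
  assumes d: "ball l0 d \<subseteq> U" and l: "l1 \<in> ball l0 d" "l2 \<in> ball l0 d" and t: "t \<in> {0..T}"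
  shows "norm1 (pw 2) (\<lambda>A. m l1 t A - m l2 t A) \<le> lambda_const * norm (l1 - l2)"
proof -
  have lU: "l1 \<in> U" "l2 \<in> U" using d l by auto
  define \<eta> where "\<eta> = 3 * real CARD('p) * M ^ 2 * norm (l1 - l2)"
  have "norm1 (pw 2) (\<lambda>A. m l1 t A - m l2 t A) \<le> 2 * (\<eta> * T) * exp (2 * (4 * M) * T)"
  proof (rule norm1_estimate[OF admissible_phi_squared _ M0 K_measurable[OF lU(1)] K_bounds[OF lU(1)], where
        \<kappa>="\<lambda>u A. 1 / 2 * m l1 u A + 1 / 2 * m l2 u A" and \<rho>="\<lambda>u A. m l1 u A - m l2 u A" and X'="\<lambda>u. 2 * M"])
    show "0 \<le> \<eta>" using M0 by (simp add: \<eta>_def)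
    show "(\<lambda>A. 1 / 2 * m l1 u A + 1 / 2 * m l2 u A) \<in> M1 (pw 3)" if u: "u \<in> {0..T}" for u
      by (rule M1_lincomb(1)[OF m_M1[OF lU(1) u] m_M1[OF lU(2) u] weight_pw])
    show "0 \<le> 1 / 2 * m l1 u A + 1 / 2 * m l2 u A" if u: "u \<in> {0..T}" for u A
      using m_nonneg[OF lU(1) u] m_nonneg[OF lU(2) u] by simp
    show "norm1 (pw 3) (\<lambda>A. 1 / 2 * m l1 u A + 1 / 2 * m l2 u A) \<le> M" if u: "u \<in> {0..T}" for u
      using M1_lincomb(2)[OF m_M1[OF lU(1) u] m_M1[OF lU(2) u] weight_pw, of "1/2" "1/2"]
        m_bound[OF lU(1) u] m_bound[OF lU(2) u] by simp
    show "(\<lambda>A. m l1 u A - m l2 u A) \<in> M1 (pw 2)" "norm1 (pw 2) (\<lambda>A. m l1 u A - m l2 u A) \<le> 2 * M" if u: "u \<in> {0..T}" for u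
      using m_diff[OF lU u u] by auto
    show "m l1 0 A - m l2 0 A = 0" for A using m_init[OF lU] by simp
    show "set_integrable lborel {0..T} (\<lambda>u. 2 * M)" by (rule set_integral_Icc_const(2)[OF T0])
    show "t \<in> {0..T}" by (rule t)
    show "evolves (pw 2) (K l1) T \<eta> (\<lambda>u A. 1 / 2 * m l1 u A + 1 / 2 * m l2 u A) (\<lambda>u A. m l1 u A - m l2 u A)"
      unfolding evolves_def
    proof (intro allI impI exI conjI ballI)
      fix f assume f: "bdd_measurable f"
      have fm: "f \<in> borel_measurable pos_borel" using f by (simp add: bdd_measurable_def)
      show "set_integrable lborel {0..T} (\<lambda>u. rate l1 f u - rate l2 f u)"
        by (rule set_integral_diff(1)[OF rate_integral(1)[OF lU(1) f] rate_integral(1)[OF lU(2) f]])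
      show "signed_integral (\<lambda>A. m l1 r A - m l2 r A) f - signed_integral (\<lambda>A. m l1 s A - m l2 s A) f =
          (LINT u:{s..r}|lborel. rate l1 f u - rate l2 f u)" if sr: "0 \<le> s \<and> s \<le> r \<and> r \<le> T" for s r
      proof -
        have "s \<in> {0..T}" "r \<in> {0..T}" using sr by auto
        then have "signed_integral (\<lambda>A. m l1 r A - m l2 r A) f = signed_integral (m l1 r) f - signed_integral (m l2 r) f"
          "signed_integral (\<lambda>A. m l1 s A - m l2 s A) f = signed_integral (m l1 s) f - signed_integral (m l2 s) f"
          by (auto intro!: signed_integral_diff_bdd[OF m_phi(1)[OF lU(1)] m_phi(1)[OF lU(2)] phi_weight f])
        moreover have "(LINT u:{s..r}|lborel. rate l1 f u - rate l2 f u) =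
            (LINT u:{s..r}|lborel. rate l1 f u) - (LINT u:{s..r}|lborel. rate l2 f u)"
          using sr by (intro set_integral_diff(2) set_integrable_Icc_subset[OF rate_integral(1)[OF lU(1) f]]
              set_integrable_Icc_subset[OF rate_integral(1)[OF lU(2) f]]) auto
        ultimately show ?thesis
          using rate_integral(2)[OF lU(1) f, of s r] rate_integral(2)[OF lU(2) f, of s r] sr by simp
      qed
      fix u c assume u: "u \<in> {0..T}" and c: "0 \<le> c" "\<forall>x>0. \<bar>f x\<bar> \<le> c * pw 2 x"
      obtain c1 where c1: "0 \<le> c1" "kernel_bound (\<lambda>x y. brace f x y * K l1 x y) c1 \<phi> \<phi>"
        using kernel_bound_K[OF lU(1) f] by blast
      obtain c2 where c2: "0 \<le> c2" "kernel_bound (\<lambda>x y. brace f x y * K l2 x y) c2 \<phi> \<phi>"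
        using kernel_bound_K[OF lU(2) f] by blast
      note m1 = m_phi(1)[OF lU(1) u] and m2 = m_phi(1)[OF lU(2) u]
      have "coag_form f (K l1) (\<lambda>A. 1 / 2 * m l1 u A + 1 / 2 * m l2 u A) (\<lambda>A. m l1 u A - m l2 u A) =
          1 / 2 * coag_form f (K l1) (m l1 u) (m l1 u) - 1 / 2 * coag_form f (K l1) (m l2 u) (m l2 u)"
        using K_sym[OF lU(1)] by (intro bilin_polarization[OF m1 m2 phi_weight c1(2)]) (simp add: brace_sym)
      moreover have "bilin (\<lambda>x y. brace f x y * (K l1 x y - K l2 x y)) (m l2 u) (m l2 u) =
          coag_form f (K l1) (m l2 u) (m l2 u) - coag_form f (K l2) (m l2 u) (m l2 u)"
        by (rule bilin_split_kernel[OF m2 m2 c1(2) c2(2)])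
      ultimately have e: "rate l1 f u - rate l2 f u - coag_form f (K l1)
          (\<lambda>A. 1 / 2 * m l1 u A + 1 / 2 * m l2 u A) (\<lambda>A. m l1 u A - m l2 u A) =
          1 / 2 * bilin (\<lambda>x y. brace f x y * (K l1 x y - K l2 x y)) (m l2 u) (m l2 u)"
        unfolding rate_def by (simp add: algebra_simps)
      have kb: "kernel_bound (\<lambda>x y. brace f x y * (K l1 x y - K l2 x y)) (6 * c * (real CARD('p) * norm (l1 - l2))) (pw 3) (pw 3)"
        using c by (intro kernel_bound_phi_squared[OF K_diff_measurable[OF lU] K_lipschitz[OF d l] _ _ fm]) auto
      have "\<bar>bilin (\<lambda>x y. brace f x y * (K l1 x y - K l2 x y)) (m l2 u) (m l2 u)\<bar> \<le>
          6 * c * (real CARD('p) * norm (l1 - l2)) * norm1 (pw 3) (m l2 u) * norm1 (pw 3) (m l2 u)"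
        by (rule bilin_bound[OF m_M1[OF lU(2) u] weight_pw m_M1[OF lU(2) u] weight_pw kb])
      also have "\<dots> \<le> 6 * c * (real CARD('p) * norm (l1 - l2)) * M * M"
        using m_bound[OF lU(2) u] M0 c(1) by (intro mult_mono) auto
      finally show "\<bar>rate l1 f u - rate l2 f u - coag_form f (K l1)
          (\<lambda>A. 1 / 2 * m l1 u A + 1 / 2 * m l2 u A) (\<lambda>A. m l1 u A - m l2 u A)\<bar> \<le> c * \<eta>"
        unfolding e by (simp add: \<eta>_def power2_eq_square abs_mult ac_simps)
    qed
  qed
  then show ?thesis by (simp add: lambda_const_def \<eta>_def ac_simps)
qed

text \<open>
  At a fixed time this is dominated convergence: the remainder is \<open>o(|l1 - l2|)\<close>
  pointwise by continuity of the gradient, and the bound on the gradient dominates it. Uniformity in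
  time follows from compactness of \<open>{0..T}\<close>: along a sequence of counterexamples the
  times converge, and moving the measures to the limit time changes the forms by a vanishing amount,
  because they are Lipschitz in time.
\<close>

lemma remainder_small:
  assumes l0: "l0 \<in> U" and \<epsilon>: "0 < \<epsilon>"
  shows "\<exists>d>0. ball l0 d \<subseteq> U \<and> (\<forall>l1\<in>ball l0 d. \<forall>l2\<in>ball l0 d. \<forall>t\<in>{0..T}.
    bilin (\<lambda>x y. \<phi> x * \<phi> y * \<bar>K l1 x y - K l2 x y - dKv l0 (l1 - l2) x y\<bar>) (m l0 t) (m l0 t) \<le> \<epsilon> * norm (l1 - l2))"
proof (rule ccontr)
  obtain d0 where d0: "d0 > 0" "ball l0 d0 \<subseteq> U" using open_U l0 by (auto simp: open_contains_ball)
  define d where "d n = d0 / real (Suc n)" for n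
  have d: "0 < d n" "d n \<le> d0" for n using d0 by (auto simp: d_def divide_le_eq mult_le_cancel_left1)
  have dU: "ball l0 (d n) \<subseteq> U" for n using subset_ball[OF d(2)] d0(2) by blast
  define R where "R l1 l2 x y = K l1 x y - K l2 x y - dKv l0 (l1 - l2) x y" for l1 l2 x y
  assume "\<not> ?thesis"
  then have ex: "\<exists>a b t. a \<in> ball l0 (d n) \<and> b \<in> ball l0 (d n) \<and> t \<in> {0..T} \<and>
      \<not> bilin (\<lambda>x y. \<phi> x * \<phi> y * \<bar>R a b x y\<bar>) (m l0 t) (m l0 t) \<le> \<epsilon> * norm (a - b)" for n
    unfolding R_def using d[of n] dU[of n] by meson
  define Q where "Q n a b t \<longleftrightarrow> a \<in> ball l0 (d n) \<and> b \<in> ball l0 (d n) \<and> t \<in> {0..T} \<and>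
      \<not> bilin (\<lambda>x y. \<phi> x * \<phi> y * \<bar>R a b x y\<bar>) (m l0 t) (m l0 t) \<le> \<epsilon> * norm (a - b)" for n a b t
  have "\<forall>n. \<exists>a b t. Q n a b t" using ex unfolding Q_def by simp
  then obtain a b t where Q: "\<And>n. Q n (a n) (b n) (t n)" by metis
  have a: "a n \<in> ball l0 (d n)" and b: "b n \<in> ball l0 (d n)" and t: "t n \<in> {0..T}"
    and big: "\<not> bilin (\<lambda>x y. \<phi> x * \<phi> y * \<bar>R (a n) (b n) x y\<bar>) (m l0 (t n)) (m l0 (t n)) \<le> \<epsilon> * norm (a n - b n)" for n
    using Q[of n] unfolding Q_def by blast+
  have aU: "a n \<in> U" "b n \<in> U" for n using a[of n] b[of n] dU[of n] by auto
  define v where "v n = norm (a n - b n)" for n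
  have v: "0 < v n" for n
  proof (rule ccontr)
    assume "\<not> 0 < v n"
    then have "a n = b n" by (simp add: v_def)
    then show False using big[of n] by (simp add: R_def dKv_def)
  qed
  define r where "r n x y = \<phi> x * \<phi> y * (\<bar>R (a n) (b n) x y\<bar> / v n)" for n x y
  have Rb: "\<bar>R (a n) (b n) x y\<bar> \<le> (2 * real CARD('p) * v n) * (\<phi> x * \<phi> y)" if "x > 0" "y > 0" for n x y
    using K_lipschitz[OF dU a b that, of n] dKv_abs[OF l0 that, of "a n - b n"] unfolding R_def v_def by linarith
  have Rm: "(\<lambda>(x, y). R (a n) (b n) x y) \<in> borel_measurable (pos_borel \<Otimes>\<^sub>M pos_borel)" for n
    using borel_measurable_diff[OF K_diff_measurable[OF aU] dKv_measurable[OF l0, of "a n - b n"]]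
    by (simp add: split_def R_def)
  have rb: "kernel_bound (r n) (2 * real CARD('p)) (pw 2) (pw 2)" for n
    unfolding kernel_bound_def
  proof (intro conjI allI impI)
    have pm: "(\<lambda>z. \<phi> (fst z)) \<in> borel_measurable (pos_borel \<Otimes>\<^sub>M pos_borel)"
      "(\<lambda>z. \<phi> (snd z)) \<in> borel_measurable (pos_borel \<Otimes>\<^sub>M pos_borel)"
      by (rule measurable_compose[OF measurable_fst phi_measurable], rule measurable_compose[OF measurable_snd phi_measurable])
    have "(\<lambda>z. \<bar>R (a n) (b n) (fst z) (snd z)\<bar> / v n) \<in> borel_measurable (pos_borel \<Otimes>\<^sub>M pos_borel)"
      using Rm[of n] by (intro borel_measurable_divide borel_measurable_abs) (auto simp: split_def)
    from borel_measurable_times[OF borel_measurable_times[OF pm] this]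
    show "(\<lambda>(x, y). r n x y) \<in> borel_measurable (pos_borel \<Otimes>\<^sub>M pos_borel)"
      by (simp add: r_def split_def)
    fix x y :: real assume xy: "x > 0" "y > 0"
    have pp: "0 \<le> \<phi> x * \<phi> y" by (rule pp_nonneg[OF xy])
    have "\<bar>R (a n) (b n) x y\<bar> / v n \<le> (2 * real CARD('p)) * (\<phi> x * \<phi> y)"
      using Rb[OF xy, of n] v[of n] by (simp add: divide_le_eq ac_simps)
    then have "\<phi> x * \<phi> y * (\<bar>R (a n) (b n) x y\<bar> / v n) \<le> \<phi> x * \<phi> y * ((2 * real CARD('p)) * (\<phi> x * \<phi> y))"
      by (rule mult_left_mono) (rule pp)
    moreover have "0 \<le> r n x y" unfolding r_def by (rule mult_nonneg_nonneg[OF pp_nonneg[OF xy] divide_nonneg_pos[OF abs_ge_zero v]])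
    ultimately show "\<bar>r n x y\<bar> \<le> 2 * real CARD('p) * (pw 2 x * pw 2 y)"
      by (simp add: r_def pw_def power2_eq_square ac_simps)
  qed
  have rbig: "\<epsilon> < bilin (r n) (m l0 (t n)) (m l0 (t n))" for n
  proof -
    have "bilin (\<lambda>x y. \<phi> x * \<phi> y * \<bar>R (a n) (b n) x y\<bar>) (m l0 (t n)) (m l0 (t n)) = bilin (\<lambda>x y. v n * r n x y) (m l0 (t n)) (m l0 (t n))"
      using v[of n] by (intro bilin_cong) (simp add: r_def)
    then have "\<epsilon> * v n < v n * bilin (r n) (m l0 (t n)) (m l0 (t n))"
      using big[of n] by (simp add: bilin_scale v_def)
    then show ?thesis using v[of n] by (simp add: mult.commute)
  qed
  obtain ts \<sigma> where ts: "ts \<in> {0..T}" and \<sigma>: "strict_mono (\<sigma> :: nat \<Rightarrow> nat)" and lim: "(t \<circ> \<sigma>) \<longlonglongrightarrow> ts"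
    using t compact_Icc[of 0 T, THEN compact_imp_seq_compact] unfolding seq_compact_def by blast
  have ptw: "(\<lambda>n. r (\<sigma> n) x y) \<longlonglongrightarrow> 0" if xy: "x > 0" "y > 0" for x y
  proof -
    have "(\<lambda>n. r n x y) \<longlonglongrightarrow> 0"
    proof (rule LIMSEQ_I)
      fix e :: real assume e: "0 < e"
      have pp: "1 \<le> \<phi> x * \<phi> y" using mult_mono[OF phi_ge1[OF xy(1)] phi_ge1[OF xy(2)]] phi_ge1[OF xy(1)] by simp
      define e' where "e' = e / (2 * (\<phi> x * \<phi> y))"
      have e': "0 < e'" using e pp by (simp add: e'_def)
      have "\<forall>e>0. \<exists>\<delta>>0. \<forall>l\<in>U. dist l l0 < \<delta> \<longrightarrow> dist (dK l x y) (dK l0 x y) < e"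
        using dK_cont[OF xy] l0 unfolding continuous_on_iff by blast
      then obtain \<delta> where \<delta>: "\<delta> > 0" "\<And>l. l \<in> U \<Longrightarrow> dist l l0 < \<delta> \<Longrightarrow> dist (dK l x y) (dK l0 x y) < e'"
        using e' by blast
      obtain N where N: "d0 / \<delta> < real N" using reals_Archimedean2 by blast
      have "norm (r n x y - 0) < e" if n: "n \<ge> N" for n
      proof -
        have "d0 < \<delta> * real (Suc n)" using N n \<delta>(1) by (simp add: divide_less_eq mult.commute)
            (smt (verit, ccfv_SIG) mult_left_mono of_nat_mono)
        then have dd: "d n < \<delta>" by (simp add: d_def divide_less_eq)
        have "\<bar>K (a n) x y - K (b n) x y - inner (a n - b n) (dK l0 x y)\<bar> \<le> e' * norm (a n - b n)"
        proof (rule K_mean_value[OF dU a b xy])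
          fix l w :: "real^'p" assume l: "l \<in> ball l0 (d n)"
          have "dist (dK l x y) (dK l0 x y) < e'" using l dd dU[of n] by (intro \<delta>(2)) (auto simp: dist_commute)
          then have "norm w * norm (dK l x y - dK l0 x y) \<le> norm w * e'" by (intro mult_left_mono) (auto simp: dist_norm)
          then show "\<bar>inner w (dK l x y - dK l0 x y)\<bar> \<le> e' * norm w"
            using Cauchy_Schwarz_ineq2[of w "dK l x y - dK l0 x y"] by (simp add: mult.commute)
        qed
        then have "\<bar>R (a n) (b n) x y\<bar> / v n \<le> e'" using v[of n] by (simp add: R_def dKv_def v_def divide_le_eq)
        then have "\<phi> x * \<phi> y * (\<bar>R (a n) (b n) x y\<bar> / v n) \<le> \<phi> x * \<phi> y * e'" using pp by (intro mult_left_mono) auto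
        also have "\<dots> = e / 2"
        proof -
          have "\<phi> x * \<phi> y \<noteq> 0" using pp by linarith
          then show ?thesis by (simp add: e'_def)
        qed
        also have "\<dots> < e" using e by simp
        finally have "r n x y < e" by (simp add: r_def)
        moreover have "0 \<le> r n x y" unfolding r_def by (rule mult_nonneg_nonneg[OF pp_nonneg[OF xy] divide_nonneg_pos[OF abs_ge_zero v]])
        ultimately show ?thesis by simp
      qed
      then show "\<exists>no. \<forall>n\<ge>no. norm (r n x y - 0) < e" by blast
    qed
    from LIMSEQ_subseq_LIMSEQ[OF this \<sigma>] show ?thesis by (simp add: o_def)
  qed
  note mts = m_M1_le[OF l0 ts, of 2, simplified]
  note fs = M1_finite_signed_measure[OF mts weight_pw]
  have wi: "integrable (total_var (m l0 ts)) (pw 2)" by (rule M1_integrable(1)[OF mts weight_pw])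
  have inner_lim: "(\<lambda>n. signed_integral (m l0 ts) (\<lambda>x. r (\<sigma> n) x y)) \<longlonglongrightarrow> 0" if y: "y > 0" for y
  proof -
    have "(\<lambda>n. signed_integral (m l0 ts) (\<lambda>x. r (\<sigma> n) x y)) \<longlonglongrightarrow> signed_integral (m l0 ts) (\<lambda>x. 0)"
    proof (rule signed_integral_tendsto[OF fs])
      show "integrable (total_var (m l0 ts)) (\<lambda>x. (2 * real CARD('p) * pw 2 y) * pw 2 x)" using wi by simp
    qed (use kernel_bound_section[OF rb y] ptw[OF _ y] in auto)
    then show ?thesis by simp
  qed
  have "(\<lambda>n. bilin (r (\<sigma> n)) (m l0 ts) (m l0 ts)) \<longlonglongrightarrow> signed_integral (m l0 ts) (\<lambda>x. 0)"
    unfolding bilin_def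
  proof (rule signed_integral_tendsto[OF fs])
    show "integrable (total_var (m l0 ts)) (\<lambda>y. (2 * real CARD('p) * norm1 (pw 2) (m l0 ts)) * pw 2 y)" using wi by simp
  qed (use bilin_inner_measurable[OF mts weight_pw rb] bilin_inner_bound[OF mts weight_pw rb] inner_lim in auto)
  then have L1: "(\<lambda>n. bilin (r (\<sigma> n)) (m l0 ts) (m l0 ts)) \<longlonglongrightarrow> 0" by simp
  have L2: "(\<lambda>n. bilin (r (\<sigma> n)) (m l0 (t (\<sigma> n))) (m l0 (t (\<sigma> n))) - bilin (r (\<sigma> n)) (m l0 ts) (m l0 ts)) \<longlonglongrightarrow> 0"
  proof (rule Lim_null_comparison)
    have "(\<lambda>n. (2 * real CARD('p)) * (2 * M) * (3 * M ^ 2 * \<bar>t (\<sigma> n) - ts\<bar>)) \<longlonglongrightarrow> (2 * real CARD('p)) * (2 * M) * (3 * M ^ 2 * \<bar>ts - ts\<bar>)"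
      using lim unfolding o_def by (intro tendsto_intros)
    then show "(\<lambda>n. (2 * real CARD('p)) * (2 * M) * (3 * M ^ 2 * \<bar>t (\<sigma> n) - ts\<bar>)) \<longlonglongrightarrow> 0" by simp
    show "\<forall>\<^sub>F n in sequentially. norm (bilin (r (\<sigma> n)) (m l0 (t (\<sigma> n))) (m l0 (t (\<sigma> n))) - bilin (r (\<sigma> n)) (m l0 ts) (m l0 ts)) \<le>
       (2 * real CARD('p)) * (2 * M) * (3 * M ^ 2 * \<bar>t (\<sigma> n) - ts\<bar>)"
    proof (intro always_eventually allI)
      fix n
      note tn = t[of "\<sigma> n"]
      note mtn = m_M1_le[OF l0 tn, of 2, simplified]
      let ?N = "norm1 (pw 2) (\<lambda>A. m l0 (t (\<sigma> n)) A - m l0 ts A)"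
      have "\<bar>bilin (r (\<sigma> n)) (m l0 (t (\<sigma> n))) (m l0 (t (\<sigma> n))) - bilin (r (\<sigma> n)) (m l0 ts) (m l0 ts)\<bar> \<le>
        (2 * real CARD('p)) * (?N * norm1 (pw 2) (m l0 (t (\<sigma> n))) + norm1 (pw 2) (m l0 ts) * ?N)"
        by (rule bilin_diff_bound[OF mtn mts weight_pw mtn mts weight_pw rb]) simp
      also have "\<dots> \<le> (2 * real CARD('p)) * (?N * M + M * ?N)"
        using m_bound_le[OF l0 tn, of 2] m_bound_le[OF l0 ts, of 2] by (intro mult_left_mono add_mono mult_right_mono) auto
      also have "\<dots> = (2 * real CARD('p)) * (2 * M) * ?N" by (simp add: algebra_simps)
      also have "\<dots> \<le> (2 * real CARD('p)) * (2 * M) * (3 * M ^ 2 * \<bar>t (\<sigma> n) - ts\<bar>)"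
        using time_lipschitz[OF l0 ts tn] M0 by (intro mult_left_mono) auto
      finally show "norm (bilin (r (\<sigma> n)) (m l0 (t (\<sigma> n))) (m l0 (t (\<sigma> n))) - bilin (r (\<sigma> n)) (m l0 ts) (m l0 ts)) \<le>
         (2 * real CARD('p)) * (2 * M) * (3 * M ^ 2 * \<bar>t (\<sigma> n) - ts\<bar>)" by simp
    qed
  qed
  have "(\<lambda>n. bilin (r (\<sigma> n)) (m l0 (t (\<sigma> n))) (m l0 (t (\<sigma> n)))) \<longlonglongrightarrow> 0"
    using tendsto_add[OF L2 L1] by simp
  then have "\<epsilon> \<le> 0" by (rule LIMSEQ_le_const) (use rbig less_imp_le in auto)
  then show False using \<epsilon> by simp
qed

section \<open>Approximate solutions of the linearised equation\<close>

text \<open>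
  The inhomogeneity of the linearised equation, due to the variation of the kernel in the direction
  \<open>v\<close>.
\<close>

definition source :: "real^'p \<Rightarrow> real^'p \<Rightarrow> (real \<Rightarrow> real) \<Rightarrow> real \<Rightarrow> real" where
  "source l v f u = 1 / 2 * coag_form f (dKv l v) (m l u) (m l u)"

text \<open>
  Like \<open>evolves\<close> with weight \<open>\<phi>\<close>, but with the source included and with
  zero initial value, as \<open>\<mu>\<^sub>0\<close> does not vary with the parameter. Carrying the
  error \<open>\<eta>\<close> along lets difference quotients and exact solutions
  (\<open>\<eta> = 0\<close>) be treated alike.
\<close>

definition linearised_up_to :: "real^'p \<Rightarrow> real^'p \<Rightarrow> real \<Rightarrow> (real \<Rightarrow> real set \<Rightarrow> real) \<Rightarrow> bool" where
  "linearised_up_to l v \<eta> \<rho> \<longleftrightarrow> (\<forall>A. \<rho> 0 A = 0) \<and> (\<forall>t\<in>{0..T}. \<rho> t \<in> M1 \<phi>) \<and>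
     (\<exists>X. set_integrable lborel {0..T} X \<and> (\<forall>t\<in>{0..T}. norm1 \<phi> (\<rho> t) \<le> X t)) \<and>
     (\<forall>f. bdd_measurable f \<longrightarrow> (\<exists>g. set_integrable lborel {0..T} g \<and>
        (\<forall>s t. 0 \<le> s \<and> s \<le> t \<and> t \<le> T \<longrightarrow>
          signed_integral (\<rho> t) f - signed_integral (\<rho> s) f = (LINT u:{s..t}|lborel. g u)) \<and>
        (\<forall>u\<in>{0..T}. \<forall>c\<ge>0. (\<forall>x>0. \<bar>f x\<bar> \<le> c * \<phi> x) \<longrightarrow>
          \<bar>g u - coag_form f (K l) (m l u) (\<rho> u) - source l v f u\<bar> \<le> c * \<eta>)))"

lemma linearised_up_toE:
  assumes "linearised_up_to l v \<eta> \<rho>" "bdd_measurable f"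
  obtains g where "set_integrable lborel {0..T} g"
    "\<And>s t. 0 \<le> s \<Longrightarrow> s \<le> t \<Longrightarrow> t \<le> T \<Longrightarrow>
          signed_integral (\<rho> t) f - signed_integral (\<rho> s) f = (LINT u:{s..t}|lborel. g u)"
    "\<And>u c. u \<in> {0..T} \<Longrightarrow> 0 \<le> c \<Longrightarrow> (\<forall>x>0. \<bar>f x\<bar> \<le> c * \<phi> x) \<Longrightarrow>
          \<bar>g u - coag_form f (K l) (m l u) (\<rho> u) - source l v f u\<bar> \<le> c * \<eta>"
proof -
  have "\<forall>f. bdd_measurable f \<longrightarrow> (\<exists>g. set_integrable lborel {0..T} g \<and>
        (\<forall>s t. 0 \<le> s \<and> s \<le> t \<and> t \<le> T \<longrightarrow>
          signed_integral (\<rho> t) f - signed_integral (\<rho> s) f = (LINT u:{s..t}|lborel. g u)) \<and>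
        (\<forall>u\<in>{0..T}. \<forall>c\<ge>0. (\<forall>x>0. \<bar>f x\<bar> \<le> c * \<phi> x) \<longrightarrow>
          \<bar>g u - coag_form f (K l) (m l u) (\<rho> u) - source l v f u\<bar> \<le> c * \<eta>))"
    using assms(1)[unfolded linearised_up_to_def] by (elim conjE)
  from this[THEN spec, THEN mp, OF assms(2)] obtain g where g: "set_integrable lborel {0..T} g \<and>
        (\<forall>s t. 0 \<le> s \<and> s \<le> t \<and> t \<le> T \<longrightarrow>
          signed_integral (\<rho> t) f - signed_integral (\<rho> s) f = (LINT u:{s..t}|lborel. g u)) \<and>
        (\<forall>u\<in>{0..T}. \<forall>c\<ge>0. (\<forall>x>0. \<bar>f x\<bar> \<le> c * \<phi> x) \<longrightarrow>
          \<bar>g u - coag_form f (K l) (m l u) (\<rho> u) - source l v f u\<bar> \<le> c * \<eta>)"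
    by (rule exE)
  show thesis
    by (rule that[of g]) (use g in \<open>simp_all only:\<close>)
qed

lemma linearised_up_toD:
  assumes "linearised_up_to l v \<eta> \<rho>"
  shows linearised_init: "\<rho> 0 A = 0" and linearised_M1: "t \<in> {0..T} \<Longrightarrow> \<rho> t \<in> M1 \<phi>"
    and linearised_dom: "\<exists>X. set_integrable lborel {0..T} X \<and> (\<forall>t\<in>{0..T}. norm1 \<phi> (\<rho> t) \<le> X t)"
  using assms unfolding linearised_up_to_def by blast+

lemma source_lincomb:
  assumes l: "l \<in> U" and u: "u \<in> {0..T}" and f: "bdd_measurable f"
  shows "source l (a *\<^sub>R v + b *\<^sub>R w) f u = a * source l v f u + b * source l w f u"
proof -
  obtain c1 where c1: "0 \<le> c1" "kernel_bound (\<lambda>x y. brace f x y * dKv l v x y) c1 \<phi> \<phi>"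
    using kernel_bound_dKv[OF l f] by blast
  obtain c2 where c2: "0 \<le> c2" "kernel_bound (\<lambda>x y. brace f x y * dKv l w x y) c2 \<phi> \<phi>"
    using kernel_bound_dKv[OF l f] by blast
  note mu = m_phi(1)[OF l u]
  have "bilin (\<lambda>x y. brace f x y * dKv l (a *\<^sub>R v + b *\<^sub>R w) x y) (m l u) (m l u) =
    bilin (\<lambda>x y. a * (brace f x y * dKv l v x y) + b * (brace f x y * dKv l w x y)) (m l u) (m l u)"
    by (intro bilin_cong) (simp add: dKv_def inner_add_left algebra_simps)
  then show ?thesis
    unfolding source_def using bilin_kernel_lincomb[OF mu phi_weight mu phi_weight c1(2) c2(2)] by (simp add: algebra_simps)
qed

lemma linearised_lincomb:
  assumes l: "l \<in> U" and 1: "linearised_up_to l v1 \<eta>1 \<rho>1" and 2: "linearised_up_to l v2 \<eta>2 \<rho>2"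
  shows "linearised_up_to l (a *\<^sub>R v1 + b *\<^sub>R v2) (\<bar>a\<bar> * \<eta>1 + \<bar>b\<bar> * \<eta>2) (\<lambda>t A. a * \<rho>1 t A + b * \<rho>2 t A)"
  unfolding linearised_up_to_def
proof (intro conjI allI impI ballI)
  show "a * \<rho>1 0 A + b * \<rho>2 0 A = 0" for A using linearised_init[OF 1] linearised_init[OF 2] by simp
  note M = linearised_M1[OF 1] linearised_M1[OF 2]
  show "(\<lambda>A. a * \<rho>1 t A + b * \<rho>2 t A) \<in> M1 \<phi>" if "t \<in> {0..T}" for t
    by (rule M1_lincomb(1)[OF M(1)[OF that] M(2)[OF that] phi_weight])
  obtain X1 where X1: "set_integrable lborel {0..T} X1" "\<And>t. t \<in> {0..T} \<Longrightarrow> norm1 \<phi> (\<rho>1 t) \<le> X1 t"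
    using linearised_dom[OF 1] by blast
  obtain X2 where X2: "set_integrable lborel {0..T} X2" "\<And>t. t \<in> {0..T} \<Longrightarrow> norm1 \<phi> (\<rho>2 t) \<le> X2 t"
    using linearised_dom[OF 2] by blast
  show "\<exists>X. set_integrable lborel {0..T} X \<and> (\<forall>t\<in>{0..T}. norm1 \<phi> (\<lambda>A. a * \<rho>1 t A + b * \<rho>2 t A) \<le> X t)"
  proof (intro exI[of _ "\<lambda>t. \<bar>a\<bar> * X1 t + \<bar>b\<bar> * X2 t"] conjI ballI)
    show "set_integrable lborel {0..T} (\<lambda>t. \<bar>a\<bar> * X1 t + \<bar>b\<bar> * X2 t)"
      using X1(1) X2(1) by (intro set_integral_add(1)) auto
    fix t assume t: "t \<in> {0..T}"
    have "norm1 \<phi> (\<lambda>A. a * \<rho>1 t A + b * \<rho>2 t A) \<le> \<bar>a\<bar> * norm1 \<phi> (\<rho>1 t) + \<bar>b\<bar> * norm1 \<phi> (\<rho>2 t)"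
      by (rule M1_lincomb(2)[OF M(1)[OF t] M(2)[OF t] phi_weight])
    also have "\<dots> \<le> \<bar>a\<bar> * X1 t + \<bar>b\<bar> * X2 t"
      using X1(2)[OF t] X2(2)[OF t] by (intro add_mono mult_left_mono) auto
    finally show "norm1 \<phi> (\<lambda>A. a * \<rho>1 t A + b * \<rho>2 t A) \<le> \<bar>a\<bar> * X1 t + \<bar>b\<bar> * X2 t" .
  qed
  fix f assume f: "bdd_measurable f"
  obtain g1 where g1: "set_integrable lborel {0..T} g1"
    "\<And>s t. 0 \<le> s \<Longrightarrow> s \<le> t \<Longrightarrow> t \<le> T \<Longrightarrow>
          signed_integral (\<rho>1 t) f - signed_integral (\<rho>1 s) f = (LINT u:{s..t}|lborel. g1 u)"
    "\<And>u c. u \<in> {0..T} \<Longrightarrow> 0 \<le> c \<Longrightarrow> (\<forall>x>0. \<bar>f x\<bar> \<le> c * \<phi> x) \<Longrightarrow>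
          \<bar>g1 u - coag_form f (K l) (m l u) (\<rho>1 u) - source l v1 f u\<bar> \<le> c * \<eta>1"
    by (rule linearised_up_toE[OF 1 f]) (rule that)
  obtain g2 where g2: "set_integrable lborel {0..T} g2"
    "\<And>s t. 0 \<le> s \<Longrightarrow> s \<le> t \<Longrightarrow> t \<le> T \<Longrightarrow>
          signed_integral (\<rho>2 t) f - signed_integral (\<rho>2 s) f = (LINT u:{s..t}|lborel. g2 u)"
    "\<And>u c. u \<in> {0..T} \<Longrightarrow> 0 \<le> c \<Longrightarrow> (\<forall>x>0. \<bar>f x\<bar> \<le> c * \<phi> x) \<Longrightarrow>
          \<bar>g2 u - coag_form f (K l) (m l u) (\<rho>2 u) - source l v2 f u\<bar> \<le> c * \<eta>2"
    by (rule linearised_up_toE[OF 2 f]) (rule that)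
  have ag: "set_integrable lborel {0..T} (\<lambda>u. a * g1 u)" "set_integrable lborel {0..T} (\<lambda>u. b * g2 u)"
    using g1(1) g2(1) by auto
  obtain c0 where c0: "0 \<le> c0" "kernel_bound (\<lambda>x y. brace f x y * K l x y) c0 \<phi> \<phi>"
    using kernel_bound_K[OF l f] by blast
  show "\<exists>g. set_integrable lborel {0..T} g \<and>
        (\<forall>s t. 0 \<le> s \<and> s \<le> t \<and> t \<le> T \<longrightarrow>
          signed_integral (\<lambda>A. a * \<rho>1 t A + b * \<rho>2 t A) f - signed_integral (\<lambda>A. a * \<rho>1 s A + b * \<rho>2 s A) f = (LINT u:{s..t}|lborel. g u)) \<and>
        (\<forall>u\<in>{0..T}. \<forall>c\<ge>0. (\<forall>x>0. \<bar>f x\<bar> \<le> c * \<phi> x) \<longrightarrow>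
          \<bar>g u - coag_form f (K l) (m l u) (\<lambda>A. a * \<rho>1 u A + b * \<rho>2 u A) - source l (a *\<^sub>R v1 + b *\<^sub>R v2) f u\<bar> \<le> c * (\<bar>a\<bar> * \<eta>1 + \<bar>b\<bar> * \<eta>2))"
  proof (intro exI[of _ "\<lambda>u. a * g1 u + b * g2 u"] conjI allI impI ballI)
    show "set_integrable lborel {0..T} (\<lambda>u. a * g1 u + b * g2 u)" by (rule set_integral_add(1)[OF ag])
    show "signed_integral (\<lambda>A. a * \<rho>1 t A + b * \<rho>2 t A) f - signed_integral (\<lambda>A. a * \<rho>1 s A + b * \<rho>2 s A) f =
        (LINT u:{s..t}|lborel. a * g1 u + b * g2 u)" if st: "0 \<le> s \<and> s \<le> t \<and> t \<le> T" for s t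
    proof -
      have e: "signed_integral (\<lambda>A. a * \<rho>1 r A + b * \<rho>2 r A) f = a * signed_integral (\<rho>1 r) f + b * signed_integral (\<rho>2 r) f"
        if "r \<in> {0..T}" for r
        by (rule signed_integral_lincomb_bdd[OF M1_finite_signed_measure[OF M(1)[OF that] phi_weight]
              M1_finite_signed_measure[OF M(2)[OF that] phi_weight] f])
      have "(LINT u:{s..t}|lborel. a * g1 u + b * g2 u) = (LINT u:{s..t}|lborel. a * g1 u) + (LINT u:{s..t}|lborel. b * g2 u)"
        using st by (intro set_integral_add(2) set_integrable_Icc_subset[OF ag(1)] set_integrable_Icc_subset[OF ag(2)]) auto
      also have "\<dots> = a * (LINT u:{s..t}|lborel. g1 u) + b * (LINT u:{s..t}|lborel. g2 u)" by simp
      also have "\<dots> = a * (signed_integral (\<rho>1 t) f - signed_integral (\<rho>1 s) f) + b * (signed_integral (\<rho>2 t) f - signed_integral (\<rho>2 s) f)"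
        using st by (simp add: g1(2) g2(2))
      finally show ?thesis using st by (simp add: e algebra_simps)
    qed
    fix u c assume u: "u \<in> {0..T}" and c: "0 \<le> c" "\<forall>x>0. \<bar>f x\<bar> \<le> c * \<phi> x"
    let ?e1 = "g1 u - coag_form f (K l) (m l u) (\<rho>1 u) - source l v1 f u"
    let ?e2 = "g2 u - coag_form f (K l) (m l u) (\<rho>2 u) - source l v2 f u"
    have e: "a * g1 u + b * g2 u - coag_form f (K l) (m l u) (\<lambda>A. a * \<rho>1 u A + b * \<rho>2 u A) - source l (a *\<^sub>R v1 + b *\<^sub>R v2) f u
       = a * ?e1 + b * ?e2"
      unfolding source_lincomb[OF l u f] bilin_lincomb_right[OF m_phi(1)[OF l u] phi_weight M(1)[OF u] M(2)[OF u] phi_weight c0(2)]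
      by (simp add: algebra_simps)
    have "\<bar>a * ?e1 + b * ?e2\<bar> \<le> \<bar>a * ?e1\<bar> + \<bar>b * ?e2\<bar>" by (rule abs_triangle_ineq)
    also have "\<dots> = \<bar>a\<bar> * \<bar>?e1\<bar> + \<bar>b\<bar> * \<bar>?e2\<bar>" by (simp only: abs_mult)
    also have "\<dots> \<le> \<bar>a\<bar> * (c * \<eta>1) + \<bar>b\<bar> * (c * \<eta>2)"
      using g1(3)[OF u c] g2(3)[OF u c] by (intro add_mono mult_left_mono) auto
    finally show "\<bar>a * g1 u + b * g2 u - coag_form f (K l) (m l u) (\<lambda>A. a * \<rho>1 u A + b * \<rho>2 u A) - source l (a *\<^sub>R v1 + b *\<^sub>R v2) f u\<bar>
        \<le> c * (\<bar>a\<bar> * \<eta>1 + \<bar>b\<bar> * \<eta>2)" unfolding e by (simp only: distrib_left mult.left_commute)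
  qed
qed

definition stability_const :: real where
  "stability_const = 2 * T * exp (2 * (4 * M) * T)"

lemma stability_const_nonneg: "0 \<le> stability_const"
  using T0 by (simp add: stability_const_def)

text \<open>
  In direction 0 the source vanishes and the basic estimate applies. All later comparisons subtract
  two approximate solutions with the same direction and end here.
\<close>

lemma linearised_zero_bound:
  assumes l: "l \<in> U" and \<rho>: "linearised_up_to l 0 \<eta> \<rho>" and \<eta>: "0 \<le> \<eta>" and t: "t \<in> {0..T}"
  shows "norm1 \<phi> (\<rho> t) \<le> stability_const * \<eta>"
proof -
  obtain X where X: "set_integrable lborel {0..T} X" "\<And>t. t \<in> {0..T} \<Longrightarrow> norm1 \<phi> (\<rho> t) \<le> X t"
    using linearised_dom[OF \<rho>] by blast
  have s0: "source l 0 f u = 0" for f u by (simp add: source_def dKv_def)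
  have ev: "evolves \<phi> (K l) T \<eta> (m l) \<rho>"
    using \<rho> unfolding evolves_def linearised_up_to_def s0 diff_zero by blast
  have "norm1 \<phi> (\<rho> t) \<le> 2 * (\<eta> * T) * exp (2 * (4 * M) * T)"
    by (rule norm1_estimate[OF admissible_phi \<eta> M0 K_measurable[OF l] K_bounds[OF l] m_M1[OF l] m_nonneg[OF l] m_bound[OF l]
          linearised_M1[OF \<rho>] linearised_init[OF \<rho>] X ev t])
  then show ?thesis by (simp add: stability_const_def ac_simps)
qed

lemma linearised_unique:
  assumes l: "l \<in> U" and 1: "linearised_up_to l v 0 \<rho>1" and 2: "linearised_up_to l v 0 \<rho>2" and t: "t \<in> {0..T}"
  shows "\<rho>1 t = \<rho>2 t"
proof
  fix A
  have d: "linearised_up_to l 0 0 (\<lambda>t A. \<rho>1 t A - \<rho>2 t A)"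
    using linearised_lincomb[OF l 1 2, of 1 "-1"] by simp
  have "\<bar>\<rho>1 t A - \<rho>2 t A\<bar> \<le> norm1 \<phi> (\<lambda>A. \<rho>1 t A - \<rho>2 t A)"
    by (rule abs_le_norm1[OF linearised_M1[OF d t] phi_weight])
  also have "\<dots> \<le> stability_const * 0" by (rule linearised_zero_bound[OF l d _ t]) simp
  finally show "\<rho>1 t A = \<rho>2 t A" by simp
qed

lemma kernel_bound_K_diff:
  assumes "l1 \<in> U" "l2 \<in> U" "bdd_measurable f"
  obtains c where "0 \<le> c" "kernel_bound (\<lambda>x y. brace f x y * (K l1 x y - K l2 x y)) c \<phi> \<phi>"
proof -
  obtain B where B: "\<And>x. x > 0 \<Longrightarrow> \<bar>f x\<bar> \<le> B" using assms(3) by (auto simp: bdd_measurable_def)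
  have "0 \<le> 3 * B * 1" using B[of 1] by simp
  moreover have "kernel_bound (\<lambda>x y. brace f x y * (K l1 x y - K l2 x y)) (3 * B * 1) \<phi> \<phi>"
  proof (rule kernel_bound_bdd[OF K_diff_measurable[OF assms(1,2)] _ _ _ B])
    show "\<bar>K l1 x y - K l2 x y\<bar> \<le> 1 * (\<phi> x * \<phi> y)" if "x > 0" "y > 0" for x y
      using K_bounds[OF assms(1) that] K_bounds[OF assms(2) that] by auto
  qed (use assms(3) in \<open>auto simp: bdd_measurable_def\<close>)
  ultimately show ?thesis by (rule that)
qed

lemma lambda_const_nonneg: "0 \<le> lambda_const"
  using T0 by (simp add: lambda_const_def)

text \<open>
  The error splits as \<open>e1 + (e2 + e3 + e4) / 2\<close>: in \<open>e1\<close> the average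
  of the two solutions is replaced by the solution at \<open>l0\<close> as driver, in
  \<open>e2\<close> the kernel \<open>K l2\<close> is replaced by \<open>K l0\<close> in the
  difference of the quadratic terms, in \<open>e3\<close> the solution at \<open>l1\<close> is
  replaced by that at \<open>l0\<close> as measure in the term with \<open>K l1 - K l2\<close>,
  and \<open>e4\<close> is the remainder of the kernel. The first three are products of two quantities
  that are Lipschitz in the parameter, one of order \<open>d\<close> and one of order
  \<open>|l1 - l2|\<close>; the Lipschitz bound in the weight \<open>\<phi>\<^sup>2\<close> is
  needed because test functions grow like \<open>\<phi>\<close>.
\<close>

lemma difference_linearised:
  assumes l0: "l0 \<in> U" and \<epsilon>: "0 < \<epsilon>"
  shows "\<exists>d>0. ball l0 d \<subseteq> U \<and> (\<forall>l1\<in>ball l0 d. \<forall>l2\<in>ball l0 d.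
    linearised_up_to l0 (l1 - l2) (\<epsilon> * norm (l1 - l2)) (\<lambda>t A. m l1 t A - m l2 t A))"
proof -
  let ?P = "real CARD('p)" and ?L = lambda_const
  have "0 < \<epsilon> / 4" using \<epsilon> by simp
  from remainder_small[OF l0 this] obtain d1 where D1: "d1 > 0 \<and> ball l0 d1 \<subseteq> U \<and>
    (\<forall>l1\<in>ball l0 d1. \<forall>l2\<in>ball l0 d1. \<forall>t\<in>{0..T}.
      bilin (\<lambda>x y. \<phi> x * \<phi> y * \<bar>K l1 x y - K l2 x y - dKv l0 (l1 - l2) x y\<bar>) (m l0 t) (m l0 t) \<le> \<epsilon> / 4 * norm (l1 - l2))"
    by (rule exE)
  note d1 = conjunct1[OF D1] conjunct1[OF conjunct2[OF D1]]
    and rem = conjunct2[OF conjunct2[OF D1], THEN bspec, THEN bspec, THEN bspec]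
  \<comment> \<open>\<open>C - 1\<close> collects the constants of \<open>e1\<close>, \<open>e2\<close>,
      \<open>e3\<close>; the summand 1 permits division by \<open>C\<close>.\<close>
  define C where "C = 4 * ?L * ?L + 8 * ?P * M * ?L + 1"
  have C: "1 \<le> C" using lambda_const_nonneg M0 by (simp add: C_def)
  define d where "d = min d1 (\<epsilon> / (2 * C))"
  have d: "0 < d" "d \<le> d1" "d * C \<le> \<epsilon> / 2"
  proof -
    show "0 < d" "d \<le> d1" using d1 \<epsilon> C by (auto simp: d_def)
    have "d * C \<le> \<epsilon> / (2 * C) * C" using C by (intro mult_right_mono) (auto simp: d_def)
    also have "\<dots> = \<epsilon> / 2" using C by simp
    finally show "d * C \<le> \<epsilon> / 2" .
  qed
  have dU: "ball l0 d \<subseteq> U" using d1(2) subset_ball[OF d(2)] by blast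
  have c0: "l0 \<in> ball l0 d" using d(1) by simp
  have "linearised_up_to l0 (l1 - l2) (\<epsilon> * norm (l1 - l2)) (\<lambda>t A. m l1 t A - m l2 t A)"
    if l1: "l1 \<in> ball l0 d" and l2: "l2 \<in> ball l0 d" for l1 l2
    unfolding linearised_up_to_def
  proof (intro conjI allI impI ballI)
    have lU: "l1 \<in> U" "l2 \<in> U" using l1 l2 dU by auto
    have n1: "norm (l1 - l0) \<le> d" "norm (l2 - l0) \<le> d" using l1 l2 by (auto simp: dist_norm norm_minus_commute)
    show "m l1 0 A - m l2 0 A = 0" for A using m_init[OF lU] by simp
    show "(\<lambda>A. m l1 t A - m l2 t A) \<in> M1 \<phi>" if "t \<in> {0..T}" for t by (rule m_diff(2)[OF lU that that])
    show "\<exists>X. set_integrable lborel {0..T} X \<and> (\<forall>t\<in>{0..T}. norm1 \<phi> (\<lambda>A. m l1 t A - m l2 t A) \<le> X t)"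
    proof (intro exI[of _ "\<lambda>t. 2 * M"] conjI ballI)
      show "set_integrable lborel {0..T} (\<lambda>t. 2 * M)" by (rule set_integral_Icc_const(2)[OF T0])
      show "norm1 \<phi> (\<lambda>A. m l1 t A - m l2 t A) \<le> 2 * M" if "t \<in> {0..T}" for t
        using m_diff(3,4)[OF lU that that] by (rule order_trans[rotated])
    qed
    fix f assume f: "bdd_measurable f"
    have fm: "f \<in> borel_measurable pos_borel" using f by (simp add: bdd_measurable_def)
    show "\<exists>g. set_integrable lborel {0..T} g \<and>
        (\<forall>s t. 0 \<le> s \<and> s \<le> t \<and> t \<le> T \<longrightarrow>
          signed_integral (\<lambda>A. m l1 t A - m l2 t A) f - signed_integral (\<lambda>A. m l1 s A - m l2 s A) f = (LINT u:{s..t}|lborel. g u)) \<and>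
        (\<forall>u\<in>{0..T}. \<forall>c\<ge>0. (\<forall>x>0. \<bar>f x\<bar> \<le> c * \<phi> x) \<longrightarrow>
          \<bar>g u - coag_form f (K l0) (m l0 u) (\<lambda>A. m l1 u A - m l2 u A) - source l0 (l1 - l2) f u\<bar> \<le> c * (\<epsilon> * norm (l1 - l2)))"
    proof (intro exI[of _ "\<lambda>u. rate l1 f u - rate l2 f u"] conjI allI impI ballI)
      show "set_integrable lborel {0..T} (\<lambda>u. rate l1 f u - rate l2 f u)"
        by (rule set_integral_diff(1)[OF rate_integral(1)[OF lU(1) f] rate_integral(1)[OF lU(2) f]])
      show "signed_integral (\<lambda>A. m l1 r A - m l2 r A) f - signed_integral (\<lambda>A. m l1 s A - m l2 s A) f =
          (LINT u:{s..r}|lborel. rate l1 f u - rate l2 f u)" if sr: "0 \<le> s \<and> s \<le> r \<and> r \<le> T" for s r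
      proof -
        have "s \<in> {0..T}" "r \<in> {0..T}" using sr by auto
        then have "signed_integral (\<lambda>A. m l1 r A - m l2 r A) f = signed_integral (m l1 r) f - signed_integral (m l2 r) f"
          "signed_integral (\<lambda>A. m l1 s A - m l2 s A) f = signed_integral (m l1 s) f - signed_integral (m l2 s) f"
          by (auto intro!: signed_integral_diff_bdd[OF m_phi(1)[OF lU(1)] m_phi(1)[OF lU(2)] phi_weight f])
        moreover have "(LINT u:{s..r}|lborel. rate l1 f u - rate l2 f u) =
            (LINT u:{s..r}|lborel. rate l1 f u) - (LINT u:{s..r}|lborel. rate l2 f u)"
          using sr by (intro set_integral_diff(2) set_integrable_Icc_subset[OF rate_integral(1)[OF lU(1) f]]
              set_integrable_Icc_subset[OF rate_integral(1)[OF lU(2) f]]) auto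
        ultimately show ?thesis
          using rate_integral(2)[OF lU(1) f, of s r] rate_integral(2)[OF lU(2) f, of s r] sr by simp
      qed
      fix u c assume u: "u \<in> {0..T}" and c: "0 \<le> c" "\<forall>x>0. \<bar>f x\<bar> \<le> c * \<phi> x"
      note m1 = m_phi(1)[OF lU(1) u] and m2 = m_phi(1)[OF lU(2) u] and m0 = m_phi(1)[OF l0 u]
      have q: "m l1 u \<in> M1 (pw 2)" "m l2 u \<in> M1 (pw 2)" "m l0 u \<in> M1 (pw 2)"
        using m_M1_le lU l0 u by auto
      have b: "norm1 (pw 2) (m l1 u) \<le> M" "norm1 (pw 2) (m l2 u) \<le> M" "norm1 (pw 2) (m l0 u) \<le> M"
        using m_bound_le lU l0 u by auto
      define v where "v = norm (l1 - l2)"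
      have v0: "0 \<le> v" by (simp add: v_def)
      define \<delta> where "\<delta> = (\<lambda>A. m l1 u A - m l2 u A)"
      have \<delta>: "\<delta> \<in> M1 (pw 2)" "\<delta> \<in> M1 \<phi>" "norm1 (pw 2) \<delta> \<le> ?L * v"
        unfolding \<delta>_def v_def using m_diff(1,2)[OF lU u u] lambda_lipschitz[OF dU l1 l2 u] by auto
      let ?G = "\<lambda>k. coag_form f k"
      let ?K12 = "\<lambda>x y. K l1 x y - K l2 x y" and ?K20 = "\<lambda>x y. K l2 x y - K l0 x y"
      obtain k0 where k0: "0 \<le> k0" "kernel_bound (\<lambda>x y. brace f x y * K l0 x y) k0 \<phi> \<phi>"
        using kernel_bound_K[OF l0 f] by blast
      obtain k1 where k1: "0 \<le> k1" "kernel_bound (\<lambda>x y. brace f x y * K l1 x y) k1 \<phi> \<phi>"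
        using kernel_bound_K[OF lU(1) f] by blast
      obtain k2 where k2: "0 \<le> k2" "kernel_bound (\<lambda>x y. brace f x y * K l2 x y) k2 \<phi> \<phi>"
        using kernel_bound_K[OF lU(2) f] by blast
      obtain k12 where k12: "0 \<le> k12" "kernel_bound (\<lambda>x y. brace f x y * ?K12 x y) k12 \<phi> \<phi>"
        using kernel_bound_K_diff[OF lU f] by blast
      obtain kd where kd: "0 \<le> kd" "kernel_bound (\<lambda>x y. brace f x y * dKv l0 (l1 - l2) x y) kd \<phi> \<phi>"
        using kernel_bound_dKv[OF l0 f] by blast
      define av where "av = (\<lambda>A. 1 / 2 * m l1 u A + 1 / 2 * m l2 u A)"
      have av: "av \<in> M1 (pw 2)" unfolding av_def by (rule M1_lincomb(1)[OF q(1,2) weight_pw])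
      have pol: "?G (K l0) av \<delta> = 1 / 2 * ?G (K l0) (m l1 u) (m l1 u) - 1 / 2 * ?G (K l0) (m l2 u) (m l2 u)"
        unfolding av_def \<delta>_def using K_sym[OF l0] by (intro bilin_polarization[OF m1 m2 phi_weight k0(2)]) (simp add: brace_sym)
      define R where "R x y = ?K12 x y - dKv l0 (l1 - l2) x y" for x y
      have s1: "?G ?K20 \<alpha> \<alpha> = ?G (K l2) \<alpha> \<alpha> - ?G (K l0) \<alpha> \<alpha>" if "\<alpha> \<in> M1 \<phi>" for \<alpha>
        by (rule bilin_split_kernel[OF that that k2(2) k0(2)])
      have s2: "?G ?K12 \<alpha> \<alpha> = ?G (K l1) \<alpha> \<alpha> - ?G (K l2) \<alpha> \<alpha>" if "\<alpha> \<in> M1 \<phi>" for \<alpha>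
        by (rule bilin_split_kernel[OF that that k1(2) k2(2)])
      have s3: "?G R (m l0 u) (m l0 u) = ?G ?K12 (m l0 u) (m l0 u) - ?G (dKv l0 (l1 - l2)) (m l0 u) (m l0 u)"
        unfolding R_def by (rule bilin_split_kernel[OF m0 m0 k12(2) kd(2)])
      define e1 where "e1 = ?G (K l0) av \<delta> - ?G (K l0) (m l0 u) \<delta>"
      define e2 where "e2 = ?G ?K20 (m l1 u) (m l1 u) - ?G ?K20 (m l2 u) (m l2 u)"
      define e3 where "e3 = ?G ?K12 (m l1 u) (m l1 u) - ?G ?K12 (m l0 u) (m l0 u)"
      define e4 where "e4 = ?G R (m l0 u) (m l0 u)"
      have eq: "rate l1 f u - rate l2 f u - ?G (K l0) (m l0 u) \<delta> - source l0 (l1 - l2) f u = e1 + 1 / 2 * e2 + 1 / 2 * e3 + 1 / 2 * e4"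
        unfolding e1_def e2_def e3_def e4_def pol s1[OF m1] s1[OF m2] s2[OF m1] s2[OF m0] s3 rate_def source_def
        by (simp add: algebra_simps)
      have c2: "\<And>x. x > 0 \<Longrightarrow> \<bar>f x\<bar> \<le> c * \<phi> x" using c(2) by blast
      have b0: "kernel_bound (\<lambda>x y. brace f x y * K l0 x y) (4 * c * 1) (pw 2) (pw 2)"
        by (rule kernel_bound_phi[OF K_measurable[OF l0] K_abs[OF l0] zero_le_one c(1) fm c2])
      have d20: "norm (l2 - l0) * ?P \<le> d * ?P" using n1 by (intro mult_right_mono) auto
      have b20: "kernel_bound (\<lambda>x y. brace f x y * ?K20 x y) (4 * c * (?P * d)) (pw 2) (pw 2)"
      proof (rule kernel_bound_phi[OF K_diff_measurable[OF lU(2) l0] _ _ c(1) fm c2])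
        fix x y :: real assume xy: "x > 0" "y > 0"
        have "(?P * norm (l2 - l0)) * (\<phi> x * \<phi> y) \<le> (?P * d) * (\<phi> x * \<phi> y)"
          using d20 pp_nonneg[OF xy] by (intro mult_right_mono) (auto simp: mult.commute)
        then show "\<bar>?K20 x y\<bar> \<le> (?P * d) * (\<phi> x * \<phi> y)" using K_lipschitz[OF dU l2 c0 xy] by linarith
      qed (use d in auto)
      have b12: "kernel_bound (\<lambda>x y. brace f x y * ?K12 x y) (4 * c * (?P * v)) (pw 2) (pw 2)"
        unfolding v_def by (rule kernel_bound_phi[OF K_diff_measurable[OF lU] K_lipschitz[OF dU l1 l2] _ c(1) fm c2]) simp_all
      have "\<bar>e1\<bar> \<le> (4 * c * 1) * (norm1 (pw 2) (\<lambda>A. av A - m l0 u A) * norm1 (pw 2) \<delta> + norm1 (pw 2) (m l0 u) * norm1 (pw 2) (\<lambda>A. \<delta> A - \<delta> A))"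
        unfolding e1_def by (rule bilin_diff_bound[OF av q(3) weight_pw \<delta>(1) \<delta>(1) weight_pw b0]) (use c in simp)
      also have "norm1 (pw 2) (\<lambda>A. \<delta> A - \<delta> A) = 0"
        using M1_scale(2)[OF \<delta>(1) weight_pw, of 0] norm1_nonneg[of "pw 2" "\<lambda>A. 0"] by simp
      also have "(4 * c * 1) * (norm1 (pw 2) (\<lambda>A. av A - m l0 u A) * norm1 (pw 2) \<delta> + norm1 (pw 2) (m l0 u) * 0) \<le> (4 * c) * ((?L * d) * (?L * v))"
      proof -
        have a1: "norm1 (pw 2) (\<lambda>A. m l1 u A - m l0 u A) \<le> ?L * d"
          using lambda_lipschitz[OF dU l1 c0 u] mult_left_mono[OF n1(1) lambda_const_nonneg] by linarith
        have a2: "norm1 (pw 2) (\<lambda>A. m l2 u A - m l0 u A) \<le> ?L * d"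
          using lambda_lipschitz[OF dU l2 c0 u] mult_left_mono[OF n1(2) lambda_const_nonneg] by linarith
        have "(\<lambda>A. av A - m l0 u A) = (\<lambda>A. 1 / 2 * (m l1 u A - m l0 u A) + 1 / 2 * (m l2 u A - m l0 u A))"
          by (simp add: av_def fun_eq_iff field_simps)
        then have "norm1 (pw 2) (\<lambda>A. av A - m l0 u A) \<le> 1 / 2 * norm1 (pw 2) (\<lambda>A. m l1 u A - m l0 u A) + 1 / 2 * norm1 (pw 2) (\<lambda>A. m l2 u A - m l0 u A)"
          using M1_lincomb(2)[OF m_diff(1)[OF lU(1) l0 u u] m_diff(1)[OF lU(2) l0 u u] weight_pw, of "1/2" "1/2"] by simp
        then have "norm1 (pw 2) (\<lambda>A. av A - m l0 u A) \<le> ?L * d" using a1 a2 by linarith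
        then have "norm1 (pw 2) (\<lambda>A. av A - m l0 u A) * norm1 (pw 2) \<delta> \<le> (?L * d) * (?L * v)"
          using \<delta>(3) lambda_const_nonneg d(1) by (intro mult_mono) auto
        then show ?thesis using c(1) mult_left_mono[of _ _ "4 * c"] by simp
      qed
      finally have E1: "\<bar>e1\<bar> \<le> c * v * d * (4 * ?L * ?L)" by (simp add: ac_simps)
      have D: "norm1 (pw 2) (\<lambda>A. m l1 u A - m l2 u A) \<le> ?L * v" using \<delta>(3) by (simp add: \<delta>_def)
      have two: "norm1 (pw 2) \<gamma> * norm1 (pw 2) \<alpha> + norm1 (pw 2) \<beta> * norm1 (pw 2) \<gamma> \<le> z * (2 * M)"
        if "norm1 (pw 2) \<alpha> \<le> M" "norm1 (pw 2) \<beta> \<le> M" "norm1 (pw 2) \<gamma> \<le> z" for \<alpha> \<beta> \<gamma> z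
      proof -
        have z: "0 \<le> z" using that(3) norm1_nonneg order_trans by blast
        have "norm1 (pw 2) \<gamma> * norm1 (pw 2) \<alpha> \<le> z * M" "norm1 (pw 2) \<beta> * norm1 (pw 2) \<gamma> \<le> M * z"
          using that z M0 by (auto intro!: mult_mono)
        then show ?thesis by (simp add: algebra_simps)
      qed
      have Pn: "0 \<le> 4 * c * (?P * d)" "0 \<le> 4 * c * (?P * v)" using c d v0 by auto
      have "\<bar>e2\<bar> \<le> (4 * c * (?P * d)) * (norm1 (pw 2) (\<lambda>A. m l1 u A - m l2 u A) * norm1 (pw 2) (m l1 u) + norm1 (pw 2) (m l2 u) * norm1 (pw 2) (\<lambda>A. m l1 u A - m l2 u A))"
        unfolding e2_def by (rule bilin_diff_bound[OF q(1,2) weight_pw q(1,2) weight_pw b20 Pn(1)])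
      also have "\<dots> \<le> (4 * c * (?P * d)) * ((?L * v) * (2 * M))"
        by (rule mult_left_mono[OF two[OF b(1,2) D] Pn(1)])
      finally have E2: "\<bar>e2\<bar> \<le> c * v * d * (8 * ?P * M * ?L)" by (simp add: ac_simps)
      have D0: "norm1 (pw 2) (\<lambda>A. m l1 u A - m l0 u A) \<le> ?L * d"
        using lambda_lipschitz[OF dU l1 c0 u] mult_left_mono[OF n1(1) lambda_const_nonneg] by linarith
      have "\<bar>e3\<bar> \<le> (4 * c * (?P * v)) * (norm1 (pw 2) (\<lambda>A. m l1 u A - m l0 u A) * norm1 (pw 2) (m l1 u) + norm1 (pw 2) (m l0 u) * norm1 (pw 2) (\<lambda>A. m l1 u A - m l0 u A))"
        unfolding e3_def by (rule bilin_diff_bound[OF q(1,3) weight_pw q(1,3) weight_pw b12 Pn(2)])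
      also have "\<dots> \<le> (4 * c * (?P * v)) * ((?L * d) * (2 * M))"
        by (rule mult_left_mono[OF two[OF b(1,3) D0] Pn(2)])
      finally have E3: "\<bar>e3\<bar> \<le> c * v * d * (8 * ?P * M * ?L)" by (simp add: ac_simps)
      have Rm: "(\<lambda>(x, y). R x y) \<in> borel_measurable (pos_borel \<Otimes>\<^sub>M pos_borel)"
        using borel_measurable_diff[OF K_diff_measurable[OF lU] dKv_measurable[OF l0, of "l1 - l2"]]
        by (simp add: split_def R_def)
      have Rb: "\<bar>R x y\<bar> \<le> (2 * ?P * v) * (\<phi> x * \<phi> y)" if "x > 0" "y > 0" for x y
        using K_lipschitz[OF dU l1 l2 that] dKv_abs[OF l0 that, of "l1 - l2"] unfolding R_def v_def by linarith
      have P0: "0 \<le> 2 * ?P * v" using v0 by simp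
      have kR: "kernel_bound (\<lambda>x y. brace f x y * R x y) (4 * c * (2 * ?P * v)) (pw 2) (pw 2)"
        by (rule kernel_bound_phi[OF Rm Rb P0 c(1) fm c2])
      have kh: "kernel_bound (\<lambda>x y. 4 * c * (\<phi> x * \<phi> y * \<bar>R x y\<bar>)) (4 * c * (2 * ?P * v)) (pw 2) (pw 2)"
        unfolding kernel_bound_def
      proof (intro conjI allI impI)
        have "(\<lambda>z. \<bar>R (fst z) (snd z)\<bar>) \<in> borel_measurable (pos_borel \<Otimes>\<^sub>M pos_borel)"
          using Rm by (intro borel_measurable_abs) (simp add: split_def)
        from borel_measurable_times[OF borel_measurable_times[OF measurable_compose[OF measurable_fst phi_measurable]
              measurable_compose[OF measurable_snd phi_measurable]] this]
        show "(\<lambda>(x, y). 4 * c * (\<phi> x * \<phi> y * \<bar>R x y\<bar>)) \<in> borel_measurable (pos_borel \<Otimes>\<^sub>M pos_borel)"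
          by (simp add: split_def)
        fix x y :: real assume xy: "x > 0" "y > 0"
        have "4 * c * (\<phi> x * \<phi> y * \<bar>R x y\<bar>) \<le> 4 * c * (\<phi> x * \<phi> y * ((2 * ?P * v) * (\<phi> x * \<phi> y)))"
          using Rb[OF xy] c(1) pp_nonneg[OF xy] by (intro mult_left_mono) auto
        moreover have "0 \<le> 4 * c * (\<phi> x * \<phi> y * \<bar>R x y\<bar>)"
          by (rule mult_nonneg_nonneg[OF mult_nonneg_nonneg[OF _ c(1)] mult_nonneg_nonneg[OF pp_nonneg[OF xy] abs_ge_zero]]) simp
        ultimately show "\<bar>4 * c * (\<phi> x * \<phi> y * \<bar>R x y\<bar>)\<bar> \<le> 4 * c * (2 * ?P * v) * (pw 2 x * pw 2 y)"
          by (simp add: pw_def power2_eq_square ac_simps)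
      qed
      have "\<bar>e4\<bar> \<le> bilin (\<lambda>x y. 4 * c * (\<phi> x * \<phi> y * \<bar>R x y\<bar>)) (m l0 u) (m l0 u)"
        unfolding e4_def
      proof (rule bilin_abs_le_nonneg[OF q(3) weight_pw m_nonneg[OF l0 u] q(3) weight_pw m_nonneg[OF l0 u] kR kh])
        fix x y :: real assume xy: "x > 0" "y > 0"
        have "\<bar>brace f x y\<bar> * \<bar>R x y\<bar> \<le> 4 * c * (\<phi> x * \<phi> y) * \<bar>R x y\<bar>"
          using brace_phi_bound[OF c(1) c2 xy] by (intro mult_right_mono) auto
        then show "\<bar>brace f x y * R x y\<bar> \<le> 4 * c * (\<phi> x * \<phi> y * \<bar>R x y\<bar>)" by (simp add: abs_mult ac_simps)
      qed
      also have "\<dots> = 4 * c * bilin (\<lambda>x y. \<phi> x * \<phi> y * \<bar>R x y\<bar>) (m l0 u) (m l0 u)" by (rule bilin_scale)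
      also have "\<dots> \<le> 4 * c * (\<epsilon> / 4 * v)"
        unfolding R_def v_def using l1 l2 d(2) c(1) u by (intro mult_left_mono rem) auto
      finally have E4: "\<bar>e4\<bar> \<le> c * v * \<epsilon>" by (simp add: ac_simps)
      have "\<bar>e1 + 1 / 2 * e2 + 1 / 2 * e3 + 1 / 2 * e4\<bar> \<le> \<bar>e1\<bar> + 1 / 2 * \<bar>e2\<bar> + 1 / 2 * \<bar>e3\<bar> + 1 / 2 * \<bar>e4\<bar>" by linarith
      also have "\<dots> \<le> c * v * d * (4 * ?L * ?L) + 1 / 2 * (c * v * d * (8 * ?P * M * ?L)) + 1 / 2 * (c * v * d * (8 * ?P * M * ?L)) + 1 / 2 * (c * v * \<epsilon>)"
        using E1 E2 E3 E4 by linarith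
      also have "\<dots> = c * v * (d * (C - 1)) + 1 / 2 * (c * v * \<epsilon>)" by (simp add: C_def algebra_simps)
      also have "\<dots> \<le> c * v * (\<epsilon> / 2) + 1 / 2 * (c * v * \<epsilon>)"
      proof -
        have "d * (C - 1) \<le> d * C" using d(1) by simp
        then have "d * (C - 1) \<le> \<epsilon> / 2" using d(3) by linarith
        then have "c * v * (d * (C - 1)) \<le> c * v * (\<epsilon> / 2)" using c(1) v0 by (intro mult_left_mono) auto
        then show ?thesis by (rule add_right_mono)
      qed
      also have "\<dots> = c * (\<epsilon> * v)" by (simp add: algebra_simps)
      finally show "\<bar>rate l1 f u - rate l2 f u - coag_form f (K l0) (m l0 u) (\<lambda>A. m l1 u A - m l2 u A) - source l0 (l1 - l2) f u\<bar> \<le> c * (\<epsilon> * norm (l1 - l2))"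
        using eq unfolding \<delta>_def v_def by simp
    qed
  qed
  with d(1) dU show ?thesis by (intro exI[of _ d] conjI ballI)
qed

section \<open>The derivative in the parameter\<close>

lemma bdd_measurable_phi_bound:
  assumes "bdd_measurable f"
  obtains B where "0 \<le> B" "\<forall>x>0. \<bar>f x\<bar> \<le> B * \<phi> x"
proof -
  obtain B where B: "\<And>x. x > 0 \<Longrightarrow> \<bar>f x\<bar> \<le> B" using assms by (auto simp: bdd_measurable_def)
  have B0: "0 \<le> B" using B[of 1] by simp
  have "\<bar>f x\<bar> \<le> B * \<phi> x" if "x > 0" for x
    using B[OF that] mult_left_mono[OF phi_ge1[OF that] B0] by simp
  with B0 show ?thesis by (intro that[of B]) auto
qed

lemma source_continuous:
  assumes "l \<in> U" "bdd_measurable f"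
  shows "continuous_on {0..T} (source l v f)"
proof -
  obtain c where c: "0 \<le> c" "kernel_bound (\<lambda>x y. brace f x y * dKv l v x y) c \<phi> \<phi>"
    using kernel_bound_dKv[OF assms] by blast
  show ?thesis unfolding source_def[abs_def]
    by (intro continuous_intros continuous_on_bilin[OF m_phi(1)[OF assms(1)] phi_weight m_phi(1)[OF assms(1)] phi_weight c(2,1)]
        time_continuous(2) assms(1))
qed

text \<open>
  By stability the curves are Cauchy at each time, at a speed that does not depend on time. So the
  limit curve is continuous, and the equation passes to the limit for every bounded test function.
\<close>

lemma linearised_limit:
  assumes l: "l \<in> U" and \<rho>: "\<And>k. linearised_up_to l v (r k) (\<rho> k)" and r: "r \<longlonglongrightarrow> 0" "\<And>k. 0 \<le> r k"
    and cont: "\<And>k t. t \<in> {0..T} \<Longrightarrow> ((\<lambda>s. norm1 \<phi> (\<lambda>A. \<rho> k s A - \<rho> k t A)) \<longlongrightarrow> 0) (at t within {0..T})"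
  shows "\<exists>\<sigma>. linearised_up_to l v 0 \<sigma>"
proof -
  let ?S = stability_const
  note M = linearised_M1[OF \<rho>]
  have r': "(\<lambda>k. ?S * r k) \<longlonglongrightarrow> 0" using tendsto_mult[OF tendsto_const r(1)] by simp
  have "\<forall>t\<in>{0..T}. \<exists>L. L \<in> M1 \<phi> \<and> (\<forall>k. norm1 \<phi> (\<lambda>A. \<rho> k t A - L A) \<le> ?S * r k)"
  proof
    fix t assume t: "t \<in> {0..T}"
    have "norm1 \<phi> (\<lambda>A. \<rho> i t A - \<rho> j t A) \<le> ?S * r i + ?S * r j" for i j
    proof -
      have "linearised_up_to l 0 (r i + r j) (\<lambda>t A. \<rho> i t A - \<rho> j t A)"
        using linearised_lincomb[OF l \<rho>[of i] \<rho>[of j], of 1 "-1"] by simp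
      from linearised_zero_bound[OF l this _ t] show ?thesis using r(2) by (simp add: distrib_left)
    qed
    from M1_complete[where \<nu>="\<lambda>k. \<rho> k t", OF phi_weight M[OF t] r' this]
    show "\<exists>L. L \<in> M1 \<phi> \<and> (\<forall>k. norm1 \<phi> (\<lambda>A. \<rho> k t A - L A) \<le> ?S * r k)" by blast
  qed
  then obtain \<sigma> where \<sigma>: "\<forall>t\<in>{0..T}. \<sigma> t \<in> M1 \<phi> \<and> (\<forall>k. norm1 \<phi> (\<lambda>A. \<rho> k t A - \<sigma> t A) \<le> ?S * r k)"
    by (rule bchoice[THEN exE])
  have \<sigma>M: "\<sigma> t \<in> M1 \<phi>" and \<sigma>r: "norm1 \<phi> (\<lambda>A. \<rho> k t A - \<sigma> t A) \<le> ?S * r k" if "t \<in> {0..T}" for t k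
    using \<sigma> that by auto
  have z: "0 \<in> {0..T}" using T0 by simp
  have \<sigma>c: "((\<lambda>s. norm1 \<phi> (\<lambda>A. \<sigma> s A - \<sigma> t A)) \<longlongrightarrow> 0) (at t within {0..T})" if t: "t \<in> {0..T}" for t
  proof (rule tendstoI)
    fix e :: real assume e: "0 < e"
    obtain k where k: "?S * r k < e / 4"
      using order_tendstoD(2)[OF r', of "e / 4"] e by (auto simp: eventually_sequentially)
    have "\<forall>\<^sub>F s in at t within {0..T}. norm1 \<phi> (\<lambda>A. \<rho> k s A - \<rho> k t A) < e / 4"
      using order_tendstoD(2)[OF cont[OF t], of "e / 4"] e by simp
    moreover have "\<forall>\<^sub>F s in at t within {0..T}. s \<in> {0..T}" by (simp add: eventually_at_filter)
    ultimately show "\<forall>\<^sub>F s in at t within {0..T}. dist (norm1 \<phi> (\<lambda>A. \<sigma> s A - \<sigma> t A)) 0 < e"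
    proof eventually_elim
      fix s assume a: "norm1 \<phi> (\<lambda>A. \<rho> k s A - \<rho> k t A) < e / 4" and s: "s \<in> {0..T}"
      have "norm1 \<phi> (\<lambda>A. \<sigma> s A - \<sigma> t A) \<le> norm1 \<phi> (\<lambda>A. \<sigma> s A - \<rho> k s A) + norm1 \<phi> (\<lambda>A. \<rho> k s A - \<sigma> t A)"
        by (rule norm1_triangle[OF \<sigma>M[OF s] M[OF s] \<sigma>M[OF t] phi_weight])
      moreover have "norm1 \<phi> (\<lambda>A. \<rho> k s A - \<sigma> t A) \<le> norm1 \<phi> (\<lambda>A. \<rho> k s A - \<rho> k t A) + norm1 \<phi> (\<lambda>A. \<rho> k t A - \<sigma> t A)"
        by (rule norm1_triangle[OF M[OF s] M[OF t] \<sigma>M[OF t] phi_weight])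
      moreover have "norm1 \<phi> (\<lambda>A. \<sigma> s A - \<rho> k s A) = norm1 \<phi> (\<lambda>A. \<rho> k s A - \<sigma> s A)"
        by (rule norm1_minus_commute[OF \<sigma>M[OF s] M[OF s] phi_weight])
      ultimately have "norm1 \<phi> (\<lambda>A. \<sigma> s A - \<sigma> t A) < e"
        using a \<sigma>r[OF s, of k] \<sigma>r[OF t, of k] k e by linarith
      then show "dist (norm1 \<phi> (\<lambda>A. \<sigma> s A - \<sigma> t A)) 0 < e" by simp
    qed
  qed
  have "linearised_up_to l v 0 \<sigma>"
    unfolding linearised_up_to_def
  proof (intro conjI allI impI ballI)
    show "\<sigma> 0 A = 0" for A
    proof -
      have "\<bar>\<sigma> 0 A\<bar> \<le> ?S * r k" for k
        using abs_le_norm1[OF M1_diff(1)[OF M[OF z] \<sigma>M[OF z] phi_weight] phi_weight, of k A] \<sigma>r[OF z, of k] linearised_init[OF \<rho>, of k A]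
        by simp
      then have "\<bar>\<sigma> 0 A\<bar> \<le> 0" by (intro LIMSEQ_le_const[OF r']) auto
      then show ?thesis by simp
    qed
    show "\<sigma> t \<in> M1 \<phi>" if "t \<in> {0..T}" for t by (rule \<sigma>M[OF that])
    obtain X where X: "set_integrable lborel {0..T} X" "\<And>t. t \<in> {0..T} \<Longrightarrow> norm1 \<phi> (\<rho> 0 t) \<le> X t"
      using linearised_dom[OF \<rho>[of 0]] by blast
    show "\<exists>X. set_integrable lborel {0..T} X \<and> (\<forall>t\<in>{0..T}. norm1 \<phi> (\<sigma> t) \<le> X t)"
    proof (intro exI[of _ "\<lambda>t. X t + ?S * r 0"] conjI ballI)
      show "set_integrable lborel {0..T} (\<lambda>t. X t + ?S * r 0)"
        by (rule set_integral_add(1)[OF X(1) set_integral_Icc_const(2)[OF T0]])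
      fix t assume t: "t \<in> {0..T}"
      have "norm1 \<phi> (\<lambda>A. 1 * \<rho> 0 t A + (-1) * (\<rho> 0 t A - \<sigma> t A)) \<le> \<bar>1\<bar> * norm1 \<phi> (\<rho> 0 t) + \<bar>-1\<bar> * norm1 \<phi> (\<lambda>A. \<rho> 0 t A - \<sigma> t A)"
        by (rule M1_lincomb(2)[OF M[OF t] M1_diff(1)[OF M[OF t] \<sigma>M[OF t] phi_weight] phi_weight])
      then show "norm1 \<phi> (\<sigma> t) \<le> X t + ?S * r 0" using X(2)[OF t] \<sigma>r[OF t, of 0] by simp
    qed
    fix f assume f: "bdd_measurable f"
    obtain B where B: "0 \<le> B" "\<forall>x>0. \<bar>f x\<bar> \<le> B * \<phi> x" by (rule bdd_measurable_phi_bound[OF f])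
    have fm: "f \<in> borel_measurable pos_borel" using f by (simp add: bdd_measurable_def)
    obtain c0 where c0: "0 \<le> c0" "kernel_bound (\<lambda>x y. brace f x y * K l x y) c0 \<phi> \<phi>"
      using kernel_bound_K[OF l f] by blast
    define g where "g u = coag_form f (K l) (m l u) (\<sigma> u) + source l v f u" for u
    have gc: "continuous_on {0..T} g" unfolding g_def[abs_def]
      by (intro continuous_intros source_continuous[OF l f]
          continuous_on_bilin[OF m_phi(1)[OF l] phi_weight \<sigma>M phi_weight c0(2,1)] time_continuous(2) l \<sigma>c)
    have gi: "set_integrable lborel {0..T} g" by (rule borel_integrable_atLeastAtMost'[OF gc])
    have eq: "signed_integral (\<sigma> t) f - signed_integral (\<sigma> s) f = (LINT u:{s..t}|lborel. g u)"
      if st: "0 \<le> s" "s \<le> t" "t \<le> T" for s t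
    proof -
      have sT: "s \<in> {0..T}" and tT: "t \<in> {0..T}" using st by auto
      define C where "C = 2 * B * ?S + (B + c0 * M * ?S) * (t - s)"
      have *: "\<bar>(signed_integral (\<sigma> t) f - signed_integral (\<sigma> s) f) - (LINT u:{s..t}|lborel. g u)\<bar> \<le> C * r k" for k
      proof -
        obtain gk where gk: "set_integrable lborel {0..T} gk"
          "\<And>s t. 0 \<le> s \<Longrightarrow> s \<le> t \<Longrightarrow> t \<le> T \<Longrightarrow>
                signed_integral (\<rho> k t) f - signed_integral (\<rho> k s) f = (LINT u:{s..t}|lborel. gk u)"
          "\<And>u c. u \<in> {0..T} \<Longrightarrow> 0 \<le> c \<Longrightarrow> (\<forall>x>0. \<bar>f x\<bar> \<le> c * \<phi> x) \<Longrightarrow>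
                \<bar>gk u - coag_form f (K l) (m l u) (\<rho> k u) - source l v f u\<bar> \<le> c * r k"
          by (rule linearised_up_toE[OF \<rho> f]) (rule that)
        have si: "\<bar>signed_integral (\<rho> k u) f - signed_integral (\<sigma> u) f\<bar> \<le> B * (?S * r k)" if u: "u \<in> {0..T}" for u
        proof -
          have "\<bar>signed_integral (\<lambda>A. \<rho> k u A - \<sigma> u A) f\<bar> \<le> B * norm1 \<phi> (\<lambda>A. \<rho> k u A - \<sigma> u A)"
            using B(2) by (intro signed_integral_bound[OF M1_diff(1)[OF M[OF u] \<sigma>M[OF u] phi_weight] phi_weight fm]) auto
          also have "\<dots> \<le> B * (?S * r k)" by (rule mult_left_mono[OF \<sigma>r[OF u] B(1)])
          finally show ?thesis by (simp add: signed_integral_diff_bdd[OF M[OF u] \<sigma>M[OF u] phi_weight f])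
        qed
        have dg: "\<bar>gk u - g u\<bar> \<le> (B + c0 * M * ?S) * r k" if u: "u \<in> {0..T}" for u
        proof -
          have "\<bar>coag_form f (K l) (m l u) (\<lambda>A. \<rho> k u A - \<sigma> u A)\<bar> \<le> c0 * norm1 \<phi> (m l u) * norm1 \<phi> (\<lambda>A. \<rho> k u A - \<sigma> u A)"
            by (rule bilin_bound[OF m_phi(1)[OF l u] phi_weight M1_diff(1)[OF M[OF u] \<sigma>M[OF u] phi_weight] phi_weight c0(2)])
          also have "\<dots> \<le> c0 * M * (?S * r k)"
            using c0(1) m_phi(2)[OF l u] M0 \<sigma>r[OF u] by (intro mult_mono) auto
          finally have "\<bar>coag_form f (K l) (m l u) (\<rho> k u) - coag_form f (K l) (m l u) (\<sigma> u)\<bar> \<le> c0 * M * (?S * r k)"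
            using bilin_lincomb_right[OF m_phi(1)[OF l u] phi_weight M[OF u] \<sigma>M[OF u] phi_weight c0(2), of 1 k "-1"] by simp
          moreover have "(B + c0 * M * ?S) * r k = B * r k + c0 * M * (?S * r k)" by (simp add: algebra_simps)
          ultimately show ?thesis using gk(3)[OF u B] unfolding g_def by linarith
        qed
        have "\<bar>LINT u:{s..t}|lborel. gk u - g u\<bar> \<le> (LINT u:{s..t}|lborel. (B + c0 * M * ?S) * r k)"
        proof (rule set_integral_Icc_abs_le)
          show "set_integrable lborel {s..t} (\<lambda>u. gk u - g u)"
            by (rule set_integral_diff(1)[OF set_integrable_Icc_subset[OF gk(1) st(1,3)] set_integrable_Icc_subset[OF gi st(1,3)]])
          show "set_integrable lborel {s..t} (\<lambda>u. (B + c0 * M * ?S) * r k)" by (rule set_integral_Icc_const(2)[OF st(2)])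
          show "\<bar>gk u - g u\<bar> \<le> (B + c0 * M * ?S) * r k" if "u \<in> {s..t}" for u using that st by (intro dg) auto
        qed
        also have "\<dots> = (B + c0 * M * ?S) * r k * (t - s)" by (rule set_integral_Icc_const(1)[OF st(2)])
        finally have "\<bar>(LINT u:{s..t}|lborel. gk u) - (LINT u:{s..t}|lborel. g u)\<bar> \<le> (B + c0 * M * ?S) * r k * (t - s)"
          by (simp add: set_integral_diff(2)[OF set_integrable_Icc_subset[OF gk(1) st(1,3)] set_integrable_Icc_subset[OF gi st(1,3)]])
        moreover have "C * r k = 2 * (B * (?S * r k)) + (B + c0 * M * ?S) * r k * (t - s)" by (simp add: C_def algebra_simps)
        ultimately show ?thesis using si[OF sT] si[OF tT] gk(2)[OF st] by linarith
      qed
      have "(\<lambda>k. C * r k) \<longlonglongrightarrow> 0" using tendsto_mult[OF tendsto_const r(1)] by simp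
      then have "\<bar>(signed_integral (\<sigma> t) f - signed_integral (\<sigma> s) f) - (LINT u:{s..t}|lborel. g u)\<bar> \<le> 0"
        by (rule LIMSEQ_le_const) (use * in auto)
      then show ?thesis by simp
    qed
    show "\<exists>g. set_integrable lborel {0..T} g \<and>
        (\<forall>s t. 0 \<le> s \<and> s \<le> t \<and> t \<le> T \<longrightarrow>
          signed_integral (\<sigma> t) f - signed_integral (\<sigma> s) f = (LINT u:{s..t}|lborel. g u)) \<and>
        (\<forall>u\<in>{0..T}. \<forall>c\<ge>0. (\<forall>x>0. \<bar>f x\<bar> \<le> c * \<phi> x) \<longrightarrow>
          \<bar>g u - coag_form f (K l) (m l u) (\<sigma> u) - source l v f u\<bar> \<le> c * 0)"
      by (intro exI[of _ g] conjI allI impI ballI gi) (simp_all add: eq g_def)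
  qed
  then show ?thesis by blast
qed

text \<open>
  The step \<open>h k\<close> is chosen so small that the difference quotient in the direction
  \<open>v\<close> solves the linearised equation up to \<open>|v| / (k + 1)\<close>.
\<close>

lemma sensitivity_exists:
  assumes l: "l \<in> U"
  shows "\<exists>\<sigma>. linearised_up_to l v 0 \<sigma>"
proof -
  have nv: "0 < norm v + 1" by (smt (verit) norm_ge_zero)
  define Q where "Q k d \<longleftrightarrow> d > 0 \<and> ball l d \<subseteq> U \<and> (\<forall>l1\<in>ball l d. \<forall>l2\<in>ball l d.
    linearised_up_to l (l1 - l2) (1 / real (Suc k) * norm (l1 - l2)) (\<lambda>t A. m l1 t A - m l2 t A))" for k d
  have "\<forall>k. \<exists>d. Q k d" unfolding Q_def by (intro allI difference_linearised[OF l]) simp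
  then obtain d where d: "\<And>k. Q k (d k)" by metis
  define h where "h k = d k / (2 * (norm v + 1))" for k
  have d0: "d k > 0" for k using d[of k] by (simp add: Q_def)
  have h0: "h k > 0" for k using d0[of k] nv by (simp add: h_def)
  have lh: "l + h k *\<^sub>R v \<in> ball l (d k)" for k
  proof -
    have "h k * norm v \<le> h k * (norm v + 1)" using h0[of k] by (intro mult_left_mono) auto
    also have "\<dots> = d k / 2" using nv unfolding h_def by (simp add: divide_simps)
    also have "\<dots> < d k" using d0[of k] by simp
    finally show ?thesis using h0[of k] by (simp add: dist_norm)
  qed
  define \<rho> where "\<rho> k t A = 1 / h k * (m (l + h k *\<^sub>R v) t A - m l t A)" for k t A
  have \<rho>: "linearised_up_to l v (1 / real (Suc k) * norm v) (\<rho> k)" for k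
  proof -
    have "l \<in> ball l (d k)" using d0 by simp
    then have L: "linearised_up_to l (l + h k *\<^sub>R v - l) (1 / real (Suc k) * norm (l + h k *\<^sub>R v - l)) (\<lambda>t A. m (l + h k *\<^sub>R v) t A - m l t A)"
      using d[of k] lh[of k] unfolding Q_def by blast
    have "\<rho> k = (\<lambda>t A. 1 / h k * (m (l + h k *\<^sub>R v) t A - m l t A) + 0 * (m (l + h k *\<^sub>R v) t A - m l t A))"
      by (auto simp: \<rho>_def fun_eq_iff)
    moreover have "(1 / h k) *\<^sub>R (l + h k *\<^sub>R v - l) + 0 *\<^sub>R (l + h k *\<^sub>R v - l) = v" using h0[of k] by simp
    moreover have "\<bar>1 / h k\<bar> * (1 / real (Suc k) * norm (l + h k *\<^sub>R v - l)) + \<bar>0\<bar> * (1 / real (Suc k) * norm (l + h k *\<^sub>R v - l)) = 1 / real (Suc k) * norm v"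
      using h0[of k] by simp
    ultimately show ?thesis using linearised_lincomb[OF l L L, of "1 / h k" 0] by simp
  qed
  show ?thesis
  proof (rule linearised_limit[OF l \<rho>])
    show "(\<lambda>k. 1 / real (Suc k) * norm v) \<longlonglongrightarrow> 0"
      using tendsto_mult[OF LIMSEQ_Suc[OF lim_const_over_n[of "1 :: real"]] tendsto_const[of "norm v"]] by simp
    show "0 \<le> 1 / real (Suc k) * norm v" for k by simp
    fix k t assume t: "t \<in> {0..T}"
    have lU: "l + h k *\<^sub>R v \<in> U" using lh[of k] d[of k] unfolding Q_def by blast
    let ?N = "\<lambda>l s. norm1 \<phi> (\<lambda>A. m l s A - m l t A)"
    have lim: "((\<lambda>s. 1 / h k * ?N (l + h k *\<^sub>R v) s + 1 / h k * ?N l s) \<longlongrightarrow> 1 / h k * 0 + 1 / h k * 0) (at t within {0..T})"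
      by (intro tendsto_intros time_continuous(2) t lU l)
    show "((\<lambda>s. norm1 \<phi> (\<lambda>A. \<rho> k s A - \<rho> k t A)) \<longlongrightarrow> 0) (at t within {0..T})"
    proof (rule Lim_null_comparison)
      show "\<forall>\<^sub>F s in at t within {0..T}. norm (norm1 \<phi> (\<lambda>A. \<rho> k s A - \<rho> k t A)) \<le> 1 / h k * ?N (l + h k *\<^sub>R v) s + 1 / h k * ?N l s"
        unfolding eventually_at_filter
      proof (intro always_eventually allI impI)
        fix s assume s: "s \<in> {0..T}"
        have "(\<lambda>A. \<rho> k s A - \<rho> k t A) = (\<lambda>A. 1 / h k * (m (l + h k *\<^sub>R v) s A - m (l + h k *\<^sub>R v) t A) + (- (1 / h k)) * (m l s A - m l t A))"
          by (auto simp: \<rho>_def fun_eq_iff algebra_simps)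
        then show "norm (norm1 \<phi> (\<lambda>A. \<rho> k s A - \<rho> k t A)) \<le> 1 / h k * ?N (l + h k *\<^sub>R v) s + 1 / h k * ?N l s"
          using M1_lincomb(2)[OF m_diff(2)[OF lU lU s t] m_diff(2)[OF l l s t] phi_weight, of "1 / h k" "- (1 / h k)"] h0[of k] by simp
      qed
    qed (use lim in simp)
  qed
qed

text \<open>
  By \<open>linearised_unique\<close> the choice is determined on \<open>{0..T}\<close>.
\<close>

definition sensitivity :: "real^'p \<Rightarrow> real^'p \<Rightarrow> real \<Rightarrow> real set \<Rightarrow> real" where
  "sensitivity l v = (SOME \<sigma>. linearised_up_to l v 0 \<sigma>)"

lemma sensitivity_linearised: "l \<in> U \<Longrightarrow> linearised_up_to l v 0 (sensitivity l v)"
  unfolding sensitivity_def by (rule someI_ex[OF sensitivity_exists])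

lemma sensitivity_M1: "l \<in> U \<Longrightarrow> t \<in> {0..T} \<Longrightarrow> sensitivity l v t \<in> M1 \<phi>"
  using linearised_M1[OF sensitivity_linearised] .

lemma sensitivity_lincomb:
  assumes l: "l \<in> U" and t: "t \<in> {0..T}"
  shows "sensitivity l (a *\<^sub>R v + b *\<^sub>R w) t = (\<lambda>A. a * sensitivity l v t A + b * sensitivity l w t A)"
proof -
  have "linearised_up_to l (a *\<^sub>R v + b *\<^sub>R w) 0 (\<lambda>t A. a * sensitivity l v t A + b * sensitivity l w t A)"
    using linearised_lincomb[OF l sensitivity_linearised[OF l, of v] sensitivity_linearised[OF l, of w], of a b] by simp
  from linearised_unique[OF l sensitivity_linearised[OF l] this t] show ?thesis .
qed

lemma sensitivity_scale: "l \<in> U \<Longrightarrow> t \<in> {0..T} \<Longrightarrow> sensitivity l (a *\<^sub>R v) t A = a * sensitivity l v t A"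
  using sensitivity_lincomb[of l t a v 0 v] by (simp add: fun_eq_iff)

text \<open>
  Both \<open>m l1 - m l2\<close> and the sensitivity in the direction \<open>l1 - l2\<close>
  solve the linearised equation at \<open>l0\<close>, up to \<open>e * |l1 - l2|\<close> and
  exactly; stability compares them.
\<close>

lemma strict_derivative:
  assumes l0: "l0 \<in> U" and \<epsilon>: "0 < \<epsilon>"
  shows "\<exists>d>0. ball l0 d \<subseteq> U \<and> (\<forall>l1\<in>ball l0 d. \<forall>l2\<in>ball l0 d. \<forall>t\<in>{0..T}.
    norm1 \<phi> (\<lambda>A. (m l1 t A - m l2 t A) - sensitivity l0 (l1 - l2) t A) \<le> \<epsilon> * norm (l1 - l2))"
proof -
  let ?S = stability_const
  have S: "0 \<le> ?S" by (rule stability_const_nonneg)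
  define e where "e = \<epsilon> / (?S + 1)"
  have e: "0 < e" "?S * e \<le> \<epsilon>" using \<epsilon> S by (auto simp: e_def field_simps)
  from difference_linearised[OF l0 e(1)] obtain d where d: "d > 0 \<and> ball l0 d \<subseteq> U \<and>
    (\<forall>l1\<in>ball l0 d. \<forall>l2\<in>ball l0 d.
    linearised_up_to l0 (l1 - l2) (e * norm (l1 - l2)) (\<lambda>t A. m l1 t A - m l2 t A))" by (rule exE)
  have "norm1 \<phi> (\<lambda>A. (m l1 t A - m l2 t A) - sensitivity l0 (l1 - l2) t A) \<le> \<epsilon> * norm (l1 - l2)"
    if l: "l1 \<in> ball l0 d" "l2 \<in> ball l0 d" and t: "t \<in> {0..T}" for l1 l2 t
  proof -
    have L: "linearised_up_to l0 (l1 - l2) (e * norm (l1 - l2)) (\<lambda>t A. m l1 t A - m l2 t A)" using d l by blast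
    have "linearised_up_to l0 0 (e * norm (l1 - l2)) (\<lambda>t A. (m l1 t A - m l2 t A) - sensitivity l0 (l1 - l2) t A)"
      using linearised_lincomb[OF l0 L sensitivity_linearised[OF l0, of "l1 - l2"], of 1 "-1"] by simp
    from linearised_zero_bound[OF l0 this _ t]
    have "norm1 \<phi> (\<lambda>A. (m l1 t A - m l2 t A) - sensitivity l0 (l1 - l2) t A) \<le> ?S * (e * norm (l1 - l2))" using e by simp
    also have "\<dots> \<le> \<epsilon> * norm (l1 - l2)" using mult_right_mono[OF e(2), of "norm (l1 - l2)"] by simp
    finally show ?thesis .
  qed
  then show ?thesis using d by blast
qed

lemma small_step:
  fixes v :: "real^'p"
  assumes "0 < d"
  obtains h where "0 < h" "h * norm v < d"
proof -
  have nv: "0 < norm v + 1" by (smt (verit) norm_ge_zero)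
  have "d / (norm v + 1) * norm v < d / (norm v + 1) * (norm v + 1)"
    using assms nv by (intro mult_strict_left_mono) auto
  also have "\<dots> = d" using nv by simp
  finally show ?thesis using assms nv by (intro that[of "d / (norm v + 1)"]) auto
qed

text \<open>
  The derivative of a Lipschitz map is bounded by the Lipschitz constant; the summand 1 avoids a
  passage to the limit.
\<close>

lemma sensitivity_bound:
  assumes l: "l \<in> U" and t: "t \<in> {0..T}"
  shows "norm1 \<phi> (sensitivity l v t) \<le> (lambda_const + 1) * norm v"
proof -
  obtain d where d: "d > 0" "ball l d \<subseteq> U"
    and sd: "\<forall>l1\<in>ball l d. \<forall>l2\<in>ball l d. \<forall>t\<in>{0..T}.
    norm1 \<phi> (\<lambda>A. (m l1 t A - m l2 t A) - sensitivity l (l1 - l2) t A) \<le> 1 * norm (l1 - l2)"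
    using strict_derivative[OF l zero_less_one] by (elim exE conjE) (rule that)
  obtain h where h: "0 < h" "h * norm v < d" by (rule small_step[OF d(1)])
  have c: "l \<in> ball l d" "l + h *\<^sub>R v \<in> ball l d" using d h by (auto simp: dist_norm)
  have lU: "l + h *\<^sub>R v \<in> U" using c d by auto
  let ?D = "\<lambda>A. m (l + h *\<^sub>R v) t A - m l t A"
  have D: "?D \<in> M1 \<phi>" "norm1 \<phi> ?D \<le> lambda_const * (h * norm v)"
    using m_diff(2,4)[OF lU l t t] lambda_lipschitz[OF d(2) c(2,1) t] h by auto
  have n: "l + h *\<^sub>R v - l = h *\<^sub>R v" "1 * norm (h *\<^sub>R v) = h * norm v" using h by auto
  have e: "norm1 \<phi> (\<lambda>A. ?D A - sensitivity l (h *\<^sub>R v) t A) \<le> h * norm v"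
    using sd[THEN bspec, THEN bspec, THEN bspec, OF c(2,1) t] unfolding n .
  have "norm1 \<phi> (\<lambda>A. 1 / h * ?D A + (- 1 / h) * (?D A - sensitivity l (h *\<^sub>R v) t A)) \<le>
      \<bar>1 / h\<bar> * norm1 \<phi> ?D + \<bar>- 1 / h\<bar> * norm1 \<phi> (\<lambda>A. ?D A - sensitivity l (h *\<^sub>R v) t A)"
    by (rule M1_lincomb(2)[OF D(1) M1_diff(1)[OF D(1) sensitivity_M1[OF l t] phi_weight] phi_weight])
  also have "(\<lambda>A. 1 / h * ?D A + (- 1 / h) * (?D A - sensitivity l (h *\<^sub>R v) t A)) = sensitivity l v t"
    using h by (auto simp: fun_eq_iff sensitivity_scale[OF l t] field_simps)
  also have "\<bar>1 / h\<bar> * norm1 \<phi> ?D + \<bar>- 1 / h\<bar> * norm1 \<phi> (\<lambda>A. ?D A - sensitivity l (h *\<^sub>R v) t A) \<le>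
      \<bar>1 / h\<bar> * (lambda_const * (h * norm v)) + \<bar>- 1 / h\<bar> * (h * norm v)"
    by (intro add_mono mult_left_mono D(2) e) auto
  also have "\<dots> = (lambda_const + 1) * norm v" using h by (simp add: field_simps)
  finally show ?thesis .
qed

text \<open>
  A short difference \<open>m (l + h v) - m l\<close> is approximated by the derivative at
  \<open>l\<close> and, by strictness, also by the derivative at \<open>l0\<close>. The radius
  \<open>d'\<close> belonging to \<open>l\<close> is not uniform in \<open>l\<close>, but
  \<open>h\<close> may depend on it.
\<close>

lemma sensitivity_continuous_lambda:
  assumes l0: "l0 \<in> U" and \<epsilon>: "0 < \<epsilon>"
  shows "\<exists>d>0. ball l0 d \<subseteq> U \<and> (\<forall>l\<in>ball l0 d. \<forall>t\<in>{0..T}. \<forall>v.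
    norm1 \<phi> (\<lambda>A. sensitivity l v t A - sensitivity l0 v t A) \<le> \<epsilon> * norm v)"
proof -
  have \<epsilon>2: "0 < \<epsilon> / 2" using \<epsilon> by simp
  obtain d where d: "d > 0" "ball l0 d \<subseteq> U"
    and sd: "\<forall>l1\<in>ball l0 d. \<forall>l2\<in>ball l0 d. \<forall>t\<in>{0..T}.
    norm1 \<phi> (\<lambda>A. (m l1 t A - m l2 t A) - sensitivity l0 (l1 - l2) t A) \<le> \<epsilon> / 2 * norm (l1 - l2)"
    using strict_derivative[OF l0 \<epsilon>2] by (elim exE conjE) (rule that)
  have "norm1 \<phi> (\<lambda>A. sensitivity l v t A - sensitivity l0 v t A) \<le> \<epsilon> * norm v"
    if lb: "l \<in> ball l0 d" and t: "t \<in> {0..T}" for l t v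
  proof -
    have l: "l \<in> U" using lb d by auto
    obtain d' where d': "d' > 0" "ball l d' \<subseteq> U"
      and sd': "\<forall>l1\<in>ball l d'. \<forall>l2\<in>ball l d'. \<forall>t\<in>{0..T}.
      norm1 \<phi> (\<lambda>A. (m l1 t A - m l2 t A) - sensitivity l (l1 - l2) t A) \<le> \<epsilon> / 2 * norm (l1 - l2)"
      using strict_derivative[OF l \<epsilon>2] by (elim exE conjE) (rule that)
    have "0 < min d' (d - dist l0 l)" using d'(1) lb by simp
    then obtain h where h: "0 < h" "h * norm v < min d' (d - dist l0 l)" by (rule small_step)
    have c: "l \<in> ball l d'" "l + h *\<^sub>R v \<in> ball l d'" using d' h by (auto simp: dist_norm)
    have lU: "l + h *\<^sub>R v \<in> U" using c d' by auto
    have "dist l0 (l + h *\<^sub>R v) \<le> dist l0 l + dist l (l + h *\<^sub>R v)" by (rule dist_triangle)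
    then have c': "l + h *\<^sub>R v \<in> ball l0 d" using h by (simp add: dist_norm)
    let ?D = "\<lambda>A. m (l + h *\<^sub>R v) t A - m l t A"
    have D: "?D \<in> M1 \<phi>" using m_diff(2)[OF lU l t t] .
    have n: "l + h *\<^sub>R v - l = h *\<^sub>R v" "norm (h *\<^sub>R v) = h * norm v" using h by auto
    have e1: "norm1 \<phi> (\<lambda>A. ?D A - sensitivity l (h *\<^sub>R v) t A) \<le> \<epsilon> / 2 * (h * norm v)"
      using sd'[THEN bspec, THEN bspec, THEN bspec, OF c(2,1) t] unfolding n .
    have e2: "norm1 \<phi> (\<lambda>A. ?D A - sensitivity l0 (h *\<^sub>R v) t A) \<le> \<epsilon> / 2 * (h * norm v)"
      using sd[THEN bspec, THEN bspec, THEN bspec, OF c' lb t] unfolding n .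
    have "norm1 \<phi> (\<lambda>A. 1 / h * (?D A - sensitivity l0 (h *\<^sub>R v) t A) + (- 1 / h) * (?D A - sensitivity l (h *\<^sub>R v) t A)) \<le>
      \<bar>1 / h\<bar> * norm1 \<phi> (\<lambda>A. ?D A - sensitivity l0 (h *\<^sub>R v) t A) + \<bar>- 1 / h\<bar> * norm1 \<phi> (\<lambda>A. ?D A - sensitivity l (h *\<^sub>R v) t A)"
      by (rule M1_lincomb(2)[OF M1_diff(1)[OF D sensitivity_M1[OF l0 t] phi_weight] M1_diff(1)[OF D sensitivity_M1[OF l t] phi_weight] phi_weight])
    also have "(\<lambda>A. 1 / h * (?D A - sensitivity l0 (h *\<^sub>R v) t A) + (- 1 / h) * (?D A - sensitivity l (h *\<^sub>R v) t A)) = (\<lambda>A. sensitivity l v t A - sensitivity l0 v t A)"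
      using h by (auto simp: fun_eq_iff sensitivity_scale[OF l t] sensitivity_scale[OF l0 t] field_simps)
    also have "\<bar>1 / h\<bar> * norm1 \<phi> (\<lambda>A. ?D A - sensitivity l0 (h *\<^sub>R v) t A) + \<bar>- 1 / h\<bar> * norm1 \<phi> (\<lambda>A. ?D A - sensitivity l (h *\<^sub>R v) t A) \<le>
        \<bar>1 / h\<bar> * (\<epsilon> / 2 * (h * norm v)) + \<bar>- 1 / h\<bar> * (\<epsilon> / 2 * (h * norm v))"
      by (intro add_mono mult_left_mono e1 e2) auto
    also have "\<dots> = \<epsilon> * norm v" using h by (simp add: field_simps)
    finally show ?thesis .
  qed
  with d show ?thesis by (intro exI[of _ d] conjI ballI allI)
qed

text \<open>
  The sensitivity is uniformly close to a difference quotient with a fixed step, and that quotient is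
  Lipschitz in time.
\<close>

lemma sensitivity_continuous_time:
  assumes l: "l \<in> U" and \<epsilon>: "0 < \<epsilon>"
  shows "\<exists>\<delta>>0. \<forall>s\<in>{0..T}. \<forall>t\<in>{0..T}. \<bar>t - s\<bar> < \<delta> \<longrightarrow> (\<forall>v.
    norm1 \<phi> (\<lambda>A. sensitivity l v t A - sensitivity l v s A) \<le> \<epsilon> * norm v)"
proof -
  have \<epsilon>4: "0 < \<epsilon> / 4" using \<epsilon> by simp
  obtain d where d: "d > 0" "ball l d \<subseteq> U"
    and sd: "\<forall>l1\<in>ball l d. \<forall>l2\<in>ball l d. \<forall>t\<in>{0..T}.
    norm1 \<phi> (\<lambda>A. (m l1 t A - m l2 t A) - sensitivity l (l1 - l2) t A) \<le> \<epsilon> / 4 * norm (l1 - l2)"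
    using strict_derivative[OF l \<epsilon>4] by (elim exE conjE) (rule that)
  define \<delta> where "\<delta> = \<epsilon> * d / (24 * M ^ 2)"
  have \<delta>: "0 < \<delta>" using \<epsilon> d M0 by (simp add: \<delta>_def)
  have "norm1 \<phi> (\<lambda>A. sensitivity l v t A - sensitivity l v s A) \<le> \<epsilon> * norm v"
    if s: "s \<in> {0..T}" and t: "t \<in> {0..T}" and ts: "\<bar>t - s\<bar> < \<delta>" for s t v
  proof (cases "v = 0")
    case True
    have "sensitivity l v r A = 0" if "r \<in> {0..T}" for r A using sensitivity_scale[OF l that, of 0 v] True by simp
    then have "(\<lambda>A. sensitivity l v t A - sensitivity l v s A) = (\<lambda>A. 0 * sensitivity l v t A)" using s t by auto
    then show ?thesis using M1_scale(2)[OF sensitivity_M1[OF l t] phi_weight, of 0 v] True by simp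
  next
    case False
    \<comment> \<open>The step has length \<open>d / 2\<close> for every direction, which makes
        \<open>\<delta>\<close> independent of \<open>v\<close>.\<close>
    define h where "h = d / (2 * norm v)"
    have h: "0 < h" "h * norm v = d / 2" using False d by (auto simp: h_def)
    have c: "l \<in> ball l d" "l + h *\<^sub>R v \<in> ball l d" using d h by (auto simp: dist_norm)
    have lU: "l + h *\<^sub>R v \<in> U" using c d by auto
    let ?D = "\<lambda>r A. m (l + h *\<^sub>R v) r A - m l r A"
    have D: "?D r \<in> M1 \<phi>" if "r \<in> {0..T}" for r using m_diff(2)[OF lU l that that] .
    have n: "l + h *\<^sub>R v - l = h *\<^sub>R v" "norm (h *\<^sub>R v) = h * norm v" using h by auto
    have e: "norm1 \<phi> (\<lambda>A. ?D r A - sensitivity l (h *\<^sub>R v) r A) \<le> \<epsilon> / 4 * (h * norm v)" if "r \<in> {0..T}" for r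
      using sd[THEN bspec, THEN bspec, THEN bspec, OF c(2,1) that] unfolding n .
    have N: "norm1 \<phi> (\<lambda>A. m l' t A - m l' s A) \<le> 3 * M ^ 2 * \<delta>" if "l' \<in> U" for l'
    proof -
      have "norm1 \<phi> (\<lambda>A. m l' t A - m l' s A) \<le> 3 * M ^ 2 * \<bar>t - s\<bar>"
        using m_diff(4)[OF that that t s] time_lipschitz[OF that s t] by linarith
      also have "\<dots> \<le> 3 * M ^ 2 * \<delta>" using ts by (intro mult_left_mono) auto
      finally show ?thesis .
    qed
    have E: "norm1 \<phi> (\<lambda>A. ?D t A - ?D s A) \<le> 6 * M ^ 2 * \<delta>"
    proof -
      have "(\<lambda>A. ?D t A - ?D s A) = (\<lambda>A. 1 * (m (l + h *\<^sub>R v) t A - m (l + h *\<^sub>R v) s A) + (-1) * (m l t A - m l s A))"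
        by auto
      then have "norm1 \<phi> (\<lambda>A. ?D t A - ?D s A) \<le> \<bar>1\<bar> * norm1 \<phi> (\<lambda>A. m (l + h *\<^sub>R v) t A - m (l + h *\<^sub>R v) s A) + \<bar>-1\<bar> * norm1 \<phi> (\<lambda>A. m l t A - m l s A)"
        using M1_lincomb(2)[OF m_diff(2)[OF lU lU t s] m_diff(2)[OF l l t s] phi_weight, of 1 "-1"] by simp
      then show ?thesis using N[OF lU] N[OF l] by simp
    qed
    let ?e = "\<lambda>r A. ?D r A - sensitivity l (h *\<^sub>R v) r A"
    have eM: "?e r \<in> M1 \<phi>" if "r \<in> {0..T}" for r by (rule M1_diff(1)[OF D[OF that] sensitivity_M1[OF l that] phi_weight])
    have ets: "norm1 \<phi> (\<lambda>A. ?e s A - ?e t A) \<le> \<epsilon> / 2 * (h * norm v)"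
      using M1_diff(2)[OF eM[OF s] eM[OF t] phi_weight] e[OF s] e[OF t] by simp
    have "norm1 \<phi> (\<lambda>A. 1 / h * (?D t A - ?D s A) + 1 / h * (?e s A - ?e t A)) \<le>
       \<bar>1 / h\<bar> * norm1 \<phi> (\<lambda>A. ?D t A - ?D s A) + \<bar>1 / h\<bar> * norm1 \<phi> (\<lambda>A. ?e s A - ?e t A)"
      by (rule M1_lincomb(2)[OF M1_diff(1)[OF D[OF t] D[OF s] phi_weight] M1_diff(1)[OF eM[OF s] eM[OF t] phi_weight] phi_weight])
    also have "(\<lambda>A. 1 / h * (?D t A - ?D s A) + 1 / h * (?e s A - ?e t A)) = (\<lambda>A. sensitivity l v t A - sensitivity l v s A)"
      using h(1) by (auto simp: fun_eq_iff sensitivity_scale[OF l t] sensitivity_scale[OF l s] field_simps)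
    also have "\<bar>1 / h\<bar> * norm1 \<phi> (\<lambda>A. ?D t A - ?D s A) + \<bar>1 / h\<bar> * norm1 \<phi> (\<lambda>A. ?e s A - ?e t A) \<le>
        \<bar>1 / h\<bar> * (6 * M ^ 2 * \<delta>) + \<bar>1 / h\<bar> * (\<epsilon> / 2 * (h * norm v))"
      by (intro add_mono mult_left_mono E ets) auto
    also have "6 * M ^ 2 * \<delta> = \<epsilon> / 2 * (h * norm v)" using M0 by (simp add: \<delta>_def h(2))
    also have "\<bar>1 / h\<bar> * (\<epsilon> / 2 * (h * norm v)) + \<bar>1 / h\<bar> * (\<epsilon> / 2 * (h * norm v)) = \<epsilon> * norm v"
      using h(1) by (simp add: field_simps)
    finally show ?thesis .
  qed
  with \<delta> show ?thesis by blast
qed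

section \<open>The derivative in time and the total derivative\<close>

definition rate_const :: real where "rate_const = 12 * M ^ 3"

lemma rate_const_nonneg: "0 \<le> rate_const"
  using M0 by (simp add: rate_const_def)

lemma coagulation_lipschitz:
  assumes l: "l \<in> U" "l' \<in> U" and t: "t \<in> {0..T}" "t' \<in> {0..T}"
    and f: "bdd_measurable f" "0 \<le> c" "\<forall>x>0. \<bar>f x\<bar> \<le> c * \<phi> x"
  shows "\<bar>coag_form f (K l) (m l t) (m l t) - coag_form f (K l) (m l' t') (m l' t')\<bar>
    \<le> 8 * c * M * norm1 (pw 2) (\<lambda>A. m l t A - m l' t' A)"
proof -
  have fm: "f \<in> borel_measurable pos_borel" using f(1) by (simp add: bdd_measurable_def)
  have c2: "\<And>x. x > 0 \<Longrightarrow> \<bar>f x\<bar> \<le> c * \<phi> x" using f(3) by blast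
  have q: "m l t \<in> M1 (pw 2)" "m l' t' \<in> M1 (pw 2)" using m_M1_le l t by auto
  have b: "norm1 (pw 2) (m l t) \<le> M" "norm1 (pw 2) (m l' t') \<le> M" using m_bound_le l t by auto
  have kb: "kernel_bound (\<lambda>x y. brace f x y * K l x y) (4 * c * 1) (pw 2) (pw 2)"
    by (rule kernel_bound_phi[OF K_measurable[OF l(1)] K_abs[OF l(1)] zero_le_one f(2) fm c2])
  let ?N = "norm1 (pw 2) (\<lambda>A. m l t A - m l' t' A)"
  have "\<bar>coag_form f (K l) (m l t) (m l t) - coag_form f (K l) (m l' t') (m l' t')\<bar>
    \<le> (4 * c * 1) * (?N * norm1 (pw 2) (m l t) + norm1 (pw 2) (m l' t') * ?N)"
    by (rule bilin_diff_bound[OF q weight_pw q weight_pw kb]) (use f in simp)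
  also have "\<dots> \<le> (4 * c * 1) * (?N * M + M * ?N)"
    using b f(2) by (intro mult_left_mono add_mono mult_right_mono) auto
  finally show ?thesis by (simp add: algebra_simps)
qed

lemma rate_lipschitz:
  assumes l: "l \<in> U" and t: "s \<in> {0..T}" "t \<in> {0..T}"
    and f: "bdd_measurable f" "0 \<le> c" "\<forall>x>0. \<bar>f x\<bar> \<le> c * \<phi> x"
  shows "\<bar>rate l f s - rate l f t\<bar> \<le> c * rate_const * \<bar>s - t\<bar>"
proof -
  have "8 * c * M * norm1 (pw 2) (\<lambda>A. m l s A - m l t A) \<le> 8 * c * M * (3 * M ^ 2 * \<bar>s - t\<bar>)"
    using time_lipschitz[OF l t(2,1)] M0 f(2) by (intro mult_left_mono) auto
  also have "\<dots> = 2 * (c * rate_const * \<bar>s - t\<bar>)" by (simp add: rate_const_def power2_eq_square power3_eq_cube)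
  finally have "\<bar>coag_form f (K l) (m l s) (m l s) - coag_form f (K l) (m l t) (m l t)\<bar>
      \<le> 2 * (c * rate_const * \<bar>s - t\<bar>)"
    using coagulation_lipschitz[OF l l t f] by linarith
  then show ?thesis unfolding rate_def by linarith
qed

text \<open>
  Taylor's formula with the remainder estimated against \<open>c\<close>, that is, in the norm dual to
  the space of test functions below \<open>\<phi>\<close>. The equation gives derivatives for single
  test functions; this uniformity turns them into a derivative in the norm.
\<close>

lemma rate_taylor:
  assumes l: "l \<in> U" and t: "s \<in> {0..T}" "t \<in> {0..T}"
    and f: "bdd_measurable f" "0 \<le> c" "\<forall>x>0. \<bar>f x\<bar> \<le> c * \<phi> x"
  shows "\<bar>signed_integral (m l s) f - signed_integral (m l t) f - (s - t) * rate l f t\<bar> \<le> c * rate_const * \<bar>s - t\<bar> * \<bar>s - t\<bar>"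
proof -
  let ?I = "{min s t..max s t}"
  have I: "?I \<subseteq> {0..T}" using t by auto
  have "norm ((signed_integral (m l s) f - s * rate l f t) - (signed_integral (m l t) f - t * rate l f t)) \<le> (c * rate_const * \<bar>s - t\<bar>) * norm (s - t)"
  proof (rule field_differentiable_bound[where S="?I"])
    show "convex ?I" by simp
    show "s \<in> ?I" "t \<in> ?I" by auto
    fix u assume u: "u \<in> ?I"
    have uT: "u \<in> {0..T}" using u I by blast
    have "((\<lambda>s. signed_integral (m l s) f) has_real_derivative rate l f u) (at u within ?I)"
      unfolding rate_def by (rule DERIV_subset[OF m_deriv[OF l uT f(1)] I])
    then show "((\<lambda>u. signed_integral (m l u) f - u * rate l f t) has_real_derivative (rate l f u - rate l f t)) (at u within ?I)"
      by (auto intro!: derivative_eq_intros)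
    have "\<bar>rate l f u - rate l f t\<bar> \<le> c * rate_const * \<bar>u - t\<bar>" by (rule rate_lipschitz[OF l uT t(2) f])
    also have "\<dots> \<le> c * rate_const * \<bar>s - t\<bar>"
      using u f(2) rate_const_nonneg by (intro mult_left_mono) auto
    finally show "norm (rate l f u - rate l f t) \<le> c * rate_const * \<bar>s - t\<bar>" by simp
  qed
  then show ?thesis by (simp add: algebra_simps)
qed

text \<open>
  The steps \<open>h k\<close> point into the interval, to the right unless \<open>t = T\<close>.
  By Taylor's formula the difference quotients are Cauchy with speed proportional to
  \<open>|h k|\<close>.
\<close>

lemma time_deriv_exists:
  assumes l: "l \<in> U" and t: "t \<in> {0..T}" and T: "0 < T"
  shows "\<exists>L\<in>M1 \<phi>. \<forall>f. bdd_measurable f \<longrightarrow> signed_integral L f = rate l f t"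
proof -
  define h where "h k = (if t < T then (T - t) / real (Suc k) else - T / real (Suc k))" for k
  have le: "x / real (Suc k) \<le> x" if "0 \<le> x" for x k using that by (simp add: divide_le_eq mult_le_cancel_left1)
  have h: "h k \<noteq> 0" "t + h k \<in> {0..T}" for k
    using t T le[of "T - t" k] le[of T k] by (auto simp: h_def)
  have hl: "(\<lambda>k. \<bar>h k\<bar>) \<longlonglongrightarrow> 0"
  proof -
    have "h = (\<lambda>k. (if t < T then T - t else - T) / real (Suc k))" by (auto simp: h_def fun_eq_iff)
    then have "h \<longlonglongrightarrow> 0" using LIMSEQ_Suc[OF lim_const_over_n[of "if t < T then T - t else - T"]] by simp
    then show ?thesis by (rule tendsto_rabs_zero)
  qed
  define q where "q k A = 1 / h k * (m l (t + h k) A - m l t A)" for k A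
  have q: "q k \<in> M1 \<phi>" for k
    unfolding q_def by (rule M1_scale(1)[OF m_diff(2)[OF l l h(2) t] phi_weight])
  have fsd: "finite_signed_measure (\<lambda>A. m l (t + h k) A - m l t A)" for k
    by (rule M1_finite_signed_measure[OF m_diff(2)[OF l l h(2) t] phi_weight])
  have qf: "\<bar>signed_integral (q k) f - rate l f t\<bar> \<le> c * rate_const * \<bar>h k\<bar>"
    if f: "bdd_measurable f" "0 \<le> c" "\<forall>x>0. \<bar>f x\<bar> \<le> c * \<phi> x" for k f c
  proof -
    have "signed_integral (q k) f = 1 / h k * signed_integral (\<lambda>A. m l (t + h k) A - m l t A) f"
      using signed_integral_lincomb_bdd[OF fsd fsd f(1), of "1 / h k" k 0 k] by (simp add: q_def[abs_def])
    also have "\<dots> = 1 / h k * (signed_integral (m l (t + h k)) f - signed_integral (m l t) f)"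
      by (simp add: signed_integral_diff_bdd[OF m_phi(1)[OF l h(2)] m_phi(1)[OF l t] phi_weight f(1)])
    finally have "signed_integral (q k) f - rate l f t = 1 / h k * (signed_integral (m l (t + h k)) f - signed_integral (m l t) f - (t + h k - t) * rate l f t)"
      using h(1)[of k] by (simp add: right_diff_distrib)
    then have "\<bar>signed_integral (q k) f - rate l f t\<bar> = \<bar>1 / h k\<bar> * \<bar>signed_integral (m l (t + h k)) f - signed_integral (m l t) f - (t + h k - t) * rate l f t\<bar>"
      by (simp only: abs_mult)
    also have "\<dots> \<le> \<bar>1 / h k\<bar> * (c * rate_const * \<bar>t + h k - t\<bar> * \<bar>t + h k - t\<bar>)"
      by (intro mult_left_mono rate_taylor[OF l h(2) t f]) auto
    also have "\<dots> = c * rate_const * \<bar>h k\<bar>" using h(1)[of k] by (simp add: field_simps)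
    finally show ?thesis .
  qed
  have "norm1 \<phi> (\<lambda>A. q i A - q j A) \<le> rate_const * \<bar>h i\<bar> + rate_const * \<bar>h j\<bar>" for i j
  proof (rule norm1_leI(2)[OF M1_finite_signed_measure[OF M1_diff(1)[OF q q phi_weight] phi_weight] phi_weight])
    fix f assume f: "bdd_measurable f" "\<forall>x>0. \<bar>f x\<bar> \<le> \<phi> x"
    then have f': "\<forall>x>0. \<bar>f x\<bar> \<le> 1 * \<phi> x" by simp
    show "signed_integral (\<lambda>A. q i A - q j A) f \<le> rate_const * \<bar>h i\<bar> + rate_const * \<bar>h j\<bar>"
      unfolding signed_integral_diff_bdd[OF q q phi_weight f(1)]
      using qf[OF f(1) zero_le_one f', of i] qf[OF f(1) zero_le_one f', of j] by linarith
  qed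
  moreover have "(\<lambda>k. rate_const * \<bar>h k\<bar>) \<longlonglongrightarrow> 0" using tendsto_mult[OF tendsto_const hl] by simp
  ultimately obtain L where L: "L \<in> M1 \<phi>" "\<And>k. norm1 \<phi> (\<lambda>A. q k A - L A) \<le> rate_const * \<bar>h k\<bar>"
    using M1_complete[where \<nu>=q and r="\<lambda>k. rate_const * \<bar>h k\<bar>", OF phi_weight q] by blast
  have "signed_integral L f = rate l f t" if f: "bdd_measurable f" for f
  proof -
    have fm: "f \<in> borel_measurable pos_borel" using f by (simp add: bdd_measurable_def)
    obtain B where B: "0 \<le> B" "\<forall>x>0. \<bar>f x\<bar> \<le> B * \<phi> x" by (rule bdd_measurable_phi_bound[OF f])
    have "\<bar>signed_integral L f - rate l f t\<bar> \<le> 2 * B * rate_const * \<bar>h k\<bar>" for k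
    proof -
      have "\<bar>signed_integral (\<lambda>A. q k A - L A) f\<bar> \<le> B * norm1 \<phi> (\<lambda>A. q k A - L A)"
        using B(2) by (intro signed_integral_bound[OF M1_diff(1)[OF q L(1) phi_weight] phi_weight fm]) auto
      also have "\<dots> \<le> B * (rate_const * \<bar>h k\<bar>)" by (rule mult_left_mono[OF L(2) B(1)])
      finally show ?thesis using qf[OF f B, of k] by (simp add: signed_integral_diff_bdd[OF q L(1) phi_weight f])
    qed
    moreover have "(\<lambda>k. 2 * B * rate_const * \<bar>h k\<bar>) \<longlonglongrightarrow> 0" using tendsto_mult[OF tendsto_const hl] by simp
    ultimately have "\<bar>signed_integral L f - rate l f t\<bar> \<le> 0" by (intro LIMSEQ_le_const) auto
    then show ?thesis by simp
  qed
  with L(1) show ?thesis by blast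
qed

text \<open>
  For \<open>T = 0\<close> there are no increments in time and any value is a derivative; 0 is
  chosen.
\<close>

definition time_deriv :: "real^'p \<Rightarrow> real \<Rightarrow> real set \<Rightarrow> real" where
  "time_deriv l t = (if 0 < T then SOME L. L \<in> M1 \<phi> \<and> (\<forall>f. bdd_measurable f \<longrightarrow> signed_integral L f = rate l f t) else (\<lambda>A. 0))"

lemma time_deriv:
  assumes l: "l \<in> U" and t: "t \<in> {0..T}"
  shows time_deriv_M1: "time_deriv l t \<in> M1 \<phi>"
    and time_deriv_rate: "0 < T \<Longrightarrow> bdd_measurable f \<Longrightarrow> signed_integral (time_deriv l t) f = rate l f t"
proof -
  have d: "time_deriv l t \<in> M1 \<phi> \<and> (\<forall>f. bdd_measurable f \<longrightarrow> signed_integral (time_deriv l t) f = rate l f t)" if T: "0 < T"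
  proof -
    have "\<exists>L. L \<in> M1 \<phi> \<and> (\<forall>f. bdd_measurable f \<longrightarrow> signed_integral L f = rate l f t)"
      using time_deriv_exists[OF l t T] by blast
    from someI_ex[OF this] show ?thesis using T by (simp add: time_deriv_def)
  qed
  have "(\<lambda>A. 0 * m l t A) \<in> M1 \<phi>" by (rule M1_scale(1)[OF m_phi(1)[OF l t] phi_weight])
  then show "time_deriv l t \<in> M1 \<phi>" using d by (cases "0 < T") (auto simp: time_deriv_def)
  show "0 < T \<Longrightarrow> bdd_measurable f \<Longrightarrow> signed_integral (time_deriv l t) f = rate l f t" using d by blast
qed

lemma time_deriv_taylor:
  assumes l: "l \<in> U" and t: "s \<in> {0..T}" "t \<in> {0..T}"
  shows "norm1 \<phi> (\<lambda>A. (m l s A - m l t A) - (s - t) * time_deriv l t A) \<le> rate_const * \<bar>s - t\<bar> * \<bar>s - t\<bar>"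
proof (cases "0 < T")
  case True
  have D: "(\<lambda>A. m l s A - m l t A) \<in> M1 \<phi>" by (rule m_diff(2)[OF l l t])
  note E = M1_scale(1)[OF time_deriv_M1[OF l t(2)] phi_weight, of "s - t"]
  show ?thesis
  proof (rule norm1_leI(2)[OF M1_finite_signed_measure[OF M1_diff(1)[OF D E phi_weight] phi_weight] phi_weight])
    fix f assume f: "bdd_measurable f" "\<forall>x>0. \<bar>f x\<bar> \<le> \<phi> x"
    then have f': "\<forall>x>0. \<bar>f x\<bar> \<le> 1 * \<phi> x" by simp
    note fs = M1_finite_signed_measure[OF time_deriv_M1[OF l t(2)] phi_weight]
    have "signed_integral (\<lambda>A. (s - t) * time_deriv l t A) f = (s - t) * rate l f t"
      using signed_integral_lincomb_bdd[OF fs fs f(1), of "s - t" 0] time_deriv_rate[OF l t(2) True f(1)] by simp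
    then have "signed_integral (\<lambda>A. (m l s A - m l t A) - (s - t) * time_deriv l t A) f =
        signed_integral (m l s) f - signed_integral (m l t) f - (s - t) * rate l f t"
      by (simp add: signed_integral_diff_bdd[OF D E phi_weight f(1)]
          signed_integral_diff_bdd[OF m_phi(1)[OF l t(1)] m_phi(1)[OF l t(2)] phi_weight f(1)])
    then show "signed_integral (\<lambda>A. (m l s A - m l t A) - (s - t) * time_deriv l t A) f \<le> rate_const * \<bar>s - t\<bar> * \<bar>s - t\<bar>"
      using rate_taylor[OF l t f(1) zero_le_one f'] by simp
  qed
next
  case False
  then have "s = 0" "t = 0" using t T0 by auto
  then have "(\<lambda>A. (m l s A - m l t A) - (s - t) * time_deriv l t A) = (\<lambda>A. 0 * m l t A)" by auto
  then show ?thesis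
    using M1_scale(2)[OF m_phi(1)[OF l t(2)] phi_weight, of 0] \<open>s = 0\<close> \<open>t = 0\<close> by simp
qed

lemma time_deriv_lipschitz:
  assumes d: "ball l0 d \<subseteq> U" and l: "l \<in> ball l0 d" and l0: "l0 \<in> ball l0 d" and t: "t \<in> {0..T}" "t0 \<in> {0..T}"
  shows "norm1 \<phi> (\<lambda>A. time_deriv l t A - time_deriv l0 t0 A) \<le>
    2 * real CARD('p) * M ^ 2 * norm (l - l0) + 4 * M * (lambda_const * norm (l - l0) + 3 * M ^ 2 * \<bar>t - t0\<bar>)"
    (is "_ \<le> ?R")
proof -
  have lU: "l \<in> U" "l0 \<in> U" using d l l0 by auto
  note M = time_deriv_M1[OF lU(1) t(1)] time_deriv_M1[OF lU(2) t(2)]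
  note fs = M1_finite_signed_measure[OF M1_diff(1)[OF M phi_weight] phi_weight]
  have R0: "0 \<le> ?R" using M0 lambda_const_nonneg by simp
  show ?thesis
  proof (rule norm1_leI(2)[OF fs phi_weight])
    fix f assume f: "bdd_measurable f" "\<forall>x>0. \<bar>f x\<bar> \<le> \<phi> x"
    then have f': "\<forall>x>0. \<bar>f x\<bar> \<le> 1 * \<phi> x" by simp
    have fm: "f \<in> borel_measurable pos_borel" using f(1) by (simp add: bdd_measurable_def)
    show "signed_integral (\<lambda>A. time_deriv l t A - time_deriv l0 t0 A) f \<le> ?R"
    proof (cases "0 < T")
      case False
      then show ?thesis using R0 signed_integral_diff_bdd[OF M phi_weight f(1)] by (simp add: time_deriv_def)
    next
      case True
      let ?G = "\<lambda>k. coag_form f k"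
      obtain k1 where k1: "0 \<le> k1" "kernel_bound (\<lambda>x y. brace f x y * K l x y) k1 \<phi> \<phi>"
        using kernel_bound_K[OF lU(1) f(1)] by blast
      obtain k0 where k0: "0 \<le> k0" "kernel_bound (\<lambda>x y. brace f x y * K l0 x y) k0 \<phi> \<phi>"
        using kernel_bound_K[OF lU(2) f(1)] by blast
      note m1 = m_phi(1)[OF lU(1) t(1)]
      have q: "m l t \<in> M1 (pw 2)" using m_M1_le lU t by auto
      have b: "norm1 (pw 2) (m l t) \<le> M" using m_bound_le lU t by auto
      have s1: "?G (\<lambda>x y. K l x y - K l0 x y) (m l t) (m l t) = ?G (K l) (m l t) (m l t) - ?G (K l0) (m l t) (m l t)"
        by (rule bilin_split_kernel[OF m1 m1 k1(2) k0(2)])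
      have kb: "kernel_bound (\<lambda>x y. brace f x y * (K l x y - K l0 x y)) (4 * 1 * (real CARD('p) * norm (l - l0))) (pw 2) (pw 2)"
        using f' by (intro kernel_bound_phi[OF K_diff_measurable[OF lU] K_lipschitz[OF d l l0] _ _ fm]) auto
      have "\<bar>?G (\<lambda>x y. K l x y - K l0 x y) (m l t) (m l t)\<bar> \<le> 4 * 1 * (real CARD('p) * norm (l - l0)) * norm1 (pw 2) (m l t) * norm1 (pw 2) (m l t)"
        by (rule bilin_bound[OF q weight_pw q weight_pw kb])
      also have "\<dots> \<le> 4 * 1 * (real CARD('p) * norm (l - l0)) * M * M"
        using b M0 by (intro mult_mono) auto
      finally have e1: "\<bar>?G (\<lambda>x y. K l x y - K l0 x y) (m l t) (m l t)\<bar> \<le> 4 * real CARD('p) * M ^ 2 * norm (l - l0)"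
        by (simp add: power2_eq_square ac_simps)
      have N: "norm1 (pw 2) (\<lambda>A. m l0 t0 A - m l t A) \<le> lambda_const * norm (l - l0) + 3 * M ^ 2 * \<bar>t - t0\<bar>"
      proof -
        have "norm1 (pw 2) (\<lambda>A. m l0 t0 A - m l t A) = norm1 (pw 2) (\<lambda>A. m l t A - m l0 t0 A)"
          using m_M1_le lU t by (intro norm1_minus_commute weight_pw) auto
        also have "\<dots> \<le> norm1 (pw 2) (\<lambda>A. m l t A - m l0 t A) + norm1 (pw 2) (\<lambda>A. m l0 t A - m l0 t0 A)"
          using m_M1_le lU t by (intro norm1_triangle weight_pw) auto
        also have "\<dots> \<le> lambda_const * norm (l - l0) + 3 * M ^ 2 * \<bar>t - t0\<bar>"
          by (intro add_mono lambda_lipschitz[OF d l l0 t(1)] time_lipschitz[OF lU(2) t(2,1)])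
        finally show ?thesis .
      qed
      have "\<bar>?G (K l0) (m l0 t0) (m l0 t0) - ?G (K l0) (m l t) (m l t)\<bar> \<le> 8 * 1 * M * norm1 (pw 2) (\<lambda>A. m l0 t0 A - m l t A)"
        by (rule coagulation_lipschitz[OF lU(2,1) t(2,1) f(1) zero_le_one f'])
      also have "\<dots> \<le> 8 * 1 * M * (lambda_const * norm (l - l0) + 3 * M ^ 2 * \<bar>t - t0\<bar>)"
        using N M0 by (intro mult_left_mono) auto
      finally have e2: "\<bar>?G (K l0) (m l0 t0) (m l0 t0) - ?G (K l0) (m l t) (m l t)\<bar> \<le> 8 * M * (lambda_const * norm (l - l0) + 3 * M ^ 2 * \<bar>t - t0\<bar>)"
        by simp
      have "signed_integral (\<lambda>A. time_deriv l t A - time_deriv l0 t0 A) f = rate l f t - rate l0 f t0"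
        using signed_integral_diff_bdd[OF M phi_weight f(1)] time_deriv_rate[OF lU(1) t(1) True f(1)] time_deriv_rate[OF lU(2) t(2) True f(1)] by simp
      also have "\<dots> \<le> ?R" using e1 e2 unfolding s1 rate_def by linarith
      finally show ?thesis .
    qed
  qed
qed

definition total_deriv :: "real \<times> (real^'p) \<Rightarrow> real \<times> (real^'p) \<Rightarrow> real set \<Rightarrow> real" where
  "total_deriv z w A = fst w * time_deriv (snd z) (fst z) A + sensitivity (snd z) (snd w) (fst z) A"

lemma total_deriv_bounded_linear:
  assumes "t \<in> {0..T}" "l \<in> U"
  shows "M1_bounded_linear \<phi> (total_deriv (t, l))"
  unfolding M1_bounded_linear_def
proof (intro conjI allI)
  note d = time_deriv_M1[OF assms(2,1)] and s = sensitivity_M1[OF assms(2,1)]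
  show "total_deriv (t, l) h \<in> M1 \<phi>" for h
    using M1_lincomb(1)[OF d s[of "snd h"] phi_weight, of "fst h" 1] by (simp add: total_deriv_def[abs_def])
  show "total_deriv (t, l) (h + k) A = total_deriv (t, l) h A + total_deriv (t, l) k A" for h k A
    using sensitivity_lincomb[OF assms(2,1), of 1 "snd h" 1 "snd k"] by (simp add: total_deriv_def algebra_simps)
  show "total_deriv (t, l) (c *\<^sub>R h) A = c * total_deriv (t, l) h A" for c h A
    using sensitivity_scale[OF assms(2,1), of c "snd h" A] by (simp add: total_deriv_def algebra_simps)
  show "\<exists>C. \<forall>h. norm1 \<phi> (total_deriv (t, l) h) \<le> C * norm h"
  proof (intro exI allI)
    fix h :: "real \<times> (real^'p)"
    have "norm1 \<phi> (total_deriv (t, l) h) \<le> \<bar>fst h\<bar> * norm1 \<phi> (time_deriv l t) + \<bar>1\<bar> * norm1 \<phi> (sensitivity l (snd h) t)"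
      using M1_lincomb(2)[OF d s[of "snd h"] phi_weight, of "fst h" 1] by (simp add: total_deriv_def[abs_def])
    also have "\<dots> \<le> norm h * norm1 \<phi> (time_deriv l t) + \<bar>1\<bar> * ((lambda_const + 1) * norm h)"
    proof (intro add_mono mult_right_mono mult_left_mono)
      show "\<bar>fst h\<bar> \<le> norm h" using norm_fst_le[of "fst h" "snd h"] by simp
      have "norm1 \<phi> (sensitivity l (snd h) t) \<le> (lambda_const + 1) * norm (snd h)" by (rule sensitivity_bound[OF assms(2,1)])
      also have "\<dots> \<le> (lambda_const + 1) * norm h"
        using norm_snd_le[of "snd h" "fst h"] lambda_const_nonneg by (intro mult_left_mono) auto
      finally show "norm1 \<phi> (sensitivity l (snd h) t) \<le> (lambda_const + 1) * norm h" .
    qed auto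
    finally show "norm1 \<phi> (total_deriv (t, l) h) \<le> (norm1 \<phi> (time_deriv l t) + lambda_const + 1) * norm h"
      by (simp add: algebra_simps)
  qed
qed

text \<open>
  The increment is the sum of the increment in the parameter at time \<open>t\<close> and the
  increment in time at \<open>l0\<close>. The first is approximated by the sensitivity at time
  \<open>t\<close>, which is replaced by that at \<open>t0\<close> by continuity in time.
\<close>

lemma flow_has_derivative:
  assumes t0: "t0 \<in> {0..T}" and l0: "l0 \<in> U"
  shows "M1_has_derivative \<phi> (\<lambda>(t, l). m l t) (total_deriv (t0, l0)) (t0, l0) ({0..T} \<times> U)"
  unfolding M1_has_derivative_def
proof (intro conjI total_deriv_bounded_linear t0 l0 tendstoI)
  fix e :: real assume e: "0 < e"
  let ?E = "\<lambda>w. norm1 \<phi> (\<lambda>A. (case w of (t, l) \<Rightarrow> m l t) A - (case (t0, l0) of (t, l) \<Rightarrow> m l t) A - total_deriv (t0, l0) (w - (t0, l0)) A)"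
  have e4: "0 < e / 4" using e by simp
  obtain d where d: "d > 0" "ball l0 d \<subseteq> U"
    and sd: "\<forall>l1\<in>ball l0 d. \<forall>l2\<in>ball l0 d. \<forall>t\<in>{0..T}.
    norm1 \<phi> (\<lambda>A. (m l1 t A - m l2 t A) - sensitivity l0 (l1 - l2) t A) \<le> e / 4 * norm (l1 - l2)"
    using strict_derivative[OF l0 e4] by (elim exE conjE) (rule that)
  obtain \<delta> where \<delta>: "\<delta> > 0" and st: "\<forall>s\<in>{0..T}. \<forall>t\<in>{0..T}. \<bar>t - s\<bar> < \<delta> \<longrightarrow> (\<forall>v.
    norm1 \<phi> (\<lambda>A. sensitivity l0 v t A - sensitivity l0 v s A) \<le> e / 4 * norm v)"
    using sensitivity_continuous_time[OF l0 e4] by (elim exE conjE) (rule that)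
  define r where "r = min d (min \<delta> (e / (4 * (rate_const + 1))))"
  have r: "0 < r" using d(1) \<delta> e rate_const_nonneg by (simp add: r_def)
  have rc: "rate_const * r \<le> e / 4"
  proof -
    have "rate_const * r \<le> (rate_const + 1) * (e / (4 * (rate_const + 1)))"
      using rate_const_nonneg r e by (intro mult_mono) (auto simp: r_def)
    also have "\<dots> = e / 4"
    proof -
      have "c * (e / (4 * c)) = e / 4" if "0 < c" for c :: real using that by simp
      then show ?thesis using rate_const_nonneg by (meson add_nonneg_pos zero_less_one)
    qed
    finally show ?thesis .
  qed
  show "\<forall>\<^sub>F w in at (t0, l0) within {0..T} \<times> U. dist (?E w / norm (w - (t0, l0))) 0 < e"
    unfolding eventually_at
  proof (intro exI[of _ r] conjI ballI impI r)
    fix w assume w: "w \<in> {0..T} \<times> U" and wd: "w \<noteq> (t0, l0) \<and> dist w (t0, l0) < r"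
    obtain t l where tl: "w = (t, l)" by (cases w)
    have t: "t \<in> {0..T}" and l: "l \<in> U" using w tl by auto
    let ?n = "norm (w - (t0, l0))"
    have n0: "0 < ?n" using wd by simp
    have nt: "\<bar>t - t0\<bar> \<le> ?n" "norm (l - l0) \<le> ?n"
      using norm_fst_le[of "t - t0" "l - l0"] norm_snd_le[of "l - l0" "t - t0"] by (auto simp: tl)
    have nr: "?n < r" using wd by (simp add: dist_norm)
    have lb: "l \<in> ball l0 d" "l0 \<in> ball l0 d" using nt nr d(1) by (auto simp: r_def dist_norm norm_minus_commute)
    have td: "\<bar>t - t0\<bar> < \<delta>" using nt nr by (simp add: r_def)
    have a1: "norm1 \<phi> (\<lambda>A. (m l t A - m l0 t A) - sensitivity l0 (l - l0) t A) \<le> e / 4 * ?n"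
      using sd[THEN bspec, THEN bspec, THEN bspec, OF lb t] mult_left_mono[OF nt(2), of "e / 4"] e by linarith
    have a2: "norm1 \<phi> (\<lambda>A. sensitivity l0 (l - l0) t A - sensitivity l0 (l - l0) t0 A) \<le> e / 4 * ?n"
      using st[THEN bspec, THEN bspec, OF t0 t, THEN mp, OF td, THEN spec, of "l - l0"] mult_left_mono[OF nt(2), of "e / 4"] e by linarith
    have a3: "norm1 \<phi> (\<lambda>A. (m l0 t A - m l0 t0 A) - (t - t0) * time_deriv l0 t0 A) \<le> e / 4 * ?n"
    proof -
      have "rate_const * \<bar>t - t0\<bar> * \<bar>t - t0\<bar> \<le> rate_const * r * ?n"
        using nt nr rate_const_nonneg r by (intro mult_mono mult_left_mono) auto
      also have "\<dots> \<le> e / 4 * ?n" by (rule mult_right_mono[OF rc]) simp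
      finally show ?thesis using time_deriv_taylor[OF l0 t t0] by linarith
    qed
    have M1: "(\<lambda>A. (m l t A - m l0 t A) - sensitivity l0 (l - l0) t A) \<in> M1 \<phi>"
      by (rule M1_diff(1)[OF m_diff(2)[OF l l0 t t] sensitivity_M1[OF l0 t] phi_weight])
    have M2: "(\<lambda>A. sensitivity l0 (l - l0) t A - sensitivity l0 (l - l0) t0 A) \<in> M1 \<phi>"
      by (rule M1_diff(1)[OF sensitivity_M1[OF l0 t] sensitivity_M1[OF l0 t0] phi_weight])
    have M3: "(\<lambda>A. (m l0 t A - m l0 t0 A) - (t - t0) * time_deriv l0 t0 A) \<in> M1 \<phi>"
      by (rule M1_diff(1)[OF m_diff(2)[OF l0 l0 t t0] M1_scale(1)[OF time_deriv_M1[OF l0 t0] phi_weight] phi_weight])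
    have eq: "(\<lambda>A. (case w of (t, l) \<Rightarrow> m l t) A - (case (t0, l0) of (t, l) \<Rightarrow> m l t) A - total_deriv (t0, l0) (w - (t0, l0)) A) =
       (\<lambda>A. 1 * (1 * ((m l t A - m l0 t A) - sensitivity l0 (l - l0) t A) + 1 * (sensitivity l0 (l - l0) t A - sensitivity l0 (l - l0) t0 A))
          + 1 * ((m l0 t A - m l0 t0 A) - (t - t0) * time_deriv l0 t0 A))"
      by (auto simp: tl total_deriv_def fun_eq_iff)
    have "?E w \<le> \<bar>1\<bar> * norm1 \<phi> (\<lambda>A. 1 * ((m l t A - m l0 t A) - sensitivity l0 (l - l0) t A) + 1 * (sensitivity l0 (l - l0) t A - sensitivity l0 (l - l0) t0 A))
        + \<bar>1\<bar> * norm1 \<phi> (\<lambda>A. (m l0 t A - m l0 t0 A) - (t - t0) * time_deriv l0 t0 A)"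
      unfolding eq by (rule M1_lincomb(2)[OF M1_lincomb(1)[OF M1 M2 phi_weight] M3 phi_weight])
    moreover have "norm1 \<phi> (\<lambda>A. 1 * ((m l t A - m l0 t A) - sensitivity l0 (l - l0) t A) + 1 * (sensitivity l0 (l - l0) t A - sensitivity l0 (l - l0) t0 A))
        \<le> \<bar>1\<bar> * norm1 \<phi> (\<lambda>A. (m l t A - m l0 t A) - sensitivity l0 (l - l0) t A) + \<bar>1\<bar> * norm1 \<phi> (\<lambda>A. sensitivity l0 (l - l0) t A - sensitivity l0 (l - l0) t0 A)"
      by (rule M1_lincomb(2)[OF M1 M2 phi_weight])
    ultimately have "?E w \<le> 3 * (e / 4 * ?n)" using a1 a2 a3 by linarith
    also have "\<dots> < e * ?n" using n0 e by simp
    finally have "?E w / ?n < e" using n0 by (simp add: divide_less_eq)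
    then show "dist (?E w / ?n) 0 < e" by simp
  qed
qed

lemma total_deriv_continuous:
  assumes t0: "t0 \<in> {0..T}" and l0: "l0 \<in> U" and e: "0 < e"
  shows "\<exists>r>0. \<forall>w\<in>{0..T} \<times> U. dist w (t0, l0) < r \<longrightarrow>
    (\<forall>h. norm1 \<phi> (\<lambda>A. total_deriv w h A - total_deriv (t0, l0) h A) \<le> e * norm h)"
proof -
  have e3: "0 < e / 3" using e by simp
  obtain d where d: "d > 0" "ball l0 d \<subseteq> U"
    and sl: "\<forall>l\<in>ball l0 d. \<forall>t\<in>{0..T}. \<forall>v. norm1 \<phi> (\<lambda>A. sensitivity l v t A - sensitivity l0 v t A) \<le> e / 3 * norm v"
    using sensitivity_continuous_lambda[OF l0 e3] by (elim exE conjE) (rule that)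
  obtain \<delta> where \<delta>: "\<delta> > 0" and st: "\<forall>s\<in>{0..T}. \<forall>t\<in>{0..T}. \<bar>t - s\<bar> < \<delta> \<longrightarrow> (\<forall>v.
    norm1 \<phi> (\<lambda>A. sensitivity l0 v t A - sensitivity l0 v s A) \<le> e / 3 * norm v)"
    using sensitivity_continuous_time[OF l0 e3] by (elim exE conjE) (rule that)
  define C where "C = 2 * real CARD('p) * M ^ 2 + 4 * M * (lambda_const + 3 * M ^ 2) + 1"
  have C: "1 \<le> C" using M0 lambda_const_nonneg by (simp add: C_def)
  define r where "r = min d (min \<delta> (e / (3 * C)))"
  have r: "0 < r" using d(1) \<delta> e C by (simp add: r_def)
  have rC: "C * r \<le> e / 3"
  proof -
    have "C * r \<le> C * (e / (3 * C))" using C by (intro mult_left_mono) (auto simp: r_def)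
    also have "\<dots> = e / 3" using C by simp
    finally show ?thesis .
  qed
  have "norm1 \<phi> (\<lambda>A. total_deriv w h A - total_deriv (t0, l0) h A) \<le> e * norm h"
    if w: "w \<in> {0..T} \<times> U" and wd: "dist w (t0, l0) < r" for w h
  proof -
    obtain t l where tl: "w = (t, l)" by (cases w)
    have t: "t \<in> {0..T}" and l: "l \<in> U" using w tl by auto
    let ?n = "norm (w - (t0, l0))"
    have nt: "\<bar>t - t0\<bar> \<le> ?n" "norm (l - l0) \<le> ?n"
      using norm_fst_le[of "t - t0" "l - l0"] norm_snd_le[of "l - l0" "t - t0"] by (auto simp: tl)
    have nr: "?n < r" using wd by (simp add: dist_norm)
    have lb: "l \<in> ball l0 d" "l0 \<in> ball l0 d" using nt nr d(1) by (auto simp: r_def dist_norm norm_minus_commute)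
    have td: "\<bar>t - t0\<bar> < \<delta>" using nt nr by (simp add: r_def)
    have ntr: "\<bar>t - t0\<bar> \<le> r" "norm (l - l0) \<le> r" using nt nr by auto
    have h1: "\<bar>fst h\<bar> \<le> norm h" "norm (snd h) \<le> norm h"
      using norm_fst_le[of "fst h" "snd h"] norm_snd_le[of "snd h" "fst h"] by auto
    have "norm1 \<phi> (\<lambda>A. time_deriv l t A - time_deriv l0 t0 A) \<le>
        2 * real CARD('p) * M ^ 2 * norm (l - l0) + 4 * M * (lambda_const * norm (l - l0) + 3 * M ^ 2 * \<bar>t - t0\<bar>)"
      by (rule time_deriv_lipschitz[OF d(2) lb t t0])
    also have "\<dots> \<le> 2 * real CARD('p) * M ^ 2 * r + 4 * M * (lambda_const * r + 3 * M ^ 2 * r)"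
      using ntr M0 lambda_const_nonneg by (intro add_mono mult_left_mono) auto
    also have "\<dots> = (C - 1) * r" by (simp add: C_def algebra_simps)
    also have "\<dots> \<le> C * r" using r by (simp add: algebra_simps)
    also have "\<dots> \<le> e / 3" by (rule rC)
    finally have a1: "norm1 \<phi> (\<lambda>A. time_deriv l t A - time_deriv l0 t0 A) \<le> e / 3" .
    have a2: "norm1 \<phi> (\<lambda>A. sensitivity l (snd h) t A - sensitivity l0 (snd h) t A) \<le> e / 3 * norm (snd h)"
      using sl lb(1) t by blast
    have a3: "norm1 \<phi> (\<lambda>A. sensitivity l0 (snd h) t A - sensitivity l0 (snd h) t0 A) \<le> e / 3 * norm (snd h)"
      using st[THEN bspec, THEN bspec, OF t0 t, THEN mp, OF td] by blast
    have s: "norm1 \<phi> (\<lambda>A. sensitivity l (snd h) t A - sensitivity l0 (snd h) t0 A) \<le> 2 * (e / 3 * norm h)"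
    proof -
      have "norm1 \<phi> (\<lambda>A. sensitivity l (snd h) t A - sensitivity l0 (snd h) t0 A) \<le>
          norm1 \<phi> (\<lambda>A. sensitivity l (snd h) t A - sensitivity l0 (snd h) t A) + norm1 \<phi> (\<lambda>A. sensitivity l0 (snd h) t A - sensitivity l0 (snd h) t0 A)"
        by (rule norm1_triangle[OF sensitivity_M1[OF l t] sensitivity_M1[OF l0 t] sensitivity_M1[OF l0 t0] phi_weight])
      then show ?thesis using a2 a3 mult_left_mono[OF h1(2), of "e / 3"] e by linarith
    qed
    have eq: "(\<lambda>A. total_deriv w h A - total_deriv (t0, l0) h A) =
        (\<lambda>A. fst h * (time_deriv l t A - time_deriv l0 t0 A) + 1 * (sensitivity l (snd h) t A - sensitivity l0 (snd h) t0 A))"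
      by (auto simp: tl total_deriv_def fun_eq_iff algebra_simps)
    have "norm1 \<phi> (\<lambda>A. total_deriv w h A - total_deriv (t0, l0) h A) \<le>
        \<bar>fst h\<bar> * norm1 \<phi> (\<lambda>A. time_deriv l t A - time_deriv l0 t0 A) + \<bar>1\<bar> * norm1 \<phi> (\<lambda>A. sensitivity l (snd h) t A - sensitivity l0 (snd h) t0 A)"
      unfolding eq by (rule M1_lincomb(2)[OF M1_diff(1)[OF time_deriv_M1[OF l t] time_deriv_M1[OF l0 t0] phi_weight]
            M1_diff(1)[OF sensitivity_M1[OF l t] sensitivity_M1[OF l0 t0] phi_weight] phi_weight])
    also have "\<bar>fst h\<bar> * norm1 \<phi> (\<lambda>A. time_deriv l t A - time_deriv l0 t0 A) \<le> norm h * (e / 3)"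
      using h1 a1 by (intro mult_mono) auto
    finally have "norm1 \<phi> (\<lambda>A. total_deriv w h A - total_deriv (t0, l0) h A) \<le> norm h * (e / 3) + 2 * (e / 3 * norm h)" using s by linarith
    then show ?thesis by simp
  qed
  with r show ?thesis by blast
qed

theorem flow_C1: "M1_C1 \<phi> ({0..T} \<times> U) (\<lambda>(t, l). m l t) total_deriv"
  unfolding M1_C1_def
proof (intro conjI ballI allI impI)
  fix z assume z: "z \<in> {0..T} \<times> U"
  obtain t l where tl: "z = (t, l)" "t \<in> {0..T}" "l \<in> U" using z by auto
  show "(case z of (t, l) \<Rightarrow> m l t) \<in> M1 \<phi>" using m_phi(1)[OF tl(3,2)] tl(1) by simp
  show "M1_has_derivative \<phi> (\<lambda>(t, l). m l t) (total_deriv z) z ({0..T} \<times> U)"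
    using flow_has_derivative[OF tl(2,3)] tl(1) by simp
  fix e :: real assume e: "0 < e"
  show "\<exists>d>0. \<forall>w\<in>{0..T} \<times> U. dist w z < d \<longrightarrow> (\<forall>h. norm1 \<phi> (\<lambda>A. total_deriv w h A - total_deriv z h A) \<le> e * norm h)"
    using total_deriv_continuous[OF tl(2,3) e] tl(1) by simp
qed

section \<open>The linearised equation\<close>

lemma sensitivity_norm_integrable:
  assumes l: "l \<in> U"
  shows "set_integrable lborel {0..T} (\<lambda>t. norm1 \<phi> (sensitivity l v t))"
proof (rule borel_integrable_atLeastAtMost')
  show "continuous_on {0..T} (\<lambda>t. norm1 \<phi> (sensitivity l v t))"
    unfolding continuous_on_iff
  proof (intro ballI allI impI)
    fix s e :: real assume s: "s \<in> {0..T}" and e: "0 < e"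
    have nv: "0 < norm v + 1" by (smt (verit) norm_ge_zero)
    then have "0 < e / (norm v + 1)" using e by simp
    from sensitivity_continuous_time[OF l this] obtain \<delta> where \<delta>: "\<delta> > 0"
      and st: "\<forall>s\<in>{0..T}. \<forall>t\<in>{0..T}. \<bar>t - s\<bar> < \<delta> \<longrightarrow> (\<forall>v'.
        norm1 \<phi> (\<lambda>A. sensitivity l v' t A - sensitivity l v' s A) \<le> e / (norm v + 1) * norm v')"
      by (elim exE conjE) (rule that)
    show "\<exists>d>0. \<forall>t\<in>{0..T}. dist t s < d \<longrightarrow> dist (norm1 \<phi> (sensitivity l v t)) (norm1 \<phi> (sensitivity l v s)) < e"
    proof (intro exI[of _ \<delta>] conjI ballI impI \<delta>)
      fix t assume t: "t \<in> {0..T}" and d: "dist t s < \<delta>"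
      note S = sensitivity_M1[OF l s, of v] and R = sensitivity_M1[OF l t, of v]
      let ?N = "norm1 \<phi> (\<lambda>A. sensitivity l v t A - sensitivity l v s A)"
      have "?N \<le> e / (norm v + 1) * norm v" using st s t d by (auto simp: dist_real_def)
      also have "\<dots> < e / (norm v + 1) * (norm v + 1)" using e nv by (intro mult_strict_left_mono) auto
      also have "\<dots> = e" using nv by simp
      finally have N: "?N < e" .
      have "norm1 \<phi> (\<lambda>A. 1 * sensitivity l v s A + 1 * (sensitivity l v t A - sensitivity l v s A)) \<le> \<bar>1\<bar> * norm1 \<phi> (sensitivity l v s) + \<bar>1\<bar> * ?N"
        by (rule M1_lincomb(2)[OF S M1_diff(1)[OF R S phi_weight] phi_weight])
      moreover have "norm1 \<phi> (\<lambda>A. 1 * sensitivity l v t A + (-1) * (sensitivity l v t A - sensitivity l v s A)) \<le> \<bar>1\<bar> * norm1 \<phi> (sensitivity l v t) + \<bar>-1\<bar> * ?N"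
        by (rule M1_lincomb(2)[OF R M1_diff(1)[OF R S phi_weight] phi_weight])
      ultimately show "dist (norm1 \<phi> (sensitivity l v t)) (norm1 \<phi> (sensitivity l v s)) < e"
        using N by (simp add: dist_real_def abs_less_iff)
    qed
  qed
qed

lemma sensitivity_equation:
  assumes l: "l \<in> U" and f: "bdd_measurable f"
  shows "set_integrable lborel {0..T} (\<lambda>u. coag_form f (K l) (m l u) (sensitivity l v u))" (is ?A)
    and "set_integrable lborel {0..T} (source l v f)" (is ?B)
    and "t \<in> {0..T} \<Longrightarrow> signed_integral (sensitivity l v t) f = signed_integral (sensitivity l v 0) f +
      (LINT u:{0..t}|lborel. coag_form f (K l) (m l u) (sensitivity l v u)) + (LINT u:{0..t}|lborel. source l v f u)"
proof -
  let ?b = "\<lambda>u. coag_form f (K l) (m l u) (sensitivity l v u)"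
  obtain g where g: "set_integrable lborel {0..T} g"
    "\<And>s t. 0 \<le> s \<Longrightarrow> s \<le> t \<Longrightarrow> t \<le> T \<Longrightarrow>
          signed_integral (sensitivity l v t) f - signed_integral (sensitivity l v s) f = (LINT u:{s..t}|lborel. g u)"
    "\<And>u c. u \<in> {0..T} \<Longrightarrow> 0 \<le> c \<Longrightarrow> (\<forall>x>0. \<bar>f x\<bar> \<le> c * \<phi> x) \<Longrightarrow>
          \<bar>g u - ?b u - source l v f u\<bar> \<le> c * 0"
    by (rule linearised_up_toE[OF sensitivity_linearised[OF l] f]) (rule that)
  obtain B where B: "0 \<le> B" "\<forall>x>0. \<bar>f x\<bar> \<le> B * \<phi> x" by (rule bdd_measurable_phi_bound[OF f])
  have e: "?b u = g u - source l v f u" if "u \<in> {0..T}" for u using g(3)[OF that B] by simp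
  show s: ?B by (rule borel_integrable_atLeastAtMost'[OF source_continuous[OF l f]])
  have d: "set_integrable lborel {0..T} (\<lambda>u. g u - source l v f u)" by (rule set_integral_diff(1)[OF g(1) s])
  then show A: ?A
    unfolding set_integrable_def
    by (rule Bochner_Integration.integrable_cong[THEN iffD1, rotated 2]) (auto simp: e split: split_indicator)
  assume t: "t \<in> {0..T}"
  have t': "0 \<le> (0::real)" "t \<le> T" using t by auto
  have "(LINT u:{0..t}|lborel. g u) = (LINT u:{0..t}|lborel. ?b u + source l v f u)"
    unfolding set_lebesgue_integral_def using t
    by (intro Bochner_Integration.integral_cong) (auto simp: e split: split_indicator)
  also have "\<dots> = (LINT u:{0..t}|lborel. ?b u) + (LINT u:{0..t}|lborel. source l v f u)"
    by (rule set_integral_add(2)[OF set_integrable_Icc_subset[OF A t'] set_integrable_Icc_subset[OF s t']])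
  finally show "signed_integral (sensitivity l v t) f = signed_integral (sensitivity l v 0) f +
      (LINT u:{0..t}|lborel. ?b u) + (LINT u:{0..t}|lborel. source l v f u)"
    using g(2)[of 0 t] t by simp
qed

text \<open>
  A solution of the integrated equation whose norm is merely integrable in time is an approximate
  solution with error 0, so stability applies to it.
\<close>

lemma sensitivity_unique:
  assumes l: "l \<in> U" and M: "\<And>t. t \<in> {0..T} \<Longrightarrow> \<rho> t \<in> M1 \<phi>" and init: "\<rho> 0 = sensitivity l v 0"
    and N: "set_integrable lborel {0..T} (\<lambda>t. norm1 \<phi> (\<rho> t))"
    and b: "\<And>f. bdd_measurable f \<Longrightarrow> set_integrable lborel {0..T} (\<lambda>u. coag_form f (K l) (m l u) (\<rho> u))"
    and eq: "\<And>f t. bdd_measurable f \<Longrightarrow> t \<in> {0..T} \<Longrightarrow> signed_integral (\<rho> t) f = signed_integral (\<rho> 0) f +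
      (LINT u:{0..t}|lborel. coag_form f (K l) (m l u) (\<rho> u)) + (LINT u:{0..t}|lborel. source l v f u)"
    and t: "t \<in> {0..T}"
  shows "\<rho> t = sensitivity l v t"
proof (rule linearised_unique[OF l _ sensitivity_linearised[OF l] t])
  show "linearised_up_to l v 0 \<rho>"
    unfolding linearised_up_to_def
  proof (intro conjI allI impI ballI)
    show "\<rho> 0 A = 0" for A using init linearised_init[OF sensitivity_linearised[OF l]] by simp
    show "\<rho> t \<in> M1 \<phi>" if "t \<in> {0..T}" for t by (rule M[OF that])
    show "\<exists>X. set_integrable lborel {0..T} X \<and> (\<forall>t\<in>{0..T}. norm1 \<phi> (\<rho> t) \<le> X t)" using N by blast
    fix f assume f: "bdd_measurable f"
    let ?b = "\<lambda>u. coag_form f (K l) (m l u) (\<rho> u)"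
    note s = sensitivity_equation(2)[OF l f, of v]
    have i: "set_integrable lborel {0..T} (\<lambda>u. ?b u + source l v f u)" by (rule set_integral_add(1)[OF b[OF f] s])
    have "signed_integral (\<rho> t) f - signed_integral (\<rho> s) f = (LINT u:{s..t}|lborel. ?b u + source l v f u)"
      if st: "0 \<le> s" "s \<le> t" "t \<le> T" for s t
    proof -
      have *: "signed_integral (\<rho> r) f = signed_integral (\<rho> 0) f + (LINT u:{0..r}|lborel. ?b u + source l v f u)" if r: "r \<in> {0..T}" for r
      proof -
        have r': "0 \<le> (0::real)" "r \<le> T" using r by auto
        show ?thesis unfolding eq[OF f r]
          by (simp add: set_integral_add(2)[OF set_integrable_Icc_subset[OF b[OF f] r'] set_integrable_Icc_subset[OF s r']])
      qed
      show ?thesis using *[of s] *[of t] set_integral_Icc_diff[OF i st] st by simp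
    qed
    then show "\<exists>g. set_integrable lborel {0..T} g \<and>
        (\<forall>s t. 0 \<le> s \<and> s \<le> t \<and> t \<le> T \<longrightarrow>
          signed_integral (\<rho> t) f - signed_integral (\<rho> s) f = (LINT u:{s..t}|lborel. g u)) \<and>
        (\<forall>u\<in>{0..T}. \<forall>c\<ge>0. (\<forall>x>0. \<bar>f x\<bar> \<le> c * \<phi> x) \<longrightarrow>
          \<bar>g u - coag_form f (K l) (m l u) (\<rho> u) - source l v f u\<bar> \<le> c * 0)"
      by (intro exI[of _ "\<lambda>u. ?b u + source l v f u"] conjI allI impI ballI i) simp_all
  qed
qed

end

section \<open>Differentiability of the solution in the parameter\<close>

text \<open>
  Finite measures are identified with their set functions, which makes the results on bilinear forms
  apply.
\<close>

lemma linearised_solution_iff: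
  assumes "\<forall>t\<in>{0..T}. finite_measure (\<mu> t) \<and> sets (\<mu> t) = sets pos_borel"
  shows "linearised_solution \<phi> K k T \<mu> \<sigma> \<longleftrightarrow> (\<forall>t\<in>{0..T}. \<sigma> t \<in> M1 \<phi>) \<and>
     set_integrable lborel {0..T} (\<lambda>t. norm1 \<phi> (\<sigma> t)) \<and>
     (\<forall>f. bdd_measurable f \<longrightarrow>
        set_integrable lborel {0..T} (\<lambda>s. coag_form f K (measure (\<mu> s)) (\<sigma> s)) \<and>
        set_integrable lborel {0..T} (\<lambda>s. coag_form f k (measure (\<mu> s)) (measure (\<mu> s))) \<and>
        (\<forall>t\<in>{0..T}. signed_integral (\<sigma> t) f = signed_integral (\<sigma> 0) f +
           (LINT s:{0..t}|lborel. coag_form f K (measure (\<mu> s)) (\<sigma> s)) +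
           1 / 2 * (LINT s:{0..t}|lborel. coag_form f k (measure (\<mu> s)) (measure (\<mu> s)))))"
proof -
  have \<mu>: "finite_measure (\<mu> t)" "sets (\<mu> t) = sets pos_borel" if "t \<in> {0..T}" for t
    using assms that by auto
  define g where "g f s = signed_integral (\<sigma> s) (\<lambda>y. \<integral>x. brace f x y * K x y \<partial>\<mu> s)" for f s
  define h where "h f s = (\<integral>y. (\<integral>x. brace f x y * k x y \<partial>\<mu> s) \<partial>\<mu> s)" for f s
  define g' where "g' f s = coag_form f K (measure (\<mu> s)) (\<sigma> s)" for f s
  define h' where "h' f s = coag_form f k (measure (\<mu> s)) (measure (\<mu> s))" for f s
  have G: "g f s = g' f s" "h f s = h' f s" if "s \<in> {0..T}" for f s
    unfolding g_def h_def g'_def h'_def bilin_def signed_integral_measure[OF \<mu>[OF that]] by simp_all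
  have i: "set_integrable lborel {0..T} a \<longleftrightarrow> set_integrable lborel {0..T} b"
    if "\<And>s. s \<in> {0..T} \<Longrightarrow> a s = b s" for a b :: "real \<Rightarrow> real"
    unfolding set_integrable_def using that
    by (intro Bochner_Integration.integrable_cong) (auto split: split_indicator)
  have j: "(LINT s:{0..t}|lborel. a s) = (LINT s:{0..t}|lborel. b s)"
    if "\<And>s. s \<in> {0..T} \<Longrightarrow> a s = b s" "t \<in> {0..T}" for a b :: "real \<Rightarrow> real" and t
    unfolding set_lebesgue_integral_def using that
    by (intro Bochner_Integration.integral_cong) (auto split: split_indicator)
  have "(set_integrable lborel {0..T} (g f) \<and> set_integrable lborel {0..T} (h f) \<and>
      (\<forall>t\<in>{0..T}. signed_integral (\<sigma> t) f = signed_integral (\<sigma> 0) f + (LINT s:{0..t}|lborel. g f s) + 1 / 2 * (LINT s:{0..t}|lborel. h f s))) \<longleftrightarrow>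
     (set_integrable lborel {0..T} (g' f) \<and> set_integrable lborel {0..T} (h' f) \<and>
      (\<forall>t\<in>{0..T}. signed_integral (\<sigma> t) f = signed_integral (\<sigma> 0) f + (LINT s:{0..t}|lborel. g' f s) + 1 / 2 * (LINT s:{0..t}|lborel. h' f s)))" for f
    using i[of "g f" "g' f"] i[of "h f" "h' f"] j[of "g f" "g' f"] j[of "h f" "h' f"] G by simp
  then show ?thesis
    unfolding linearised_solution_def Let_def g_def[symmetric] h_def[symmetric] g'_def[symmetric] h'_def[symmetric]
    by simp
qed

text \<open>
  The witness of the second order differentiability is some gradient; by uniqueness of derivatives it
  is the given one.
\<close>

lemma C2_on_gradient_continuous:
  fixes U :: "(real^'p) set"
  assumes U: "open U" and C2: "C2_on U g" and D: "\<And>l. l \<in> U \<Longrightarrow> GDERIV g l :> D l"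
  shows "continuous_on U D"
proof -
  obtain G :: "real^'p \<Rightarrow> real^'p" and H :: "real^'p \<Rightarrow> real^'p^'p"
    where G: "\<forall>l\<in>U. (GDERIV g l :> G l) \<and> (G has_derivative (\<lambda>h. H l *v h)) (at l)"
    using C2 unfolding C2_on_def by blast
  have "G l = D l" if l: "l \<in> U" for l
  proof -
    have "(\<lambda>h. inner h (G l)) = (\<lambda>h. inner h (D l))"
      using G l D[OF l] unfolding gderiv_def by (blast intro: has_derivative_unique)
    then have "inner (G l - D l) (G l) = inner (G l - D l) (D l)" by (rule fun_cong)
    then have "inner (G l - D l) (G l - D l) = 0" by (simp add: inner_diff_right)
    then show ?thesis by simp
  qed
  moreover have "continuous_on U G"
    using G U by (auto simp: continuous_on_eq_continuous_at intro: has_derivative_continuous)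
  ultimately show ?thesis by (simp cong: continuous_on_cong)
qed

text \<open>
  As \<open>\<phi> \<ge> 1\<close>, the moment of order \<open>4 + \<epsilon>\<close> dominates
  the third moment and the total mass.
\<close>

lemma moments_of_smoluchowski:
  assumes \<phi>: "size_weight \<phi>" and \<epsilon>: "0 < \<epsilon>" and r: "radon \<mu>"
    and fin: "(\<integral>\<^sup>+x. ennreal (\<phi> x powr (4 + \<epsilon>)) \<partial>\<mu>) \<le> ennreal C" "0 \<le> C"
  shows "finite_measure \<mu>" "sets \<mu> = sets pos_borel" "measure \<mu> \<in> M1 (size_weight.pw \<phi> 3)"
    "norm1 (size_weight.pw \<phi> 3) (measure \<mu>) \<le> C"
proof -
  interpret size_weight \<phi> by fact
  show s: "sets \<mu> = sets pos_borel" using r by (simp add: radon_def)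
  have sp: "space \<mu> = {0<..}" using sets_eq_imp_space_eq[OF s] by simp
  have le: "pw 3 x \<le> \<phi> x powr (4 + \<epsilon>)" if "x > 0" for x
  proof -
    have "pw 3 x = \<phi> x powr real 3" using phi_ge1[OF that] by (simp add: pw_def powr_realpow)
    also have "\<dots> \<le> \<phi> x powr (4 + \<epsilon>)" using phi_ge1[OF that] \<epsilon> by (intro powr_mono) auto
    finally show ?thesis .
  qed
  have i3: "(\<integral>\<^sup>+x. ennreal (pw 3 x) \<partial>\<mu>) \<le> ennreal C"
    using le sp by (intro order_trans[OF nn_integral_mono fin(1)] ennreal_leI) auto
  have w3: "1 \<le> pw 3 x" if "x > 0" for x using weight_pw[of 3] that by (simp add: weight_def)
  have "emeasure \<mu> (space \<mu>) = (\<integral>\<^sup>+x. 1 \<partial>\<mu>)" by simp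
  also have "\<dots> \<le> (\<integral>\<^sup>+x. ennreal (pw 3 x) \<partial>\<mu>)" using w3 sp by (intro nn_integral_mono) auto
  also have "\<dots> < \<infinity>" using i3 by (rule le_less_trans) simp
  finally show f: "finite_measure \<mu>" by (intro finite_measureI) auto
  have t: "total_var (measure \<mu>) = \<mu>" by (rule parts_of_measure(3)[OF f s])
  show "measure \<mu> \<in> M1 (pw 3)"
    using finite_signed_measure_signed[OF finite_signed_measure_measure[OF f s]] i3
    by (auto simp: M1_def t intro: le_less_trans)
  show "norm1 (pw 3) (measure \<mu>) \<le> C"
    unfolding norm1_def t using enn2real_mono[OF i3] fin(2) by simp
qed

theorem theorem6:
  fixes U :: "(real^'p) set"
    and K :: "real^'p \<Rightarrow> real \<Rightarrow> real \<Rightarrow> real"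
    and dK :: "real^'p \<Rightarrow> real \<Rightarrow> real \<Rightarrow> real^'p"
    and \<phi> :: "real \<Rightarrow> real"
    and \<mu>0 :: "real measure"
    and \<mu> :: "real^'p \<Rightarrow> real \<Rightarrow> real measure"
    and \<epsilon> T Ts :: real
  assumes "open U"
    and "\<phi> \<in> borel_measurable pos_borel"
    and "\<And>x. x > 0 \<Longrightarrow> 1 \<le> \<phi> x"
    and "sub_additive \<phi>"
    and "\<And>l. l \<in> U \<Longrightarrow> coag_kernel \<phi> (K l)"
    and "\<And>x y. x > 0 \<Longrightarrow> y > 0 \<Longrightarrow> C2_on U (\<lambda>l. K l x y)"
    and "\<And>l x y. l \<in> U \<Longrightarrow> x > 0 \<Longrightarrow> y > 0 \<Longrightarrow> GDERIV (\<lambda>l'. K l' x y) l :> dK l x y"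
    and "\<And>l x y i. l \<in> U \<Longrightarrow> x > 0 \<Longrightarrow> y > 0 \<Longrightarrow> \<bar>dK l x y $ i\<bar> \<le> \<phi> x * \<phi> y"
    and "radon \<mu>0"
    and "\<epsilon> > 0"
    and "(\<integral>\<^sup>+x. ennreal (\<phi> x powr (4 + \<epsilon>)) \<partial>\<mu>0) < \<infinity>"
    and "norris_time \<phi> (4 + \<epsilon>) \<mu>0 Ts"
    and "0 \<le> T" and "T < Ts"
    and "\<And>l. l \<in> U \<Longrightarrow> smoluchowski_solution \<phi> (4 + \<epsilon>) (K l) \<mu>0 Ts (\<mu> l)"
  shows "\<exists>D. M1_C1 \<phi> ({0..T} \<times> U) (\<lambda>(t, l). measure (\<mu> l t)) D \<and>
    (\<forall>l\<in>U. \<forall>i. let \<sigma> = (\<lambda>t. D (t, l) (0, axis i 1)) in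
       linearised_solution \<phi> (K l) (\<lambda>x y. dK l x y $ i) T (\<mu> l) \<sigma> \<and>
       (\<forall>\<rho>. linearised_solution \<phi> (K l) (\<lambda>x y. dK l x y $ i) T (\<mu> l) \<rho> \<and> \<rho> 0 = \<sigma> 0 \<longrightarrow>
          (\<forall>t\<in>{0..T}. \<rho> t = \<sigma> t)))"
proof -
  have phi: "weight \<phi>" using assms(2,3) by (simp add: weight_def)
  interpret W: size_weight \<phi> by standard (rule phi, rule assms(4))
  note nt = \<open>norris_time \<phi> (4 + \<epsilon>) \<mu>0 Ts\<close>[unfolded norris_time_def]
  have "\<forall>T<Ts. \<exists>C::real. \<forall>K \<mu>. coag_kernel \<phi> K \<and> smoluchowski_solution \<phi> (4 + \<epsilon>) K \<mu>0 Ts \<mu> \<longrightarrow>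
      (\<forall>t\<in>{0..T}. (\<integral>\<^sup>+x. ennreal (\<phi> x powr (4 + \<epsilon>)) \<partial>\<mu> t) \<le> ennreal C)"
    by (rule conjunct2[OF conjunct2[OF nt]])
  from this[THEN spec, THEN mp, OF \<open>T < Ts\<close>] obtain C where
    C: "\<forall>K \<mu>. coag_kernel \<phi> K \<and> smoluchowski_solution \<phi> (4 + \<epsilon>) K \<mu>0 Ts \<mu> \<longrightarrow>
      (\<forall>t\<in>{0..T}. (\<integral>\<^sup>+x. ennreal (\<phi> x powr (4 + \<epsilon>)) \<partial>\<mu> t) \<le> ennreal C)"
    by (rule exE)
  \<comment> \<open>The moment bound of the existence theorem, uniform over all kernels below
      \<open>\<phi> x * \<phi> y\<close> and so over the parameter. The maximum makes it
      positive.\<close>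
  define M where "M = max 1 C"
  have sol: "smoluchowski_solution \<phi> (4 + \<epsilon>) (K l) \<mu>0 Ts (\<mu> l)" if "l \<in> U" for l
    using assms(15) that .
  have tT: "t \<in> {0..<Ts}" if "t \<in> {0..T}" for t using that \<open>T < Ts\<close> by auto
  have mom: "(\<integral>\<^sup>+x. ennreal (\<phi> x powr (4 + \<epsilon>)) \<partial>\<mu> l t) \<le> ennreal M" if "l \<in> U" "t \<in> {0..T}" for l t
  proof -
    have "(\<integral>\<^sup>+x. ennreal (\<phi> x powr (4 + \<epsilon>)) \<partial>\<mu> l t) \<le> ennreal C"
      using C[THEN spec, THEN spec, THEN mp, OF conjI, OF assms(5)[OF that(1)] sol[OF that(1)]] that(2) by blast
    also have "\<dots> \<le> ennreal M" by (intro ennreal_leI) (simp add: M_def)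
    finally show ?thesis .
  qed
  have rad: "radon (\<mu> l t)" if "l \<in> U" "t \<in> {0..T}" for l t
    using sol[OF that(1)] tT[OF that(2)] unfolding smoluchowski_solution_def by blast
  have M1: "0 \<le> M" by (simp add: M_def)
  have mm: "finite_measure (\<mu> l t)" "sets (\<mu> l t) = sets pos_borel" "measure (\<mu> l t) \<in> M1 (W.pw 3)"
    "norm1 (W.pw 3) (measure (\<mu> l t)) \<le> M" if "l \<in> U" "t \<in> {0..T}" for l t
    using moments_of_smoluchowski[OF W.size_weight_axioms \<open>\<epsilon> > 0\<close> rad[OF that] mom[OF that] M1] by blast+
  have deriv: "((\<lambda>s. signed_integral (measure (\<mu> l s)) f) has_real_derivative
        1 / 2 * coag_form f (K l) (measure (\<mu> l t)) (measure (\<mu> l t))) (at t within {0..T})"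
    if l: "l \<in> U" and t: "t \<in> {0..T}" and f: "bdd_measurable f" for l t f
  proof -
    have "((\<lambda>s. \<integral>x. f x \<partial>\<mu> l s) has_real_derivative
           1 / 2 * (\<integral>x. (\<integral>y. brace f x y * K l x y \<partial>\<mu> l t) \<partial>\<mu> l t)) (at t within {0..<Ts})"
      using sol[OF l] tT[OF t] f unfolding smoluchowski_solution_def by blast
    then have D: "((\<lambda>s. \<integral>x. f x \<partial>\<mu> l s) has_real_derivative
           1 / 2 * (\<integral>x. (\<integral>y. brace f x y * K l x y \<partial>\<mu> l t) \<partial>\<mu> l t)) (at t within {0..T})"
      by (rule DERIV_subset) (use tT in auto)
    have sp: "space (\<mu> l t) = {0<..}" using sets_eq_imp_space_eq[OF mm(2)[OF l t]] by simp
    \<comment> \<open>The bilinear form integrates over the first variable inside; symmetry of the kernel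
        reconciles the order.\<close>
    have "(\<integral>x. (\<integral>y. brace f x y * K l x y \<partial>\<mu> l t) \<partial>\<mu> l t) = (\<integral>x. (\<integral>y. brace f y x * K l y x \<partial>\<mu> l t) \<partial>\<mu> l t)"
      using assms(5)[OF l] sp
      by (intro Bochner_Integration.integral_cong) (auto simp: coag_kernel_def brace_def add.commute)
    also have "\<dots> = coag_form f (K l) (measure (\<mu> l t)) (measure (\<mu> l t))"
      by (simp add: bilin_def signed_integral_measure[OF mm(1,2)[OF l t]])
    finally have e: "(\<integral>x. (\<integral>y. brace f x y * K l x y \<partial>\<mu> l t) \<partial>\<mu> l t) = coag_form f (K l) (measure (\<mu> l t)) (measure (\<mu> l t))" .
    show ?thesis
      using D unfolding e
      by (rule has_field_derivative_transform_within[OF _ zero_less_one t])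
        (simp add: signed_integral_measure[OF mm(1,2)[OF l]])
  qed
  interpret S: smoluchowski_family \<phi> U K dK "\<lambda>l t. measure (\<mu> l t)" T M
  proof
    show "open U" "0 \<le> T" by fact+
    show "0 < M" by (simp add: M_def)
    show "coag_kernel \<phi> (K l)" if "l \<in> U" for l by (rule assms(5)[OF that])
    show "GDERIV (\<lambda>l'. K l' x y) l :> dK l x y" if "l \<in> U" "x > 0" "y > 0" for l x y by (rule assms(7)[OF that])
    show "continuous_on U (\<lambda>l. dK l x y)" if "x > 0" "y > 0" for x y
      by (rule C2_on_gradient_continuous[OF assms(1) assms(6)[OF that] assms(7)[OF _ that]])
    show "\<bar>dK l x y $ i\<bar> \<le> \<phi> x * \<phi> y" if "l \<in> U" "x > 0" "y > 0" for l x y i by (rule assms(8)[OF that])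
    show "measure (\<mu> l t) \<in> M1 (W.pw 3)" if "l \<in> U" "t \<in> {0..T}" for l t by (rule mm(3)[OF that])
    show "0 \<le> measure (\<mu> l t) A" for l t A by simp
    show "norm1 (W.pw 3) (measure (\<mu> l t)) \<le> M" if "l \<in> U" "t \<in> {0..T}" for l t by (rule mm(4)[OF that])
    show "measure (\<mu> l 0) = measure (\<mu> l' 0)" if "l \<in> U" "l' \<in> U" for l l'
    proof -
      have "\<mu> l 0 = \<mu>0" "\<mu> l' 0 = \<mu>0" using sol[OF that(1)] sol[OF that(2)] by (simp_all add: smoluchowski_solution_def)
      then show ?thesis by simp
    qed
    show "((\<lambda>s. signed_integral (measure (\<mu> l s)) f) has_real_derivative
        1 / 2 * coag_form f (K l) (measure (\<mu> l t)) (measure (\<mu> l t))) (at t within {0..T})"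
      if "l \<in> U" "t \<in> {0..T}" "bdd_measurable f" for l t f by (rule deriv[OF that])
  qed
  have k: "(\<lambda>x y. brace f x y * S.dKv l (axis i 1) x y) = (\<lambda>x y. brace f x y * dK l x y $ i)" for f l i
    by (simp add: S.dKv_def inner_axis')
  have src: "S.source l (axis i 1) f = (\<lambda>u. 1 / 2 * bilin (\<lambda>x y. brace f x y * dK l x y $ i) (measure (\<mu> l u)) (measure (\<mu> l u)))" for l i f
    unfolding S.source_def[abs_def] k ..
  have sg: "(\<lambda>t. S.total_deriv (t, l) (0, axis i 1)) = S.sensitivity l (axis i 1)" for l i
    by (simp add: S.total_deriv_def fun_eq_iff)
  have lin: "linearised_solution \<phi> (K l) (\<lambda>x y. dK l x y $ i) T (\<mu> l) (S.sensitivity l (axis i 1)) \<and>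
      (\<forall>\<rho>. linearised_solution \<phi> (K l) (\<lambda>x y. dK l x y $ i) T (\<mu> l) \<rho> \<and> \<rho> 0 = S.sensitivity l (axis i 1) 0 \<longrightarrow>
          (\<forall>t\<in>{0..T}. \<rho> t = S.sensitivity l (axis i 1) t))" if l: "l \<in> U" for l i
  proof (intro conjI allI impI ballI)
    have "\<forall>t\<in>{0..T}. finite_measure (\<mu> l t) \<and> sets (\<mu> l t) = sets pos_borel"
      using mm(1,2)[OF l] by blast
    note iff = linearised_solution_iff[OF this]
    let ?h = "\<lambda>f u. bilin (\<lambda>x y. brace f x y * dK l x y $ i) (measure (\<mu> l u)) (measure (\<mu> l u))"
    show "linearised_solution \<phi> (K l) (\<lambda>x y. dK l x y $ i) T (\<mu> l) (S.sensitivity l (axis i 1))"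
      unfolding iff
    proof (intro conjI ballI allI impI)
      show "S.sensitivity l (axis i 1) t \<in> M1 \<phi>" if "t \<in> {0..T}" for t by (rule S.sensitivity_M1[OF l that])
      show "set_integrable lborel {0..T} (\<lambda>t. norm1 \<phi> (S.sensitivity l (axis i 1) t))" by (rule S.sensitivity_norm_integrable[OF l])
      fix f assume f: "bdd_measurable f"
      note E = S.sensitivity_equation[OF l f, where v="axis i 1"]
      show "set_integrable lborel {0..T} (\<lambda>s. coag_form f (K l) (measure (\<mu> l s)) (S.sensitivity l (axis i 1) s))"
        by (rule E(1))
      show "set_integrable lborel {0..T} (?h f)"
        using set_integrable_mult_right[of 2, OF E(2)] unfolding src by simp
      show "signed_integral (S.sensitivity l (axis i 1) t) f = signed_integral (S.sensitivity l (axis i 1) 0) f +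
           (LINT s:{0..t}|lborel. coag_form f (K l) (measure (\<mu> l s)) (S.sensitivity l (axis i 1) s)) +
           1 / 2 * (LINT s:{0..t}|lborel. ?h f s)" if "t \<in> {0..T}" for t
        using E(3)[OF that] unfolding src by simp
    qed
    fix \<rho> t assume "linearised_solution \<phi> (K l) (\<lambda>x y. dK l x y $ i) T (\<mu> l) \<rho> \<and> \<rho> 0 = S.sensitivity l (axis i 1) 0"
      and t: "t \<in> {0..T}"
    then have R: "linearised_solution \<phi> (K l) (\<lambda>x y. dK l x y $ i) T (\<mu> l) \<rho>" and init: "\<rho> 0 = S.sensitivity l (axis i 1) 0" by auto
    note R = R[unfolded iff]
    note R1 = conjunct1[OF R] and R2 = conjunct1[OF conjunct2[OF R]]
      and R3 = conjunct2[OF conjunct2[OF R], THEN spec, THEN mp]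
    show "\<rho> t = S.sensitivity l (axis i 1) t"
    proof (rule S.sensitivity_unique[OF l _ init R2 _ _ t])
      show "\<rho> t \<in> M1 \<phi>" if "t \<in> {0..T}" for t using R1 that by blast
      show "set_integrable lborel {0..T} (\<lambda>u. coag_form f (K l) (measure (\<mu> l u)) (\<rho> u))"
        if "bdd_measurable f" for f by (rule conjunct1[OF R3[OF that]])
      show "signed_integral (\<rho> t) f = signed_integral (\<rho> 0) f +
          (LINT u:{0..t}|lborel. coag_form f (K l) (measure (\<mu> l u)) (\<rho> u)) +
          (LINT u:{0..t}|lborel. S.source l (axis i 1) f u)" if "bdd_measurable f" "t \<in> {0..T}" for f t
        using conjunct2[OF conjunct2[OF R3[OF that(1)]], THEN bspec, OF that(2)] unfolding src by simp
    qed
  qed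
  show ?thesis
  proof (intro exI[of _ S.total_deriv] conjI ballI allI)
    show "M1_C1 \<phi> ({0..T} \<times> U) (\<lambda>(t, l). measure (\<mu> l t)) S.total_deriv" by (rule S.flow_C1)
    fix l i assume l: "l \<in> U"
    show "let \<sigma> = (\<lambda>t. S.total_deriv (t, l) (0, axis i 1)) in
       linearised_solution \<phi> (K l) (\<lambda>x y. dK l x y $ i) T (\<mu> l) \<sigma> \<and>
       (\<forall>\<rho>. linearised_solution \<phi> (K l) (\<lambda>x y. dK l x y $ i) T (\<mu> l) \<rho> \<and> \<rho> 0 = \<sigma> 0 \<longrightarrow>
          (\<forall>t\<in>{0..T}. \<rho> t = \<sigma> t))"
      unfolding Let_def sg by (rule lin[OF l])
  qed
qed

end
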